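(* Let $n>0$, $\alpha>0$, $M>0$. Let $u$ be a global strong solution of $$u_t+\partial_x\left[u^n(u_{xxx}+\alpha^2u_x-\sin x)\right]=0,\qquad x\in\Omega,$$ of mass $M$ and initial energy $E_0=E(u(\cdot,0))$ constructed by the method of Bernis and Friedman, and let $u^*$ be the energy minimizer on $\mathcal{C}_M$. If $\alpha>1$, assume in addition that the sub-level set $\{E\le E_0\}$ in $\mathcal{C}_M$ contains no steady states with zero dissipation other than $u^*$. Then $$\lim_{t\to\infty}d_{H^1}(u(\cdot,t),u^* )=0.$$
   Context: $\Omega=\mathbb{R}/(2\pi\mathbb{Z})$; $\mathcal{C}_M=\{u\in L^2(\Omega)\mid u\ge0,\ \int_\Omega u\,dx=M\}$; $d_{H^1}(u,v)=\|u_x-v_x\|_{L^2}$ for $u,v\in\mathcal{C}_M$. The energy is $E(u)=\frac12\int_\Omega(u_x^2-\alpha^2u^2)\,dx-\int_\Omega u\cos x\,dx$ ($=\infty$ if $u\notin H^1$); it has a unique minimizer $u^*$ on $\mathcal{C}_M$. A (strong) steady state is $u\in\mathcal{C}_M\cap H^2(\Omega)$ with $\int_\Omega(u_{xx}+\alpha^2u+\cos x)(u^n\phi_x)_x\,dx=0$ for every smooth $2\pi$-periodic $\phi$; it has zero dissipation if $u\in H^3_{loc}(\{u>0\})$ and $D(u)=\int_{\{u>0\}}u^n(u_{xxx}+\alpha^2u_x-\sin x)^2\,dx=0$. A global strong solution is a nonnegative function $u\in L^2_{loc}((0,\infty),H^2(\Omega))$ such that $\int_0^\infty\int_\Omega\{u\phi_t-(u_{xx}+\alpha^2u+\cos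 x)(u^n\phi_x)_x\}\,dx\,dt=0$ for every smooth $\phi$ with compact support in $(0,\infty)\times\Omega$. It has mass $M$ if $\int_\Omega u(x,t)\,dx=M$ for all $t$. "Constructed by the method of Bernis and Friedman" means: for a sequence $\varepsilon_j\to0$ there are smooth global solutions $u^{\varepsilon_j}$ of the regularized equations $u_t+\partial_x[f_{\varepsilon}(u)\,\partial_x(u_{xx}+\alpha^2u+\cos x)]=0$ with $\varepsilon=\varepsilon_j$ and a suitable regularization $f_\varepsilon$ of $z\mapsto z^n$ (for example $f_\varepsilon(z)=z^n+\varepsilon$), such that $u^{\varepsilon_j}\to u$ uniformly on compact time intervals, $u$ is smooth wherever it is positive, $u^{\varepsilon_j}_{xx}\to u_{xx}$ weakly in $L^2((0,T)\times\Omega)$ for each $T>0$, and $u^{\varepsilon_j}_{xxx}\to u_{xxx}$ weakly in $L^2_{loc}(\{u>0\})$. Such solutions have finite initial energy and satisfy, for all $T>0$, the bound $\int_0^T\int_\Omega u_{xx}^2\,dx\,dt\le A+BT$ with some constants $A,B$, and the energy inequality $E(u(\cdot,T))+\int_0^T\int_{\{u>0\}}u^n(u_{xxx}+\alpha^2u_x-\sin x)^2\,dx\,dt\le E(u(\cdot,0))$. *)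

theory Defs
  imports "HOL-Analysis.Analysis"
begin

(* Functions on the circle R/(2 pi Z) are represented by 2 pi-periodic functions on the real line;
   integrals over the circle are integrals over {0..2*pi}. Functions of time and space are
   curried, u t x. *)

definition periodic :: "(real \<Rightarrow> real) \<Rightarrow> bool" where
  "periodic f \<longleftrightarrow> (\<forall>x. f (x + 2 * pi) = f x)"

primrec Ck_on :: "nat \<Rightarrow> 'a::euclidean_space set \<Rightarrow> ('a \<Rightarrow> real) \<Rightarrow> bool" where
  "Ck_on 0 S f \<longleftrightarrow> continuous_on S f"
| "Ck_on (Suc k) S f \<longleftrightarrow> (\<forall>x\<in>S. f differentiable (at x)) \<and>
     (\<forall>v. Ck_on k S (\<lambda>x. frechet_derivative f (at x) v))"

(* Used for open S only. *)
definition smooth_on :: "'a::euclidean_space set \<Rightarrow> ('a \<Rightarrow> real) \<Rightarrow> bool" where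
  "smooth_on S f \<longleftrightarrow> (\<forall>k. Ck_on k S f)"

definition L2_on :: "'a::euclidean_space set \<Rightarrow> ('a \<Rightarrow> real) \<Rightarrow> bool" where
  "L2_on S f \<longleftrightarrow> set_borel_measurable lborel S f \<and> set_integrable lborel S (\<lambda>x. (f x)\<^sup>2)"

definition L2_loc :: "real set \<Rightarrow> (real \<Rightarrow> real) \<Rightarrow> bool" where
  "L2_loc U f \<longleftrightarrow> (\<forall>K. compact K \<and> K \<subseteq> U \<longrightarrow> L2_on K f)"

definition L1_loc :: "real set \<Rightarrow> (real \<Rightarrow> real) \<Rightarrow> bool" where
  "L1_loc U f \<longleftrightarrow> (\<forall>K. compact K \<and> K \<subseteq> U \<longrightarrow> set_integrable lborel K f)"

definition weak_deriv :: "real set \<Rightarrow> (real \<Rightarrow> real) \<Rightarrow> (real \<Rightarrow> real) \<Rightarrow> bool" where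
  "weak_deriv U f g \<longleftrightarrow> L1_loc U f \<and> L1_loc U g \<and>
     (\<forall>\<phi> K. smooth_on UNIV \<phi> \<and> compact K \<and> K \<subseteq> U \<and> (\<forall>x. x \<notin> K \<longrightarrow> \<phi> x = 0) \<longrightarrow>
        (LINT x:U|lborel. f x * deriv \<phi> x) = - (LINT x:U|lborel. g x * \<phi> x))"

(* A representative of the weak derivative, which is unique up to null subsets of the open set U. *)
definition wderiv :: "real set \<Rightarrow> (real \<Rightarrow> real) \<Rightarrow> real \<Rightarrow> real" where
  "wderiv U f = (SOME g. weak_deriv U f g)"

primrec H_loc :: "nat \<Rightarrow> real set \<Rightarrow> (real \<Rightarrow> real) \<Rightarrow> bool" where
  "H_loc 0 U f \<longleftrightarrow> L2_loc U f"
| "H_loc (Suc k) U f \<longleftrightarrow> L2_loc U f \<and> (\<exists>g. weak_deriv U f g \<and> H_loc k U g)"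

(* Since the circle is compact, its Sobolev space of order k consists of the periodic functions
   that are locally in the Sobolev space of order k on the line. *)
definition H_circle :: "nat \<Rightarrow> (real \<Rightarrow> real) \<Rightarrow> bool" where
  "H_circle k f \<longleftrightarrow> periodic f \<and> H_loc k UNIV f"

definition weakly_L2 ::
    "'a::euclidean_space set \<Rightarrow> (nat \<Rightarrow> 'a \<Rightarrow> real) \<Rightarrow> ('a \<Rightarrow> real) \<Rightarrow> bool" where
  "weakly_L2 S fs f \<longleftrightarrow> (\<forall>j. L2_on S (fs j)) \<and> L2_on S f \<and>
     (\<forall>\<psi>. L2_on S \<psi> \<longrightarrow>
        (\<lambda>j. LINT p:S|lborel. fs j p * \<psi> p) \<longlonglongrightarrow> (LINT p:S|lborel. f p * \<psi> p))"

definition admissible :: "real \<Rightarrow> (real \<Rightarrow> real) set" where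
  "admissible M = {u. periodic u \<and> L2_on {0..2*pi} u \<and> (AE x in lborel. 0 \<le> u x) \<and>
     (LINT x:{0..2*pi}|lborel. u x) = M}"

definition energy :: "real \<Rightarrow> (real \<Rightarrow> real) \<Rightarrow> ereal" where
  "energy \<alpha> u = (if H_circle 1 u
     then ereal ((1/2) * (LINT x:{0..2*pi}|lborel. (wderiv UNIV u x)\<^sup>2 - \<alpha>\<^sup>2 * (u x)\<^sup>2)
                 - (LINT x:{0..2*pi}|lborel. u x * cos x))
     else \<infinity>)"

definition dist_H1 :: "(real \<Rightarrow> real) \<Rightarrow> (real \<Rightarrow> real) \<Rightarrow> ennreal" where
  "dist_H1 u v = (if H_circle 1 u \<and> H_circle 1 v
     then ennreal (sqrt (LINT x:{0..2*pi}|lborel. (wderiv UNIV u x - wderiv UNIV v x)\<^sup>2))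
     else \<infinity>)"

(* Elements of the Sobolev space of order 2 are taken in their continuous representative, so that
   the set where u is positive is well defined and open. The outer derivative in the steady-state
   equation is a weak derivative; its existence and the convergence of the integral are part of
   the condition. *)
definition steady_state :: "real \<Rightarrow> real \<Rightarrow> real \<Rightarrow> (real \<Rightarrow> real) \<Rightarrow> bool" where
  "steady_state n \<alpha> M u \<longleftrightarrow> u \<in> admissible M \<and> H_circle 2 u \<and> continuous_on UNIV u \<and>
     (\<forall>\<phi>. smooth_on UNIV \<phi> \<and> periodic \<phi> \<longrightarrow>
        (\<exists>g. weak_deriv UNIV (\<lambda>x. u x powr n * deriv \<phi> x) g \<and>
           set_integrable lborel {0..2*pi}
             (\<lambda>x. ((wderiv UNIV ^^ 2) u x + \<alpha>\<^sup>2 * u x + cos x) * g x) \<and>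
           (LINT x:{0..2*pi}|lborel.
              ((wderiv UNIV ^^ 2) u x + \<alpha>\<^sup>2 * u x + cos x) * g x) = 0))"

definition dissipation :: "real \<Rightarrow> real \<Rightarrow> (real \<Rightarrow> real) \<Rightarrow> ennreal" where
  "dissipation n \<alpha> u = (let P = {x. 0 < u x} in
     \<integral>\<^sup>+x\<in>P \<inter> {0..2*pi}. ennreal (u x powr n *
        ((wderiv P ^^ 3) u x + \<alpha>\<^sup>2 * wderiv P u x - sin x)\<^sup>2) \<partial>lborel)"

definition zero_dissipation :: "real \<Rightarrow> real \<Rightarrow> (real \<Rightarrow> real) \<Rightarrow> bool" where
  "zero_dissipation n \<alpha> u \<longleftrightarrow> H_loc 3 {x. 0 < u x} u \<and> dissipation n \<alpha> u = 0"

(* The space of locally square-integrable functions of t > 0 with values in the Sobolev space of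
   order 2 on the circle. A function uxx of both variables is carried along as a jointly
   measurable representative of the second spatial derivative, unique up to null sets; choosing
   wderiv separately for each t would not give joint measurability. *)
definition L2_loc_H2 :: "(real \<Rightarrow> real \<Rightarrow> real) \<Rightarrow> (real \<Rightarrow> real \<Rightarrow> real) \<Rightarrow> bool" where
  "L2_loc_H2 u uxx \<longleftrightarrow> (\<exists>ux.
     (AE t in lborel. 0 < t \<longrightarrow> periodic (u t) \<and>
        weak_deriv UNIV (u t) (ux t) \<and> weak_deriv UNIV (ux t) (uxx t)) \<and>
     (\<forall>a b. 0 < a \<and> a < b \<longrightarrow>
        (\<forall>w\<in>{u, ux, uxx}. L2_on ({a..b} \<times> {0..2*pi}) (\<lambda>(t, x). w t x))))"

definition test_function :: "(real \<Rightarrow> real \<Rightarrow> real) \<Rightarrow> bool" where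
  "test_function \<phi> \<longleftrightarrow> smooth_on UNIV (\<lambda>(t, x). \<phi> t x) \<and> (\<forall>t. periodic (\<phi> t)) \<and>
     (\<exists>a b. 0 < a \<and> a < b \<and> (\<forall>t x. t \<notin> {a..b} \<longrightarrow> \<phi> t x = 0))"

definition global_strong_solution ::
    "real \<Rightarrow> real \<Rightarrow> (real \<Rightarrow> real \<Rightarrow> real) \<Rightarrow> (real \<Rightarrow> real \<Rightarrow> real) \<Rightarrow> bool" where
  "global_strong_solution n \<alpha> u uxx \<longleftrightarrow>
     (\<forall>t\<ge>0. periodic (u t) \<and> (\<forall>x. 0 \<le> u t x)) \<and> L2_loc_H2 u uxx \<and>
     (\<forall>\<phi>. test_function \<phi> \<longrightarrow>
        (\<exists>g. (AE t in lborel. 0 < t \<longrightarrow>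
                weak_deriv UNIV (\<lambda>x. u t x powr n * deriv (\<phi> t) x) (g t)) \<and>
           set_integrable lborel ({0<..} \<times> {0..2*pi})
             (\<lambda>(t, x). u t x * deriv (\<lambda>s. \<phi> s x) t
                        - (uxx t x + \<alpha>\<^sup>2 * u t x + cos x) * g t x) \<and>
           (LINT p:({0<..} \<times> {0..2*pi})|lborel.
              (case p of (t, x) \<Rightarrow> u t x * deriv (\<lambda>s. \<phi> s x) t
                        - (uxx t x + \<alpha>\<^sup>2 * u t x + cos x) * g t x)) = 0))"

definition has_mass :: "real \<Rightarrow> (real \<Rightarrow> real \<Rightarrow> real) \<Rightarrow> bool" where
  "has_mass M u \<longleftrightarrow> (\<forall>t\<ge>0. set_integrable lborel {0..2*pi} (u t) \<and>
     (LINT x:{0..2*pi}|lborel. u t x) = M)"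

(* Solutions of the regularized equation may become negative, so f eps is defined and
   nonnegative on the whole line. *)
definition regularization :: "real \<Rightarrow> (real \<Rightarrow> real \<Rightarrow> real) \<Rightarrow> bool" where
  "regularization n f \<longleftrightarrow>
     (\<forall>\<epsilon>>0. continuous_on UNIV (f \<epsilon>) \<and> (\<forall>z. 0 \<le> f \<epsilon> z) \<and> (\<forall>z>0. 0 < f \<epsilon> z)) \<and>
     (\<forall>R>0. uniform_limit {0..R} f (\<lambda>z. z powr n) (at_right 0))"

lemma regularization_add_eps:
  assumes "0 < n"
  shows "regularization n (\<lambda>\<epsilon> z. \<bar>z\<bar> powr n + \<epsilon>)"
  unfolding regularization_def
proof (intro conjI allI impI)
  fix \<epsilon> :: real assume \<epsilon>: "0 < \<epsilon>"
  show "continuous_on UNIV (\<lambda>z::real. \<bar>z\<bar> powr n + \<epsilon>)"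
    using assms by (intro continuous_intros continuous_on_powr') auto
  show "0 \<le> \<bar>z\<bar> powr n + \<epsilon>" for z :: real using \<epsilon> by simp
  show "0 < \<bar>z\<bar> powr n + \<epsilon>" for z :: real using \<epsilon> by (simp add: add_nonneg_pos)
next
  fix R :: real
  show "uniform_limit {0..R} (\<lambda>\<epsilon> z. \<bar>z\<bar> powr n + \<epsilon>) (\<lambda>z. z powr n) (at_right 0)"
  proof (rule uniform_limitI)
    fix e :: real assume "0 < e"
    then have "eventually (\<lambda>\<epsilon>. \<epsilon> \<in> {0<..<e}) (at_right (0::real))"
      by (rule eventually_at_right_real)
    then show "\<forall>\<^sub>F \<epsilon> in at_right 0. \<forall>z\<in>{0..R}. dist (\<bar>z\<bar> powr n + \<epsilon>) (z powr n) < e"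
      by eventually_elim (auto simp: dist_real_def)
  qed
qed

definition regularized_solution ::
    "real \<Rightarrow> (real \<Rightarrow> real) \<Rightarrow> (real \<Rightarrow> real \<Rightarrow> real) \<Rightarrow> bool" where
  "regularized_solution \<alpha> g v \<longleftrightarrow>
     (\<forall>t\<ge>0. periodic (v t)) \<and>
     continuous_on ({0..} \<times> UNIV) (\<lambda>(t, x). v t x) \<and>
     smooth_on ({0<..} \<times> UNIV) (\<lambda>(t, x). v t x) \<and>
     (\<forall>t>0. \<forall>x.
        ((\<lambda>y. g (v t y) * deriv (\<lambda>z. (deriv ^^ 2) (v t) z + \<alpha>\<^sup>2 * v t z + cos z) y)
           has_real_derivative - deriv (\<lambda>s. v s x) t) (at x))"

(* The last three conditions are properties that solutions obtained from the construction have
   by the choice of the approximating initial data and of the regularization. *)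
definition bernis_friedman ::
    "real \<Rightarrow> real \<Rightarrow> (real \<Rightarrow> real \<Rightarrow> real) \<Rightarrow> (real \<Rightarrow> real \<Rightarrow> real) \<Rightarrow> bool" where
  "bernis_friedman n \<alpha> u uxx \<longleftrightarrow>
     (\<exists>f \<epsilon> v.
        regularization n f \<and> (\<forall>j. 0 < \<epsilon> j) \<and> \<epsilon> \<longlonglongrightarrow> 0 \<and>
        (\<forall>j. regularized_solution \<alpha> (f (\<epsilon> j)) (v j)) \<and>
        (\<forall>T>0. uniform_limit ({0..T} \<times> UNIV) (\<lambda>j (t, x). v j t x) (\<lambda>(t, x). u t x) sequentially) \<and>
        smooth_on {(t, x). 0 < t \<and> 0 < u t x} (\<lambda>(t, x). u t x) \<and>
        (\<forall>T>0. weakly_L2 ({0<..<T} \<times> {0..2*pi})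
           (\<lambda>j (t, x). (deriv ^^ 2) (v j t) x) (\<lambda>(t, x). uxx t x)) \<and>
        (\<forall>K. compact K \<and> K \<subseteq> {(t, x). 0 < t \<and> 0 < u t x} \<longrightarrow>
           weakly_L2 K (\<lambda>j (t, x). (deriv ^^ 3) (v j t) x) (\<lambda>(t, x). (deriv ^^ 3) (u t) x))) \<and>
     energy \<alpha> (u 0) < \<infinity> \<and>
     (\<exists>A\<ge>0. \<exists>B\<ge>0. \<forall>T>0.
        (\<integral>\<^sup>+p\<in>{0<..<T} \<times> {0..2*pi}. (case p of (t, x) \<Rightarrow> ennreal ((uxx t x)\<^sup>2)) \<partial>lborel)
          \<le> ennreal (A + B * T)) \<and>
     (\<forall>T>0. energy \<alpha> (u T) + enn2ereal
        (\<integral>\<^sup>+p\<in>{(t, x). 0 < t \<and> t < T \<and> 0 \<le> x \<and> x \<le> 2 * pi \<and> 0 < u t x}.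
           (case p of (t, x) \<Rightarrow> ennreal (u t x powr n *
              ((deriv ^^ 3) (u t) x + \<alpha>\<^sup>2 * deriv (u t) x - sin x)\<^sup>2)) \<partial>lborel)
        \<le> energy \<alpha> (u 0))"

end

theory Submission
  imports Defs "HOL-Complex_Analysis.Great_Picard"
begin

text \<open>The energy decreases along the regularized flows, so its value at time \<open>T\<close> is at most its average over any
set of earlier times, and averages pass to the limit because the energy equals \<open>-1/2 \<integral> u (u_xx + \<alpha>^2 u + 2 cos x)\<close>,
which involves \<open>u_xx\<close> only linearly. The bounds on curvature and dissipation provide a positive measure of times at which
\<open>u\<close> is close in \<open>C^1\<close> to a steady state without dissipation; such a state is \<open>u*\<close>, by the convex structure of the
problem if \<open>\<alpha> \<le> 1\<close> and by assumption otherwise. Hence \<open>E(u(T)) \<longlongrightarrow> E(u*)\<close>, and the parallelogram law turns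
convergence of the energy into convergence in \<open>H^1\<close>, once it is known that minimizers are such states themselves.\<close>

text \<open>The energy inequality compares time T only with time 0, so a time of nearly minimal
  energy says nothing by itself about later times; this is why monotonicity has to be borrowed from
  the regularized flows. Three further obstacles shape the proof. A film may touch zero at many
  points, with a different pressure constant on each component; integral identities are therefore
  proved by bisection down to intervals where the film is dry, positive or strictly monotone. At
  \<alpha> = 1 the quadratic part of the energy degenerates along cos and sin: without a dry
  interval the resonance with the forcing gives a contradiction, and with one the rest of the period
  is shorter than 2 pi, where Wirtinger's inequality has room to spare. Finally, the assumption for
  \<alpha> > 1 speaks of weak derivatives of \<open>u x powr n * deriv \<phi> x\<close>, whose
  classical derivative can be singular at touchdown for n < 1, so limits and minimizers must be
  shown to be steady states in exactly that sense.\<close>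

abbreviation L1_on :: "'a::euclidean_space set => ('a => real) => bool" where
 "L1_on A f == set_integrable lborel A f"

notation (input) LIMSEQ (infix "---->" 60)

abbreviation circle_integral :: "(real => real) => real" (binder "\<oint>" 60) where
 "circle_integral f == LINT x:{0..2*pi}|lborel. f x"

section \<open>Absolutely continuous functions and integration by parts\<close>

text \<open>The Borel sets over whose part in the interval \<open>h\<close> integrates to zero form
  a Dynkin system containing the intersection-stable family of half-lines, hence all Borel sets; a
  density with only zero integrals vanishes almost everywhere.\<close>

lemma AE_zero_if_interval_integrals_zero:
 fixes h :: "real => real"
 assumes int: "L1_on {c..d} h"
  and zero: "!!x. c <= x ==> x <= d ==> (LINT y:{c..x}|lborel. h y) = 0"
 shows "AE x in lborel. x \<in> {c..d} --> h x = 0"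
proof -
 have *: "(LINT y:A \<inter> {c..d}|lborel. h y) = 0" if "A \<in> sets borel" for A
 proof -
  have sb: "sets borel = sigma_sets UNIV (range (%a::real. {..a}))"
   by (subst borel_eq_atMost) (rule sets_measure_of, simp)
  have A: "A \<in> sigma_sets UNIV (range (%a::real. {..a}))"
   using that sb by simp
  have m: "A \<in> sets borel" if "A \<in> sigma_sets UNIV (range (%a::real. {..a}))" for A
   using that sb by simp
  have cd: "(LINT y:{c..d}|lborel. h y) = 0"
   using zero[of d] by (cases "c <= d") (auto simp: set_lebesgue_integral_def)
  have "Int_stable (range (%a::real. {..a}))"
   by (auto simp: Int_stable_def)
  moreover have "range (%a::real. {..a}) \<subseteq> Pow UNIV" by auto
  ultimately show ?thesis using A
  proof (induction A rule: sigma_sets_induct_disjoint)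
   case (basic A)
   then obtain a where "A = {..a}" by auto
   then have "A \<inter> {c..d} = {c..min a d}" by auto
   then show ?case using zero[of "min a d"]
    by (cases "c <= min a d") (auto simp: set_lebesgue_integral_def)
  next
   case empty
   then show ?case by (simp add: set_lebesgue_integral_def)
  next
   case (compl A)
   have 1: "L1_on (A \<inter> {c..d}) h"
    "L1_on ((UNIV - A) \<inter> {c..d}) h"
    using m[OF compl(1)] by (auto intro!: set_integrable_subset[OF int])
   have "(LINT y:((A \<inter> {c..d}) \<union> ((UNIV - A) \<inter> {c..d}))|lborel. h y)
    = (LINT y:A \<inter> {c..d}|lborel. h y) + (LINT y:(UNIV - A) \<inter> {c..d}|lborel. h y)"
    by (rule set_integral_Un) (use 1 in auto)
   moreover have "(A \<inter> {c..d}) \<union> ((UNIV - A) \<inter> {c..d}) = {c..d}" by auto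
   ultimately show ?case using compl cd by simp
  next
   case (union A)
   have eq: "(\<Union>i. A i) \<inter> {c..d} = (\<Union>i. A i \<inter> {c..d})" by auto
   have AB: "A i \<in> sets borel" for i by (rule m) (use union(2) in auto)
   have "(LINT y:(\<Union>i. A i \<inter> {c..d})|lborel. h y) = (\<Sum>i. (LINT y:(A i \<inter> {c..d})|lborel. h y))"
   proof (rule lebesgue_integral_countable_add)
    show "L1_on (\<Union>i. A i \<inter> {c..d}) h"
     using AB by (intro set_integrable_subset[OF int]) auto
   qed (use AB union(1) in "auto simp: disjoint_family_on_def")
   then show ?case unfolding eq using union(3) by (simp only: suminf_zero)
  qed
 qed
 have "AE x in lborel. indicator {c..d} x *\<^sub>R h x = 0"
 proof (rule sigma_finite_measure.density_zero[OF sigma_finite_lborel])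
  show "integrable lborel (%x. indicat_real {c..d} x *\<^sub>R h x)"
   using int by (simp add: set_integrable_def)
  show "set_lebesgue_integral lborel A (%x. indicat_real {c..d} x *\<^sub>R h x) = 0"
   if "A \<in> sets lborel" for A
   using *[of A] that by (simp add: set_lebesgue_integral_def indicator_inter_arith mult.assoc)
 qed
 then show ?thesis by eventually_elim auto
qed

text \<open>This is local absolute continuity with density \<open>g\<close>. The integral form
  reduces integration by parts to Fubini, needs no differentiability at individual points, and is
  the bridge to weak derivatives in both directions.\<close>

definition primitive :: "(real => real) => (real => real) => bool" where
 "primitive f g \<longleftrightarrow> (ALL a b. a <= b --> L1_on {a..b} g &
  f b - f a = (LINT x:{a..b}|lborel. g x))"

lemma primitiveD:
 assumes "primitive f g"
 shows "L1_on {a..b} g"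
  and "a <= b ==> (LINT x:{a..b}|lborel. g x) = f b - f a"
 using assms unfolding primitive_def
 by (cases "a <= b"; simp)+

lemma set_integral_split:
 fixes g :: "real => real"
 assumes "a <= b" "b <= c" "L1_on {a..c} g"
 shows "(LINT x:{a..c}|lborel. g x) = (LINT x:{a..b}|lborel. g x) + (LINT x:{b..c}|lborel. g x)"
proof -
 have i: "L1_on {a..b} g" "L1_on {b..c} g"
  using assms by (auto intro!: set_integrable_subset[OF assms(3)])
 show ?thesis
  using assms i by (simp add: set_borel_integral_eq_integral Henstock_Kurzweil_Integration.integral_combine)
qed

lemma primitive_continuous:
 assumes "primitive f g"
 shows "continuous_on S f"
proof -
 have "isCont f x" for x
 proof -
  have "continuous_on {x-1..x+1} (%y. integral {x-1..y} g)"
   by (rule indefinite_integral_continuous_1)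
    (use primitiveD(1)[OF assms] set_borel_integral_eq_integral in blast)
  moreover have "integral {x-1..y} g = f y - f (x-1)" if "x - 1 <= y" for y
   using primitiveD[OF assms, of "x-1" y] that set_borel_integral_eq_integral(2) by metis
  ultimately have "continuous_on {x-1..x+1} (%y. f y - f (x-1))"
   by (subst continuous_on_cong[OF refl]) auto
  then have "continuous_on {x-1..x+1} (%y. (f y - f (x-1)) + f (x-1))"
   by (rule continuous_on_add[OF _ continuous_on_const])
  moreover have "(%y. (f y - f (x-1)) + f (x-1)) = f" by auto
  ultimately have "continuous_on {x-1..x+1} f" by metis
  then show ?thesis by (rule continuous_on_interior) auto
 qed
 then show ?thesis by (simp add: continuous_at_imp_continuous_on)
qed

lemma primitive_of_deriv:
 assumes "!!x. (f has_real_derivative g x) (at x)" "continuous_on UNIV g"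
 shows "primitive f g"
 unfolding primitive_def
proof (intro allI impI conjI)
 fix a b :: real assume "a <= b"
 show i: "L1_on {a..b} g"
  by (intro borel_integrable_atLeastAtMost' continuous_on_subset[OF assms(2)]) auto
 have "(g has_integral f b - f a) {a..b}"
  using \<open>a <= b\<close> assms(1) by (intro fundamental_theorem_of_calculus)
   (auto simp: has_real_derivative_iff_has_vector_derivative[symmetric] intro: has_field_derivative_at_within)
 then show "f b - f a = (LINT x:{a..b}|lborel. g x)"
  using i by (simp add: set_borel_integral_eq_integral integral_unique)
qed

lemma set_integrable_cont_mult:
 fixes f g :: "real => real"
 assumes "continuous_on {a..b} f" "L1_on {a..b} g"
 shows "L1_on {a..b} (%x. f x * g x)"
proof -
 obtain B where B: "!!x. x \<in> {a..b} ==> \<bar>f x\<bar> <= B"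
  using compact_continuous_image[OF assms(1) compact_Icc]
  by (metis (no_types, lifting) bounded_iff compact_imp_bounded image_eqI real_norm_def)
 have m: "set_borel_measurable borel {a..b} f"
  by (rule set_measurable_continuous_on[OF _ assms(1)]) auto
 show ?thesis
  unfolding set_integrable_def
 proof (rule Bochner_Integration.integrable_bound)
  show "integrable lborel (%x. B * (indicator {a..b} x *\<^sub>R g x))"
   using assms(2) by (auto simp: set_integrable_def)
  have "(%x. (indicator {a..b} x *\<^sub>R f x) * (indicator {a..b} x *\<^sub>R g x)) \<in> borel_measurable lborel"
   using m assms(2) by (intro borel_measurable_times)
    (auto simp: set_borel_measurable_def set_integrable_def)
  also have "(%x. (indicator {a..b} x *\<^sub>R f x) * (indicator {a..b} x *\<^sub>R g x))
   = (%x. indicat_real {a..b} x *\<^sub>R (f x * g x))" by (auto simp: indicator_def)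
  finally show "(%x. indicat_real {a..b} x *\<^sub>R (f x * g x)) \<in> borel_measurable lborel" .
  show "AE x in lborel. norm (indicat_real {a..b} x *\<^sub>R (f x * g x))
    <= norm (B * (indicat_real {a..b} x *\<^sub>R g x))"
   using B by (intro AE_I2) (force simp: indicator_def abs_mult intro!: mult_right_mono)
 qed
qed

text \<open>Fubini for \<open>f s * g t\<close> over the triangle a \<le> s \<le> t \<le> b: the
  inner integrals are the increments \<open>G b - G s\<close> and \<open>F t - F a\<close>. Neither
  density is assumed continuous, so the identity covers second derivatives that are merely
  integrable.\<close>

lemma integral_by_parts_primitive:
 assumes F: "primitive F f" and G: "primitive G g" and ab: "a <= b"
 shows "(LINT x:{a..b}|lborel. F x * g x) + (LINT x:{a..b}|lborel. G x * f x)
  = F b * G b - F a * G a"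
proof -
 let ?I = "%x. indicat_real {a..b} x"
 note iF = primitiveD[OF F] and iG = primitiveD[OF G]
 let ?h = "%s t. (if s <= t then 1 else 0) * ((?I s * f s) * (?I t * g t))"
 have mf: "(%s. ?I s * f s) \<in> borel_measurable borel" and mg: "(%s. ?I s * g s) \<in> borel_measurable borel"
  using iF(1)[of a b] iG(1)[of a b] by (auto simp: set_integrable_def)
 have [measurable]: "case_prod ?h \<in> borel_measurable (lborel \<Otimes>\<^sub>M lborel)"
 proof -
  have [measurable]: "(%s. ?I s * f s) \<in> borel_measurable lborel" "(%s. ?I s * g s) \<in> borel_measurable lborel"
   using mf mg by auto
  show ?thesis by measurable
 qed
 have fst_int: "(\<integral>t. ?h s t \<partial>lborel) = ?I s * (f s * (G b - G s))" for s
 proof (cases "s \<in> {a..b}")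
  case True
  have "(\<integral>t. ?h s t \<partial>lborel) = (\<integral>t. f s * (indicator {s..b} t *\<^sub>R g t) \<partial>lborel)"
   using True by (intro Bochner_Integration.integral_cong) (auto simp: indicator_def)
  also have "... = f s * (G b - G s)"
   using iG(2)[of s b] True by (simp add: set_lebesgue_integral_def)
  finally show ?thesis using True by simp
 qed auto
 have snd_int: "(\<integral>s. ?h s t \<partial>lborel) = ?I t * (g t * (F t - F a))" for t
 proof (cases "t \<in> {a..b}")
  case True
  have "(\<integral>s. ?h s t \<partial>lborel) = (\<integral>s. g t * (indicator {a..t} s *\<^sub>R f s) \<partial>lborel)"
   using True by (intro Bochner_Integration.integral_cong) (auto simp: indicator_def)
  also have "... = g t * (F t - F a)"
   using iF(2)[of a t] True by (simp add: set_lebesgue_integral_def)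
  finally show ?thesis using True by simp
 qed auto
 have intf: "integrable lborel (%s. ?I s * f s)" and intg: "integrable lborel (%s. ?I s * g s)"
  using iF(1)[of a b] iG(1)[of a b] by (auto simp: set_integrable_def)
 have row: "integrable lborel (%t. ?h s t)" for s
 proof (rule Bochner_Integration.integrable_bound)
  show "integrable lborel (%t. (?I s * f s) * (?I t * g t))"
   using intg by simp
  show "(%t. ?h s t) \<in> borel_measurable lborel"
   using mg by measurable
 qed auto
 have prodi: "integrable (lborel \<Otimes>\<^sub>M lborel) (case_prod ?h)"
 proof (rule lborel_pair.Fubini_integrable)
  show "integrable lborel (%x. \<integral>y. norm (case_prod ?h (x, y)) \<partial>lborel)"
  proof (rule Bochner_Integration.integrable_bound)
   show "integrable lborel (%s. (?I s * f s) * (\<integral>t. \<bar>?I t * g t\<bar> \<partial>lborel))"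
    using intf by simp
   show "(%x. \<integral>y. norm (case_prod ?h (x, y)) \<partial>lborel) \<in> borel_measurable lborel"
    by (intro lborel.borel_measurable_lebesgue_integral) simp
   show "AE x in lborel. norm (\<integral>y. norm (case_prod ?h (x, y)) \<partial>lborel)
    <= norm (?I x * f x * (\<integral>t. \<bar>?I t * g t\<bar> \<partial>lborel))"
   proof (intro AE_I2)
    fix x
    have "(\<integral>y. norm (case_prod ?h (x, y)) \<partial>lborel) <= (\<integral>t. \<bar>?I x * f x\<bar> * \<bar>?I t * g t\<bar> \<partial>lborel)"
    proof (rule integral_mono)
     show "integrable lborel (%y. norm (case_prod ?h (x, y)))"
      using integrable_norm[OF row[of x]] by simp
     show "integrable lborel (%t. \<bar>?I x * f x\<bar> * \<bar>?I t * g t\<bar>)"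
      by (intro integrable_mult_right integrable_abs intg)
     fix t
     show "norm (case_prod ?h (x, t)) <= \<bar>?I x * f x\<bar> * \<bar>?I t * g t\<bar>"
      by (cases "x <= t") (simp_all add: abs_mult)
    qed
    moreover have "0 <= (\<integral>y. norm (case_prod ?h (x, y)) \<partial>lborel)" by simp
    ultimately show "norm (\<integral>y. norm (case_prod ?h (x, y)) \<partial>lborel)
     <= norm (?I x * f x * (\<integral>t. \<bar>?I t * g t\<bar> \<partial>lborel))" by (simp add: abs_mult)
   qed
  qed
  show "AE x in lborel. integrable lborel (%y. case_prod ?h (x, y))"
   using row by simp
 qed simp
 have "(\<integral>t. (\<integral>s. ?h s t \<partial>lborel) \<partial>lborel) = (\<integral>s. (\<integral>t. ?h s t \<partial>lborel) \<partial>lborel)"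
  by (rule lborel_pair.Fubini_integral[OF prodi])
 then have eq: "(LINT t:{a..b}|lborel. g t * (F t - F a)) = (LINT s:{a..b}|lborel. f s * (G b - G s))"
  unfolding fst_int snd_int set_lebesgue_integral_def by simp
 have i1: "L1_on {a..b} (%x. F x * g x)" "L1_on {a..b} (%x. G x * f x)"
  using set_integrable_cont_mult[OF primitive_continuous[OF F] iG(1)]
   set_integrable_cont_mult[OF primitive_continuous[OF G] iF(1)] by auto
 have "(LINT t:{a..b}|lborel. g t * (F t - F a)) = (LINT t:{a..b}|lborel. F t * g t - F a * g t)"
  by (simp add: algebra_simps)
 also have "... = (LINT t:{a..b}|lborel. F t * g t) - F a * (G b - G a)"
  using i1 iG[of a b] ab by (subst set_integral_diff) auto
 finally have e1: "(LINT t:{a..b}|lborel. g t * (F t - F a)) = (LINT t:{a..b}|lborel. F t * g t) - F a * (G b - G a)" .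
 have "(LINT t:{a..b}|lborel. f t * (G b - G t)) = (LINT t:{a..b}|lborel. G b * f t - G t * f t)"
  by (simp add: algebra_simps)
 also have "... = G b * (F b - F a) - (LINT t:{a..b}|lborel. G t * f t)"
  using i1 iF[of a b] ab by (subst set_integral_diff) auto
 finally show ?thesis using eq e1 by (simp add: algebra_simps)
qed

lemma primitive_mult:
 assumes F: "primitive F f" and G: "primitive G g"
 shows "primitive (%x. F x * G x) (%x. F x * g x + G x * f x)"
 unfolding primitive_def
proof (intro allI impI conjI)
 fix a b :: real assume ab: "a <= b"
 have i1: "L1_on {a..b} (%x. F x * g x)" "L1_on {a..b} (%x. G x * f x)"
  using set_integrable_cont_mult[OF primitive_continuous[OF F] primitiveD(1)[OF G]]
   set_integrable_cont_mult[OF primitive_continuous[OF G] primitiveD(1)[OF F]] by auto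
 then show "L1_on {a..b} (%x. F x * g x + G x * f x)" by auto
 show "F b * G b - F a * G a = (LINT x:{a..b}|lborel. F x * g x + G x * f x)"
  using integral_by_parts_primitive[OF F G ab] i1 by (simp add: set_integral_add)
qed

lemma primitive_add:
 assumes F: "primitive F f" and G: "primitive G g"
 shows "primitive (%x. F x + G x) (%x. f x + g x)"
 unfolding primitive_def
 using primitiveD[OF F] primitiveD[OF G] by (auto simp: set_integral_add)

lemma primitive_cmult:
 assumes F: "primitive F f"
 shows "primitive (%x. c * F x) (%x. c * f x)"
 unfolding primitive_def
 using primitiveD[OF F] by (auto simp flip: right_diff_distrib)

lemma primitive_diff:
 assumes F: "primitive F f" and G: "primitive G g"
 shows "primitive (%x. F x - G x) (%x. f x - g x)"
 using primitive_add[OF F primitive_cmult[OF G, of "-1"]] by simp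

lemma primitive_const: "primitive (%x. c) (%x. 0)"
 by (simp add: primitive_def set_integrable_def)

lemma cauchy_schwarz_integral:
 fixes f g :: "'a => real"
 assumes f: "f \<in> borel_measurable M" "integrable M (%x. (f x)^2)"
  and g: "g \<in> borel_measurable M" "integrable M (%x. (g x)^2)"
 shows "integrable M (%x. f x * g x)"
  and "(\<integral>x. f x * g x \<partial>M)^2 <= (\<integral>x. (f x)^2 \<partial>M) * (\<integral>x. (g x)^2 \<partial>M)"
  and "(\<integral>x. \<bar>f x * g x\<bar> \<partial>M) <= sqrt (\<integral>x. (f x)^2 \<partial>M) * sqrt (\<integral>x. (g x)^2 \<partial>M)"
proof -
 show i: "integrable M (%x. f x * g x)"
 proof (rule Bochner_Integration.integrable_bound)
  show "integrable M (%x. (f x)^2 + (g x)^2)" using f g by simp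
  have "\<bar>f x * g x\<bar> <= (f x)^2 + (g x)^2" for x
   using sum_squares_bound[of "\<bar>f x\<bar>" "\<bar>g x\<bar>"] by (simp add: abs_mult mult.assoc) (smt (verit) mult_nonneg_nonneg abs_ge_zero)
  then show "AE x in M. norm (f x * g x) <= norm ((f x)^2 + (g x)^2)" by simp
 qed (use f g in simp)
 define A B C where "A = (\<integral>x. (f x)^2 \<partial>M)" and "B = (\<integral>x. (g x)^2 \<partial>M)" and "C = (\<integral>x. \<bar>f x * g x\<bar> \<partial>M)"
 have AB: "0 <= A" "0 <= B" "0 <= C" by (auto simp: A_def B_def C_def)
 \<comment> \<open>Young's inequality with free weights; s = sqrt B and t = sqrt A are optimal when
   both integrals are positive.\<close>
 have q: "2 * s * t * C <= s^2 * A + t^2 * B" if "s \<ge> 0" "t \<ge> 0" for s t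
 proof -
  have "(\<integral>x. 2 * s * t * \<bar>f x * g x\<bar> \<partial>M) <= (\<integral>x. s^2 * (f x)^2 + t^2 * (g x)^2 \<partial>M)"
  proof (rule integral_mono)
   show "2 * s * t * \<bar>f x * g x\<bar> <= s^2 * (f x)^2 + t^2 * (g x)^2" for x
    using sum_squares_bound[of "s * \<bar>f x\<bar>" "t * \<bar>g x\<bar>"] by (simp add: abs_mult power_mult_distrib algebra_simps)
  qed (use i f g in "auto intro!: integrable_mult_right integrable_abs")
  then show ?thesis using f g i by (simp add: A_def B_def C_def)
 qed
 have CAB: "C <= sqrt A * sqrt B"
 proof (cases "A = 0 \<or> B = 0")
  case True
  have "C <= 0"
  proof (rule ccontr)
   assume "~ C <= 0"
   then have "C > 0" by simp
   show False using True
   proof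
    assume "A = 0"
    \<comment> \<open>With A = 0 and t = 1 the weighted inequality reads 2 * s * C \<le> B, and this
      s turns the left side into 2 * B + 2.\<close>
    then show False using q[of "(B + 1) / C" 1] \<open>C > 0\<close> AB by simp
   next
    assume "B = 0"
    then show False using q[of 1 "(A + 1) / C"] \<open>C > 0\<close> AB by simp
   qed
  qed
  then show ?thesis using True AB by auto
 next
  case False
  then have "sqrt A > 0" "sqrt B > 0" using AB by auto
  moreover have "2 * sqrt B * sqrt A * C <= 2 * (sqrt B * sqrt A) * (sqrt A * sqrt B)"
   using q[of "sqrt B" "sqrt A"] AB by (simp add: algebra_simps)
  ultimately show ?thesis by (auto simp: algebra_simps)
 qed
 then show "(\<integral>x. \<bar>f x * g x\<bar> \<partial>M) <= sqrt (\<integral>x. (f x)^2 \<partial>M) * sqrt (\<integral>x. (g x)^2 \<partial>M)"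
  by (simp add: A_def B_def C_def)
 have "\<bar>\<integral>x. f x * g x \<partial>M\<bar> <= C"
  unfolding C_def by (rule integral_abs_bound)
 with CAB have "\<bar>\<integral>x. f x * g x \<partial>M\<bar> <= sqrt A * sqrt B" by simp
 then have "\<bar>\<integral>x. f x * g x \<partial>M\<bar>\<^sup>2 <= (sqrt A * sqrt B)^2" by (intro power_mono) auto
 then show "(\<integral>x. f x * g x \<partial>M)^2 <= (\<integral>x. (f x)^2 \<partial>M) * (\<integral>x. (g x)^2 \<partial>M)"
  using AB by (simp add: power_mult_distrib A_def B_def)
qed

section \<open>Smooth functions on the line and cut-offs\<close>

text \<open>The one-variable form of \<open>Ck_on\<close> on the whole line. With ordinary
  derivatives as witnesses, closure under sums, products, reciprocals and affine substitutions
  follows by induction on the order.\<close>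

primrec diff_upto :: "nat => (real => real) => bool" where
 "diff_upto 0 f \<longleftrightarrow> continuous_on UNIV f"
| "diff_upto (Suc k) f \<longleftrightarrow> (EX f'. (ALL x. (f has_real_derivative f' x) (at x)) & diff_upto k f')"

lemma diff_upto_SucI:
 "(!!x. (f has_real_derivative f' x) (at x)) ==> diff_upto k f' ==> diff_upto (Suc k) f"
 by auto

lemma DERIV_imp_continuous_on:
 "(!!x. (f has_real_derivative f' x) (at x)) ==> continuous_on S f"
 by (meson DERIV_isCont continuous_at_imp_continuous_on)

lemma diff_upto_continuous: "diff_upto k f ==> continuous_on UNIV f"
 by (cases k) (auto intro: DERIV_imp_continuous_on)

lemma diff_upto_Suc: "diff_upto (Suc k) f ==> diff_upto k f"
proof (induction k arbitrary: f)
 case 0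
 then show ?case using diff_upto_continuous[of "Suc 0" f] by simp
next
 case (Suc k)
 then show ?case by (metis diff_upto.simps(2))
qed

lemma diff_upto_const: "diff_upto k (%x. c)"
proof (induction k arbitrary: c)
 case (Suc k)
 then show ?case by (auto intro!: exI[of _ "%x. 0"])
qed auto

lemma diff_upto_add: "diff_upto k f ==> diff_upto k g ==> diff_upto k (%x. f x + g x)"
proof (induction k arbitrary: f g)
 case 0
 then show ?case by (auto intro: continuous_intros)
next
 case (Suc k)
 then obtain f' g' where "ALL x. (f has_real_derivative f' x) (at x)" "diff_upto k f'"
  "ALL x. (g has_real_derivative g' x) (at x)" "diff_upto k g'" by auto
 then show ?case using Suc.IH[of f' g']
  by (auto intro!: exI[of _ "%x. f' x + g' x"] derivative_intros)
qed

lemma diff_upto_mult: "diff_upto k f ==> diff_upto k g ==> diff_upto k (%x. f x * g x)"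
proof (induction k arbitrary: f g)
 case 0
 then show ?case by (auto intro: continuous_intros)
next
 case (Suc k)
 then obtain f' g' where *: "ALL x. (f has_real_derivative f' x) (at x)" "diff_upto k f'"
  "ALL x. (g has_real_derivative g' x) (at x)" "diff_upto k g'" by auto
 have "diff_upto k (%x. f' x * g x + g' x * f x)"
  using Suc * diff_upto_Suc[OF Suc.prems(1)] diff_upto_Suc[OF Suc.prems(2)]
  by (intro diff_upto_add) auto
 then show ?case using *
  by (auto intro!: exI[of _ "%x. f' x * g x + g' x * f x"] DERIV_mult)
qed

lemma diff_upto_inverse:
 assumes "diff_upto k g" "!!x. g x ~= 0" shows "diff_upto k (%x. inverse (g x))"
 using assms
proof (induction k arbitrary: g)
 case 0
 then show ?case by (auto intro: continuous_intros)
next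
 case (Suc k)
 then obtain g' where *: "ALL x. (g has_real_derivative g' x) (at x)" "diff_upto k g'" by auto
 have i: "diff_upto k (%x. inverse (g x))" using Suc diff_upto_Suc by blast
 have "diff_upto k (%x. (-1) * ((g' x) * (inverse (g x) * inverse (g x))))"
  using i * by (intro diff_upto_mult diff_upto_const) auto
 moreover have "((%x. inverse (g x)) has_real_derivative (-1) * ((g' x) * (inverse (g x) * inverse (g x)))) (at x)" for x
  by (rule DERIV_cong[OF DERIV_inverse'[of g "g' x"]]) (use * Suc in auto)
 ultimately show ?case by (intro diff_upto_SucI)
qed

lemma diff_upto_affine:
 assumes "diff_upto k g" shows "diff_upto k (%x. g (c * x + d))"
 using assms
proof (induction k arbitrary: g)
 case 0
 have "continuous_on UNIV (%x. g (c * x + d))"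
  by (rule continuous_on_compose2[of UNIV g]) (use 0 in "auto intro!: continuous_intros")
 then show ?case by simp
next
 case (Suc k)
 then obtain g' where *: "ALL x. (g has_real_derivative g' x) (at x)" "diff_upto k g'" by auto
 have "((%x. g (c * x + d)) has_real_derivative g' (c * x + d) * c) (at x)" for x
  by (rule DERIV_chain'[where g=g]) (use * in "auto intro!: derivative_eq_intros")
 moreover have "diff_upto k (%x. g' (c * x + d) * c)"
  using Suc.IH[OF *(2)] by (intro diff_upto_mult diff_upto_const)
 ultimately show ?case by (intro diff_upto_SucI)
qed

lemma frechet_derivative_real:
 assumes "(f has_real_derivative D) (at x)"
 shows "frechet_derivative f (at x) v = D * v"
 using frechet_derivative_at[OF assms[unfolded has_field_derivative_def]] by (metis)

lemma Ck_on_of_diff_upto: "diff_upto k f ==> Ck_on k UNIV f"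
proof (induction k arbitrary: f)
 case (Suc k)
 then obtain f' where *: "!!x. (f has_real_derivative f' x) (at x)" "diff_upto k f'" by auto
 have "(%x. frechet_derivative f (at x) v) = (%x. f' x * v)" for v
  by (rule ext) (rule frechet_derivative_real[OF *(1)])
 moreover have "Ck_on k UNIV (%x. f' x * v)" for v
  using * by (intro Suc.IH diff_upto_mult diff_upto_const)
 moreover have "f differentiable at x" for x
  using *(1) real_differentiable_def by blast
 ultimately show ?case by (simp only: Ck_on.simps) blast
qed auto

lemma diff_upto_of_Ck_on: "Ck_on k UNIV f ==> diff_upto k f"
proof (induction k arbitrary: f)
 case (Suc k)
 have d: "(f has_real_derivative deriv f x) (at x)" for x
  using Suc.prems by (simp add: DERIV_deriv_iff_real_differentiable)
 have "frechet_derivative f (at x) 1 = deriv f x" for x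
  using frechet_derivative_real[OF d] by simp
 then have "(%x. frechet_derivative f (at x) 1) = deriv f" by (rule ext)
 moreover have "Ck_on k UNIV (%x. frechet_derivative f (at x) 1)" using Suc.prems by simp
 ultimately have "diff_upto k (deriv f)" using Suc.IH by simp
 then show ?case using d by auto
qed auto

lemma smooth_on_UNIV_iff: "smooth_on UNIV f \<longleftrightarrow> (ALL k. diff_upto k f)" for f :: "real => real"
 using Ck_on_of_diff_upto diff_upto_of_Ck_on by (auto simp: smooth_on_def)

lemma smooth_on_UNIV_DERIV:
 assumes "smooth_on UNIV (f :: real => real)"
 shows "(f has_real_derivative deriv f x) (at x)" "smooth_on UNIV (deriv f)"
proof -
 have "EX f'. (ALL x. (f has_real_derivative f' x) (at x)) & diff_upto k f'" for k
  using assms smooth_on_UNIV_iff diff_upto.simps(2) by blast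
 moreover have "f' = deriv f" if "ALL x. (f has_real_derivative f' x) (at x)" for f'
 proof
  show "f' x = deriv f x" for x using that DERIV_imp_deriv[of f "f' x" x] by simp
 qed
 ultimately have *: "(ALL x. (f has_real_derivative deriv f x) (at x)) & diff_upto k (deriv f)" for k
  by metis
 then show "(f has_real_derivative deriv f x) (at x)" "smooth_on UNIV (deriv f)"
  by (auto simp: smooth_on_UNIV_iff)
qed

lemma smooth_on_UNIV_antideriv:
 assumes "smooth_on UNIV (f :: real => real)" "!!x. (F has_real_derivative f x) (at x)"
 shows "smooth_on UNIV F"
 unfolding smooth_on_UNIV_iff
proof
 fix k show "diff_upto k F"
 proof (cases k)
  case 0
  then show ?thesis using DERIV_imp_continuous_on[OF assms(2)] by simp
 next
  case (Suc m)
  then show ?thesis using assms by (auto simp: smooth_on_UNIV_iff simp del: diff_upto.simps intro!: diff_upto_SucI)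
 qed
qed

text \<open>The polynomial factor closes the family generated by exp (- 1/x) under differentiation,
  so smoothness at 0 needs a single differentiability proof.\<close>

definition expinv :: "real poly => real => real" where
 "expinv p x = (if x > 0 then poly p (1/x) * exp (- (1/x)) else 0)"

lemma poly_div_exp_tendsto_0: "((%x::real. poly p x / exp x) \<longlongrightarrow> 0) at_top"
proof -
 have "((%x::real. \<Sum>i\<le>degree p. coeff p i * (x ^ i / exp x)) \<longlongrightarrow> (\<Sum>i\<le>degree p. coeff p i * 0)) at_top"
  by (intro tendsto_sum tendsto_mult tendsto_const tendsto_power_div_exp_0)
 then show ?thesis by (simp add: poly_altdef sum_divide_distrib)
qed

text \<open>With y = 1/x one has dy/dx = - y^2, so differentiation acts on the polynomial by p
  \<mapsto> y^2 * (p - p'). At 0 the right difference quotient is y * p(y) / exp y, which tends to 0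
  as y grows.\<close>

lemma DERIV_expinv:
 "(expinv p has_real_derivative expinv (monom 1 2 * (p - pderiv p)) x) (at x)"
proof -
 consider "x > 0" | "x < 0" | "x = 0" by linarith
 then show ?thesis
 proof cases
  case 1
  have "((%x. poly p (1/x) * exp (- (1/x))) has_real_derivative
    expinv (monom 1 2 * (p - pderiv p)) x) (at x)"
  proof -
   have 2: "((%x. 1 / x) has_real_derivative - (1 / x^2)) (at x)"
    using 1 by (auto intro!: derivative_eq_intros simp: power2_eq_square)
   have "((%x. poly p (1/x)) has_real_derivative poly (pderiv p) (1/x) * (- (1 / x^2))) (at x)"
    by (rule DERIV_chain2[OF poly_DERIV 2])
   moreover have "((%x. exp (- (1/x))) has_real_derivative exp (- (1/x)) * (- (- (1 / x^2)))) (at x)"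
    by (rule DERIV_chain2[OF DERIV_exp DERIV_minus[OF 2]])
   ultimately have "((%x. poly p (1/x) * exp (- (1/x))) has_real_derivative
    poly (pderiv p) (1/x) * (- (1 / x^2)) * exp (- (1/x)) + exp (- (1/x)) * (- (- (1 / x^2))) * poly p (1/x)) (at x)"
    by (rule DERIV_mult)
   then show ?thesis
    by (rule DERIV_cong) (use 1 in "simp add: expinv_def poly_monom power_one_over algebra_simps")
  qed
  then show ?thesis
   by (rule has_field_derivative_transform_within_open[where S="{0<..}"]) (use 1 in "auto simp: expinv_def")
 next
  case 2
  have "((%x. 0) has_real_derivative 0) (at x)" by simp
  then have "(expinv p has_real_derivative 0) (at x)"
   by (rule has_field_derivative_transform_within_open[where S="{..<0}"]) (use 2 in "auto simp: expinv_def")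
  then show ?thesis using 2 by (simp add: expinv_def)
 next
  case 3
  have "((%h. poly (pCons 0 p) (inverse h) / exp (inverse h)) \<longlongrightarrow> 0) (at_right 0)"
   by (rule filterlim_compose[OF poly_div_exp_tendsto_0 filterlim_inverse_at_top_right])
  then have "((%h. (expinv p (0 + h) - expinv p 0) / h) \<longlongrightarrow> 0) (at_right 0)"
  proof (rule Lim_transform_eventually)
   have "poly (pCons 0 p) (inverse h) / exp (inverse h) = (expinv p (0 + h) - expinv p 0) / h" if "0 < h" for h
    using that by (simp add: expinv_def exp_minus divide_inverse mult_ac)
   then show "\<forall>\<^sub>F h in at_right 0. poly (pCons 0 p) (inverse h) / exp (inverse h) = (expinv p (0 + h) - expinv p 0) / h"
    unfolding eventually_at_filter by (intro always_eventually) auto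
  qed
  moreover have "((%h. (expinv p (0 + h) - expinv p 0) / h) \<longlongrightarrow> 0) (at_left 0)"
   by (rule Lim_transform_eventually[OF tendsto_const])
    (unfold eventually_at_filter, intro always_eventually, auto simp: expinv_def)
  ultimately have "((%h. (expinv p (0 + h) - expinv p 0) / h) \<longlongrightarrow> 0) (at 0)"
   by (simp add: filterlim_split_at_real)
  then show ?thesis using 3 by (simp add: DERIV_def) (simp add: expinv_def)
 qed
qed

lemma diff_upto_expinv: "diff_upto k (expinv p)"
proof (induction k arbitrary: p)
 case 0
 then show ?case using DERIV_imp_continuous_on[OF DERIV_expinv] by simp
next
 case (Suc k)
 then show ?case using DERIV_expinv by (intro diff_upto_SucI)
qed

text \<open>The standard smooth transition from 0 to 1 on the unit interval. The argument 1 - x is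
  spelled \<open>(-1) * x + 1\<close> to fit \<open>diff_upto_affine\<close>.\<close>

definition smooth_step :: "real => real" where
 "smooth_step x = expinv 1 x * inverse (expinv 1 x + expinv 1 ((-1) * x + 1))"

lemma expinv_1: "0 <= expinv 1 x" "0 < x ==> 0 < expinv 1 x" "x <= 0 ==> expinv 1 x = 0"
 by (auto simp: expinv_def)

lemma smooth_step_denom: "0 < expinv 1 x + expinv 1 ((-1) * x + 1)"
 using expinv_1(1)[of x] expinv_1(2)[of x] expinv_1(1)[of "1-x"] expinv_1(2)[of "1-x"]
 by (cases "x > 0") auto

lemma diff_upto_smooth_step: "diff_upto k smooth_step"
 unfolding smooth_step_def[abs_def]
 by (intro diff_upto_mult diff_upto_inverse diff_upto_add diff_upto_expinv diff_upto_affine)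
  (rule less_imp_neq[OF smooth_step_denom, THEN not_sym])

lemma smooth_step_simps: "x <= 0 ==> smooth_step x = 0" "x \<ge> 1 ==> smooth_step x = 1"
  "0 <= smooth_step x" "smooth_step x <= 1" "0 < x ==> 0 < smooth_step x"
proof -
 let ?A = "expinv 1 x" and ?B = "expinv 1 ((-1) * x + 1)"
 have eq: "smooth_step x = ?A / (?A + ?B)" by (simp add: smooth_step_def divide_inverse)
 have pos: "0 < ?A + ?B" by (rule smooth_step_denom)
 have nn: "0 <= ?A" "0 <= ?B" by (rule expinv_1)+
 show "x <= 0 ==> smooth_step x = 0" unfolding eq by (simp add: expinv_1(3))
 show "x \<ge> 1 ==> smooth_step x = 1" unfolding eq using expinv_1(2)[of x] expinv_1(3)[of "(-1) * x + 1"] by simp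
 show "0 <= smooth_step x" unfolding eq using nn by simp
 show "smooth_step x <= 1" unfolding eq using nn pos by (simp add: divide_le_eq)
 show "0 < x ==> 0 < smooth_step x" unfolding eq using pos expinv_1(2)[of x] by simp
qed

text \<open>A cut-off living on [a, b] that equals 1 at distance at least 1/d from both ends; as d
  grows it tends to the indicator of the open interval.\<close>

definition plateau :: "real => real => real => real => real" where
 "plateau d a b x = smooth_step (d * x + (- d * a)) * smooth_step ((-d) * x + d * b)"

lemma smooth_plateau: "smooth_on UNIV (plateau d a b)"
 unfolding plateau_def[abs_def] smooth_on_UNIV_iff
 by (intro allI diff_upto_mult diff_upto_affine diff_upto_smooth_step)

lemma plateau_simps:
 assumes "0 < d"
 shows "x \<notin> {a<..<b} ==> plateau d a b x = 0"
  and "0 <= plateau d a b x" "plateau d a b x <= 1"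
  and "x \<in> {a<..<b} ==> 0 < plateau d a b x"
  and "a + 1/d <= x ==> x <= b - 1/d ==> plateau d a b x = 1"
proof -
 have 1: "d * x + (- d * a) = d * (x - a)" "(-d) * x + d * b = d * (b - x)" by (auto simp: algebra_simps)
 show "x \<notin> {a<..<b} ==> plateau d a b x = 0"
  unfolding plateau_def 1 using assms
  by (cases "x <= a") (auto simp: smooth_step_simps(1) mult_nonneg_nonpos)
 show "0 <= plateau d a b x" "plateau d a b x <= 1"
  unfolding plateau_def using smooth_step_simps(3,4) by (auto intro!: mult_le_one)
 show "x \<in> {a<..<b} ==> 0 < plateau d a b x"
  unfolding plateau_def 1 using assms by (auto intro!: mult_pos_pos smooth_step_simps(5))
 show "a + 1/d <= x ==> x <= b - 1/d ==> plateau d a b x = 1"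
 proof -
  assume "a + 1/d <= x" "x <= b - 1/d"
  then have "1 <= d * (x - a)" "1 <= d * (b - x)" using assms by (auto simp: field_simps)
  then show ?thesis unfolding plateau_def 1 by (simp add: smooth_step_simps)
 qed
qed

lemma plateau_tendsto:
 "(%n. plateau (real (Suc n)) a b x) ----> indicator {a<..<b} x"
proof (cases "x \<in> {a<..<b}")
 case True
 obtain N where N: "inverse (real (Suc N)) < min (x - a) (b - x)"
  using True reals_Archimedean[of "min (x-a) (b-x)"] by auto
 have "\<forall>n\<ge>N. plateau (real (Suc n)) a b x = 1"
 proof (intro allI impI)
  fix n assume "n \<ge> N"
  then have "1 / real (Suc n) <= inverse (real (Suc N))" by (auto simp: field_simps)
  then show "plateau (real (Suc n)) a b x = 1"
   using N by (intro plateau_simps(5)) auto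
 qed
 then show ?thesis using True
  by (intro tendsto_eventually) (auto simp: eventually_sequentially)
next
 case False
 then show ?thesis by (simp add: plateau_simps(1))
qed

section \<open>Weak derivatives on the line\<close>

lemma L1_loc_Icc: "L1_loc U f ==> {a..b} \<subseteq> U ==> L1_on {a..b} f"
 by (simp add: L1_loc_def)

lemma set_integral_supp_cong:
 fixes h :: "'a::euclidean_space => real"
 assumes "!!x. x \<in> A ==> x \<notin> B ==> h x = 0" "!!x. x \<in> B ==> x \<notin> A ==> h x = 0"
 shows "(LINT x:A|lborel. h x) = (LINT x:B|lborel. h x)"
 unfolding set_lebesgue_integral_def
 by (rule Bochner_Integration.integral_cong) (use assms in "auto simp: indicator_def")

lemma smooth_on_UNIV_continuous: "smooth_on UNIV (f :: real => real) ==> continuous_on UNIV f"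
 unfolding smooth_on_UNIV_iff using diff_upto_continuous by blast

text \<open>The fundamental lemma of the calculus of variations. Plateaus are admissible test
  functions, and by dominated convergence their integrals against \<open>h\<close> tend to interval
  integrals of \<open>h\<close>, which therefore vanish.\<close>

lemma AE_zero_if_test_integrals_zero:
 fixes h :: "real => real"
 assumes U: "open U" and h: "L1_loc U h"
  and zero: "!!\<phi> K. smooth_on UNIV \<phi> ==> compact K ==> K \<subseteq> U ==> (!!x. x \<notin> K ==> \<phi> x = 0)
   ==> (LINT x:U|lborel. h x * \<phi> x) = 0"
 shows "AE x in lborel. x \<in> U --> h x = 0"
proof -
 have int0: "(LINT y:{c..x}|lborel. h y) = 0" if cx: "{c..x} \<subseteq> U" for c x
 proof -
  let ?p = "%n. plateau (real (Suc n)) c x"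
  have ih: "L1_on {c..x} h" using h cx by (rule L1_loc_Icc)
  have "(LINT y:{c..x}|lborel. h y * ?p n y) = 0" for n
  proof -
   have "(LINT y:{c..x}|lborel. h y * ?p n y) = (LINT y:U|lborel. h y * ?p n y)"
    by (rule set_integral_supp_cong) (use cx in "auto simp: plateau_simps(1)")
   also have "... = 0"
    by (rule zero[OF smooth_plateau _ cx]) (auto simp: plateau_simps(1))
   finally show ?thesis .
  qed
  moreover have "(%n. LINT y:{c..x}|lborel. h y * ?p n y) ----> (LINT y:{c..x}|lborel. h y)"
   unfolding set_lebesgue_integral_def
  proof (rule integral_dominated_convergence)
   show "integrable lborel (%y. \<bar>indicator {c..x} y *\<^sub>R h y\<bar>)"
    using ih unfolding set_integrable_def by (rule integrable_abs)
   show "(%y. indicat_real {c..x} y *\<^sub>R h y) \<in> borel_measurable lborel"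
    using ih unfolding set_integrable_def by auto
   have "L1_on {c..x} (%y. ?p n y * h y)" for n
    by (intro set_integrable_cont_mult ih continuous_on_subset[OF smooth_on_UNIV_continuous[OF smooth_plateau]]) auto
   then show "(%y. indicat_real {c..x} y *\<^sub>R (h y * ?p n y)) \<in> borel_measurable lborel" for n
    unfolding set_integrable_def by (simp add: mult.commute)
   have "AE y in lborel. y ~= c" "AE y in lborel. y ~= x"
    by (auto simp: AE_lborel_singleton)
   then show "AE y in lborel. (%n. indicat_real {c..x} y *\<^sub>R (h y * ?p n y)) ----> indicat_real {c..x} y *\<^sub>R h y"
   proof eventually_elim
    case (elim y)
    have "(%n. indicat_real {c..x} y *\<^sub>R (h y * ?p n y)) ----> indicat_real {c..x} y *\<^sub>R (h y * indicator {c<..<x} y)"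
     by (intro tendsto_intros plateau_tendsto)
    then show ?case using elim by (auto simp: indicator_def)
   qed
   show "AE y in lborel. norm (indicat_real {c..x} y *\<^sub>R (h y * ?p n y)) <= \<bar>indicat_real {c..x} y *\<^sub>R h y\<bar>" for n
    using plateau_simps(2,3)[of "real (Suc n)" c x]
    by (intro AE_I2) (auto simp: indicator_def abs_mult intro!: mult_right_le_one_le)
  qed
  ultimately show ?thesis by (simp add: LIMSEQ_const_iff)
 qed
 have I: "AE x in lborel. x \<in> {c..d} --> h x = 0" if "{c..d} \<subseteq> U" for c d
  using that by (intro AE_zero_if_interval_integrals_zero[OF L1_loc_Icc[OF h that]] int0) auto
 \<comment> \<open>Countably many intervals with rational ends exhaust the open set, so their
   exceptional null sets can be collected.\<close>
 have "AE x in lborel. \<forall>c\<in>\<rat>. \<forall>d\<in>\<rat>. {c..d} \<subseteq> U --> x \<in> {c..d} --> h x = 0"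
 proof -
  have "AE x in lborel. {c..d} \<subseteq> U --> x \<in> {c..d} --> h x = 0" for c d
   using I[of c d] by (cases "{c..d} \<subseteq> U") auto
  then show ?thesis
   unfolding AE_ball_countable[OF countable_rat] by blast
 qed
 then show ?thesis
 proof eventually_elim
  case (elim x)
  show ?case
  proof
   assume "x \<in> U"
   then obtain e where e: "e > 0" "ball x e \<subseteq> U" using U open_contains_ball by blast
   obtain c where c: "c \<in> \<rat>" "x - e < c" "c < x" using Rats_dense_in_real[of "x-e" x] e by auto
   obtain d where d: "d \<in> \<rat>" "x < d" "d < x + e" using Rats_dense_in_real[of x "x+e"] e by auto
   have "{c..d} \<subseteq> ball x e" using c d by (auto simp: dist_real_def)
   then show "h x = 0" using elim c d e by auto
  qed
 qed
qed

lemma test_set_integrable: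
 fixes h \<phi> :: "real => real"
 assumes "L1_loc U h" "continuous_on UNIV \<phi>" "compact K" "K \<subseteq> U" "!!x. x \<notin> K ==> \<phi> x = 0"
 shows "L1_on U (%x. h x * \<phi> x)"
proof -
 have "compact (\<phi> ` K)"
  using compact_continuous_image[OF continuous_on_subset[OF assms(2)] assms(3)] by simp
 then obtain B where B: "!!x. x \<in> K ==> \<bar>\<phi> x\<bar> <= B"
  by (metis (no_types, lifting) bounded_iff compact_imp_bounded image_eqI real_norm_def)
 have hK: "L1_on K h" using assms by (simp add: L1_loc_def)
 have "integrable lborel (%x. (indicator K x *\<^sub>R h x) * \<phi> x)"
 proof (rule Bochner_Integration.integrable_bound)
  show "integrable lborel (%x. B * (indicator K x *\<^sub>R h x))"
   using hK by (auto simp: set_integrable_def)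
  show "(%x. (indicator K x *\<^sub>R h x) * \<phi> x) \<in> borel_measurable lborel"
   using hK borel_measurable_continuous_onI[OF assms(2)] unfolding set_integrable_def by auto
  show "AE x in lborel. norm ((indicat_real K x *\<^sub>R h x) * \<phi> x) <= norm (B * indicat_real K x *\<^sub>R h x)"
   using B by (intro AE_I2) (force simp: indicator_def abs_mult mult.commute intro!: mult_right_mono)
 qed
 also have "(%x. (indicator K x *\<^sub>R h x) * \<phi> x) = (%x. indicator U x *\<^sub>R (h x * \<phi> x))"
  using assms by (auto simp: indicator_def fun_eq_iff)
 finally show ?thesis by (simp add: set_integrable_def)
qed

lemma deriv_zero_outside:
 fixes \<phi> :: "real => real"
 assumes "compact K" "!!x. x \<notin> K ==> \<phi> x = 0" "x \<notin> K"
 shows "deriv \<phi> x = 0"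
proof -
 have "((%x. 0) has_real_derivative 0) (at x)" by simp
 then have "(\<phi> has_real_derivative 0) (at x)"
  by (rule has_field_derivative_transform_within_open[where S="- K"])
   (use assms compact_imp_closed in auto)
 then show ?thesis by (rule DERIV_imp_deriv)
qed

lemma weak_deriv_unique:
 assumes U: "open U" and w: "weak_deriv U f g" "weak_deriv U f h"
 shows "AE x in lborel. x \<in> U --> g x = h x"
proof -
 have L: "L1_loc U g" "L1_loc U h" using w by (auto simp: weak_deriv_def)
 have "AE x in lborel. x \<in> U --> g x - h x = 0"
 proof (rule AE_zero_if_test_integrals_zero[OF U])
  show "L1_loc U (%x. g x - h x)" using L by (auto simp: L1_loc_def)
  fix \<phi> :: "real => real" and K assume *: "smooth_on UNIV \<phi>" "compact K" "K \<subseteq> U" "!!x. x \<notin> K ==> \<phi> x = 0"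
  have c: "continuous_on UNIV \<phi>" using smooth_on_UNIV_continuous[OF *(1)] .
  have "(LINT x:U|lborel. (g x - h x) * \<phi> x) = (LINT x:U|lborel. g x * \<phi> x) - (LINT x:U|lborel. h x * \<phi> x)"
   using test_set_integrable[OF L(1) c *(2,3,4)] test_set_integrable[OF L(2) c *(2,3,4)]
   by (simp add: left_diff_distrib)
  also have "... = 0"
  proof -
   have "(LINT x:U|lborel. f x * deriv \<phi> x) = - (LINT x:U|lborel. g x * \<phi> x)"
    using w(1) * unfolding weak_deriv_def by blast
   moreover have "(LINT x:U|lborel. f x * deriv \<phi> x) = - (LINT x:U|lborel. h x * \<phi> x)"
    using w(2) * unfolding weak_deriv_def by blast
   ultimately show ?thesis by simp
  qed
  finally show "(LINT x:U|lborel. (g x - h x) * \<phi> x) = 0" .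
 qed
 then show ?thesis by eventually_elim auto
qed

lemma weak_deriv_wderiv: "weak_deriv U f g ==> weak_deriv U f (wderiv U f)"
 unfolding wderiv_def by (rule someI[where P="weak_deriv U f"])

lemma compact_in_Icc:
 fixes K :: "real set"
 assumes "compact K" obtains B where "K \<subseteq> {-B<..<B}" "B > 0"
proof -
 obtain B where "B > 0" "K \<subseteq> ball 0 B"
  using bounded_subset_ballD[OF compact_imp_bounded[OF assms], of 0] by blast
 then show ?thesis using that[of B] by (simp add: ball_eq_greaterThanLessThan)
qed

lemma L1_loc_UNIV_I:
 assumes *: "!!a b. L1_on {a..b} f"
 shows "L1_loc UNIV f"
 unfolding L1_loc_def
proof (intro allI impI)
 fix K :: "real set" assume K: "compact K & K \<subseteq> UNIV"
 then obtain B where B: "K \<subseteq> {-B<..<B}" using compact_in_Icc by blast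
 have KB: "K \<subseteq> {-B..B}" by (rule subset_trans[OF B]) auto
 have "K \<in> sets lborel" using K compact_imp_closed[of K] by simp
 then show "L1_on K f"
  by (rule set_integrable_subset[OF *[of "-B" B] _ KB])
qed

lemma L1_loc_UNIV_iff: "L1_loc UNIV f \<longleftrightarrow> (ALL a b. L1_on {a..b} f)"
proof
 assume "L1_loc UNIV f"
 then show "ALL a b. L1_on {a..b} f" by (intro allI L1_loc_Icc[of UNIV]) auto
next
 assume "ALL a b. L1_on {a..b} f"
 then show "L1_loc UNIV f" by (intro L1_loc_UNIV_I) blast
qed

lemma continuous_imp_L1_loc: "continuous_on UNIV f ==> L1_loc UNIV f"
 by (intro L1_loc_UNIV_I borel_integrable_atLeastAtMost') (auto intro: continuous_on_subset)

lemma primitive_imp_weak_deriv: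
 assumes p: "primitive f g"
 shows "weak_deriv UNIV f g"
 unfolding weak_deriv_def
proof (intro conjI allI impI)
 show "L1_loc UNIV f" by (rule continuous_imp_L1_loc[OF primitive_continuous[OF p]])
 show "L1_loc UNIV g" using primitiveD(1)[OF p] by (simp add: L1_loc_UNIV_iff)
 fix \<phi> :: "real => real" and K :: "real set"
 assume *: "smooth_on UNIV \<phi> & compact K & K \<subseteq> UNIV & (ALL x. x \<notin> K --> \<phi> x = 0)"
 then obtain B where B: "K \<subseteq> {-B<..<B}" "B > 0" using compact_in_Icc by blast
 have pp: "primitive \<phi> (deriv \<phi>)"
  using * smooth_on_UNIV_DERIV[of \<phi>] smooth_on_UNIV_continuous[of "deriv \<phi>"]
  by (intro primitive_of_deriv) auto
 have phi0: "\<phi> x = 0" if "x \<notin> {-B<..<B}" for x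
  using * B(1) that by blast
 then have z: "\<phi> B = 0" "\<phi> (-B) = 0" by auto
 have dphi0: "deriv \<phi> x = 0" if "x \<notin> {-B..B}" for x
  by (rule deriv_zero_outside[OF compact_Icc phi0 that]) auto
 have "(LINT x:UNIV|lborel. f x * deriv \<phi> x) = (LINT x:{-B..B}|lborel. f x * deriv \<phi> x)"
  by (rule set_integral_supp_cong) (use dphi0 in auto)
 moreover have "(LINT x:UNIV|lborel. g x * \<phi> x) = (LINT x:{-B..B}|lborel. \<phi> x * g x)"
  by (subst mult.commute, rule set_integral_supp_cong) (use phi0 in auto)
 moreover have "(LINT x:{-B..B}|lborel. f x * deriv \<phi> x) + (LINT x:{-B..B}|lborel. \<phi> x * g x) = 0"
  using integral_by_parts_primitive[OF p pp, of "-B" B] z B by simp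
 ultimately show "(LINT x:UNIV|lborel. f x * deriv \<phi> x) = - (LINT x:UNIV|lborel. g x * \<phi> x)" by simp
qed

lemma primitive_indefinite_integral:
 assumes "!!a b. L1_on {a..b} g"
 shows "primitive (%x. if 0 <= x then (LINT y:{0..x}|lborel. g y) else - (LINT y:{x..0}|lborel. g y)) g"
 unfolding primitive_def
proof (intro allI impI conjI assms)
 fix a b :: real assume "a <= b"
 then consider "0 <= a" | "b < 0" | "a < 0" "0 <= b" by linarith
 then show "(if 0 <= b then LINT y:{0..b}|lborel. g y else - (LINT y:{b..0}|lborel. g y)) -
  (if 0 <= a then LINT y:{0..a}|lborel. g y else - (LINT y:{a..0}|lborel. g y)) = (LINT x:{a..b}|lborel. g x)"
 proof cases
  case 1
  then show ?thesis using set_integral_split[OF 1 \<open>a <= b\<close> assms] \<open>a <= b\<close> by simp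
 next
  case 2
  then show ?thesis using set_integral_split[of a b 0 g, OF _ _ assms] \<open>a <= b\<close> by simp
 next
  case 3
  then show ?thesis using set_integral_split[of a 0 b g, OF _ _ assms] by simp
 qed
qed

lemma primitive_DERIV:
 assumes p: "primitive f g" and g: "continuous_on {a..b} g" and x: "a < x" "x < b"
 shows "(f has_real_derivative g x) (at x)"
proof -
 have "((%u. integral {a..u} g) has_real_derivative g x) (at x within {a..b})"
  by (rule integral_has_real_derivative[OF g]) (use x in auto)
 then have "((%u. integral {a..u} g) has_real_derivative g x) (at x)"
  unfolding at_within_Icc_at[OF x] .
 then have "((%u. f a + integral {a..u} g) has_real_derivative g x) (at x)"
  using DERIV_add[OF DERIV_const, of _ _ _ _ "f a"] by fastforce
 then show ?thesis
 proof (rule has_field_derivative_transform_within_open[where S="{a<..<b}"])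
  fix u assume "u \<in> {a<..<b}"
  then show "f a + integral {a..u} g = f u"
   using primitiveD[OF p, of a u] set_borel_integral_eq_integral(2)[OF primitiveD(1)[OF p, of a u]] by simp
 qed (use x in auto)
qed

text \<open>The difference of \<open>f\<close> and an indefinite integral of \<open>g\<close>
  annihilates all derivatives of test functions. A test function is such a derivative as soon as its
  mean is zero, and subtracting a multiple of one fixed bump arranges that; hence the difference is
  constant almost everywhere.\<close>

lemma weak_deriv_UNIV_imp_primitive:
 assumes w: "weak_deriv UNIV f g"
 obtains F where "primitive F g" "AE x in lborel. f x = F x"
proof -
 define F0 where "F0 = (%x. if 0 <= x then (LINT y:{0..x}|lborel. g y) else - (LINT y:{x..0}|lborel. g y))"
 have p0: "primitive F0 g" unfolding F0_def
  by (rule primitive_indefinite_integral) (use w in "simp add: weak_deriv_def L1_loc_UNIV_iff")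
 let ?h = "%x. f x - F0 x"
 have w0: "weak_deriv UNIV F0 g" by (rule primitive_imp_weak_deriv[OF p0])
 have L: "L1_loc UNIV f" "L1_loc UNIV F0" using w w0 by (auto simp: weak_deriv_def)
 have Lh: "L1_loc UNIV ?h" using L by (auto simp: L1_loc_def)
 have hz: "(LINT x:UNIV|lborel. ?h x * deriv \<phi> x) = 0"
  if *: "smooth_on UNIV \<phi>" "compact K" "!!x. x \<notin> K ==> \<phi> x = 0" for \<phi> K
 proof -
  have c: "continuous_on UNIV (deriv \<phi>)" using smooth_on_UNIV_continuous[OF smooth_on_UNIV_DERIV(2)[OF *(1)]] .
  have d0: "!!x. x \<notin> K ==> deriv \<phi> x = 0" using deriv_zero_outside * by blast
  have "(LINT x:UNIV|lborel. ?h x * deriv \<phi> x) = (LINT x:UNIV|lborel. f x * deriv \<phi> x) - (LINT x:UNIV|lborel. F0 x * deriv \<phi> x)"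
   using test_set_integrable[OF L(1) c *(2) _ d0] test_set_integrable[OF L(2) c *(2) _ d0]
   by (simp add: left_diff_distrib)
  also have "(LINT x:UNIV|lborel. f x * deriv \<phi> x) = - (LINT x:UNIV|lborel. g x * \<phi> x)"
   using w * unfolding weak_deriv_def by blast
  also have "(LINT x:UNIV|lborel. F0 x * deriv \<phi> x) = - (LINT x:UNIV|lborel. g x * \<phi> x)"
   using w0 * unfolding weak_deriv_def by blast
  finally show ?thesis by simp
 qed
 let ?q = "plateau 1 0 1"
 define I where "I = (LINT x:{0..1}|lborel. ?q x)"
 have qc: "continuous_on UNIV ?q" using smooth_on_UNIV_continuous[OF smooth_plateau] .
 have Ipos: "I > 0"
 proof -
  have "~ (AE x in lborel. indicator {0..1} x *\<^sub>R ?q x = 0)"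
  proof
   assume "AE x in lborel. indicator {0..1} x *\<^sub>R ?q x = (0::real)"
   then have "AE x in lborel. x \<notin> {0<..<1::real}"
   proof eventually_elim
    case (elim x)
    then show ?case using plateau_simps(4)[of 1 x 0 1] by (auto simp: indicator_def split: if_splits)
   qed
   then have "{0<..<1::real} \<in> null_sets lborel" by (simp add: AE_iff_null_sets)
   then have "emeasure lborel {0<..<1::real} = 0" by blast
   then show False by simp
  qed
  moreover have "L1_on {0..1} ?q" by (intro borel_integrable_atLeastAtMost' continuous_on_subset[OF qc]) auto
  ultimately have "I ~= 0" using plateau_simps(2)[of 1 0 1] unfolding I_def set_lebesgue_integral_def set_integrable_def
   by (subst integral_nonneg_eq_0_iff_AE) auto
  moreover have "I \<ge> 0" unfolding I_def set_lebesgue_integral_def using plateau_simps(2)[of 1 0 1] by (intro integral_nonneg_AE) auto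
  ultimately show ?thesis by simp
 qed
 \<comment> \<open>The only possible value of the constant: the mean of the difference weighted by
   the normalised bump.\<close>
 define c where "c = (LINT x:UNIV|lborel. ?h x * ?q x) / I"
 have Lc: "L1_loc UNIV (%x. ?h x - c)" using Lh continuous_imp_L1_loc[of "%x. c"] by (auto simp: L1_loc_def)
 have "AE x in lborel. x \<in> UNIV --> ?h x - c = 0"
 proof (rule AE_zero_if_test_integrals_zero[OF open_UNIV Lc])
  fix \<psi> :: "real => real" and K :: "real set" assume *: "smooth_on UNIV \<psi>" "compact K" "K \<subseteq> UNIV" "!!x. x \<notin> K ==> \<psi> x = 0"
  have psic: "continuous_on UNIV \<psi>" using smooth_on_UNIV_continuous[OF *(1)] .
  obtain B0 where B0: "K \<subseteq> {-B0<..<B0}" "B0 > 0" using compact_in_Icc * by blast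
  define B where "B = max B0 2"
  have B: "K \<subseteq> {-B..B}" "{0..1} \<subseteq> {-B..B}" "B > 0" "1 <= B"
  proof -
   show "K \<subseteq> {-B..B}" by (rule subset_trans[OF B0(1)]) (auto simp: B_def)
  qed (auto simp: B_def)
  define J where "J = (LINT x:{-B..B}|lborel. \<psi> x)"
  let ?k = "%x. \<psi> x - J / I * ?q x"
  have kc: "continuous_on UNIV ?k" by (intro continuous_intros psic qc)
  have ks: "smooth_on UNIV ?k"
   using smooth_on_UNIV_iff * smooth_plateau diff_upto_add[OF _ diff_upto_mult[OF diff_upto_const[of _ "- J / I"]]] by simp
  have k0: "?k x = 0" if "x \<notin> {-B..B}" for x
  proof -
   have "x \<notin> K" "x \<notin> {0<..<1}" using that B by (auto simp: subset_iff)
   then show ?thesis using *(4) by (simp add: plateau_simps(1))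
  qed
  have ci: "L1_on {a..b} f" if "continuous_on UNIV f" for a b and f :: "real => real"
   using continuous_imp_L1_loc[OF that] by (simp add: L1_loc_UNIV_iff)
  \<comment> \<open>The indefinite integral minus its value at -B, which is
    \<open>- (LINT y:{-B..0}|lborel. ?k y)\<close>. Since \<open>?k\<close> vanishes off [-B, B] and
    has mean zero, \<open>P\<close> has compact support and is a legitimate test function.\<close>
  define P where "P = (%x. (if 0 <= x then (LINT y:{0..x}|lborel. ?k y) else - (LINT y:{x..0}|lborel. ?k y)) - - (LINT y:{-B..0}|lborel. ?k y))"
  have pP: "primitive P ?k" unfolding P_def
   by (rule primitive_diff[OF primitive_indefinite_integral[OF ci[OF kc]] primitive_const, of "- (LINT y:{-B..0}|lborel. ?k y)", simplified diff_zero])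
  have PB: "P (-B) = 0" using B by (simp add: P_def)
  have q1: "(LINT y:{-B..B}|lborel. ?q y) = I"
   unfolding I_def by (rule set_integral_supp_cong) (use B in "auto simp: plateau_simps(1)")
  have "(LINT y:{-B..B}|lborel. ?k y) = 0"
   using ci[OF psic] ci[OF qc] Ipos by (subst set_integral_diff) (auto simp: q1 J_def)
  then have PB2: "P B = 0" using primitiveD(2)[OF pP, of "-B" B] PB B by simp
  have P0: "P x = 0" if "x \<notin> {-B..B}" for x
  proof (cases "x < -B")
   case True
   have "(LINT y:{x..-B}|lborel. ?k y) = (LINT y:{-B}|lborel. ?k y)"
    by (rule set_integral_supp_cong) (use True k0 in auto)
   also have "... = 0" by (subst set_lebesgue_integral_def) (rule integral_eq_zero_AE, use AE_lborel_singleton[of "-B"] in "auto elim!: eventually_mono")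
   finally show ?thesis using primitiveD(2)[OF pP, of x "-B"] PB True by simp
  next
   case False
   then have "B < x" using that by auto
   have "(LINT y:{B..x}|lborel. ?k y) = (LINT y:{B}|lborel. ?k y)"
    by (rule set_integral_supp_cong) (use \<open>B < x\<close> k0 B in auto)
   also have "... = 0" by (subst set_lebesgue_integral_def) (rule integral_eq_zero_AE, use AE_lborel_singleton[of "B"] in "auto elim!: eventually_mono")
   finally show ?thesis using primitiveD(2)[OF pP, of B x] PB2 \<open>B < x\<close> by simp
  qed
  have dP: "(P has_real_derivative ?k x) (at x)" for x
   by (rule primitive_DERIV[OF pP, of "x-1" "x+1"]) (intro continuous_on_subset[OF kc subset_UNIV], auto)
  have Ps: "smooth_on UNIV P" by (rule smooth_on_UNIV_antideriv[OF ks dP])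
  have dPk: "deriv P = ?k" using dP DERIV_imp_deriv by blast
  have "(LINT x:UNIV|lborel. ?h x * ?k x) = 0"
   using hz[OF Ps compact_Icc P0] unfolding dPk by simp
  moreover have hp: "L1_on UNIV (%x. ?h x * \<psi> x)" by (rule test_set_integrable[OF Lh psic *(2,3,4)])
  moreover have hq: "L1_on UNIV (%x. ?h x * ?q x)"
   by (rule test_set_integrable[OF Lh qc, of "{0..1}"]) (auto simp: plateau_simps(1))
  moreover have "(LINT x:UNIV|lborel. ?h x * ?k x) = (LINT x:UNIV|lborel. ?h x * \<psi> x - J / I * (?h x * ?q x))"
   by (rule arg_cong[where f="set_lebesgue_integral lborel UNIV"]) (rule ext, simp only: right_diff_distrib mult.assoc mult.left_commute)
  moreover have "(LINT x:UNIV|lborel. ?h x * \<psi> x - J / I * (?h x * ?q x)) = (LINT x:UNIV|lborel. ?h x * \<psi> x) - J / I * (LINT x:UNIV|lborel. ?h x * ?q x)"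
   using hp hq by (subst set_integral_diff) auto
  ultimately have hpsi: "(LINT x:UNIV|lborel. ?h x * \<psi> x) = c * J" by (simp add: c_def)
  have hp: "L1_on UNIV (%x. ?h x * \<psi> x)" by (rule test_set_integrable[OF Lh psic *(2,3,4)])
  have psiJ: "(LINT x:UNIV|lborel. \<psi> x) = J" unfolding J_def
  proof (rule set_integral_supp_cong)
   fix x :: real assume "x \<notin> {-B..B}"
   then show "\<psi> x = 0" using *(4) B(1) by blast
  qed simp
  have psii: "L1_on UNIV \<psi>"
   using test_set_integrable[OF continuous_imp_L1_loc[of "%_. 1"] psic *(2,3,4)] by simp
  have "(LINT x:UNIV|lborel. (?h x - c) * \<psi> x) = (LINT x:UNIV|lborel. ?h x * \<psi> x - c * \<psi> x)"
   by (simp only: left_diff_distrib)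
  also have "... = (LINT x:UNIV|lborel. ?h x * \<psi> x) - (LINT x:UNIV|lborel. c * \<psi> x)"
   using hp psii by (intro set_integral_diff) auto
  also have "... = 0" using hpsi psiJ by simp
  finally show "(LINT x:UNIV|lborel. (?h x - c) * \<psi> x) = 0" .
 qed
 then have "AE x in lborel. f x = F0 x + c" by eventually_elim simp
 moreover have "primitive (%x. F0 x + c) g" using primitive_add[OF p0 primitive_const[of c]] by simp
 ultimately show ?thesis using that by blast
qed

section \<open>Components of positivity and one-sided zeros\<close>

text \<open>The ends are the last zero before \<open>c\<close> and the first zero after it, which
  exist by compactness; a nonpositive value in between would produce another zero by the
  intermediate value theorem.\<close>

lemma hump_exists:
 fixes f :: "real => real"
 assumes f: "continuous_on {a..b} f" "f a = 0" "f b = 0" and c: "a < c" "c < b" "0 < f c"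
 obtains a' b' where "a <= a'" "a' < c" "c < b'" "b' <= b" "f a' = 0" "f b' = 0"
  "!!x. a' < x ==> x < b' ==> 0 < f x"
proof -
 let ?S = "{x \<in> {a..c}. f x = 0}" and ?T = "{x \<in> {c..b}. f x = 0}"
 have fc: "continuous_on {a..c} f" "continuous_on {c..b} f"
  using f c by (auto intro: continuous_on_subset)
 have cS: "compact ?S" "compact ?T"
  using continuous_closed_preimage_constant[OF fc(1) closed_atLeastAtMost, of 0]
   continuous_closed_preimage_constant[OF fc(2) closed_atLeastAtMost, of 0]
  by (auto simp: compact_eq_bounded_closed intro: bounded_subset[OF bounded_closed_interval])
 have "a \<in> ?S" "b \<in> ?T" using f c by auto
 then obtain a' b' where a': "a' \<in> ?S" "!!x. x \<in> ?S ==> x <= a'" and b': "b' \<in> ?T" "!!x. x \<in> ?T ==> b' <= x"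
  using compact_attains_sup[OF cS(1)] compact_attains_inf[OF cS(2)] by blast
 show ?thesis
 proof (rule that)
  show "a <= a'" "f a' = 0" "b' <= b" "f b' = 0" using a' b' by auto
  show "a' < c" "c < b'" using a' b' c by (auto simp: less_le)
  fix x assume x: "a' < x" "x < b'"
  show "0 < f x"
  proof (rule ccontr)
   assume n: "~ 0 < f x"
   consider "x <= c" | "c < x" by linarith
   then show False
   proof cases
    case 1
    have "continuous_on {x..c} f" using fc(1) x a' by (auto intro: continuous_on_subset)
    then obtain z where "x <= z" "z <= c" "f z = 0"
     using IVT'[of f x 0 c] n c 1 by auto
    then have "z \<in> ?S" "a' < z" using x a' by auto
    then show False using a'(2)[of z] by linarith
   next
    case 2
    have "continuous_on {c..x} f" using fc(2) x b' by (auto intro: continuous_on_subset)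
    then obtain z where "c <= z" "z <= x" "f z = 0"
     using IVT2'[of f x 0 c] n c 2 by auto
    then have "z \<in> ?T" "z < b'" using x b' by auto
    then show False using b'(2)[of z] by linarith
   qed
  qed
 qed
qed

lemma MVT_open:
 fixes f f' :: "real => real"
 assumes "a < b" "continuous_on {a..b} f"
  and d: "!!x. a < x ==> x < b ==> (f has_real_derivative f' x) (at x)"
 obtains z where "a < z" "z < b" "f b - f a = (b - a) * f' z"
proof -
 have "f differentiable (at x)" if "a < x" "x < b" for x
  using d[OF that] real_differentiable_def by blast
 then obtain l z where z: "a < z" "z < b" "(f has_real_derivative l) (at z)" "f b - f a = (b - a) * l"
  using MVT[OF assms(1,2)] by blast
 moreover have "l = f' z" using DERIV_unique[OF z(3) d[OF z(1,2)]] .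
 ultimately show ?thesis using that by simp
qed

text \<open>Two zeros of \<open>f\<close> would enclose a zero of \<open>f'\<close> by Rolle, so
  there is at most one in the interval, and \<open>e\<close> stops at it.\<close>

lemma eventually_nonzero_right_of_deriv:
 fixes f f' :: "real => real"
 assumes "0 < d" "continuous_on {x0..x0+d} f"
  and "!!x. x0 < x ==> x < x0 + d ==> (f has_real_derivative f' x) (at x)"
  and "!!x. x0 < x ==> x < x0 + d ==> f' x ~= 0"
 obtains e where "0 < e" "e <= d" "!!x. x0 < x ==> x < x0 + e ==> f x ~= 0"
proof (cases "EX z. x0 < z & z < x0 + d & f z = 0")
 case True
 then obtain z where z: "x0 < z" "z < x0 + d" "f z = 0" by auto
 show ?thesis
 proof (rule that[of "z - x0"])
  fix x assume x: "x0 < x" "x < x0 + (z - x0)"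
  show "f x ~= 0"
  proof
   assume "f x = 0"
   have c: "continuous_on {x..z} f" using assms(2) x z by (auto intro: continuous_on_subset)
   have d: "(f has_real_derivative f' y) (at y)" if "x < y" "y < z" for y
    using assms(3)[of y] that x z by auto
   obtain y where "x < y" "y < z" "f z - f x = (z - x) * f' y"
    using MVT_open[OF _ c d] x by auto
   then show False using assms(4)[of y] x z \<open>f x = 0\<close> by auto
  qed
 qed (use z in auto)
next
 case False
 then show ?thesis using that[of d] assms(1) by auto
qed

lemma eventually_nonzero_right_of_cont:
 fixes f :: "real => real"
 assumes "isCont f x0" "f x0 ~= 0" "0 < d"
 obtains e where "0 < e" "e <= d" "!!x. x0 < x ==> x < x0 + e ==> f x ~= 0"
proof -
 have "eventually (%x. f x ~= 0) (nhds x0)"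
  using tendsto_imp_eventually_ne[of f "f x0" "nhds x0" 0] assms by (simp add: isCont_def tendsto_nhds_iff)
 then obtain e where "e > 0" "!!x. dist x x0 < e ==> f x ~= 0" by (auto simp: eventually_nhds_metric)
 then show ?thesis using that[of "min e d"] assms by (auto simp: dist_real_def)
qed

lemma sin_sign_right: "\<exists>d>0. \<exists>s\<in>{1,-1::real}. ALL x. x0 < x & x < x0 + d --> 0 < s * sin x"
proof (cases "sin x0 = 0")
 case True
 then have c: "cos x0 = 1 \<or> cos x0 = -1" using sin_cos_squared_add[of x0] by (auto simp: power2_eq_1_iff)
 have "0 < cos x0 * sin x" if "x0 < x" "x < x0 + pi" for x
 proof -
  have "sin x = sin x0 * cos (x - x0) + cos x0 * sin (x - x0)" using sin_add[of x0 "x - x0"] by simp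
  moreover have "0 < sin (x - x0)" using that by (intro sin_gt_zero) auto
  ultimately show ?thesis using c True by auto
 qed
 then show ?thesis using c pi_gt_zero by (intro exI[of _ pi]) auto
next
 case False
 have "\<exists>d>0. ALL x. dist x x0 < d --> 0 < sgn (sin x0) * sin x"
 proof -
  have "((%x. sgn (sin x0) * sin x) \<longlongrightarrow> sgn (sin x0) * sin x0) (nhds x0)"
   by (intro tendsto_intros filterlim_ident)
  then have "eventually (%x. 0 < sgn (sin x0) * sin x) (nhds x0)"
   by (rule order_tendstoD) (use False in "auto simp: sgn_if")
  then show ?thesis by (simp add: eventually_nhds_metric)
 qed
 then obtain d where "d > 0" "!!x. dist x x0 < d ==> 0 < sgn (sin x0) * sin x" by auto
 then show ?thesis using False
  by (intro exI[of _ d] conjI bexI[of _ "sgn (sin x0)"]) (auto simp: dist_real_def sgn_if)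
qed

section \<open>Films: zero-dissipation states and their touchdown structure\<close>

text \<open>On each component of positivity, \<open>deriv3\<close> says that the pressure
  \<open>w2 x + \<alpha>^2 * w x + cos x\<close> is constant; the constants of different components
  are unrelated. On the zero set \<open>w1\<close> need not be differentiable, and the value 0
  prescribed there for \<open>w2\<close> is the one that makes it a weak second derivative.\<close>

locale film =
 fixes \<alpha> :: real and w w1 w2 :: "real => real"
 assumes alpha: "0 < \<alpha>"
  and per: "periodic w" and nonneg: "0 <= w x"
  and deriv1: "(w has_real_derivative w1 x) (at x)"
  and cont1: "continuous_on UNIV w1"
  and deriv2: "0 < w x ==> (w1 has_real_derivative w2 x) (at x)"
  and deriv3: "0 < w x ==> (w2 has_real_derivative sin x - \<alpha>\<^sup>2 * w1 x) (at x)"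
  and zero2: "w x = 0 ==> w2 x = 0"
begin

lemma w_cont: "continuous_on S w"
 using DERIV_imp_continuous_on[of w w1] deriv1 by blast

lemma w1_isCont: "isCont w1 x"
 using cont1 by (simp add: continuous_on_eq_continuous_at)

lemma not_pos: "~ 0 < w x \<longleftrightarrow> w x = 0" using nonneg[of x] by auto

lemma zero1: "w x = 0 ==> w1 x = 0"
 by (rule DERIV_local_min[OF deriv1, of 1]) (use nonneg in auto)

text \<open>The forcing cos is even, so reflected films are films, and every statement about the
  right of a point transfers to its left.\<close>

lemma film_reflect: "film \<alpha> (%x. w (- x)) (%x. - w1 (- x)) (%x. w2 (- x))"
proof
 show "periodic (%x. w (- x))"
  unfolding periodic_def
 proof
  fix x show "w (- (x + 2 * pi)) = w (- x)"
   using per unfolding periodic_def by (metis add_diff_cancel diff_conv_add_uminus minus_add_distrib add.commute diff_add_cancel)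
 qed
 fix x
 have m: "((%x. - x) has_real_derivative -1) (at x)" for x :: real by (auto intro!: derivative_eq_intros)
 show "((%x. w (- x)) has_real_derivative - w1 (- x)) (at x)"
  using DERIV_chain2[OF deriv1[of "-x"] m] by simp
 show "continuous_on UNIV (%x. - w1 (- x))"
  by (intro continuous_intros continuous_on_compose2[OF cont1]) auto
 show "((%x. - w1 (- x)) has_real_derivative w2 (- x)) (at x)" if "0 < w (- x)"
  using DERIV_minus[OF DERIV_chain2[OF deriv2[OF that] m]] by simp
 show "((%x. w2 (- x)) has_real_derivative sin x - \<alpha>\<^sup>2 * - w1 (- x)) (at x)" if "0 < w (- x)"
  using DERIV_chain2[OF deriv3[OF that] m] by (simp add: algebra_simps)
qed (use alpha nonneg zero2 in auto)

lemma pressure_const: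
 assumes "!!x. a < x ==> x < b ==> 0 < w x"
 obtains l where "!!x. a < x ==> x < b ==> w2 x = l - \<alpha>\<^sup>2 * w x - cos x"
proof -
 let ?p = "%x. w2 x + \<alpha>^2 * w x + cos x"
 have d: "(?p has_real_derivative 0) (at x)" if "a < x" "x < b" for x
  by (rule DERIV_cong, (rule derivative_intros deriv3 deriv1 assms that)+) simp
 have c: "?p x = ?p y" if xy: "a < x" "x < y" "y < b" for x y
 proof (rule DERIV_isconst2[where a=x and b=y, symmetric])
  show "continuous_on {x..y} ?p"
  proof (rule continuous_at_imp_continuous_on, rule ballI)
   fix z assume "z \<in> {x..y}"
   then have "a < z" "z < b" using xy by auto
   then show "isCont ?p z" using DERIV_isCont[OF d] by blast
  qed
 qed (use xy d in auto)
 have e: "?p x = ?p ((a+b)/2)" if "a < x" "x < b" for x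
 proof -
  have m: "a < (a+b)/2" "(a+b)/2 < b" using that by auto
  consider "x < (a+b)/2" | "x = (a+b)/2" | "(a+b)/2 < x" by linarith
  then show ?thesis
  proof cases
   case 1
   then show ?thesis by (rule c[OF that(1) _ m(2)])
  next
   case 2
   show ?thesis unfolding 2 ..
  next
   case 3
   then show ?thesis by (rule c[OF m(1) _ that(2), symmetric])
  qed
 qed
 show ?thesis
 proof (rule that[of "?p ((a+b)/2)"])
  fix x assume "a < x" "x < b"
  from e[OF this] show "w2 x = ?p ((a+b)/2) - \<alpha>\<^sup>2 * w x - cos x" by linarith
 qed
qed

text \<open>Testing the third-order equation against \<open>sin (\<alpha> * (x - a))\<close> eliminates the zero-order term
 and leaves only the forcing \<open>sin\<close>.\<close>

lemma no_slope_hump: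
 assumes ab: "a < b" "\<alpha> * (b - a) <= pi" and s: "s = 1 \<or> s = -1"
  and pos: "!!x. a < x ==> x < b ==> 0 < w x"
  and w1: "w1 a = 0" "w1 b = 0" "!!x. a < x ==> x < b ==> 0 < s * w1 x"
  and sn: "!!x. a < x ==> x < b ==> 0 < s * sin x"
 shows False
proof -
 obtain l where l: "!!x. a < x ==> x < b ==> w2 x = l - \<alpha>\<^sup>2 * w x - cos x"
  using pressure_const[OF pos] by blast
 define q where "q = (%x. l - \<alpha>\<^sup>2 * w x - cos x)"
 have qd: "(q has_real_derivative sin x - \<alpha>\<^sup>2 * w1 x) (at x)" for x
  unfolding q_def by (rule DERIV_cong, (rule derivative_intros deriv1)+) simp
 have w1d: "(w1 has_real_derivative q x) (at x)" if "a < x" "x < b" for x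
  using deriv2[OF pos[OF that]] l[OF that] by (simp add: q_def)
 let ?psi = "%x. sin (\<alpha> * (x - a))" and ?psi' = "%x. \<alpha> * cos (\<alpha> * (x - a))"
 define W where "W = (%x. q x * ?psi x - w1 x * ?psi' x)"
 have Wd: "(W has_real_derivative sin x * ?psi x) (at x)" if "a < x" "x < b" for x
  unfolding W_def
  by (rule DERIV_cong, (rule derivative_intros qd w1d that)+) (simp add: algebra_simps power2_eq_square)
 have qc: "continuous_on UNIV q" by (rule DERIV_imp_continuous_on[OF qd])
 have Wc: "continuous_on {a..b} W" unfolding W_def
  by (intro continuous_intros continuous_on_subset[OF qc] continuous_on_subset[OF cont1]) auto
 obtain c where c: "a < c" "c < b" "W b - W a = (b - a) * (sin c * ?psi c)"
  using MVT_open[OF ab(1) Wc Wd] by blast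
 have psic: "0 < ?psi c"
 proof (rule sin_gt_zero)
  show "0 < \<alpha> * (c - a)" using alpha c by simp
  have "\<alpha> * (c - a) < \<alpha> * (b - a)" using alpha c by simp
  then show "\<alpha> * (c - a) < pi" using ab by simp
 qed
 have "0 < (s * sin c) * ((b - a) * ?psi c)" using sn[OF c(1,2)] psic ab by simp
 then have gt: "0 < s * (W b - W a)" unfolding c(3) by (simp add: mult_ac)
 \<comment> \<open>At the right end of the hump \<open>s * w1\<close> comes down to 0 from positive
   values, so its derivative \<open>s * q\<close> cannot be positive there.\<close>
 have sqb: "s * q b <= 0"
 proof (rule ccontr)
  assume "~ s * q b <= 0"
  have "((%x. s * q x) \<longlongrightarrow> s * q b) (nhds b)"
   using qc by (intro tendsto_intros) (simp add: continuous_on_eq_continuous_at isCont_def tendsto_nhds_iff)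
  then have "eventually (%x. 0 < s * q x) (nhds b)"
   by (rule order_tendstoD) (use \<open>~ s * q b <= 0\<close> in auto)
  then obtain e where e: "e > 0" "!!x. dist x b < e ==> 0 < s * q x" by (auto simp: eventually_nhds_metric)
  define y where "y = max ((a+b)/2) (b - e/2)"
  have y: "a < y" "y < b" "b - e < y" using ab e by (auto simp: y_def less_max_iff_disj)
  have "continuous_on {y..b} w1" using cont1 by (rule continuous_on_subset) auto
  moreover have "(w1 has_real_derivative q x) (at x)" if "y < x" "x < b" for x
   using w1d that y by simp
  ultimately obtain z where z: "y < z" "z < b" "w1 b - w1 y = (b - y) * q z"
   using MVT_open[OF y(2)] by blast
  have "0 < s * q z" using e(2)[of z] z y by (auto simp: dist_real_def)
  then have "0 < (b - y) * (s * q z)" using y by simp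
  also have "... = - (s * w1 y)" using z w1 by (simp add: algebra_simps)
  finally show False using w1(3)[OF y(1,2)] by simp
 qed
 have psib: "0 <= ?psi b" using ab alpha by (intro sin_ge_zero) auto
 \<comment> \<open>Only the term with \<open>q b\<close> survives: \<open>w1\<close> vanishes at
   both ends and the test function vanishes at \<open>a\<close>.\<close>
 have "s * (W b - W a) = (s * q b) * ?psi b" unfolding W_def by (simp add: w1)
 also have "... <= 0" using sqb psib by (rule mult_nonpos_nonneg)
 finally show False using gt by simp
qed

text \<open>On a component the slope is somewhere positive and somewhere negative. At a point where
  its sign agrees with that of the forcing, the hump of the slope around that point contradicts
  \<open>no_slope_hump\<close>.\<close>

lemma no_short_component:
 assumes lr: "\<alpha> * (r - l) <= pi" "s = 1 \<or> s = -1" "!!x. l < x ==> x < r ==> 0 < s * sin x"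
  and ab: "l <= a" "a < b" "b <= r" "w a = 0" "w b = 0"
  and pos: "!!x. a < x ==> x < b ==> 0 < w x"
 shows False
proof -
 have wd: "continuous_on {x..y} w" "!!z. (w has_real_derivative w1 z) (at z)" for x y using w_cont deriv1 by auto
 let ?m = "(a + b) / 2"
 have m: "a < ?m" "?m < b" "0 < w ?m" using ab pos by auto
 obtain z1 where z1: "a < z1" "z1 < ?m" "w ?m - w a = (?m - a) * w1 z1"
  using MVT2[OF m(1), of w w1] deriv1 by auto
 obtain z2 where z2: "?m < z2" "z2 < b" "w b - w ?m = (b - ?m) * w1 z2"
  using MVT2[OF m(2), of w w1] deriv1 by auto
 have "0 < (?m - a) * w1 z1" using m(3) ab(4) unfolding z1(3)[symmetric] by simp
 then have "0 < w1 z1" using m(1) by (simp add: zero_less_mult_iff)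
 moreover have "w1 z2 < 0"
 proof -
  have "(b - ?m) * w1 z2 < 0" using m(3) ab(5) unfolding z2(3)[symmetric] by simp
  then show ?thesis using m(2) by (simp add: mult_less_0_iff)
 qed
 ultimately obtain c where c: "a < c" "c < b" "0 < s * w1 c"
  using lr(2) z1 z2 m that by (metis (no_types, lifting) mult_1 mult_minus1 neg_0_less_iff_less order.strict_trans)
 have "continuous_on {a..b} (%x. s * w1 x)" by (intro continuous_intros continuous_on_subset[OF cont1]) auto
 then obtain a' b' where h: "a <= a'" "a' < c" "c < b'" "b' <= b" "s * w1 a' = 0" "s * w1 b' = 0"
  "!!x. a' < x ==> x < b' ==> 0 < s * w1 x"
  using hump_exists[of a b "%x. s * w1 x" c] c zero1 ab by auto
 have "\<alpha> * (b' - a') <= \<alpha> * (r - l)" using alpha h ab by (intro mult_left_mono) auto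
 then have "\<alpha> * (b' - a') <= pi" using lr by simp
 then show False
  using no_slope_hump[of a' b' s] h lr pos ab by (smt (verit, best) mult_eq_0_iff)
qed

lemma zero_between:
 assumes lr: "\<alpha> * (r - l) <= pi" "s = 1 \<or> s = -1" "!!x. l < x ==> x < r ==> 0 < s * sin x"
  and xy: "l <= x" "x <= z" "z <= y" "y <= r" "w x = 0" "w y = 0"
 shows "w z = 0"
proof (rule ccontr)
 assume "w z ~= 0"
 then have z: "0 < w z" "x < z" "z < y" using nonneg[of z] xy by (auto simp: less_le)
 obtain a' b' where h: "x <= a'" "a' < z" "z < b'" "b' <= y" "w a' = 0" "w b' = 0"
  "!!u. a' < u ==> u < b' ==> 0 < w u"
  using hump_exists[OF w_cont xy(5,6) z(2,3,1)] by blast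
 show False by (rule no_short_component[OF lr, of a' b']) (use h xy in auto)
qed

text \<open>Zeros cannot accumulate at \<open>x0\<close> from the right without filling an interval:
  just to the right of \<open>x0\<close> the sine has one sign, and there
  \<open>zero_between\<close> makes the zero set convex.\<close>

lemma right_dichotomy:
 obtains d where "0 < d" "(ALL x. x0 < x & x < x0 + d --> 0 < w x) \<or> (ALL x. x0 < x & x < x0 + d --> w x = 0)"
proof -
 obtain d0 s where d0: "d0 > 0" "s = 1 \<or> s = -1" "!!x. x0 < x & x < x0 + d0 ==> 0 < s * sin x"
  using sin_sign_right[of x0] by blast
 \<comment> \<open>Short enough for both conditions of \<open>zero_between\<close>: constant sign of
   the sine and length at most pi / \<alpha>.\<close>
 define d where "d = min d0 (pi / \<alpha>)"
 have d: "0 < d" "d <= d0" "\<alpha> * d <= pi" using d0 alpha by (auto simp: d_def min_def field_simps)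
 show ?thesis
 proof (cases "EX y. x0 < y & y < x0 + d & w y = 0")
  case False
  then show ?thesis using that[of d] d not_pos by blast
 next
  case True
  then obtain y where y: "x0 < y" "y < x0 + d" "w y = 0" by auto
  show ?thesis
  proof (cases "\<exists>d'>0. ALL x. x0 < x & x < x0 + d' --> 0 < w x")
   case True
   then show ?thesis using that by blast
  next
   case False
   have "w z = 0" if z: "x0 < z" "z < y" for z
   proof -
    obtain x where x: "x0 < x" "x < x0 + (z - x0)" "~ 0 < w x" using False z by (metis diff_gt_0_iff_gt)
    show ?thesis
     by (rule zero_between[of "x0 + d" x0 s x z y]) (use d d0 x z y not_pos in auto)
   qed
   then show ?thesis using that[of "y - x0"] y by auto
  qed
 qed
qed

text \<open>Right of \<open>x0\<close> the functions \<open>q\<close>, \<open>q1\<close>,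
  \<open>q2\<close> are the successive derivatives of \<open>w1\<close>. At the touchdown
  \<open>q1 x0 = sin x0\<close>, and \<open>q2 x0 = cos x0\<close> when \<open>q x0 = 0\<close>; as
  sine and cosine have no common zero, one of the three is nonzero, and nonvanishing climbs back
  from a derivative to its function. The resulting monotonicity of \<open>w\<close> is what keeps
  the derivative of \<open>w x powr n\<close> integrable.\<close>

lemma right_slope_nonzero:
 assumes "w x0 = 0" "0 < d" "!!x. x0 < x ==> x < x0 + d ==> 0 < w x"
 obtains e where "0 < e" "e <= d" "!!x. x0 < x ==> x < x0 + e ==> w1 x ~= 0"
proof -
 obtain l where l: "!!x. x0 < x ==> x < x0 + d ==> w2 x = l - \<alpha>\<^sup>2 * w x - cos x"
  using pressure_const[of x0 "x0 + d"] assms(3) by blast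
 define q where "q = (%x. l - \<alpha>\<^sup>2 * w x - cos x)"
 define q1 where "q1 = (%x. sin x - \<alpha>\<^sup>2 * w1 x)"
 define q2 where "q2 = (%x. cos x - \<alpha>\<^sup>2 * q x)"
 have qd: "(q has_real_derivative q1 x) (at x)" for x
  unfolding q_def q1_def by (rule DERIV_cong, (rule derivative_intros deriv1)+) simp
 have w1d: "(w1 has_real_derivative q x) (at x)" if "x0 < x" "x < x0 + d" for x
  using deriv2[OF assms(3)[OF that]] l[OF that] by (simp add: q_def)
 have q1d: "(q1 has_real_derivative q2 x) (at x)" if "x0 < x" "x < x0 + d" for x
  unfolding q1_def q2_def by (rule DERIV_cong, (rule derivative_intros w1d that)+) simp
 have qi: "isCont q x" for x using qd DERIV_isCont by blast
 have q1i: "isCont q1 x" for x unfolding q1_def by (intro continuous_intros w1_isCont)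
 have q2i: "isCont q2 x" for x unfolding q2_def by (intro continuous_intros qi)
 define N where "N f \<longleftrightarrow> (EX e. 0 < e & e <= d & (ALL x. x0 < x & x < x0 + e --> f x ~= 0))" for f :: "real => real"
 have lift: "N f" if N: "N f'" and c: "!!x. isCont f x"
   and dv: "!!x. x0 < x ==> x < x0 + d ==> (f has_real_derivative f' x) (at x)" for f f'
 proof -
  obtain e where e: "0 < e" "e <= d" "!!x. x0 < x ==> x < x0 + e ==> f' x ~= 0"
   using N unfolding N_def by blast
  have c': "continuous_on {x0..x0+e} f" using c by (simp add: continuous_at_imp_continuous_on)
  have dv': "(f has_real_derivative f' x) (at x)" if "x0 < x" "x < x0 + e" for x
   using dv that e by simp
  obtain e' where "0 < e'" "e' <= e" "!!x. x0 < x ==> x < x0 + e' ==> f x ~= 0"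
   by (rule eventually_nonzero_right_of_deriv[OF e(1) c' dv' e(3)]) blast+
  then show ?thesis unfolding N_def using e(2) by (meson order.trans)
 qed
 have start: "N f" if "isCont f x0" "f x0 ~= 0" for f
  using eventually_nonzero_right_of_cont[OF that assms(2)] unfolding N_def by metis
 have "N w1"
 proof (cases "q x0 = 0")
  case False
  show ?thesis by (rule lift[OF start[OF qi False] w1_isCont w1d])
 next
  case q0: True
  show ?thesis
  proof (cases "sin x0 = 0")
   case False
   then have "q1 x0 ~= 0" using zero1[OF assms(1)] by (simp add: q1_def)
   then show ?thesis by (intro lift[OF lift[OF start[OF q1i] qi qd] w1_isCont w1d])
  next
   case True
   then have "q2 x0 ~= 0" using q0 sin_cos_squared_add[of x0] by (auto simp: q2_def)
   then show ?thesis
    by (intro lift[OF lift[OF lift[OF start[OF q2i] q1i q1d] qi qd] w1_isCont w1d])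
  qed
 qed
 then show thesis using that unfolding N_def by blast
qed

text \<open>The three local pictures: dry, positive up to and including the ends, or positive and
  strictly monotone inside. The last one serves intervals with a touchdown at an end.\<close>

definition simple_piece :: "real => real => bool" where
 "simple_piece a b \<longleftrightarrow> (\<forall>x\<in>{a<..<b}. w x = 0) \<or> (\<forall>x\<in>{a..b}. 0 < w x) \<or>
  (\<forall>x\<in>{a<..<b}. 0 < w x & w1 x ~= 0)"

lemma simple_right: "\<exists>d>0. ALL b. x0 <= b & b < x0 + d --> simple_piece x0 b"
proof (cases "w x0 = 0")
 case True
 obtain d where d: "0 < d" "(ALL x. x0 < x & x < x0 + d --> 0 < w x) \<or> (ALL x. x0 < x & x < x0 + d --> w x = 0)"
  by (rule right_dichotomy[of x0])
 show ?thesis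
 proof (cases "ALL x. x0 < x & x < x0 + d --> w x = 0")
  case True
  then show ?thesis using d(1) by (intro exI[of _ d]) (auto simp: simple_piece_def)
 next
  case False
  then have p: "ALL x. x0 < x & x < x0 + d --> 0 < w x" using d by blast
  obtain e where e: "0 < e" "e <= d" "!!x. x0 < x ==> x < x0 + e ==> w1 x ~= 0"
   using right_slope_nonzero[OF True d(1)] p by blast
  then show ?thesis using p by (intro exI[of _ e]) (auto simp: simple_piece_def)
 qed
next
 case False
 have "((%x. w x) \<longlongrightarrow> w x0) (nhds x0)"
  using w_cont[of UNIV] by (simp add: continuous_on_eq_continuous_at isCont_def tendsto_nhds_iff)
 then have "eventually (%x. 0 < w x) (nhds x0)"
  by (rule order_tendstoD) (use False nonneg[of x0] in auto)
 then obtain e where e: "e > 0" "!!x. dist x x0 < e ==> 0 < w x" by (auto simp: eventually_nhds_metric)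
 then show ?thesis by (intro exI[of _ e]) (auto simp: simple_piece_def dist_real_def)
qed

end

context film
begin

lemma simple_left: "\<exists>d>0. ALL a. a <= x0 & x0 - d < a --> simple_piece a x0"
proof -
 interpret r: film \<alpha> "%x. w (- x)" "%x. - w1 (- x)" "%x. w2 (- x)" by (rule film_reflect)
 obtain d where d: "d > 0" "!!b. - x0 <= b ==> b < - x0 + d ==> r.simple_piece (- x0) b"
  using r.simple_right[of "-x0"] by blast
 have "simple_piece a x0" if "a <= x0" "x0 - d < a" for a
 proof -
  have "r.simple_piece (- x0) (- a)" using d(2)[of "-a"] that by simp
  then have "(\<forall>x\<in>{-x0<..<-a}. w (-x) = 0) \<or> (\<forall>x\<in>{-x0..-a}. 0 < w (-x)) \<or>
   (\<forall>x\<in>{-x0<..<-a}. 0 < w (-x) & - w1 (-x) ~= 0)" by (simp add: r.simple_piece_def)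
  moreover have "x \<in> {a<..<x0} ==> - x \<in> {-x0<..<-a}" "x \<in> {a..x0} ==> - x \<in> {-x0..-a}" for x by auto
  ultimately show ?thesis unfolding simple_piece_def by (metis minus_minus neg_equal_0_iff_equal)
 qed
 then show ?thesis using d(1) by blast
qed

text \<open>Every point has simple pieces on both sides, so Bolzano bisection reduces a property
  that is additive over adjacent intervals to simple pieces. The touchdown points never have to be
  enumerated.\<close>

lemma film_induct [consumes 1, case_names trans piece]:
 assumes "a <= b"
  and trans: "!!a b c. P a b ==> P b c ==> a <= b ==> b <= c ==> P a c"
  and piece: "!!a b. a <= b ==> simple_piece a b ==> P a b"
 shows "P a b"
 using assms(1)
proof (induction rule: Bolzano)
 case (trans a b c)
 then show ?case using assms(2) by blast
next
 case (local x)
 obtain d1 d2 where d: "d1 > 0" "!!b. x <= b ==> b < x + d1 ==> simple_piece x b"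
  "d2 > 0" "!!a. a <= x ==> x - d2 < a ==> simple_piece a x"
  using simple_right[of x] simple_left[of x] by metis
 have "P a b" if "a <= x" "x <= b" "b - a < min d1 d2" for a b
  using piece[of a x] piece[of x b] d(2)[of b] d(4)[of a] assms(2)[of a x b] that by simp
 then show ?case using d by (intro exI[of _ "min d1 d2"]) auto
qed

lemma piece_pressure:
 assumes "simple_piece a b"
 obtains l where "!!x. x \<in> {a<..<b} ==> 0 < w x ==> w2 x = l - \<alpha>\<^sup>2 * w x - cos x"
proof (cases "\<forall>x\<in>{a<..<b}. w x = 0")
 case True
 then show ?thesis using that[of 0] by auto
next
 case False
 then have "!!x. a < x ==> x < b ==> 0 < w x" using assms by (auto simp: simple_piece_def)
 then show ?thesis using that pressure_const[of a b] by (metis greaterThanLessThan_iff)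
qed

lemma AE_interior: "AE x in lborel. x \<in> {a..b} --> x \<in> {a<..<b::real}"
proof -
 have "AE x in lborel. x ~= a" "AE x in lborel. x ~= b" by (auto simp: AE_lborel_singleton)
 then show ?thesis by eventually_elim auto
qed

lemma w2_borel: "w2 \<in> borel_measurable borel"
proof -
 have o: "open {x. 0 < w x}" by (rule open_Collect_less) (auto intro: w_cont)
 have "continuous_on {x. 0 < w x} w2"
  using deriv3 DERIV_isCont by (intro continuous_at_imp_continuous_on) blast
 then have "(%x. if x \<in> {x. 0 < w x} then w2 x else 0) \<in> borel_measurable borel"
  by (rule borel_measurable_continuous_on_if[rotated]) (use o in auto)
 also have "(%x. if x \<in> {x. 0 < w x} then w2 x else 0) = w2" using zero2 not_pos by (intro ext) auto
 finally show ?thesis .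
qed

text \<open>Inside a simple piece \<open>w2\<close> coincides with a continuous function, either 0
  or the one given by the pressure law; integrability of \<open>w2\<close> and of its square and the
  fundamental theorem then add up over adjacent pieces.\<close>

lemma w2_L2_primitive:
 assumes "a <= b"
 shows "L1_on {a..b} w2 & L1_on {a..b} (%x. (w2 x)^2) &
  (LINT x:{a..b}|lborel. w2 x) = w1 b - w1 a"
 using assms
proof (induction rule: film_induct)
 case (trans a b c)
 have "{a..c} = {a..b} \<union> {b..c}" using trans by auto
 then have "L1_on {a..c} w2" "L1_on {a..c} (%x. (w2 x)^2)"
  using trans by (auto intro!: set_integrable_Un)
 then show ?case using trans set_integral_split[of a b c w2] by auto
next
 case (piece a b)
 obtain q where q: "continuous_on UNIV q" "!!x. x \<in> {a<..<b} ==> w2 x = q x"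
   "!!x. x \<in> {a<..<b} ==> (w1 has_real_derivative q x) (at x)"
 proof (cases "\<forall>x\<in>{a<..<b}. w x = 0")
  case True
  have "(w1 has_real_derivative 0) (at x)" if "x \<in> {a<..<b}" for x
   by (rule has_field_derivative_transform_within_open[of "%_. 0" 0 x "{a<..<b}"])
    (use that True zero1 in auto)
  then show ?thesis using that[of "%_. 0"] True zero2 by auto
 next
  case False
  then have p: "!!x. x \<in> {a<..<b} ==> 0 < w x" using piece by (auto simp: simple_piece_def)
  obtain l where l: "!!x. x \<in> {a<..<b} ==> 0 < w x ==> w2 x = l - \<alpha>\<^sup>2 * w x - cos x"
   using piece_pressure piece by blast
  show ?thesis
  proof (rule that[of "%x. l - \<alpha>\<^sup>2 * w x - cos x"])
   show "continuous_on UNIV (%x. l - \<alpha>\<^sup>2 * w x - cos x)" by (intro continuous_intros w_cont)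
   show "(w1 has_real_derivative l - \<alpha>\<^sup>2 * w x - cos x) (at x)" if "x \<in> {a<..<b}" for x
    using deriv2[OF p[OF that]] l[OF that p[OF that]] by simp
  qed (use l p in auto)
 qed
 have qi: "L1_on {a..b} q" "L1_on {a..b} (%x. (q x)^2)"
  using q(1) by (auto intro!: borel_integrable_atLeastAtMost' continuous_intros intro: continuous_on_subset)
 have ae: "AE x in lborel. x \<in> {a..b} --> w2 x = q x"
  using AE_interior[of a b] by eventually_elim (use q(2) in auto)
 have m: "set_borel_measurable lborel {a..b} w2" "set_borel_measurable lborel {a..b} q"
  "set_borel_measurable lborel {a..b} (%x. (w2 x)^2)" "set_borel_measurable lborel {a..b} (%x. (q x)^2)"
  using w2_borel borel_measurable_continuous_onI[OF q(1)] unfolding set_borel_measurable_def by measurable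
 have "L1_on {a..b} w2"
  using qi(1) set_integrable_cong_AE[of w2 lborel q "{a..b}"] ae w2_borel borel_measurable_continuous_onI[OF q(1)] by simp
 moreover have "L1_on {a..b} (%x. (w2 x)^2)"
 proof -
  have "AE x in lborel. x \<in> {a..b} --> (w2 x)\<^sup>2 = (q x)^2" using ae by eventually_elim simp
  then show ?thesis
   using qi(2) set_integrable_cong_AE[of "%x. (w2 x)^2" lborel "%x. (q x)^2" "{a..b}"] w2_borel borel_measurable_continuous_onI[OF q(1)]
   by simp
 qed
 moreover have "(LINT x:{a..b}|lborel. w2 x) = (LINT x:{a..b}|lborel. q x)"
  by (rule set_lebesgue_integral_cong_AE) (use ae w2_borel borel_measurable_continuous_onI[OF q(1)] in auto)
 moreover have "(q has_integral (w1 b - w1 a)) {a..b}"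
  by (rule fundamental_theorem_of_calculus_interior[OF piece(1)])
   (use q(3) continuous_on_subset[OF cont1] in "auto simp: has_real_derivative_iff_has_vector_derivative")
 ultimately show ?case using set_borel_integral_eq_integral(2)[OF qi(1)] integral_unique by metis
qed

lemma primitive_w: "primitive w w1"
 by (rule primitive_of_deriv[OF deriv1 cont1])

lemma primitive_w1: "primitive w1 w2"
 unfolding primitive_def using w2_L2_primitive by auto

lemma film_H_circle: "H_circle 2 w" "weak_deriv UNIV w w1" "weak_deriv UNIV w1 w2"
proof -
 show wd: "weak_deriv UNIV w w1" "weak_deriv UNIV w1 w2"
  by (rule primitive_imp_weak_deriv primitive_w primitive_w1)+
 have L2: "L2_loc UNIV f" if "f \<in> borel_measurable borel" "!!a b. L1_on {a..b} (%x. (f x)^2)" for f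
  using L1_loc_UNIV_I[OF that(2)] that(1) unfolding L2_loc_def L2_on_def L1_loc_def set_borel_measurable_def
  by (auto intro!: borel_measurable_indicator simp: compact_imp_closed)
 have L2c: "L2_loc UNIV f" if "continuous_on UNIV f" for f
  by (rule L2[OF borel_measurable_continuous_onI[OF that]])
   (auto intro!: borel_integrable_atLeastAtMost' continuous_intros continuous_on_subset[OF that])
 have i: "L1_on {a..b} (%x. (w2 x)^2)" for a b
  using w2_L2_primitive[of a b] by (cases "a <= b") auto
 show "H_circle 2 w"
  unfolding H_circle_def numeral_2_eq_2 using per wd L2c[OF w_cont] L2c[OF cont1] L2[OF w2_borel i] by auto
qed

end

section \<open>Wirtinger's inequality with the sharp constant\<close>

lemma cont_set_integrable: "continuous_on {a..b} f ==> L1_on {a..b} (f :: real => real)"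
 by (rule borel_integrable_atLeastAtMost')

text \<open>Freezing the density at its end values outside [a, b] gives global data, to which the
  facts about \<open>primitive\<close> apply.\<close>

lemma extend_primitive:
 fixes G g :: "real => real"
 assumes ab: "a <= b" and G: "!!x. x \<in> {a..b} ==> (G has_real_derivative g x) (at x)"
  and g: "continuous_on {a..b} g"
 obtains H h where "primitive H h" "!!x. x \<in> {a..b} ==> H x = G x" "!!x. x \<in> {a..b} ==> h x = g x"
proof -
 define h where "h = (%x. g (max a (min b x)))"
 have hc: "continuous_on UNIV h" unfolding h_def
  by (rule continuous_on_compose2[OF g]) (use ab in "auto intro!: continuous_intros")
 have hg: "h x = g x" if "x \<in> {a..b}" for x using that by (simp add: h_def)
 obtain F where F: "primitive F h"
  using primitive_indefinite_integral[OF cont_set_integrable[OF continuous_on_subset[OF hc subset_UNIV]]] by blast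
 have p: "primitive (%x. F x - (F a - G a)) h" using primitive_diff[OF F primitive_const] by simp
 show ?thesis
 proof (rule that[OF p _ hg])
  fix x assume x: "x \<in> {a..b}"
  have hi: "(g has_integral G x - G a) {a..x}"
   using G x by (intro fundamental_theorem_of_calculus)
    (auto simp: has_real_derivative_iff_has_vector_derivative[symmetric] intro: has_field_derivative_at_within)
  have hg': "(LINT y:{a..x}|lborel. h y) = (LINT y:{a..x}|lborel. g y)"
   by (rule set_lebesgue_integral_cong) (use hg x in auto)
  have gi: "L1_on {a..x} g"
   by (rule cont_set_integrable[OF continuous_on_subset[OF g]]) (use x in auto)
  have "(LINT y:{a..x}|lborel. g y) = G x - G a"
   using set_borel_integral_eq_integral(2)[OF gi] integral_unique[OF hi] by simp
  then show "F x - (F a - G a) = G x"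
   using primitiveD(2)[OF F, of a x] x hg' by simp
 qed
qed

lemma set_integral_square_expand:
 fixes f g :: "'a => real"
 assumes "set_integrable M A (%x. (f x)^2)" "set_integrable M A (%x. f x * g x)" "set_integrable M A (%x. (g x)^2)"
 shows "(LINT x:A|M. (f x + g x)^2) = (LINT x:A|M. (f x)^2) + 2 * (LINT x:A|M. f x * g x) + (LINT x:A|M. (g x)^2)"
  "set_integrable M A (%x. (f x + g x)^2)"
proof -
 have e: "(%x. (f x + g x)^2) = (%x. ((f x)^2 + 2 * (f x * g x)) + (g x)^2)"
  by (auto simp: power2_sum algebra_simps)
 have i: "set_integrable M A (%x. 2 * (f x * g x))" using assms(2) by (rule set_integrable_mult_right)
 have j: "set_integrable M A (%x. (f x)^2 + 2 * (f x * g x))" using assms(1) i by (rule set_integral_add)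
 show "set_integrable M A (%x. (f x + g x)^2)" unfolding e using j assms(3) by (rule set_integral_add)
 show "(LINT x:A|M. (f x + g x)^2) = (LINT x:A|M. (f x)^2) + 2 * (LINT x:A|M. f x * g x) + (LINT x:A|M. (g x)^2)"
  unfolding e by (simp only: set_integral_add(2)[OF j assms(3)] set_integral_add(2)[OF assms(1) i] set_integral_mult_right)
qed

lemma set_integral_nonneg:
 "(!!x. x \<in> A ==> 0 <= f x) ==> 0 <= (LINT x:A|M. f x :: real)"
 unfolding set_lebesgue_integral_def by (rule integral_nonneg_AE) (auto simp: indicator_def)

text \<open>The square \<open>(f' + k tan(k(x - m)) f)\<^sup>2\<close> differs from \<open>f'\<^sup>2 - k\<^sup>2 f\<^sup>2\<close> by an exact derivative.\<close>

lemma weighted_dirichlet: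
 assumes p: "primitive f g" and g2: "L1_on {a..b} (%x. (g x)^2)" and ab: "a <= b"
  and cs: "!!x. x \<in> {a..b} ==> \<bar>k * (x - m)\<bar> < pi / 2"
 shows "k^2 * (LINT x:{a..b}|lborel. (f x)^2) <= (LINT x:{a..b}|lborel. (g x)^2)
  + k * ((f b)^2 * tan (k * (b - m)) - (f a)\<^sup>2 * tan (k * (a - m)))"
proof -
 let ?T = "%x. tan (k * (x - m))"
 have c: "cos (k * (x - m)) ~= 0" if "x \<in> {a..b}" for x
 proof -
  have "- (pi / 2) < k * (x - m)" "k * (x - m) < pi / 2" using cs[OF that] by linarith+
  then show ?thesis using cos_gt_zero_pi by fastforce
 qed
 have Td: "(?T has_real_derivative (1 + (?T x)^2) * k) (at x)" if "x \<in> {a..b}" for x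
  by (rule DERIV_cong, rule DERIV_chain2[where g="%x. k * (x - m)", OF DERIV_tan[OF c[OF that]]], (rule derivative_intros)+)
   (use c[OF that] tan_sec[of "k * (x - m)"] in "simp add: power_inverse")
 have Tc: "continuous_on {a..b} ?T"
  using Td DERIV_isCont by (intro continuous_at_imp_continuous_on) blast
 have T'c: "continuous_on {a..b} (%x. (1 + (?T x)^2) * k)" by (intro continuous_intros Tc)
 obtain H h where H: "primitive H h" "!!x. x \<in> {a..b} ==> H x = ?T x" "!!x. x \<in> {a..b} ==> h x = (1 + (?T x)^2) * k"
  using extend_primitive[OF ab Td T'c] by blast
 have fc: "continuous_on S f" for S by (rule primitive_continuous[OF p])
 have gi: "L1_on {a..b} g" by (rule primitiveD(1)[OF p])
 have p2: "primitive (%x. f x * f x) (%x. f x * g x + f x * g x)" by (rule primitive_mult[OF p p])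
 have ibp: "(LINT x:{a..b}|lborel. (f x * f x) * h x) + (LINT x:{a..b}|lborel. H x * (f x * g x + f x * g x))
  = f b * f b * H b - f a * f a * H a"
  by (rule integral_by_parts_primitive[OF p2 H(1) ab])
 have e1: "(LINT x:{a..b}|lborel. (f x * f x) * h x) = k * ((LINT x:{a..b}|lborel. (f x)^2) + (LINT x:{a..b}|lborel. (?T x * f x)^2))"
 proof -
  have "(LINT x:{a..b}|lborel. (f x * f x) * h x) = (LINT x:{a..b}|lborel. k * ((f x)^2 + (?T x * f x)^2))"
   by (rule set_lebesgue_integral_cong) (use H(3) in "auto simp: power2_eq_square algebra_simps")
  also have "... = k * (LINT x:{a..b}|lborel. (f x)^2 + (?T x * f x)^2)" by simp
  also have "(LINT x:{a..b}|lborel. (f x)^2 + (?T x * f x)^2) = (LINT x:{a..b}|lborel. (f x)^2) + (LINT x:{a..b}|lborel. (?T x * f x)^2)"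
   by (rule set_integral_add(2)) (intro cont_set_integrable continuous_intros fc Tc)+
  finally show ?thesis .
 qed
 have e2: "(LINT x:{a..b}|lborel. H x * (f x * g x + f x * g x)) = 2 * (LINT x:{a..b}|lborel. g x * (?T x * f x))"
 proof -
  have "(LINT x:{a..b}|lborel. H x * (f x * g x + f x * g x)) = (LINT x:{a..b}|lborel. 2 * (g x * (?T x * f x)))"
   by (rule set_lebesgue_integral_cong) (use H(2) in auto)
  then show ?thesis by simp
 qed
 have i1: "L1_on {a..b} (%x. g x * (k * ?T x * f x))"
  using set_integrable_cont_mult[OF _ gi, of "%x. k * ?T x * f x"] by (simp add: continuous_intros fc Tc mult.commute)
 have i2: "L1_on {a..b} (%x. (k * ?T x * f x)^2)"
  by (intro cont_set_integrable continuous_intros fc Tc)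
 have "0 <= (LINT x:{a..b}|lborel. (g x + k * ?T x * f x)^2)"
  by (rule set_integral_nonneg) simp
 also have "... = (LINT x:{a..b}|lborel. (g x)^2) + 2 * (LINT x:{a..b}|lborel. g x * (k * ?T x * f x)) + (LINT x:{a..b}|lborel. (k * ?T x * f x)^2)"
  by (rule set_integral_square_expand(1)[OF g2 i1 i2])
 also have "(LINT x:{a..b}|lborel. g x * (k * ?T x * f x)) = k * (LINT x:{a..b}|lborel. g x * (?T x * f x))"
  by (subst set_integral_mult_right[symmetric]) (simp add: mult_ac)
 also have "(LINT x:{a..b}|lborel. (k * ?T x * f x)^2) = k^2 * (LINT x:{a..b}|lborel. (?T x * f x)^2)"
  by (subst set_integral_mult_right[symmetric]) (simp add: power_mult_distrib mult_ac)
 finally have A: "0 <= (LINT x:{a..b}|lborel. (g x)^2) + k * (2 * (LINT x:{a..b}|lborel. g x * (?T x * f x))) + k^2 * (LINT x:{a..b}|lborel. (?T x * f x)^2)"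
  by (simp add: mult_ac)
 have e: "2 * (LINT x:{a..b}|lborel. g x * (?T x * f x)) = (f b)^2 * ?T b - (f a)\<^sup>2 * ?T a
  - k * ((LINT x:{a..b}|lborel. (f x)^2) + (LINT x:{a..b}|lborel. (?T x * f x)^2))"
  using ibp unfolding e1 e2 using H(2)[of a] H(2)[of b] ab by (simp add: power2_eq_square)
 have "k^2 * F <= G + k * Y" if "0 <= G + k * X + k^2 * S" "X = Y - k * (F + S)" for F G X Y S
  using that by (simp add: algebra_simps power2_eq_square)
 from this[OF A e] show ?thesis .
qed

text \<open>With \<open>l\<close> half the length, some \<open>x0\<close> satisfies f(x0) = f(x0 +
  l) = c. The function f - c vanishes at these two points, and on the three intervals they cut out
  the tangent weights, centred at distance l/2 from them, stay finite because k * l < pi. The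
  mean-zero condition shows that passing from f to f - c can only increase the integral of the
  square.\<close>

lemma wirtinger_strict:
 assumes p: "primitive f g" and g2: "L1_on {a..b} (%x. (g x)^2)" and ab: "a < b"
  and fab: "f a = f b" and mean: "(LINT x:{a..b}|lborel. f x) = 0" and k: "0 < k" "k * (b - a) < 2 * pi"
 shows "k^2 * (LINT x:{a..b}|lborel. (f x)^2) <= (LINT x:{a..b}|lborel. (g x)^2)"
proof -
 define l where "l = (b - a) / 2"
 have l: "0 < l" "b = a + 2 * l" "k * l < pi" using ab k by (auto simp: l_def field_simps)
 have fc: "continuous_on S f" for S by (rule primitive_continuous[OF p])
 obtain x0 where x0: "a <= x0" "x0 <= a + l" "f (x0 + l) - f x0 = 0"
 proof -
  have c: "continuous_on {a..a+l} (%x. f (x + l) - f x)"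
   by (intro continuous_intros fc continuous_on_compose2[OF fc[of UNIV]]) auto
  \<comment> \<open>Because the values at \<open>a\<close> and \<open>b\<close> agree, the
    difference f(x + l) - f(x) has opposite signs at \<open>a\<close> and
    \<open>a + l\<close>.\<close>
  have "f (a + l + l) = f a" using fab l by (simp add: algebra_simps)
  then show ?thesis
   using IVT'[of "%x. f (x + l) - f x" a 0 "a+l", OF _ _ _ c] IVT2'[of "%x. f (x + l) - f x" "a+l" 0 a, OF _ _ _ c] l that
   by (cases "f (a + l) - f a <= 0") force+
 qed
 define c where "c = f x0"
 have ph: "primitive (%x. f x - c) g" using primitive_diff[OF p primitive_const[of c]] by simp
 have hz: "f x0 - c = 0" "f (x0 + l) - c = 0" using x0 by (auto simp: c_def)
 have sub: "L1_on {u..v} (%x. (g x)^2)" if "a <= u" "v <= b" for u v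
  by (rule set_integrable_subset[OF g2]) (use that in auto)
 have kk: "\<bar>k * y\<bar> < pi / 2" if "\<bar>y\<bar> <= l / 2" for y
 proof -
  have "\<bar>k * y\<bar> = k * \<bar>y\<bar>" using k by (simp add: abs_mult)
  also have "... <= k * (l / 2)" using that k by (intro mult_left_mono) auto
  also have "... < pi / 2" using l by simp
  finally show ?thesis .
 qed
 have b1: "\<bar>x - (x0 - l/2)\<bar> <= l / 2" if "x \<in> {a..x0}" for x
  unfolding abs_le_iff using that x0(1,2) l(1,2) by auto
 have b2: "\<bar>x - (x0 + l/2)\<bar> <= l / 2" if "x \<in> {x0..x0+l}" for x
  unfolding abs_le_iff using that x0(1,2) l(1,2) by auto
 have b3: "\<bar>x - (x0 + 3*l/2)\<bar> <= l / 2" if "x \<in> {x0+l..b}" for x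
  unfolding abs_le_iff using that x0(1,2) l(1,2) by auto
 let ?H = "%u v. LINT x:{u..v}|lborel. (f x - c)^2" and ?G = "%u v. LINT x:{u..v}|lborel. (g x)^2"
 have 1: "k^2 * ?H a x0 <= ?G a x0 + k * ((f x0 - c)^2 * tan (k * (x0 - (x0 - l/2))) - (f a - c)\<^sup>2 * tan (k * (a - (x0 - l/2))))"
  by (rule weighted_dirichlet[OF ph sub _ kk[OF b1]]) (use x0(1,2) l in auto)
 have 2: "k^2 * ?H x0 (x0+l) <= ?G x0 (x0+l) + k * ((f (x0+l) - c)^2 * tan (k * (x0 + l - (x0 + l/2))) - (f x0 - c)\<^sup>2 * tan (k * (x0 - (x0 + l/2))))"
  by (rule weighted_dirichlet[OF ph sub _ kk[OF b2]]) (use x0(1,2) l in auto)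
 have 3: "k^2 * ?H (x0+l) b <= ?G (x0+l) b + k * ((f b - c)^2 * tan (k * (b - (x0 + 3*l/2))) - (f (x0+l) - c)\<^sup>2 * tan (k * (x0 + l - (x0 + 3*l/2))))"
  by (rule weighted_dirichlet[OF ph sub _ kk[OF b3]]) (use x0(1,2) l in auto)
 \<comment> \<open>The first and last centres differ by the full length, so the weights at
   \<open>a\<close> and \<open>b\<close> coincide and the two outer boundary terms cancel.\<close>
 have t: "b - (x0 + 3*l/2) = a - (x0 - l/2)" using l by (simp add: algebra_simps)
 have "k^2 * (?H a x0 + ?H x0 (x0+l) + ?H (x0+l) b) <= ?G a x0 + ?G x0 (x0+l) + ?G (x0+l) b"
  using 1 2 3 unfolding t hz fab by (simp add: algebra_simps)
 also have "?G a x0 + ?G x0 (x0+l) + ?G (x0+l) b = ?G a b"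
  using set_integral_split[of a x0 b "%x. (g x)^2"] set_integral_split[of x0 "x0+l" b "%x. (g x)^2"] sub x0 l by simp
 also have "?H a x0 + ?H x0 (x0+l) + ?H (x0+l) b = ?H a b"
 proof -
  have i: "L1_on {u..v} (%x. (f x - c)^2)" for u v by (intro cont_set_integrable continuous_intros fc)
  show ?thesis
   using set_integral_split[of a x0 b, OF _ _ i] set_integral_split[of x0 "x0+l" b, OF _ _ i] x0 l by simp
 qed
 also have "?H a b = (LINT x:{a..b}|lborel. (f x)^2) + c^2 * (b - a)"
 proof -
  have fi: "L1_on {a..b} f" by (intro cont_set_integrable fc)
  have "?H a b = (LINT x:{a..b}|lborel. (f x + (- c))^2)" by simp
  also have "... = (LINT x:{a..b}|lborel. (f x)^2) + 2 * (LINT x:{a..b}|lborel. f x * (- c)) + (LINT x:{a..b}|lborel. (- c)^2)"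
   by (rule set_integral_square_expand(1)) (intro cont_set_integrable continuous_intros fc)+
  also have "(LINT x:{a..b}|lborel. f x * (- c)) = 0" by (subst set_integral_mult_left) (simp add: mean)
  also have "(LINT x:{a..b}|lborel. (- c)^2) = c^2 * (b - a)"
   using ab by (simp add: set_integral_const)
  finally show ?thesis by simp
 qed
 finally have "k^2 * ((LINT x:{a..b}|lborel. (f x)^2) + c^2 * (b - a)) <= ?G a b" .
 moreover have "0 <= k^2 * (c^2 * (b - a))" using ab by simp
 ultimately show ?thesis by (simp add: distrib_left)
qed

text \<open>At k * (b - a) = 2 pi the tangent weights blow up; replacing \<open>k\<close> by sqrt z
  * k with z < 1 and letting z tend to 1 covers this case.\<close>

lemma wirtinger:
 assumes p: "primitive f g" and g2: "L1_on {a..b} (%x. (g x)^2)" and ab: "a < b"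
  and fab: "f a = f b" and mean: "(LINT x:{a..b}|lborel. f x) = 0" and k: "0 < k" "k * (b - a) <= 2 * pi"
 shows "k^2 * (LINT x:{a..b}|lborel. (f x)^2) <= (LINT x:{a..b}|lborel. (g x)^2)"
proof (rule field_le_mult_one_interval)
 fix z :: real assume z: "0 < z" "z < 1"
 have "(sqrt z * k)^2 * (LINT x:{a..b}|lborel. (f x)^2) <= (LINT x:{a..b}|lborel. (g x)^2)"
 proof (rule wirtinger_strict[OF p g2 ab fab mean])
  have "sqrt z < 1" using z by simp
  then have "sqrt z * (k * (b - a)) < 1 * (k * (b - a))" using k ab by (intro mult_strict_right_mono) auto
  also have "1 * (k * (b - a)) <= 2 * pi" using k by simp
  finally show "sqrt z * k * (b - a) < 2 * pi" by (simp only: mult.assoc)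
 qed (use z k in auto)
 then show "z * (k^2 * (LINT x:{a..b}|lborel. (f x)^2)) <= (LINT x:{a..b}|lborel. (g x)^2)"
  using z by (simp add: power_mult_distrib mult.assoc)
qed

lemma continuous_zero_if_integral_zero:
 fixes f :: "real => real"
 assumes "continuous_on {a..b} f" "!!x. x \<in> {a..b} ==> 0 <= f x" "(LINT x:{a..b}|lborel. f x) <= 0" "a < b" "x \<in> {a..b}"
 shows "f x = 0"
proof -
 have i: "L1_on {a..b} f" by (rule cont_set_integrable[OF assms(1)])
 have "0 <= (LINT x:{a..b}|lborel. f x)" by (rule set_integral_nonneg) (use assms in auto)
 then have "integral {a..b} f = 0" using assms(3) set_borel_integral_eq_integral(2)[OF i] by simp
 then show ?thesis using integral_eq_0_iff[OF assms(1,4,2)] assms(5) by blast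
qed

lemma set_integral_shift:
 fixes h :: "real => real"
 shows "(LINT x:{a+p..b+p}|lborel. h x) = (LINT x:{a..b}|lborel. h (x + p))"
  and "L1_on {a+p..b+p} h ==> L1_on {a..b} (%x. h (x + p))"
proof -
 have ind: "indicat_real {a+p..b+p} (p + 1 * x) = indicator {a..b} x" for x
  by (auto simp: indicator_def)
 show "(LINT x:{a+p..b+p}|lborel. h x) = (LINT x:{a..b}|lborel. h (x + p))"
  unfolding set_lebesgue_integral_def
  by (subst lborel_integral_real_affine[where c=1 and t=p]) (simp_all only: ind, simp_all add: add.commute)
 show "L1_on {a+p..b+p} h ==> L1_on {a..b} (%x. h (x + p))"
  unfolding set_integrable_def
  by (subst (asm) lborel_integrable_real_affine_iff[where c=1 and t=p, symmetric]) (simp_all only: ind, simp_all add: add.commute)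
qed

lemma primitive_shift:
 assumes "primitive f g" shows "primitive (%x. f (x + p)) (%x. g (x + p))"
 unfolding primitive_def
proof (intro allI impI conjI)
 fix a b :: real assume "a <= b"
 show "L1_on {a..b} (%x. g (x + p))"
  by (rule set_integral_shift(2)[OF primitiveD(1)[OF assms]])
 show "f (b + p) - f (a + p) = (LINT x:{a..b}|lborel. g (x + p))"
  unfolding set_integral_shift(1)[symmetric] using primitiveD(2)[OF assms, of "a+p" "b+p"] \<open>a <= b\<close> by simp
qed

lemma primitive_unique_AE:
 assumes "primitive f g" "primitive f h"
 shows "AE x in lborel. g x = h x"
 using weak_deriv_unique[OF open_UNIV primitive_imp_weak_deriv primitive_imp_weak_deriv, OF assms] by simp

lemma periodic_deriv_AE:
 assumes "periodic f" "primitive f g"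
 shows "AE x in lborel. g (x + 2 * pi) = g x"
proof -
 have "(%x. f (x + 2 * pi)) = f" using assms(1) by (auto simp: periodic_def)
 then show ?thesis using primitive_shift[OF assms(2), of "2*pi"] assms(2) primitive_unique_AE by metis
qed

lemma periodic_window:
 fixes h :: "real => real"
 assumes h: "!!a b. L1_on {a..b} h" "AE x in lborel. h (x + 2 * pi) = h x" and c: "0 <= c" "c <= 2 * pi"
 shows "(LINT x:{c..c + 2 * pi}|lborel. h x) = (\<oint>x. h x)"
proof -
 have m: "set_borel_measurable lborel A h" if "A = {a..b}" for A a b
  using h(1) that by (auto simp: set_integrable_def set_borel_measurable_def)
 have "(LINT x:{0+2*pi..c + 2 * pi}|lborel. h x) = (LINT x:{0..c}|lborel. h (x + 2 * pi))"
  by (rule set_integral_shift)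
 also have "... = (LINT x:{0..c}|lborel. h x)"
  unfolding set_lebesgue_integral_def
 proof (rule integral_cong_AE)
  show "(%x. indicat_real {0..c} x *\<^sub>R h (x + 2 * pi)) \<in> borel_measurable lborel"
   using set_integral_shift(2)[OF h(1), of 0 c "2*pi"] unfolding set_integrable_def by auto
  show "(%x. indicat_real {0..c} x *\<^sub>R h x) \<in> borel_measurable lborel"
   using h(1)[of 0 c] unfolding set_integrable_def by auto
  show "AE x in lborel. indicat_real {0..c} x *\<^sub>R h (x + 2 * pi) = indicat_real {0..c} x *\<^sub>R h x"
   using h(2) by eventually_elim simp
 qed
 finally show ?thesis
  using set_integral_split[of c "2*pi" "c+2*pi", OF _ _ h(1)] set_integral_split[of 0 c "2*pi", OF _ _ h(1)] c by simp
qed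

section \<open>Structure and uniqueness of films for \<alpha> at most 1\<close>

definition circle_energy :: "real => (real => real) => (real => real) => real" where
 "circle_energy \<alpha> f g = (1/2) * ((\<oint>x. (g x)^2) - \<alpha>\<^sup>2 * (\<oint>x. (f x)^2))
  - (\<oint>x. f x * cos x)"

context film
begin

lemma w1_per: "w1 (x + 2 * pi) = w1 x"
proof -
 have "((%x. w (x + 2 * pi)) has_real_derivative w1 (x + 2 * pi)) (at x)"
  using deriv1[of "x + 2 * pi"] by (simp add: DERIV_shift)
 moreover have "(%x. w (x + 2 * pi)) = w" using per by (auto simp: periodic_def)
 ultimately show ?thesis using DERIV_unique deriv1 by metis
qed

lemma w_per: "w (x + 2 * pi) = w x" using per by (simp add: periodic_def)

lemma w2_per: "w2 (x + 2 * pi) = w2 x"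
proof (cases "w x = 0")
 case True
 then show ?thesis using zero2 w_per by metis
next
 case False
 then have p: "0 < w x" "0 < w (x + 2 * pi)" using nonneg[of x] w_per[of x] by auto
 have "((%x. w1 (x + 2 * pi)) has_real_derivative w2 (x + 2 * pi)) (at x)"
  using deriv2[OF p(2)] by (simp add: DERIV_shift)
 moreover have "(%x. w1 (x + 2 * pi)) = w1" using w1_per by auto
 ultimately show ?thesis using DERIV_unique deriv2[OF p(1)] by metis
qed

lemma w2_int: "L1_on {a..b} w2"
 using primitiveD(1)[OF primitive_w1] .

text \<open>To the right of the touchdown the second derivative tends to \<open>l - cos x0\<close>.
  If this were negative, first the slope and then the film would become negative.\<close>

lemma pressure_right_edge:
 assumes "w x0 = 0" "0 < d" "!!x. x0 < x ==> x < x0 + d ==> 0 < w x"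
  and l: "!!x. x0 < x ==> x < x0 + d ==> w2 x = l - \<alpha>\<^sup>2 * w x - cos x"
 shows "cos x0 <= l"
proof (rule ccontr)
 assume n: "~ cos x0 <= l"
 define q where "q = (%x. l - \<alpha>\<^sup>2 * w x - cos x)"
 have qc: "continuous_on UNIV q" unfolding q_def by (intro continuous_intros w_cont)
 have "(q \<longlongrightarrow> q x0) (nhds x0)"
  using qc by (simp add: continuous_on_eq_continuous_at isCont_def tendsto_nhds_iff)
 then have "eventually (%x. q x < 0) (nhds x0)"
  by (rule order_tendstoD) (use n assms(1) in "auto simp: q_def")
 then obtain e where e: "e > 0" "!!x. dist x x0 < e ==> q x < 0" by (auto simp: eventually_nhds_metric)
 define r where "r = min e d"
 have r: "0 < r" "r <= e" "r <= d" using e assms(2) by (auto simp: r_def)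
 have w1neg: "w1 x < 0" if x: "x0 < x" "x < x0 + r" for x
 proof -
  have "(w1 has_real_derivative q y) (at y)" if "x0 < y" "y < x" for y
   using deriv2[OF assms(3), of y] l[of y] that x r by (simp add: q_def)
  then obtain z where z: "x0 < z" "z < x" "w1 x - w1 x0 = (x - x0) * q z"
   using MVT_open[OF x(1) continuous_on_subset[OF cont1 subset_UNIV]] by blast
  have "(x - x0) * q z < 0" using e(2)[of z] z x r by (intro mult_pos_neg) (auto simp: dist_real_def)
  then show ?thesis using z zero1[OF assms(1)] by simp
 qed
 obtain z where z: "x0 < z" "z < x0 + r/2" "w (x0 + r/2) - w x0 = (x0 + r/2 - x0) * w1 z"
  using MVT2[of x0 "x0 + r/2" w w1] deriv1 r by auto
 have "(x0 + r/2 - x0) * w1 z < 0" using w1neg[of z] z r by (intro mult_pos_neg) auto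
 then show False using z assms(1) nonneg[of "x0 + r/2"] by simp
qed

lemma pressure_left_edge:
 assumes "w x0 = 0" "0 < d" "!!x. x0 - d < x ==> x < x0 ==> 0 < w x"
  and l: "!!x. x0 - d < x ==> x < x0 ==> w2 x = l - \<alpha>\<^sup>2 * w x - cos x"
 shows "cos x0 <= l"
proof -
 interpret r: film \<alpha> "%x. w (- x)" "%x. - w1 (- x)" "%x. w2 (- x)" by (rule film_reflect)
 have "cos (- x0) <= l"
  by (rule r.pressure_right_edge[of "-x0" d l]) (use assms in auto)
 then show ?thesis by simp
qed

text \<open>For \<alpha> at most 1 the half-periods [0, pi] and [pi, 2 pi], on each of which the
  sine has one sign, are short enough for \<open>no_short_component\<close>. Only a component
  straddling pi needs a separate argument, with humps of the slope.\<close>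

lemma zero_interval:
 assumes a1: "\<alpha> <= 1" and xy: "0 <= x" "x <= z" "z <= y" "y <= 2 * pi" "w x = 0" "w y = 0"
 shows "w z = 0"
proof (rule ccontr)
 assume "w z ~= 0"
 then have z: "0 < w z" "x < z" "z < y" using nonneg[of z] xy by (auto simp: less_le)
 obtain a b where h: "x <= a" "a < z" "z < b" "b <= y" "w a = 0" "w b = 0"
  "!!u. a < u ==> u < b ==> 0 < w u"
  using hump_exists[OF w_cont xy(5,6) z(2,3,1)] by blast
 have ap: "\<alpha> * L <= pi" if "0 <= L" "L <= pi" for L
  using mult_mono[OF a1 that(2)] that by simp
 have s1: "0 < 1 * sin t" if "0 < t" "t < pi" for t using that sin_gt_zero by simp
 have s2: "0 < (-1) * sin t" if "pi < t" "t < 2 * pi" for t using that sin_lt_zero by simp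
 consider "b <= pi" | "pi <= a" | "a < pi" "pi < b" by linarith
 then show False
 proof cases
  case 1
  show False by (rule no_short_component[of pi 0 1 a b]) (use 1 h xy ap s1 in auto)
 next
  case 2
  show False by (rule no_short_component[of "2*pi" pi "-1" a b]) (use 2 h xy ap s2 in auto)
 next
  case 3
  obtain c where c: "a < c" "c < pi" "w pi - w a = (pi - a) * w1 c"
   using MVT2[OF 3(1), of w w1] deriv1 by auto
  obtain d where d: "pi < d" "d < b" "w b - w pi = (b - pi) * w1 d"
   using MVT2[OF 3(2), of w w1] deriv1 by auto
  have wp: "0 < w pi" using h 3 by auto
  have "0 < (pi - a) * w1 c" using wp h(5) unfolding c(3)[symmetric] by simp
  then have c1: "0 < w1 c" using 3 by (simp add: zero_less_mult_iff)
  have "(b - pi) * w1 d < 0" using wp h(6) unfolding d(3)[symmetric] by simp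
  then have d1: "w1 d < 0" using 3 by (simp add: mult_less_0_iff)
  obtain e where e: "c <= e" "e <= d" "w1 e = 0"
   using IVT2'[of w1 d 0 c] c1 d1 c d continuous_on_subset[OF cont1] by (metis less_eq_real_def order.strict_trans subset_UNIV)
  have ce: "c < e" "e < d" using e c1 d1 by (auto simp: less_le)
  show False
  \<comment> \<open>The slope is positive at c < pi, zero at \<open>e\<close> and negative at d >
    pi. If \<open>e\<close> lies left of pi, the positive hump around \<open>c\<close> stays in the
    first half-period; otherwise the negative hump around \<open>d\<close> stays in the
    second.\<close>
  proof (cases "e <= pi")
   case True
   obtain a' b' where k: "a <= a'" "a' < c" "c < b'" "b' <= e" "w1 a' = 0" "w1 b' = 0"
    "!!u. a' < u ==> u < b' ==> 0 < w1 u"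
    using hump_exists[OF continuous_on_subset[OF cont1] zero1[OF h(5)] e(3) c(1) ce(1) c1] by blast
   show False
    by (rule no_slope_hump[of a' b' 1]) (use k True h xy 3 s1 ap[of "b' - a'"] in auto)
  next
   case False
   have "continuous_on {e..b} (%x. - w1 x)" by (intro continuous_intros continuous_on_subset[OF cont1]) auto
   then obtain a' b' where k: "e <= a'" "a' < d" "d < b'" "b' <= b" "- w1 a' = 0" "- w1 b' = 0"
    "!!u. a' < u ==> u < b' ==> 0 < - w1 u"
    using hump_exists[of e b "%x. - w1 x" d] e zero1[OF h(6)] ce d d1 by auto
   show False
    by (rule no_slope_hump[of a' b' "-1"]) (use k False h xy 3 s2 ap[of "b' - a'"] in auto)
  qed
 qed
qed

end

lemma periodic_int: "periodic f ==> f (x + of_int n * (2 * pi)) = f x"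
proof -
 assume "periodic f"
 then interpret periodic_fun_simple f "2 * pi" by unfold_locales (simp add: periodic_def)
 show "f (x + of_int n * (2 * pi)) = f x" by (rule plus_of_int)
qed

lemma fold_period:
 obtains n :: int where "c <= x + of_int n * (2 * pi)" "x + of_int n * (2 * pi) < c + 2 * pi"
proof (rule that[of "- \<lfloor>(x - c) / (2 * pi)\<rfloor>"])
 have "of_int \<lfloor>(x - c) / (2 * pi)\<rfloor> * (2 * pi) <= x - c"
  using of_int_floor_le[of "(x - c) / (2 * pi)"] pi_gt_zero by (subst (asm) pos_le_divide_eq) auto
 then show "c <= x + of_int (- \<lfloor>(x - c) / (2 * pi)\<rfloor>) * (2 * pi)" by simp
 have "(x - c) / (2 * pi) < of_int \<lfloor>(x - c) / (2 * pi)\<rfloor> + 1" by linarith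
 then have "(x - c) < (of_int \<lfloor>(x - c) / (2 * pi)\<rfloor> + 1) * (2 * pi)" using pi_gt_zero by (subst (asm) pos_divide_less_eq) auto
 then show "x + of_int (- \<lfloor>(x - c) / (2 * pi)\<rfloor>) * (2 * pi) < c + 2 * pi" by (simp add: algebra_simps)
qed

lemma periodic_zero:
 assumes "periodic f" "!!x. x \<in> {c..c + 2 * pi} ==> f x = 0"
 shows "f x = 0"
proof -
 obtain n :: int where "c <= x + of_int n * (2 * pi)" "x + of_int n * (2 * pi) < c + 2 * pi"
  by (rule fold_period)
 then have "f (x + of_int n * (2 * pi)) = 0" by (intro assms(2)) auto
 then show ?thesis using periodic_int[OF assms(1)] by simp
qed

lemma primitive_sin: "primitive sin cos"
 by (rule primitive_of_deriv[OF DERIV_sin]) (intro continuous_intros)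

lemma primitive_cos: "primitive cos (%x. - sin x)"
 by (rule primitive_of_deriv[OF DERIV_cos]) (intro continuous_intros)

lemma set_integrable_uminus: "set_integrable M A f ==> set_integrable M A (%x. - f x :: real)"
 unfolding set_integrable_def by simp

lemma integral_cos_circle: "(\<oint>x. cos x) = 0"
 using primitiveD(2)[OF primitive_sin, of 0 "2*pi"] by simp

context film
begin

abbreviation pressure :: "real => real" where
 "pressure x \<equiv> w2 x + \<alpha>^2 * w x + cos x"

text \<open>At \<alpha> = 1 the cosine lies in the kernel of w \<mapsto> w'' + w. Pairing a constant
  pressure with cos therefore leaves the integral of cos^2, which would have to be 0.\<close>

lemma no_constant_pressure_resonant:
 assumes a1: "\<alpha> = 1" and P: "AE x in lborel. x \<in> {0..2*pi} --> pressure x = l"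
 shows False
proof -
 let ?I = "{0..2*pi}"
 have ibp1: "(\<oint>x. w1 x * - sin x) + (\<oint>x. cos x * w2 x) = 0"
  using integral_by_parts_primitive[OF primitive_w1 primitive_cos, of 0 "2*pi"] w1_per[of 0] by simp
 have ibp2: "(\<oint>x. w x * cos x) + (\<oint>x. sin x * w1 x) = 0"
  using integral_by_parts_primitive[OF primitive_w primitive_sin, of 0 "2*pi"] by simp
 have e: "(\<oint>x. w1 x * - sin x) = - (\<oint>x. sin x * w1 x)"
  by (simp add: set_lebesgue_integral_def mult.commute)
 have i1: "L1_on ?I (%x. cos x * w2 x)"
  by (rule set_integrable_cont_mult[OF _ w2_int]) (intro continuous_intros)
 have i2: "L1_on ?I (%x. w x * cos x)" "L1_on ?I (%x. (cos x)^2)"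
  by (intro cont_set_integrable continuous_intros w_cont)+
 have "(\<oint>x. cos x * pressure x) = (\<oint>x. (cos x * w2 x + w x * cos x) + (cos x)^2)"
  using a1 by (simp add: algebra_simps power2_eq_square)
 also have "... = (\<oint>x. cos x * w2 x) + (\<oint>x. w x * cos x) + (\<oint>x. (cos x)^2)"
  by (simp only: set_integral_add(2)[OF set_integral_add(1)[OF i1 i2(1)] i2(2)] set_integral_add(2)[OF i1 i2(1)])
 also have "... = (\<oint>x. (cos x)^2)" using ibp1 ibp2 e by simp
 finally have A: "(\<oint>x. cos x * pressure x) = (\<oint>x. (cos x)^2)" .
 have m: "pressure \<in> borel_measurable borel"
  using w2_borel borel_measurable_continuous_onI[OF w_cont] by measurable
 have "(\<oint>x. cos x * pressure x) = (\<oint>x. l * cos x)"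
 proof (rule set_lebesgue_integral_cong_AE)
  show "AE x\<in>?I in lborel. cos x * pressure x = l * cos x" using P by eventually_elim auto
 qed (use m in auto)
 also have "... = 0" using integral_cos_circle by simp
 finally have "(\<oint>x. (cos x)^2) <= 0" using A by simp
 then have "(cos 0)^2 = (0::real)"
  by (intro continuous_zero_if_integral_zero[of 0 "2*pi" "%x. (cos x)^2" 0]) (auto intro!: continuous_intros)
 then show False by simp
qed

text \<open>Zeros at 0 and 2 pi would make the whole film vanish, so \<open>w\<close> is positive at
  0 and there is at most one dry interval. The edge conditions bound cos by \<open>l\<close> at its
  two ends; since cos falls up to pi and rises afterwards, the bound persists inside, as in the
  complementarity condition of an obstacle problem.\<close>

lemma pressure_structure:
 assumes a1: "\<alpha> <= 1" and M: "0 < (\<oint>x. w x)"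
 obtains (full) l where "!!x. x \<in> {0..2*pi} ==> 0 < w x" "!!x. x \<in> {0..2*pi} ==> pressure x = l"
 | (gap) l a b where "0 < b" "b <= a" "a < 2 * pi" "!!x. x \<in> {0..2*pi} ==> w x = 0 \<longleftrightarrow> x \<in> {b..a}"
  "!!x. x \<in> {0..2*pi} ==> 0 < w x ==> pressure x = l"
  "!!x. x \<in> {b..a} ==> cos x <= l" "!!x. x \<in> {b<..<a} ==> cos x < l"
proof (cases "\<exists>x\<in>{0..2*pi}. w x = 0")
 case False
 then have p: "0 < w x" if "x \<in> {0..2*pi}" for x using that nonneg[of x] by (metis less_le)
 have pa: "0 < w x" for x
 proof -
  obtain n :: int where "0 <= x + of_int n * (2 * pi)" "x + of_int n * (2 * pi) < 0 + 2 * pi"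
   by (rule fold_period)
  then have "0 < w (x + of_int n * (2 * pi))" by (intro p) auto
  then show ?thesis using periodic_int[OF per] by simp
 qed
 obtain l where l: "!!x. -1 < x ==> x < 2 * pi + 1 ==> w2 x = l - \<alpha>\<^sup>2 * w x - cos x"
  using pressure_const[of "-1" "2*pi+1"] pa by blast
 have "pressure x = l" if "x \<in> {0..2*pi}" for x using l[of x] that by simp
 then show ?thesis using full p by blast
next
 case True
 let ?Z = "{x \<in> {0..2*pi}. w x = 0}"
 have "compact ?Z" using continuous_closed_preimage_constant[OF w_cont closed_atLeastAtMost, of 0 "2*pi" 0]
  by (auto simp: compact_eq_bounded_closed intro: bounded_subset[OF bounded_closed_interval])
 moreover have "?Z ~= {}" using True by auto
 \<comment> \<open>Here \<open>a\<close> is the last and \<open>b\<close> the first zero of the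
   period, so b \<le> a, and on the line (a - 2 pi, b) is a single component of positivity with one
   pressure constant.\<close>
 ultimately obtain a b where a: "a \<in> ?Z" "!!x. x \<in> ?Z ==> x <= a" and b: "b \<in> ?Z" "!!x. x \<in> ?Z ==> b <= x"
  using compact_attains_sup[of ?Z] compact_attains_inf[of ?Z] by blast
 have w02: "w (2 * pi) = w 0" using w_per[of 0] by simp
 have w0: "0 < w 0"
 proof (rule ccontr)
  assume "~ 0 < w 0"
  then have "w 0 = 0" "w (2 * pi) = 0" using not_pos w02 by auto
  then have "w x = 0" if "x \<in> {0..2*pi}" for x
   using zero_interval[OF a1, of 0 x "2*pi"] that by auto
  then have "(\<oint>x. w x) = (\<oint>x. 0)"
   by (intro set_lebesgue_integral_cong) auto
  then show False using M by simp
 qed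
 have b0: "0 < b" using b w0 by (auto simp: less_le)
 have a2: "a < 2 * pi" using a w0 w02 by (auto simp: less_le)
 have ba: "b <= a" using a b by auto
 have z: "w x = 0 \<longleftrightarrow> x \<in> {b..a}" if "x \<in> {0..2*pi}" for x
  using zero_interval[OF a1, of b x a] a b that by auto
 have pos: "0 < w x" if "a - 2 * pi < x" "x < b" for x
 proof (cases "x < 0")
  case True
  then have "w (x + 2 * pi) ~= 0" using z[of "x + 2 * pi"] that a2 a(1) by auto
  then show ?thesis using w_per[of x] nonneg[of x] by auto
 next
  case False
  then have "w x ~= 0" using z[of x] that a b ba by auto
  then show ?thesis using nonneg[of x] by auto
 qed
 obtain l where l: "!!x. a - 2 * pi < x ==> x < b ==> w2 x = l - \<alpha>\<^sup>2 * w x - cos x"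
  using pressure_const[of "a - 2 * pi" b] pos by blast
 have len: "0 < b - (a - 2 * pi)" using a2 b0 by simp
 have ca: "cos a <= l"
 proof -
  have "w (a - 2 * pi) = 0" using a w_per[of "a - 2 * pi"] by simp
  then have "cos (a - 2 * pi) <= l"
   by (rule pressure_right_edge[OF _ len]) (use pos l in auto)
  then show ?thesis using cos_diff[of a "2 * pi"] by simp
 qed
 have cb: "cos b <= l" by (rule pressure_left_edge[OF _ len]) (use b pos l in auto)
 have c2: "cos x = cos (2 * pi - x)" for x :: real by (simp add: cos_diff)
 show ?thesis
 proof (rule gap[OF b0 ba a2 z])
  fix x assume x: "x \<in> {0..2*pi}" "0 < w x"
  show "pressure x = l"
  proof (cases "x < b")
   case True
   then show ?thesis using l[of x] x a2 by auto
  next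
   case False
   then have "a < x" using z[OF x(1)] x by auto
   then have "w2 (x - 2 * pi) = l - \<alpha>\<^sup>2 * w (x - 2 * pi) - cos (x - 2 * pi)"
    using x b0 by (intro l) auto
   then show ?thesis using w_per[of "x - 2 * pi"] w2_per[of "x - 2 * pi"] cos_diff[of x "2 * pi"] by simp
  qed
 next
  fix x assume x: "x \<in> {b..a}"
  show "cos x <= l"
  proof (cases "x <= pi")
   case True
   then have "cos x <= cos b" using x b0 by (intro cos_monotone_0_pi_le) auto
   then show ?thesis using cb by simp
  next
   case False
   then have "cos (2 * pi - x) <= cos (2 * pi - a)" using x a2 by (intro cos_monotone_0_pi_le) auto
   then show ?thesis using ca c2[of x] c2[of a] by linarith
  qed
 next
  fix x assume x: "x \<in> {b<..<a}"
  show "cos x < l"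
  proof (cases "x <= pi")
   case True
   then have "cos x < cos b" using x b0 by (intro cos_monotone_0_pi) auto
   then show ?thesis using cb by simp
  next
   case False
   then have "cos (2 * pi - x) < cos (2 * pi - a)" using x a2 by (intro cos_monotone_0_pi) auto
   then show ?thesis using ca c2[of x] c2[of a] by linarith
  qed
 qed
qed

text \<open>Exact second-order expansion of the energy around \<open>w\<close>. The linear term is
  minus the pairing of v - w with the pressure, to which any constant \<open>l\<close> may be added
  because v - w has mean zero.\<close>

lemma energy_difference:
 assumes v: "primitive v g" "periodic v" and g2: "L1_on {0..2*pi} (%x. (g x)^2)"
  and mass: "(\<oint>x. v x) = (\<oint>x. w x)"
 shows "circle_energy \<alpha> v g - circle_energy \<alpha> w w1 =
  (1/2) * ((\<oint>x. (g x - w1 x)^2) - \<alpha>\<^sup>2 * (\<oint>x. (v x - w x)^2))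
   + (\<oint>x. (v x - w x) * (l - pressure x))"
  and "L1_on {0..2*pi} (%x. (g x - w1 x)^2)"
proof -
 let ?I = "{0..2*pi}"
 define z where "z = (%x. v x - w x)"
 define z1 where "z1 = (%x. g x - w1 x)"
 have pz: "primitive z z1" unfolding z_def z1_def by (rule primitive_diff[OF v(1) primitive_w])
 have zc: "continuous_on S z" "continuous_on S v" for S using primitive_continuous pz v(1) by blast+
 have w1c: "continuous_on S w1" for S by (rule continuous_on_subset[OF cont1 subset_UNIV])
 have gi: "L1_on ?I g" "L1_on ?I z1" using primitiveD(1) v(1) pz by blast+
 have gw: "L1_on ?I (%x. w1 x * g x)" "L1_on ?I (%x. w1 x * z1 x)"
  by (rule set_integrable_cont_mult[OF w1c] gi)+
 have w1i: "L1_on ?I (%x. (w1 x)^2)" by (intro cont_set_integrable continuous_intros w1c)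
 have z12: "L1_on ?I (%x. (z1 x)^2)"
  using set_integral_square_expand(2)[OF g2, of "%x. - w1 x"] gw(1) w1i by (simp add: z1_def mult.commute set_integrable_uminus)
 then show "L1_on ?I (%x. (g x - w1 x)^2)" by (simp add: z1_def)
 have E1: "(\<oint>x. (g x)^2) = (\<oint>x. (z1 x)^2) + 2 * (\<oint>x. w1 x * z1 x) + (\<oint>x. (w1 x)^2)"
  using set_integral_square_expand(1)[OF z12, of w1] gw(2) w1i by (simp add: z1_def mult.commute)
 have E2: "(\<oint>x. (v x)^2) = (\<oint>x. (z x)^2) + 2 * (\<oint>x. z x * w x) + (\<oint>x. (w x)^2)"
 proof -
  have "(\<oint>x. (z x + w x)^2) = (\<oint>x. (z x)^2) + 2 * (\<oint>x. z x * w x) + (\<oint>x. (w x)^2)"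
   by (rule set_integral_square_expand(1)) (intro cont_set_integrable continuous_intros zc w_cont)+
  then show ?thesis by (simp add: z_def)
 qed
 have ci: "L1_on ?I (%x. z x * cos x)" "L1_on ?I (%x. w x * cos x)"
   "L1_on ?I (%x. z x * w x)" "L1_on ?I z" "L1_on ?I v" "L1_on ?I w"
  by (intro cont_set_integrable continuous_intros zc w_cont)+
 have E3: "(\<oint>x. v x * cos x) = (\<oint>x. z x * cos x) + (\<oint>x. w x * cos x)"
  using set_integral_add(2)[OF ci(1,2)] by (simp add: z_def left_diff_distrib)
 have z0: "(\<oint>x. z x) = 0"
  unfolding z_def using set_integral_diff(2)[OF ci(5,6)] mass by simp
 have zper: "z (2 * pi) = z 0" using v(2) w_per[of 0] by (simp add: z_def periodic_def) (metis add_0)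
 have ibp: "(\<oint>x. w1 x * z1 x) = - (\<oint>x. z x * w2 x)"
  using integral_by_parts_primitive[OF primitive_w1 pz, of 0 "2*pi"] w1_per[of 0] zper by simp
 have zw2: "L1_on ?I (%x. z x * w2 x)" by (rule set_integrable_cont_mult[OF zc(1) w2_int])
 have azw: "L1_on ?I (%x. \<alpha>^2 * (z x * w x))" using ci(3) by simp
 have lz: "L1_on ?I (%x. l * z x)" using ci(4) by simp
 have "(\<oint>x. z x * (l - pressure x)) = (\<oint>x. l * z x - ((z x * w2 x + \<alpha>^2 * (z x * w x)) + z x * cos x))"
  by (rule arg_cong[where f="set_lebesgue_integral lborel ?I"]) (rule ext, simp add: algebra_simps)
 also have "... = l * (\<oint>x. z x) - ((\<oint>x. z x * w2 x) + \<alpha>^2 * (\<oint>x. z x * w x) + (\<oint>x. z x * cos x))"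
  by (simp only: set_integral_diff(2)[OF lz set_integral_add(1)[OF set_integral_add(1)[OF zw2 azw] ci(1)]]
   set_integral_add(2)[OF set_integral_add(1)[OF zw2 azw] ci(1)] set_integral_add(2)[OF zw2 azw] set_integral_mult_right)
 finally have E4: "(\<oint>x. z x * (l - pressure x)) = - ((\<oint>x. z x * w2 x) + \<alpha>^2 * (\<oint>x. z x * w x) + (\<oint>x. z x * cos x))"
  by (simp only: z0)
 have "circle_energy \<alpha> v g - circle_energy \<alpha> w w1 =
  (1/2) * ((\<oint>x. (z1 x)^2) - \<alpha>\<^sup>2 * (\<oint>x. (z x)^2)) + (\<oint>x. z x * (l - pressure x))"
  unfolding circle_energy_def E1 E2 E3 E4 ibp by (simp add: algebra_simps)
 then show "circle_energy \<alpha> v g - circle_energy \<alpha> w w1 =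
  (1/2) * ((\<oint>x. (g x - w1 x)^2) - \<alpha>\<^sup>2 * (\<oint>x. (v x - w x)^2))
   + (\<oint>x. (v x - w x) * (l - pressure x))"
  by (simp add: z_def z1_def)
qed

text \<open>The energy difference is a sum of two nonnegative terms: the quadratic form, by
  Wirtinger, and the integral of v * (l - cos) over the dry interval. For \<alpha> < 1 the first
  alone forces v = w. For \<alpha> = 1 the second forces \<open>v\<close> to vanish on the dry
  interval too, after which v - w lives on a window shorter than a period, where Wirtinger holds
  with a constant above 1.\<close>

theorem convex_unique:
 assumes a1: "\<alpha> <= 1" and M: "0 < (\<oint>x. w x)"
  and v: "primitive v g" "periodic v" "!!x. 0 <= v x" and g2: "!!a b. L1_on {a..b} (%x. (g x)^2)"
  and mass: "(\<oint>x. v x) = (\<oint>x. w x)"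
  and E: "circle_energy \<alpha> v g <= circle_energy \<alpha> w w1"
 shows "v x = w x"
proof -
 let ?I = "{0..2*pi}"
 define z where "z = (%x. v x - w x)"
 define z1 where "z1 = (%x. g x - w1 x)"
 have pz: "primitive z z1" unfolding z_def z1_def by (rule primitive_diff[OF v(1) primitive_w])
 have zc: "continuous_on S z" for S using primitive_continuous pz by blast
 have vc: "continuous_on S v" for S using primitive_continuous v(1) by blast
 have zper: "periodic z" using v(2) per by (simp add: z_def periodic_def)
 have z20: "z (2 * pi) = z 0" using zper unfolding periodic_def by (metis add_0)
 have z0: "(\<oint>x. z x) = 0"
  unfolding z_def using set_integral_diff(2)[OF cont_set_integrable cont_set_integrable, OF vc w_cont] mass by simp
 have z12: "L1_on {a..b} (%x. (z1 x)^2)" for a b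
 proof -
  have "L1_on {a..b} (%x. w1 x * g x)"
   by (rule set_integrable_cont_mult[OF continuous_on_subset[OF cont1 subset_UNIV] primitiveD(1)[OF v(1)]])
  moreover have "L1_on {a..b} (%x. (w1 x)^2)"
   by (intro cont_set_integrable continuous_intros continuous_on_subset[OF cont1 subset_UNIV])
  ultimately show ?thesis
   using set_integral_square_expand(2)[of lborel "{a..b}" g "%x. - w1 x", OF g2] by (simp add: z1_def mult.commute set_integrable_uminus)
 qed
 have dif: "(1/2) * ((\<oint>x. (z1 x)^2) - \<alpha>\<^sup>2 * (\<oint>x. (z x)^2))
   + (\<oint>x. z x * (l - pressure x)) <= 0" for l
  using energy_difference(1)[OF v(1,2) g2 mass, of l] E by (simp add: z_def z1_def)
 have W: "(\<oint>x. (z x)^2) <= (\<oint>x. (z1 x)^2)"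
  using wirtinger[of z z1 0 "2*pi" 1, OF pz z12] z20 z0 by simp
 have sq0: "0 <= (\<oint>x. (z x)^2)" by (rule set_integral_nonneg) simp
 have sub: "\<alpha>^2 * (\<oint>x. (z x)^2) <= (\<oint>x. (z x)^2)"
  using sq0 a1 alpha by (intro mult_left_le_one_le) (auto simp: power_le_one)
 have small: "z x = 0" if "\<alpha> < 1" "0 <= (\<oint>x. z x * (l - pressure x))" for l x
 proof -
  have "\<alpha>^2 < 1" using that(1) alpha by (simp add: power_less_one_iff abs_square_less_1)
  have "(\<oint>x. (z x)^2) - \<alpha>\<^sup>2 * (\<oint>x. (z x)^2) <= 0" using dif[of l] W that(2) by argo
  then have "(1 - \<alpha>\<^sup>2) * (\<oint>x. (z x)^2) <= 0" by (simp add: algebra_simps)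
  then have le0: "(\<oint>x. (z x)^2) <= 0" using \<open>\<alpha>\<^sup>2 < 1\<close> by (simp add: mult_le_0_iff)
  have "z y = 0" if "y \<in> {0..0 + 2 * pi}" for y
  proof -
   have "(z y)^2 = 0"
    by (rule continuous_zero_if_integral_zero[of 0 "2*pi" "%x. (z x)^2"]) (use le0 that in "auto intro!: continuous_intros zc")
   then show ?thesis by simp
  qed
  then show ?thesis using periodic_zero[OF zper] by blast
 qed
 from a1 M have "z x = 0"
 proof (cases rule: pressure_structure)
  case (full l)
  have e: "(\<oint>x. z x * (l - pressure x)) = (\<oint>x. 0)"
   by (rule set_lebesgue_integral_cong) (use full(2) in auto)
  show ?thesis
  proof (cases "\<alpha> < 1")
   case True
   then show ?thesis using small[of l x] e by simp
  next
   case False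
   then have "\<alpha> = 1" using a1 by simp
   then show ?thesis using no_constant_pressure_resonant[of l] full(2) by auto
  qed
 next
  case (gap l a b)
  have e: "(\<oint>x. z x * (l - pressure x)) = (LINT x:{b..a}|lborel. v x * (l - cos x))"
  proof -
   have "(\<oint>x. z x * (l - pressure x)) = (LINT x:{b..a}|lborel. z x * (l - pressure x))"
   proof (rule set_integral_supp_cong)
    fix y assume "y \<in> ?I" "y \<notin> {b..a}"
    then have "pressure y = l" using gap(4,5)[of y] nonneg[of y] by auto
    then show "z y * (l - pressure y) = 0" by simp
   qed (use gap(1,3) in auto)
   also have "... = (LINT x:{b..a}|lborel. v x * (l - cos x))"
   proof (rule set_lebesgue_integral_cong)
    have "w y = 0" if "y \<in> {b..a}" for y using that gap(1,3) gap(4)[of y] by auto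
    then show "ALL y. y \<in> {b..a} --> z y * (l - pressure y) = v y * (l - cos y)"
     using zero2 by (simp add: z_def)
   qed simp
   finally show ?thesis .
  qed
  have nn: "0 <= v y * (l - cos y)" if "y \<in> {b..a}" for y using v(3)[of y] gap(6)[OF that] by simp
  then have nn': "0 <= (LINT x:{b..a}|lborel. v x * (l - cos x))" by (rule set_integral_nonneg)
  show ?thesis
  proof (cases "\<alpha> < 1")
   case True
   then show ?thesis using small[of l x] e nn' by simp
  next
   case False
   then have al: "\<alpha> = 1" using a1 by simp
   \<comment> \<open>A dry set reduced to one point would mean a pressure that is constant almost
     everywhere, which resonance excludes.\<close>
   have "b < a"
   proof (rule ccontr)
    assume "~ b < a"
    then have "b = a" using gap(2) by simp
    have "AE x in lborel. x ~= a" by (rule AE_lborel_singleton)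
    then have "AE x in lborel. x \<in> ?I --> pressure x = l"
     by eventually_elim (use gap(4,5) \<open>b = a\<close> nonneg in "auto simp: less_le")
    then show False by (rule no_constant_pressure_resonant[OF al])
   qed
   have v0: "v y = 0" if y: "y \<in> {b<..<a}" for y
   proof -
    have "v y * (l - cos y) = 0"
    proof (rule continuous_zero_if_integral_zero[of b a "%x. v x * (l - cos x)"])
     show "continuous_on {b..a} (%x. v x * (l - cos x))" by (intro continuous_intros vc)
     show "(LINT x:{b..a}|lborel. v x * (l - cos x)) <= 0"
     proof -
      have "C <= 0" if "1 / 2 * (A - 1\<^sup>2 * B) + C <= 0" "B <= A" for A B C :: real
       using that by (simp add: field_simps)
      from this[OF dif[of l, unfolded e, unfolded al] W] show ?thesis .
     qed
    qed (use nn \<open>b < a\<close> y in auto)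
    then show ?thesis using gap(7)[OF y] by simp
   qed
   \<comment> \<open>The middle third of the dry interval. The difference \<open>z\<close> vanishes
     on it including its ends, which supplies the equal end values and the zero mean that Wirtinger
     needs on the complementary window.\<close>
   define b' where "b' = (2 * b + a) / 3"
   define a' where "a' = (b + 2 * a) / 3"
   have ab': "b < b'" "b' < a'" "a' < a" using \<open>b < a\<close> by (auto simp: b'_def a'_def)
   have z0': "z y = 0" if "y \<in> {b'..a'}" for y
    using that ab' gap(1,3) gap(4)[of y] v0[of y] by (auto simp: z_def)
   have z0'': "z y = 0" if "y \<in> {b' + 2 * pi..a' + 2 * pi}" for y
    using z0'[of "y - 2 * pi"] zper that unfolding periodic_def by (metis add_le_imp_le_diff atLeastAtMost_iff diff_add_cancel diff_le_eq)
   let ?W = "{a'..b' + 2 * pi}"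
   have lenW: "0 < b' + 2 * pi - a'" "b' + 2 * pi - a' < 2 * pi" using ab' gap(1,3) by auto
   have per_AE: "AE x in lborel. z1 (x + 2 * pi) = z1 x" by (rule periodic_deriv_AE[OF zper pz])
   have iz2: "L1_on {c..d} (%x. (z x)^2)" "L1_on {c..d} z" for c d
    by (intro cont_set_integrable continuous_intros zc)+
   have zper': "AE x in lborel. z (x + 2 * pi) = z x" using zper by (simp add: periodic_def)
   have win: "(LINT x:{a'..a' + 2 * pi}|lborel. h x) = (\<oint>x. h x)"
    if "!!a b. L1_on {a..b} h" "AE x in lborel. h (x + 2 * pi) = h x" for h :: "real => real"
    by (rule periodic_window[OF that]) (use ab' gap(1,3) in auto)
   have splitW: "(LINT x:{a'..a' + 2 * pi}|lborel. h x) = (LINT x:?W|lborel. h x) + (LINT x:{b' + 2 * pi..a' + 2 * pi}|lborel. h x)"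
    if "!!a b. L1_on {a..b} h" for h :: "real => real"
    by (rule set_integral_split[OF _ _ that]) (use lenW ab' in auto)
   have zz: "(LINT x:{b' + 2 * pi..a' + 2 * pi}|lborel. z x) = 0"
    "(LINT x:{b' + 2 * pi..a' + 2 * pi}|lborel. (z x)^2) = 0"
    using set_lebesgue_integral_cong[of "{b' + 2 * pi..a' + 2 * pi}" lborel z "%_. 0"]
     set_lebesgue_integral_cong[of "{b' + 2 * pi..a' + 2 * pi}" lborel "%x. (z x)^2" "%_. 0"] z0'' by auto
   have mW: "(LINT x:?W|lborel. z x) = 0"
    using win[OF iz2(2) zper'] splitW[OF iz2(2)] zz z0 by simp
   have sW: "(LINT x:?W|lborel. (z x)^2) = (\<oint>x. (z x)^2)"
    using win[OF iz2(1)] zper' splitW[OF iz2(1)] zz by (simp add: eventually_mono)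
   have gW: "(LINT x:?W|lborel. (z1 x)^2) <= (\<oint>x. (z1 x)^2)"
   proof -
    have "AE x in lborel. (z1 (x + 2 * pi))^2 = (z1 x)^2" using per_AE by eventually_elim simp
    moreover have "0 <= (LINT x:{b' + 2 * pi..a' + 2 * pi}|lborel. (z1 x)^2)" by (rule set_integral_nonneg) simp
    ultimately show ?thesis using win[OF z12] splitW[OF z12] by simp
   qed
   \<comment> \<open>The sharp Wirtinger constant of the window; it exceeds 1 because the window is
     shorter than 2 pi.\<close>
   define k where "k = 2 * pi / (b' + 2 * pi - a')"
   have k: "1 < k" "k * (b' + 2 * pi - a') = 2 * pi" using lenW by (auto simp: k_def field_simps)
   have "k^2 * (LINT x:?W|lborel. (z x)^2) <= (LINT x:?W|lborel. (z1 x)^2)"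
    by (rule wirtinger[OF pz z12]) (use k lenW mW z0'[of a'] z0''[of "b' + 2 * pi"] ab' in auto)
   also have "... <= (\<oint>x. (z1 x)^2)" by (rule gW)
   also have "... <= (\<oint>x. (z x)^2)"
   proof -
    have "A <= B" if "1 / 2 * (A - 1\<^sup>2 * B) + C <= 0" "0 <= C" for A B C :: real
     using that by (simp add: field_simps)
    from this[OF dif[of l, unfolded e, unfolded al] nn'] show ?thesis .
   qed
   finally have "k^2 * (\<oint>x. (z x)^2) <= (\<oint>x. (z x)^2)" unfolding sW .
   then have "(k^2 - 1) * (\<oint>x. (z x)^2) <= 0" by (simp add: algebra_simps)
   moreover have "1 < k^2" using k(1) by (simp add: one_less_power)
   ultimately have le0: "(\<oint>x. (z x)^2) <= 0" by (simp add: mult_le_0_iff)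
   have "z y = 0" if "y \<in> {0..0 + 2 * pi}" for y
   proof -
    have "(z y)^2 = 0"
     by (rule continuous_zero_if_integral_zero[of 0 "2*pi" "%x. (z x)^2"]) (use le0 that in "auto intro!: continuous_intros zc")
    then show ?thesis by simp
   qed
   then show ?thesis using periodic_zero[OF zper] by blast
  qed
 qed
 then show ?thesis by (simp add: z_def)
qed

end

section \<open>Films meet the definitions of steady state and zero dissipation\<close>

lemma L1_loc_continuous: "continuous_on U f ==> L1_loc U f"
 unfolding L1_loc_def set_integrable_def
 using borel_integrable_compact continuous_on_subset by blast

lemma L2_loc_continuous:
 assumes "continuous_on U f" shows "L2_loc U f"
 unfolding L2_loc_def L2_on_def
proof (intro allI impI conjI)
 fix K assume K: "compact K & K \<subseteq> U"
 have c: "continuous_on K f" using assms K continuous_on_subset by blast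
 have "set_borel_measurable borel K f"
  by (rule set_measurable_continuous_on[OF _ c]) (use K compact_imp_closed[of K] in auto)
 then show "set_borel_measurable lborel K f" by (simp add: set_borel_measurable_def)
 show "L1_on K (%x. (f x)^2)"
  unfolding set_integrable_def using K by (intro borel_integrable_compact continuous_intros c) auto
qed

text \<open>The test function vanishes off a compact part of \<open>U\<close>, so its product with
  \<open>f\<close>, extended by 0, is continuously differentiable on the whole line, and the
  integral of the derivative is zero.\<close>

lemma weak_deriv_classical:
 fixes f g :: "real => real"
 assumes U: "open U" and d: "!!x. x \<in> U ==> (f has_real_derivative g x) (at x)" and g: "continuous_on U g"
 shows "weak_deriv U f g"
 unfolding weak_deriv_def
proof (intro conjI allI impI)
 have fc: "continuous_on U f" using d DERIV_isCont by (intro continuous_at_imp_continuous_on) blast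
 show L: "L1_loc U f" "L1_loc U g" using fc g L1_loc_continuous by auto
 fix \<phi> :: "real => real" and K assume *: "smooth_on UNIV \<phi> & compact K & K \<subseteq> U & (ALL x. x \<notin> K --> \<phi> x = 0)"
 then have s: "smooth_on UNIV \<phi>" and K: "compact K" "K \<subseteq> U" and z: "!!x. x \<notin> K ==> \<phi> x = 0" by auto
 have pd: "(\<phi> has_real_derivative deriv \<phi> x) (at x)" for x by (rule smooth_on_UNIV_DERIV(1)[OF s])
 have pc: "continuous_on UNIV \<phi>" "continuous_on UNIV (deriv \<phi>)"
  by (rule smooth_on_UNIV_continuous[OF s] smooth_on_UNIV_continuous[OF smooth_on_UNIV_DERIV(2)[OF s]])+
 have dz: "deriv \<phi> x = 0" if "x \<notin> K" for x
  by (rule deriv_zero_outside[OF K(1) _ that]) (rule z)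
 define H where "H = (%x. if x \<in> U then f x * \<phi> x else 0)"
 define h where "h = (%x. if x \<in> U then f x * deriv \<phi> x + g x * \<phi> x else 0)"
 have oK: "open (- K)" using K compact_imp_closed by blast
 have Hd: "(H has_real_derivative h x) (at x)" for x
 proof (cases "x \<in> U")
  case True
  have "((%x. f x * \<phi> x) has_real_derivative g x * \<phi> x + deriv \<phi> x * f x) (at x)"
   by (rule DERIV_mult[OF d[OF True] pd])
  then have "((%x. f x * \<phi> x) has_real_derivative h x) (at x)" using True by (simp add: h_def algebra_simps)
  then show ?thesis by (rule has_field_derivative_transform_within_open[OF _ U True]) (simp add: H_def)
 next
  case False
  then have "x \<in> - K" using K by blast
  have "((%_. 0) has_real_derivative 0) (at x)" by simp
  then have "(H has_real_derivative 0) (at x)"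
   by (rule has_field_derivative_transform_within_open[OF _ oK \<open>x \<in> - K\<close>]) (auto simp: H_def z)
  then show ?thesis using False by (simp add: h_def)
 qed
 have hc: "continuous_on UNIV h"
 proof (rule continuous_at_imp_continuous_on, rule ballI)
  fix x :: real
  show "isCont h x"
  proof (cases "x \<in> U")
   case True
   have "continuous_on U (%x. f x * deriv \<phi> x + g x * \<phi> x)"
    by (intro continuous_intros fc g continuous_on_subset[OF pc(1)] continuous_on_subset[OF pc(2)]) auto
   then have "continuous_on U h" by (rule continuous_on_eq) (simp add: h_def)
   then show ?thesis using U True by (simp add: continuous_on_eq_continuous_at)
  next
   case False
   then have "x \<in> - K" using K by blast
   have "continuous_on (- K) h"
    by (rule continuous_on_eq[OF continuous_on_const[of _ 0]]) (auto simp: h_def z dz)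
   then show ?thesis using oK \<open>x \<in> - K\<close> by (simp add: continuous_on_eq_continuous_at)
  qed
 qed
 have pH: "primitive H h" by (rule primitive_of_deriv[OF Hd hc])
 obtain B where B: "K \<subseteq> {-B<..<B}" "B > 0" using compact_in_Icc[OF K(1)] by blast
 have nK: "- B \<notin> K" "B \<notin> K" "x \<notin> {-B..B} ==> x \<notin> K" for x using B by (auto simp: subset_iff)
 have "(LINT x:{-B..B}|lborel. h x) = H B - H (-B)" using primitiveD(2)[OF pH] B by simp
 also have "... = 0" using z nK by (simp add: H_def)
 also have "(LINT x:{-B..B}|lborel. h x) = (LINT x:U|lborel. f x * deriv \<phi> x + g x * \<phi> x)"
  unfolding set_lebesgue_integral_def
 proof (rule Bochner_Integration.integral_cong[OF refl])
  fix x show "indicat_real {-B..B} x *\<^sub>R h x = indicat_real U x *\<^sub>R (f x * deriv \<phi> x + g x * \<phi> x)"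
  proof (cases "x \<in> {-B..B}")
   case True
   then show ?thesis by (simp add: h_def)
  next
   case False
   then have "\<phi> x = 0" "deriv \<phi> x = 0" using z dz nK(3) by blast+
   then show ?thesis using False by simp
  qed
 qed
 also have "... = (LINT x:U|lborel. f x * deriv \<phi> x) + (LINT x:U|lborel. g x * \<phi> x)"
  by (rule set_integral_add(2)) (rule test_set_integrable[OF L(1) pc(2) K dz] test_set_integrable[OF L(2) pc(1) K z], assumption)+
 finally show "(LINT x:U|lborel. f x * deriv \<phi> x) = - (LINT x:U|lborel. g x * \<phi> x)" by simp
qed

lemma weak_deriv_cong_AE:
 assumes w: "weak_deriv U f g" and f': "L1_loc U f'" and ae: "AE x in lborel. x \<in> U --> f x = f' x"
 shows "weak_deriv U f' g"
 unfolding weak_deriv_def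
proof (intro conjI allI impI f')
 show "L1_loc U g" using w by (simp add: weak_deriv_def)
 fix \<phi> :: "real => real" and K assume *: "smooth_on UNIV \<phi> & compact K & K \<subseteq> U & (ALL x. x \<notin> K --> \<phi> x = 0)"
 then have s: "smooth_on UNIV \<phi>" and K: "compact K" "K \<subseteq> U" and z: "!!x. x \<notin> K ==> \<phi> x = 0" by auto
 have pc: "continuous_on UNIV (deriv \<phi>)"
  using smooth_on_UNIV_continuous smooth_on_UNIV_DERIV(2)[OF s] by auto
 have dz: "deriv \<phi> x = 0" if "x \<notin> K" for x
  by (rule deriv_zero_outside[OF K(1) _ that]) (rule z)
 have Lf: "L1_loc U f" using w by (simp add: weak_deriv_def)
 have "(LINT x:U|lborel. f x * deriv \<phi> x) = (LINT x:U|lborel. f' x * deriv \<phi> x)"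
  unfolding set_lebesgue_integral_def
 proof (rule integral_cong_AE)
  show "(%x. indicat_real U x *\<^sub>R (f x * deriv \<phi> x)) \<in> borel_measurable lborel"
   using test_set_integrable[OF Lf pc K dz] unfolding set_integrable_def by blast
  show "(%x. indicat_real U x *\<^sub>R (f' x * deriv \<phi> x)) \<in> borel_measurable lborel"
   using test_set_integrable[OF f' pc K dz] unfolding set_integrable_def by blast
  show "AE x in lborel. indicat_real U x *\<^sub>R (f x * deriv \<phi> x) = indicat_real U x *\<^sub>R (f' x * deriv \<phi> x)"
   using ae by eventually_elim (auto simp: indicator_def)
 qed
 moreover have "(LINT x:U|lborel. f x * deriv \<phi> x) = - (LINT x:U|lborel. g x * \<phi> x)"
  using w * unfolding weak_deriv_def by blast
 ultimately show "(LINT x:U|lborel. f' x * deriv \<phi> x) = - (LINT x:U|lborel. g x * \<phi> x)" by simp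
qed

text \<open>\<open>wderiv\<close> picks an arbitrary version, so iterating it means differentiating
  a function known only almost everywhere; this lemma carries a classical derivative through one
  such step.\<close>

lemma wderiv_eq_AE:
 assumes U: "open U" and w: "weak_deriv U f g" and f': "L1_loc U f'" "AE x in lborel. x \<in> U --> f x = f' x"
 shows "AE x in lborel. x \<in> U --> g x = wderiv U f' x" "L1_loc U (wderiv U f')"
proof -
 have w': "weak_deriv U f' g" by (rule weak_deriv_cong_AE[OF w f'])
 have ww: "weak_deriv U f' (wderiv U f')" by (rule weak_deriv_wderiv[OF w'])
 show "AE x in lborel. x \<in> U --> g x = wderiv U f' x" by (rule weak_deriv_unique[OF U w' ww])
 show "L1_loc U (wderiv U f')" using ww by (simp add: weak_deriv_def)
qed

lemma L1_loc_UNIV_borel: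
 assumes "L1_loc UNIV f" shows "f \<in> borel_measurable borel"
proof (rule borel_measurable_LIMSEQ_real)
 show "(%x. indicat_real {- real n..real n} x *\<^sub>R f x) \<in> borel_measurable borel" for n
  using assms[unfolded L1_loc_UNIV_iff, rule_format, of "- real n" "real n"] unfolding set_integrable_def by auto
 fix x
 obtain N where N: "\<bar>x\<bar> <= real N" using real_arch_simple by blast
 show "(%n. indicat_real {- real n..real n} x *\<^sub>R f x) ----> f x"
 proof (rule tendsto_eventually)
  have "indicat_real {- real n..real n} x *\<^sub>R f x = f x" if "N <= n" for n
  proof -
   have "\<bar>x\<bar> <= real n" using N that by linarith
   then show ?thesis by (simp add: abs_le_iff)
  qed
  then show "\<forall>\<^sub>F n in sequentially. indicat_real {- real n..real n} x *\<^sub>R f x = f x"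
   unfolding eventually_sequentially by blast
 qed
qed

lemma sign_constant:
 fixes f :: "real => real"
 assumes "continuous_on {a<..<b} f" "!!x. x \<in> {a<..<b} ==> f x ~= 0"
 obtains s where "s = 1 \<or> s = -1" "!!x. x \<in> {a<..<b} ==> 0 < s * f x"
proof -
 have c: "connected (f ` {a<..<b})" by (rule connected_continuous_image[OF assms(1)]) simp
 have "~ (\<exists>x\<in>{a<..<b}. \<exists>y\<in>{a<..<b}. f x < 0 & 0 < f y)"
 proof
  assume "\<exists>x\<in>{a<..<b}. \<exists>y\<in>{a<..<b}. f x < 0 & 0 < f y"
  then obtain x y where "x \<in> {a<..<b}" "y \<in> {a<..<b}" "f x < 0" "0 < f y" by blast
  then have "0 \<in> f ` {a<..<b}" using connected_contains_Icc[OF c, of "f x" "f y"] by (auto simp: subset_iff)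
  then show False using assms(2) by auto
 qed
 then consider "\<forall>x\<in>{a<..<b}. 0 < f x" | "\<forall>x\<in>{a<..<b}. f x < 0" using assms(2) by (meson linorder_neqE)
 then show ?thesis by cases (use that[of 1] that[of "-1"] in auto)
qed

context film
begin

lemma positive_open: "open {x. 0 < w x}"
 by (rule open_Collect_less) (auto intro: w_cont)

lemma w2_cont_positive: "continuous_on {x. 0 < w x} w2"
 using deriv3 DERIV_isCont by (intro continuous_at_imp_continuous_on) blast

lemma film_zero_dissipation: "zero_dissipation n \<alpha> w"
proof -
 let ?P = "{x. 0 < w x}"
 let ?w3 = "%x. sin x - \<alpha>\<^sup>2 * w1 x"
 have w3c: "continuous_on ?P ?w3" by (intro continuous_intros continuous_on_subset[OF cont1]) auto
 have d1: "weak_deriv ?P w w1"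
  by (rule weak_deriv_classical[OF positive_open]) (use deriv1 continuous_on_subset[OF cont1] in auto)
 have d2: "weak_deriv ?P w1 w2"
  by (rule weak_deriv_classical[OF positive_open]) (use deriv2 w2_cont_positive in auto)
 have d3: "weak_deriv ?P w2 ?w3"
  by (rule weak_deriv_classical[OF positive_open]) (use deriv3 w3c in auto)
 have H: "H_loc 3 ?P w"
  unfolding numeral_3_eq_3 H_loc.simps
  by (intro conjI exI[of _ w1] exI[of _ w2] exI[of _ ?w3] d1 d2 d3 L2_loc_continuous w_cont w2_cont_positive w3c
    continuous_on_subset[OF cont1 subset_UNIV])
 have Lw: "L1_loc ?P w" by (rule L1_loc_continuous[OF w_cont])
 have t: "AE x in lborel. x \<in> ?P --> w x = w x" by simp
 note e1 = wderiv_eq_AE[OF positive_open d1 Lw t]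
 note e2 = wderiv_eq_AE[OF positive_open d2 e1(2,1)]
 note e3 = wderiv_eq_AE[OF positive_open d3 e2(2,1)]
 have "dissipation n \<alpha> w = (\<integral>\<^sup>+x\<in>?P \<inter> {0..2*pi}. 0 \<partial>lborel)"
  unfolding dissipation_def Let_def
 proof (rule nn_integral_cong_AE)
  show "AE x in lborel. ennreal (w x powr n * ((wderiv ?P ^^ 3) w x + \<alpha>^2 * wderiv ?P w x - sin x)^2) * indicator (?P \<inter> {0..2*pi}) x
   = 0 * indicator (?P \<inter> {0..2*pi}) x"
   using e1(1) e3(1)
  proof eventually_elim
   case (elim x)
   show ?case
   proof (cases "x \<in> ?P")
    case True
    then have "wderiv ?P w x = w1 x" "(wderiv ?P ^^ 3) w x = sin x - \<alpha>\<^sup>2 * w1 x"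
     using elim by (auto simp: numeral_3_eq_3)
    then show ?thesis by simp
   qed simp
  qed
 qed
 then show ?thesis unfolding zero_dissipation_def using H by simp
qed

lemma zero_left_endpoint:
 assumes "a < b" "!!x. x \<in> {a<..<b} ==> w x = 0" "x \<in> {a..b}"
 shows "w x = 0"
proof -
 have "closed {x. w x = 0}" by (rule closed_Collect_eq) (auto intro: w_cont)
 then have "closure {a<..<b} \<subseteq> {x. w x = 0}" using assms(2) by (intro closure_minimal) auto
 then show ?thesis using assms by (auto simp: closure_greaterThanLessThan)
qed

text \<open>For n < 1 the factor \<open>w x powr (n - 1)\<close> is singular at a touchdown end. On
  a monotone piece the derivative of \<open>w x powr n\<close> has one sign, and a derivative of one
  sign is integrable when its primitive has finite limits at the ends.\<close>

lemma powr_slope_integrable: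
 assumes n: "0 < n" and ab: "a < b" and pos: "!!x. x \<in> {a<..<b} ==> 0 < w x"
  and ne: "!!x. x \<in> {a<..<b} ==> w1 x ~= 0"
 shows "L1_on {a<..<b} (%x. n * w x powr (n - 1) * w1 x)"
proof -
 obtain s where s: "s = 1 \<or> s = -1" "!!x. x \<in> {a<..<b} ==> 0 < s * w1 x"
  using sign_constant[of a b w1] ne continuous_on_subset[OF cont1 subset_UNIV] by blast
 let ?f = "%x. s * (n * w x powr (n - 1) * w1 x)"
 have Wc: "continuous_on UNIV (%x. s * w x powr n)"
  using n nonneg by (intro continuous_intros continuous_on_powr' w_cont) auto
 have "L1_on (einterval (ereal a) (ereal b)) ?f"
 proof (rule interval_integral_FTC_nonneg)
  show "ereal a < ereal b" using ab by simp
  fix x assume "ereal a < ereal x" "ereal x < ereal b"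
  then have x: "x \<in> {a<..<b}" by auto
  have "((%x. w x powr n) has_real_derivative n * w x powr (n - of_nat 1) * w1 x) (at x)"
   by (rule DERIV_fun_powr[OF deriv1 pos[OF x]])
  then show "((%x. s * w x powr n) has_real_derivative ?f x) (at x)"
   by (intro DERIV_cmult) simp
  have "isCont w x" using DERIV_isCont[OF deriv1] .
  then show "isCont ?f x" using pos[OF x] by (intro continuous_intros w1_isCont) auto
 next
  have "0 <= ?f x" if "x \<in> {a<..<b}" for x
  proof -
   have "0 <= (n * w x powr (n - 1)) * (s * w1 x)"
    by (rule mult_nonneg_nonneg[OF _ less_imp_le[OF s(2)[OF that]]]) (use n in simp)
   then show ?thesis by (simp add: mult_ac)
  qed
  then show "AE x in lborel. ereal a < ereal x --> ereal x < ereal b --> 0 <= ?f x" by auto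
 next
  have i: "((%x. s * w x powr n) \<longlongrightarrow> s * w y powr n) (at y within S)" for y S
   using Wc by (meson continuous_on_eq_continuous_at continuous_within isCont_def iso_tuple_UNIV_I open_UNIV tendsto_within_subset subset_UNIV)
  show "(((%x. s * w x powr n) \<circ> real_of_ereal) \<longlongrightarrow> s * w a powr n) (at_right (ereal a))"
   using i unfolding ereal_tendsto_simps by blast
  show "(((%x. s * w x powr n) \<circ> real_of_ereal) \<longlongrightarrow> s * w b powr n) (at_left (ereal b))"
   using i unfolding ereal_tendsto_simps by blast
 qed
 then have "L1_on {a<..<b} ?f" by (simp add: einterval_eq_Icc einterval_def greaterThanLessThan_def greaterThan_def lessThan_def Collect_conj_eq)
 then have "L1_on {a<..<b} (%x. s * ?f x)" by (rule set_integrable_mult_right)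
 moreover have "(%x. s * ?f x) = (%x. n * w x powr (n - 1) * w1 x)" using s(1) by auto
 ultimately show ?thesis by simp
qed

end

context film
begin

lemma pressure_deriv_zero:
 assumes "0 < w x" shows "((%x. w2 x + \<alpha>^2 * w x + cos x) has_real_derivative 0) (at x)"
 by (rule DERIV_cong, (rule derivative_intros deriv3 deriv1 assms)+) simp

lemma pressure_endpoint:
 assumes ab: "a < b" "y \<in> {a..b}" and pos: "0 < w y"
  and l: "!!x. x \<in> {a<..<b} ==> w2 x + \<alpha>^2 * w x + cos x = l"
 shows "w2 y + \<alpha>^2 * w y + cos y = l"
proof -
 let ?p = "%x. w2 x + \<alpha>^2 * w x + cos x"
 have "isCont ?p y" using pressure_deriv_zero[OF pos] DERIV_isCont by blast
 then have t: "(?p \<longlongrightarrow> ?p y) (at y within {a<..<b})"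
  unfolding isCont_def by (rule tendsto_within_subset[OF _ subset_UNIV])
 moreover have "(?p \<longlongrightarrow> l) (at y within {a<..<b})"
  by (rule tendsto_eventually) (simp add: eventually_at_filter l)
 moreover have "at y within {a<..<b} ~= bot"
 proof -
  consider "y = a" | "y = b" | "y \<in> {a<..<b}" using ab(2) by fastforce
  then have "y islimpt {a<..<b}"
  proof cases
   case 3
   then show ?thesis by (intro interior_limit_point) (simp add: interior_open)
  qed (use ab islimpt_greaterThanLessThan1 islimpt_greaterThanLessThan2 in auto)
  then show ?thesis by (simp add: trivial_limit_within)
 qed
 ultimately show ?thesis using tendsto_unique by blast
qed

context
 fixes n :: real and \<phi> :: "real => real"
 assumes n: "0 < n" and phi: "smooth_on UNIV \<phi>"
begin

definition flux :: "real => real" where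
 "flux x = w x powr n * deriv \<phi> x"

definition flux' :: "real => real" where
 "flux' x = (if 0 < w x then n * w x powr (n - 1) * w1 x * deriv \<phi> x + w x powr n * deriv (deriv \<phi>) x else 0)"

lemma phi': "(deriv \<phi> has_real_derivative deriv (deriv \<phi>) x) (at x)"
  "continuous_on S (deriv \<phi>)" "continuous_on S (deriv (deriv \<phi>))"
 using smooth_on_UNIV_DERIV(1)[OF smooth_on_UNIV_DERIV(2)[OF phi]]
  smooth_on_UNIV_continuous[OF smooth_on_UNIV_DERIV(2)[OF phi]]
  smooth_on_UNIV_continuous[OF smooth_on_UNIV_DERIV(2)[OF smooth_on_UNIV_DERIV(2)[OF phi]]]
  continuous_on_subset by blast+

lemma powr_cont: "continuous_on S (%x. w x powr n)"
 using n nonneg by (intro continuous_on_powr' w_cont continuous_intros) auto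

lemma flux_cont: "continuous_on S flux"
 unfolding flux_def by (intro continuous_intros powr_cont phi')

lemma flux_deriv:
 assumes "0 < w x" shows "(flux has_real_derivative flux' x) (at x)"
proof -
 have "((%x. w x powr n) has_real_derivative n * w x powr (n - of_nat 1) * w1 x) (at x)"
  by (rule DERIV_fun_powr[OF deriv1 assms])
 then have "((%x. w x powr n) has_real_derivative n * w x powr (n - 1) * w1 x) (at x)" by simp
 from DERIV_mult[OF this phi'(1)] show ?thesis
  using assms unfolding flux_def flux'_def by (simp add: mult_ac)
qed

lemma flux'_borel: "flux' \<in> borel_measurable borel"
proof -
 let ?P = "{x. 0 < w x}"
 have "continuous_on ?P (%x. n * w x powr (n - 1) * w1 x * deriv \<phi> x + w x powr n * deriv (deriv \<phi>) x)"
  by (intro continuous_intros w_cont phi' continuous_on_subset[OF cont1]) auto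
 then have "(%x. if x \<in> ?P then n * w x powr (n - 1) * w1 x * deriv \<phi> x + w x powr n * deriv (deriv \<phi>) x else 0) \<in> borel_measurable borel"
  by (rule borel_measurable_continuous_on_if[rotated]) (use positive_open in auto)
 then show ?thesis unfolding flux'_def[abs_def] by simp
qed

lemma set_integrable_interior:
 fixes f :: "real => real"
 assumes "L1_on {a<..<b} f" "f \<in> borel_measurable borel"
 shows "L1_on {a..b} f"
 unfolding set_integrable_def
proof (rule integrable_cong_AE_imp)
 show "integrable lborel (%x. indicat_real {a<..<b} x *\<^sub>R f x)" using assms(1) by (simp add: set_integrable_def)
 show "AE x in lborel. indicat_real {a<..<b} x *\<^sub>R f x = indicat_real {a..b} x *\<^sub>R f x"
  using AE_interior[of a b] by eventually_elim (auto simp: indicator_def)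
qed (use assms(2) in simp)

lemma flux_piece:
 assumes ab: "a < b" and l: "!!x. x \<in> {a<..<b} ==> w2 x + \<alpha>^2 * w x + cos x = l"
  and pos: "!!x. x \<in> {a<..<b} ==> 0 < w x"
  and i: "L1_on {a..b} flux'"
 shows "(LINT x:{a..b}|lborel. flux' x) = flux b - flux a"
  "L1_on {a..b} (%x. (w2 x + \<alpha>^2 * w x + cos x) * flux' x)"
  "(LINT x:{a..b}|lborel. (w2 x + \<alpha>^2 * w x + cos x) * flux' x)
   = (w2 b + \<alpha>^2 * w b + cos b) * flux b - (w2 a + \<alpha>^2 * w a + cos a) * flux a"
proof -
 let ?p = "%x. w2 x + \<alpha>^2 * w x + cos x"
 have "(flux' has_integral flux b - flux a) {a..b}"
  by (rule fundamental_theorem_of_calculus_interior)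
   (use ab flux_cont flux_deriv pos in "auto simp: has_real_derivative_iff_has_vector_derivative[symmetric]")
 then show I: "(LINT x:{a..b}|lborel. flux' x) = flux b - flux a"
  using set_borel_integral_eq_integral(2)[OF i] integral_unique by metis
 have m: "?p \<in> borel_measurable borel"
  using w2_borel borel_measurable_continuous_onI[OF w_cont] by measurable
 have ae: "AE x in lborel. x \<in> {a..b} --> ?p x * flux' x = l * flux' x"
  using AE_interior[of a b] by eventually_elim (use l in auto)
 have li: "L1_on {a..b} (%x. l * flux' x)" using i by (rule set_integrable_mult_right)
 show "L1_on {a..b} (%x. ?p x * flux' x)"
  using li set_integrable_cong_AE[of "%x. ?p x * flux' x" lborel "%x. l * flux' x" "{a..b}"] ae m flux'_borel by simp
 have "(LINT x:{a..b}|lborel. ?p x * flux' x) = (LINT x:{a..b}|lborel. l * flux' x)"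
  by (rule set_lebesgue_integral_cong_AE) (use ae m flux'_borel in auto)
 also have "... = l * flux b - l * flux a" using I by (simp add: right_diff_distrib)
 \<comment> \<open>At a dry end both sides vanish with the flux; at a positive end the pressure is
   continuous. Hence the constant of the piece can be traded at the ends for the pressure
   itself.\<close>
 also have "l * flux y = ?p y * flux y" if "y \<in> {a..b}" for y
 proof (cases "w y = 0")
  case True
  then show ?thesis by (simp add: flux_def)
 next
  case False
  then show ?thesis using pressure_endpoint[OF ab that _ l] nonneg[of y] by auto
 qed
 finally show "(LINT x:{a..b}|lborel. ?p x * flux' x) = ?p b * flux b - ?p a * flux a"
  using ab \<open>!!y. y \<in> {a..b} ==> l * flux y = ?p y * flux y\<close> by simp
qed

text \<open>The pressure constant may jump from one component to the next, but only across points
  where \<open>w\<close>, and with it the flux, is zero. The boundary terms pressure times flux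
  therefore telescope over simple pieces, and over a full period they cancel.\<close>

lemma flux_identities:
 assumes "a <= b"
 shows "L1_on {a..b} flux' & (LINT x:{a..b}|lborel. flux' x) = flux b - flux a &
  L1_on {a..b} (%x. (w2 x + \<alpha>^2 * w x + cos x) * flux' x) &
  (LINT x:{a..b}|lborel. (w2 x + \<alpha>^2 * w x + cos x) * flux' x)
   = (w2 b + \<alpha>^2 * w b + cos b) * flux b - (w2 a + \<alpha>^2 * w a + cos a) * flux a"
 using assms
proof (induction rule: film_induct)
 case (trans a b c)
 let ?p = "%x. (w2 x + \<alpha>^2 * w x + cos x) * flux' x"
 have "{a..c} = {a..b} \<union> {b..c}" using trans by auto
 then have u: "L1_on {a..c} flux'" "L1_on {a..c} ?p"
  using trans set_integrable_Un[of lborel "{a..b}" _ "{b..c}"] by auto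
 then show ?case
  using trans set_integral_split[OF trans(3,4) u(1)] set_integral_split[OF trans(3,4) u(2)] by simp
next
 case (piece a b)
 let ?p = "%x. w2 x + \<alpha>^2 * w x + cos x"
 have m: "?p \<in> borel_measurable borel"
  using w2_borel borel_measurable_continuous_onI[OF w_cont] by measurable
 have trivial: ?case if z: "!!x. x \<in> {a<..<b} ==> flux' x = 0" and e: "flux a = 0 & flux b = 0 \<or> a = b"
 proof -
  have ae: "AE x in lborel. x \<in> {a..b} --> flux' x = 0" "AE x in lborel. x \<in> {a..b} --> ?p x * flux' x = 0"
   using AE_interior[of a b] by (eventually_elim, use z in auto)+
  have z0: "L1_on {a..b} (%x. 0 :: real)" by (simp add: set_integrable_def)
  have "L1_on {a..b} flux'" "L1_on {a..b} (%x. ?p x * flux' x)"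
   using z0 set_integrable_cong_AE[of "%x. ?p x * flux' x" lborel "%_. 0" "{a..b}"] set_integrable_cong_AE[of flux' lborel "%_. 0" "{a..b}"]
    ae m flux'_borel by simp_all
  moreover have "(LINT x:{a..b}|lborel. flux' x) = (LINT x:{a..b}|lborel. 0)"
   "(LINT x:{a..b}|lborel. ?p x * flux' x) = (LINT x:{a..b}|lborel. 0)"
   by (rule set_lebesgue_integral_cong_AE; use ae m flux'_borel in auto)+
  ultimately show ?thesis using e by auto
 qed
 show ?case
 proof (cases "a < b")
  case False
  then show ?thesis using piece trivial by auto
 next
  case ab: True
  show ?thesis
  proof (cases "\<forall>x\<in>{a<..<b}. w x = 0")
   case True
   then have "w a = 0" "w b = 0" using zero_left_endpoint[OF ab] ab by auto
   then show ?thesis using True by (intro trivial) (auto simp: flux'_def flux_def)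
  next
   case False
   then have pos: "!!x. x \<in> {a<..<b} ==> 0 < w x" using piece by (auto simp: simple_piece_def)
   obtain l where l: "!!x. x \<in> {a<..<b} ==> 0 < w x ==> w2 x = l - \<alpha>\<^sup>2 * w x - cos x"
    using piece_pressure piece by blast
   have l': "!!x. x \<in> {a<..<b} ==> ?p x = l" using l pos by simp
   have i: "L1_on {a..b} flux'"
   proof (cases "\<forall>x\<in>{a..b}. 0 < w x")
    case True
    have "continuous_on {a..b} (%x. n * w x powr (n - 1) * w1 x * deriv \<phi> x + w x powr n * deriv (deriv \<phi>) x)"
     using True by (intro continuous_intros w_cont phi' continuous_on_subset[OF cont1]) auto
    then have "continuous_on {a..b} flux'"
     by (rule continuous_on_eq) (use True in "auto simp: flux'_def")
    then show ?thesis by (rule cont_set_integrable)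
   next
    case F: False
    then have ne: "!!x. x \<in> {a<..<b} ==> w1 x ~= 0" using piece False by (auto simp: simple_piece_def)
    have q: "L1_on {a<..<b} (%x. n * w x powr (n - 1) * w1 x)"
     by (rule powr_slope_integrable[OF n ab pos ne])
    have wm: "w \<in> borel_measurable borel" "w1 \<in> borel_measurable borel"
     using borel_measurable_continuous_onI[OF w_cont] borel_measurable_continuous_onI[OF cont1] by auto
    have q': "L1_on {a..b} (%x. n * w x powr (n - 1) * w1 x)"
     by (rule set_integrable_interior[OF q]) (use wm in measurable)
    have "L1_on {a..b} (%x. deriv \<phi> x * (n * w x powr (n - 1) * w1 x))"
     by (rule set_integrable_cont_mult[OF phi'(2) q'])
    moreover have "L1_on {a..b} (%x. w x powr n * deriv (deriv \<phi>) x)"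
     by (intro cont_set_integrable continuous_intros powr_cont phi')
    ultimately have s: "L1_on {a..b} (%x. deriv \<phi> x * (n * w x powr (n - 1) * w1 x) + w x powr n * deriv (deriv \<phi>) x)"
     by (rule set_integral_add(1))
    have "AE x in lborel. x \<in> {a..b} --> flux' x = deriv \<phi> x * (n * w x powr (n - 1) * w1 x) + w x powr n * deriv (deriv \<phi>) x"
     using AE_interior[of a b] by eventually_elim (use pos in "auto simp: flux'_def mult_ac")
    moreover have "(%x. deriv \<phi> x * (n * w x powr (n - 1) * w1 x) + w x powr n * deriv (deriv \<phi>) x) \<in> borel_measurable borel"
     using wm borel_measurable_continuous_onI[OF phi'(2)] borel_measurable_continuous_onI[OF phi'(3)] by measurable
    ultimately show ?thesis using s set_integrable_cong_AE[of flux' lborel _ "{a..b}"] flux'_borel by simp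
   qed
   show ?thesis using flux_piece[OF ab l' pos i] i by blast
  qed
 qed
qed

end

theorem film_steady_state:
 assumes n: "0 < n" and mass: "(\<oint>x. w x) = M"
 shows "steady_state n \<alpha> M w"
 unfolding steady_state_def
proof (intro conjI allI impI)
 have "L2_on {0..2*pi} w" using L2_loc_continuous[OF w_cont[of UNIV]] by (simp add: L2_loc_def)
 then show "w \<in> admissible M" using per mass nonneg by (simp add: admissible_def)
 show "H_circle 2 w" "continuous_on UNIV w" by (rule film_H_circle w_cont)+
 fix \<phi> assume "smooth_on UNIV \<phi> & periodic \<phi>"
 then have phi: "smooth_on UNIV \<phi>" and pphi: "periodic \<phi>" by auto
 note id = flux_identities[OF n phi]
 have prim: "primitive (flux n \<phi>) (flux' n \<phi>)"
  unfolding primitive_def using id by (simp add: flux_def[OF n phi])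
 let ?W2 = "(wderiv UNIV ^^ 2) w" and ?p = "%x. w2 x + \<alpha>^2 * w x + cos x"
 have Lw: "L1_loc UNIV w" by (rule L1_loc_continuous[OF w_cont])
 have t: "AE x in lborel. x \<in> UNIV --> w x = w x" by simp
 note e1 = wderiv_eq_AE[OF open_UNIV film_H_circle(2) Lw t]
 note e2 = wderiv_eq_AE[OF open_UNIV film_H_circle(3) e1(2,1)]
 have W2: "AE x in lborel. w2 x = ?W2 x" "?W2 \<in> borel_measurable borel"
  using e2(1) L1_loc_UNIV_borel[OF e2(2)] by (simp_all add: numeral_2_eq_2)
 have m: "?p \<in> borel_measurable borel" "w \<in> borel_measurable borel" "flux' n \<phi> \<in> borel_measurable borel"
  using w2_borel borel_measurable_continuous_onI[OF w_cont] flux'_borel[OF n phi] by measurable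
 have mW: "(%x. ?W2 x + \<alpha>^2 * w x + cos x) \<in> borel_measurable borel" using W2(2) m(2) by measurable
 let ?I = "{0..2*pi}"
 have ae: "AE x in lborel. x \<in> ?I --> (?W2 x + \<alpha>^2 * w x + cos x) * flux' n \<phi> x = ?p x * flux' n \<phi> x"
  using W2(1) by eventually_elim simp
 have dper: "deriv \<phi> (x + 2 * pi) = deriv \<phi> x" for x
 proof -
  have "((%x. \<phi> (x + 2 * pi)) has_real_derivative deriv \<phi> (x + 2 * pi)) (at x)"
   using smooth_on_UNIV_DERIV(1)[OF phi, of "x + 2 * pi"] by (simp add: DERIV_shift)
  moreover have "(%x. \<phi> (x + 2 * pi)) = \<phi>" using pphi by (auto simp: periodic_def)
  ultimately show ?thesis using DERIV_unique smooth_on_UNIV_DERIV(1)[OF phi] by metis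
 qed
 have pi0: "(0::real) <= 2 * pi" by simp
 have "?p (2 * pi) * flux n \<phi> (2 * pi) - ?p 0 * flux n \<phi> 0 = 0"
  using w_per[of 0] w2_per[of 0] dper[of 0] by (simp add: flux_def[OF n phi])
 then have I0: "L1_on ?I (%x. ?p x * flux' n \<phi> x)" "(\<oint>x. ?p x * flux' n \<phi> x) = 0"
  using id[OF pi0] by simp_all
 show "EX g. weak_deriv UNIV (%x. w x powr n * deriv \<phi> x) g &
   L1_on ?I (%x. (?W2 x + \<alpha>^2 * w x + cos x) * g x) &
   (\<oint>x. (?W2 x + \<alpha>^2 * w x + cos x) * g x) = 0"
 proof (intro exI conjI)
  show "weak_deriv UNIV (%x. w x powr n * deriv \<phi> x) (flux' n \<phi>)"
   using primitive_imp_weak_deriv[OF prim] by (simp add: flux_def[OF n phi, abs_def])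
  show "L1_on ?I (%x. (?W2 x + \<alpha>^2 * w x + cos x) * flux' n \<phi> x)"
   using I0(1) set_integrable_cong_AE[of "%x. (?W2 x + \<alpha>^2 * w x + cos x) * flux' n \<phi> x" lborel "%x. ?p x * flux' n \<phi> x" ?I] ae m mW by simp
  have "(\<oint>x. (?W2 x + \<alpha>^2 * w x + cos x) * flux' n \<phi> x) = (\<oint>x. ?p x * flux' n \<phi> x)"
   by (rule set_lebesgue_integral_cong_AE) (use ae m mW in auto)
  then show "(\<oint>x. (?W2 x + \<alpha>^2 * w x + cos x) * flux' n \<phi> x) = 0" using I0(2) by simp
 qed
qed

end

section \<open>The Sobolev space of order one on the circle\<close>

text \<open>An element of the Sobolev space in its absolutely continuous representative together
  with one version of its derivative. Carrying the derivative as an argument keeps the choice made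
  by \<open>wderiv\<close> out of the calculations.\<close>

definition circle_H1 :: "(real => real) => (real => real) => bool" where
 "circle_H1 f g \<longleftrightarrow> primitive f g & periodic f & (ALL a b. L1_on {a..b} (%x. (g x)^2))"

lemma circle_H1D:
 assumes "circle_H1 f g"
 shows "primitive f g" "periodic f" "L1_on {a..b} (%x. (g x)^2)" "L1_on {a..b} g"
  "continuous_on S f" "AE x in lborel. g (x + 2 * pi) = g x"
 using assms primitiveD(1) primitive_continuous periodic_deriv_AE unfolding circle_H1_def by blast+

lemma set_integrable_mult_L2:
 fixes f g :: "'a => real"
 assumes "set_borel_measurable M A f" "set_integrable M A (%x. (f x)^2)"
  "set_borel_measurable M A g" "set_integrable M A (%x. (g x)^2)"
 shows "set_integrable M A (%x. f x * g x)"
  "(LINT x:A|M. f x * g x)^2 <= (LINT x:A|M. (f x)^2) * (LINT x:A|M. (g x)^2)"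
  "(LINT x:A|M. \<bar>f x * g x\<bar>) <= sqrt (LINT x:A|M. (f x)^2) * sqrt (LINT x:A|M. (g x)^2)"
proof -
 let ?f = "%x. indicator A x * f x" and ?g = "%x. indicator A x * g x"
 have e: "(%x. (?f x)^2) = (%x. indicator A x *\<^sub>R (f x)\<^sup>2)" "(%x. (?g x)^2) = (%x. indicator A x *\<^sub>R (g x)\<^sup>2)"
  "(%x. ?f x * ?g x) = (%x. indicator A x *\<^sub>R (f x * g x))" "(%x. \<bar>?f x * ?g x\<bar>) = (%x. indicator A x *\<^sub>R \<bar>f x * g x\<bar>)"
  by (auto simp: indicator_def fun_eq_iff abs_mult)
 have m: "?f \<in> borel_measurable M" "?g \<in> borel_measurable M" using assms by (auto simp: set_borel_measurable_def)
 note cs = cauchy_schwarz_integral[OF m(1) _ m(2), unfolded e]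
 show "set_integrable M A (%x. f x * g x)"
  "(LINT x:A|M. f x * g x)^2 <= (LINT x:A|M. (f x)^2) * (LINT x:A|M. (g x)^2)"
  "(LINT x:A|M. \<bar>f x * g x\<bar>) <= sqrt (LINT x:A|M. (f x)^2) * sqrt (LINT x:A|M. (g x)^2)"
  using cs assms unfolding set_integrable_def set_lebesgue_integral_def by blast+
qed

lemma set_integrable_imp_measurable: "set_integrable M A f ==> set_borel_measurable M A f"
 by (auto simp: set_integrable_def set_borel_measurable_def)

lemma circle_H1_prod:
 assumes "circle_H1 f g" "circle_H1 f' g'"
 shows "L1_on {a..b} (%x. g x * g' x)"
 by (rule set_integrable_mult_L2(1)) (use circle_H1D[OF assms(1)] circle_H1D[OF assms(2)] set_integrable_imp_measurable in blast)+

lemma circle_H1_add_scaled: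
 assumes f: "circle_H1 f g" and f': "circle_H1 f' g'"
 shows "circle_H1 (%x. f x + c * f' x) (%x. g x + c * g' x)"
 unfolding circle_H1_def
proof (intro conjI allI)
 show "primitive (%x. f x + c * f' x) (%x. g x + c * g' x)"
  by (intro primitive_add primitive_cmult circle_H1D(1)[OF f] circle_H1D(1)[OF f'])
 show "periodic (%x. f x + c * f' x)" using circle_H1D(2)[OF f] circle_H1D(2)[OF f'] by (simp add: periodic_def)
 fix a b
 show "L1_on {a..b} (%x. (g x + c * g' x)^2)"
 proof (rule set_integral_square_expand(2))
  have "(%x. g x * (c * g' x)) = (%x. c * (g x * g' x))" by (auto simp: mult_ac)
  then show "L1_on {a..b} (%x. g x * (c * g' x))" using circle_H1_prod[OF f f'] by simp
  show "L1_on {a..b} (%x. (c * g' x)^2)" using circle_H1D(3)[OF f'] by (simp add: power_mult_distrib)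
 qed (rule circle_H1D(3)[OF f])
qed

lemma primitive_zero_constant:
 assumes "primitive f g" "AE x in lborel. g x = 0"
 shows "f x = f y"
proof -
 have *: "f b = f a" if "a <= b" for a b
 proof -
  have "(LINT x:{a..b}|lborel. g x) = 0" unfolding set_lebesgue_integral_def
   by (rule integral_eq_zero_AE) (use assms(2) in "auto elim: eventually_mono")
  then show ?thesis using primitiveD(2)[OF assms(1) that] by simp
 qed
 show ?thesis using *[of x y] *[of y x] by (cases "x <= y") auto
qed

text \<open>A primitive minus its translate by a period has density zero almost everywhere and is
  therefore constant, so the starting point of the window does not matter.\<close>

lemma periodic_window_any:
 fixes h :: "real => real"
 assumes h: "!!a b. L1_on {a..b} h" "AE x in lborel. h (x + 2 * pi) = h x"
 shows "(LINT x:{c..c + 2 * pi}|lborel. h x) = (\<oint>x. h x)"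
proof -
 obtain H where H: "primitive H h" using primitive_indefinite_integral[OF h(1)] by blast
 have p: "primitive (%x. H (x + 2 * pi) - H x) (%x. h (x + 2 * pi) - h x)"
  by (intro primitive_diff primitive_shift H)
 have "AE x in lborel. h (x + 2 * pi) - h x = 0" using h(2) by eventually_elim simp
 then have "H (c + 2 * pi) - H c = H (0 + 2 * pi) - H 0" by (rule primitive_zero_constant[OF p])
 then show ?thesis using primitiveD(2)[OF H, of c "c + 2 * pi"] primitiveD(2)[OF H, of 0 "2 * pi"] by simp
qed

text \<open>The density is repeated with the floor function, and its zero mean makes the primitive
  periodic. This produces variations on the circle from a prescribed derivative on one
  period.\<close>

lemma periodize:
 fixes k :: "real => real"
 assumes k: "k \<in> borel_measurable borel" "L1_on {c..c + 2 * pi} k"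
  "L1_on {c..c + 2 * pi} (%x. (k x)^2)" and k0: "(LINT x:{c..c + 2 * pi}|lborel. k x) = 0"
 obtains \<eta> \<eta>' where "circle_H1 \<eta> \<eta>'" "!!x. c <= x ==> x < c + 2 * pi ==> \<eta>' x = k x"
  "!!x. c <= x ==> x <= c + 2 * pi ==> \<eta> x = (LINT y:{c..x}|lborel. k y)"
proof -
 define \<eta>' where "\<eta>' = (%x. k (x - of_int \<lfloor>(x - c) / (2 * pi)\<rfloor> * (2 * pi)))"
 have per: "\<eta>' (x + 2 * pi) = \<eta>' x" for x
 proof -
  have "(x + 2 * pi - c) / (2 * pi) = (x - c) / (2 * pi) + 1" by (simp add: field_simps)
  then have "\<lfloor>(x + 2 * pi - c) / (2 * pi)\<rfloor> = \<lfloor>(x - c) / (2 * pi)\<rfloor> + 1" by simp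
  then show ?thesis unfolding \<eta>'_def by (simp add: algebra_simps)
 qed
 have eq: "\<eta>' x = k x" if "c <= x" "x < c + 2 * pi" for x
 proof -
  have "\<lfloor>(x - c) / (2 * pi)\<rfloor> = 0" using that by (intro floor_unique) (auto simp: field_simps)
  then show ?thesis by (simp add: \<eta>'_def)
 qed
 have m: "\<eta>' \<in> borel_measurable borel" unfolding \<eta>'_def using k(1) by measurable
 have ae: "AE x in lborel. x \<in> {c..c + 2 * pi} --> \<eta>' x = k x"
  using AE_lborel_singleton[of "c + 2 * pi"] by eventually_elim (use eq in auto)
 have int: "L1_on {a..b} (%x. F (\<eta>' x))"
  if F: "F \<in> borel_measurable borel" "L1_on {c..c + 2 * pi} (%x. F (k x))" for F :: "real => real" and a b
 proof -
  let ?h = "%x. F (\<eta>' x)"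
  have Fm: "?h \<in> borel_measurable borel" "(%x. F (k x)) \<in> borel_measurable borel" using F(1) m k(1) by measurable
  have "AE x in lborel. x \<in> {c..c + 2 * pi} --> F (\<eta>' x) = F (k x)" using ae by eventually_elim simp
  then have base: "L1_on {c..c + 2 * pi} ?h"
   using F(2) set_integrable_cong_AE[of ?h lborel "%x. F (k x)" "{c..c + 2 * pi}"] Fm by simp
  have hper: "?h (x + of_int n * (2 * pi)) = ?h x" for x n using periodic_int[of ?h x n] per by (simp add: periodic_def)
  have shift: "L1_on {c + of_int n * (2 * pi)..c + 2 * pi + of_int n * (2 * pi)} ?h" for n :: int
  proof -
   have "L1_on {(c + of_int n * (2 * pi)) + of_int (-n) * (2 * pi)..(c + 2 * pi + of_int n * (2 * pi)) + of_int (-n) * (2 * pi)} ?h"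
    using base by simp
   from set_integral_shift(2)[OF this] show ?thesis by (simp only: hper)
  qed
  have big: "L1_on {c - of_nat N * (2 * pi)..c + of_nat N * (2 * pi)} ?h" for N
  proof (induction N)
   case 0
   have "L1_on {c..c} ?h" by (rule set_integrable_subset[OF base]) auto
   then show ?case by simp
  next
   case (Suc N)
   let ?A = "{c + of_int (- int (Suc N)) * (2 * pi)..c + 2 * pi + of_int (- int (Suc N)) * (2 * pi)}"
    and ?B = "{c - of_nat N * (2 * pi)..c + of_nat N * (2 * pi)}"
    and ?C = "{c + of_int (int N) * (2 * pi)..c + 2 * pi + of_int (int N) * (2 * pi)}"
   have "{c - of_nat (Suc N) * (2 * pi)..c + of_nat (Suc N) * (2 * pi)} \<subseteq> (?A \<union> ?B) \<union> ?C"
    by (auto simp: algebra_simps)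
   moreover have "L1_on ((?A \<union> ?B) \<union> ?C) ?h"
    by (intro set_integrable_Un shift Suc) auto
   ultimately show ?case by (rule set_integrable_subset[rotated 2]) auto
  qed
  obtain N where "\<bar>a - c\<bar> + \<bar>b - c\<bar> < of_nat N * (2 * pi)"
   using reals_Archimedean3[of "2 * pi"] pi_gt_zero by (metis mult_pos_pos zero_less_numeral)
  then have "{a..b} \<subseteq> {c - of_nat N * (2 * pi)..c + of_nat N * (2 * pi)}" by auto
  then show ?thesis by (rule set_integrable_subset[OF big, rotated]) auto
 qed
 have i1: "L1_on {a..b} \<eta>'" for a b using int[of "%x. x"] k(2) by simp
 have i2: "L1_on {a..b} (%x. (\<eta>' x)^2)" for a b using int[of "%x. x^2"] k(3) by simp
 obtain H where H: "primitive H \<eta>'" using primitive_indefinite_integral[OF i1] by blast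
 define \<eta> where "\<eta> = (%x. H x - H c)"
 have p: "primitive \<eta> \<eta>'" unfolding \<eta>_def using primitive_diff[OF H primitive_const] by simp
 have val: "\<eta> x = (LINT y:{c..x}|lborel. k y)" if "c <= x" "x <= c + 2 * pi" for x
 proof -
  have "(LINT y:{c..x}|lborel. k y) = (LINT y:{c..x}|lborel. \<eta>' y)"
   by (rule set_lebesgue_integral_cong_AE) (use ae m k(1) that in "auto elim!: eventually_mono")
  then show ?thesis using primitiveD(2)[OF p that(1)] by (simp add: \<eta>_def)
 qed
 have "primitive (%x. \<eta> (x + 2 * pi) - \<eta> x) (%x. \<eta>' (x + 2 * pi) - \<eta>' x)"
  by (intro primitive_diff primitive_shift p)
 then have "\<eta> (x + 2 * pi) - \<eta> x = \<eta> (c + 2 * pi) - \<eta> c" for x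
  by (rule primitive_zero_constant) (simp add: per)
 moreover have "\<eta> (c + 2 * pi) = 0" "\<eta> c = 0" using val[of "c + 2 * pi"] k0 by (auto simp: \<eta>_def)
 ultimately have "periodic \<eta>" by (simp add: periodic_def)
 then show ?thesis using that[of \<eta> \<eta>'] p i2 eq val by (auto simp: circle_H1_def)
qed

lemma periodic_bounded:
 assumes "continuous_on UNIV f" "periodic f"
 obtains B where "!!x. \<bar>f x :: real\<bar> <= B" "0 < B"
proof -
 have "compact (f ` {0..2*pi})" by (rule compact_continuous_image[OF continuous_on_subset[OF assms(1)]]) auto
 then obtain B where B: "!!x. x \<in> {0..2*pi} ==> \<bar>f x\<bar> <= B"
  by (metis (no_types, lifting) bounded_iff compact_imp_bounded image_eqI real_norm_def)
 have "\<bar>f x\<bar> <= \<bar>B\<bar> + 1" for x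
 proof -
  obtain n :: int where "0 <= x + of_int n * (2 * pi)" "x + of_int n * (2 * pi) < 0 + 2 * pi" by (rule fold_period)
  then have "\<bar>f (x + of_int n * (2 * pi))\<bar> <= B" by (intro B) auto
  then show ?thesis using periodic_int[OF assms(2)] by auto
 qed
 then show ?thesis using that[of "\<bar>B\<bar> + 1"] by auto
qed

section \<open>First variation and regularity of minimizers\<close>

definition first_variation :: "real => (real => real) => (real => real) => (real => real) => (real => real) => real" where
 "first_variation \<alpha> v g \<eta> \<eta>' = (\<oint>x. g x * \<eta>' x) - \<alpha>\<^sup>2 * (\<oint>x. v x * \<eta> x)
  - (\<oint>x. \<eta> x * cos x)"

lemma first_variation_add_scaled:
 assumes v: "circle_H1 v g" and \<eta>: "circle_H1 \<eta> \<eta>'" and \<theta>: "circle_H1 \<theta> \<theta>'"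
 shows "first_variation \<alpha> v g (%x. \<eta> x + c * \<theta> x) (%x. \<eta>' x + c * \<theta>' x) =
  first_variation \<alpha> v g \<eta> \<eta>' + c * first_variation \<alpha> v g \<theta> \<theta>'"
proof -
 let ?I = "{0..2*pi}"
 have lin: "(\<oint>x. p x + c * q x) = (\<oint>x. p x) + c * (\<oint>x. q x)"
  if "L1_on ?I p" "L1_on ?I q" for p q :: "real => real"
  using that by (simp add: set_integral_add)
 have ci: "L1_on ?I (%x. v x * \<eta> x)" "L1_on ?I (%x. v x * \<theta> x)"
  "L1_on ?I (%x. \<eta> x * cos x)" "L1_on ?I (%x. \<theta> x * cos x)"
  by (intro cont_set_integrable continuous_intros circle_H1D(5)[OF v] circle_H1D(5)[OF \<eta>] circle_H1D(5)[OF \<theta>])+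
 have "(%x. g x * (\<eta>' x + c * \<theta>' x)) = (%x. g x * \<eta>' x + c * (g x * \<theta>' x))"
  "(%x. v x * (\<eta> x + c * \<theta> x)) = (%x. v x * \<eta> x + c * (v x * \<theta> x))"
  "(%x. (\<eta> x + c * \<theta> x) * cos x) = (%x. \<eta> x * cos x + c * (\<theta> x * cos x))"
  by (auto simp: algebra_simps)
 then show ?thesis unfolding first_variation_def
  by (simp only: lin[OF circle_H1_prod[OF v \<eta>] circle_H1_prod[OF v \<theta>]] lin[OF ci(1,2)] lin[OF ci(3,4)]) (simp add: algebra_simps)
qed

lemma energy_expansion:
 assumes v: "circle_H1 v g" and \<eta>: "circle_H1 \<eta> \<eta>'"
 shows "circle_energy \<alpha> (%x. v x + c * \<eta> x) (%x. g x + c * \<eta>' x) = circle_energy \<alpha> v g + c * first_variation \<alpha> v g \<eta> \<eta>'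
  + c^2 * ((1/2) * ((\<oint>x. (\<eta>' x)^2) - \<alpha>\<^sup>2 * (\<oint>x. (\<eta> x)^2)))"
proof -
 let ?I = "{0..2*pi}"
 have c1: "(%x. p x * (c * q x)) = (%x. c * (p x * q x))" for p q :: "real => real" by (auto simp: mult_ac)
 have c2: "(%x. (c * q x)^2) = (%x. c^2 * (q x)^2)" for q :: "real => real" by (auto simp: power_mult_distrib)
 have i: "L1_on ?I (%x. (v x)^2)" "L1_on ?I (%x. v x * \<eta> x)" "L1_on ?I (%x. (\<eta> x)^2)"
  "L1_on ?I (%x. v x * cos x)" "L1_on ?I (%x. \<eta> x * cos x)"
  by (intro cont_set_integrable continuous_intros circle_H1D(5)[OF v] circle_H1D(5)[OF \<eta>])+
 have e1: "(\<oint>x. (g x + c * \<eta>' x)^2) = (\<oint>x. (g x)^2) + 2 * (c * (\<oint>x. g x * \<eta>' x)) + c^2 * (\<oint>x. (\<eta>' x)^2)"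
  by (subst set_integral_square_expand(1)) (simp_all add: c1 c2 circle_H1D(3)[OF v] circle_H1D(3)[OF \<eta>] circle_H1_prod[OF v \<eta>])
 have e2: "(\<oint>x. (v x + c * \<eta> x)^2) = (\<oint>x. (v x)^2) + 2 * (c * (\<oint>x. v x * \<eta> x)) + c^2 * (\<oint>x. (\<eta> x)^2)"
  by (subst set_integral_square_expand(1)) (simp_all add: c1 c2 i)
 have "(%x. (v x + c * \<eta> x) * cos x) = (%x. v x * cos x + c * (\<eta> x * cos x))" by (auto simp: algebra_simps)
 then have e3: "(\<oint>x. (v x + c * \<eta> x) * cos x) = (\<oint>x. v x * cos x) + c * (\<oint>x. \<eta> x * cos x)"
  using i by (simp add: set_integral_add)
 show ?thesis unfolding circle_energy_def first_variation_def e1 e2 e3 by (simp add: field_simps power2_eq_square)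
qed

lemma quadratic_nonneg_slope:
 fixes L S :: real
 assumes "0 < e1" "!!e. 0 < e ==> e < e1 ==> 0 <= e * L + e^2 * S"
 shows "0 <= L"
proof (rule ccontr)
 assume "~ 0 <= L"
 \<comment> \<open>Small enough that \<open>e * \<bar>S\<bar>\<close> stays below half of
   \<open>- L\<close>, so the linear term decides the sign.\<close>
 define e where "e = min (e1 / 2) (- L / (2 * (\<bar>S\<bar> + 1)))"
 have e: "0 < e" "e < e1" "e <= - L / (2 * (\<bar>S\<bar> + 1))"
 proof -
  have p: "0 < - L / (2 * (\<bar>S\<bar> + 1))" using \<open>~ 0 <= L\<close> by (intro divide_pos_pos) auto
  then show "0 < e" using assms(1) by (simp add: e_def)
  have "e <= e1 / 2" unfolding e_def by (rule min.cobounded1)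
  then show "e < e1" using assms(1) by simp
  show "e <= - L / (2 * (\<bar>S\<bar> + 1))" unfolding e_def by (rule min.cobounded2)
 qed
 have "e * (2 * (\<bar>S\<bar> + 1)) <= - L" using e(3) by (subst (asm) pos_le_divide_eq) auto
 moreover have "e * S <= e * (\<bar>S\<bar> + 1)" using e by (intro mult_left_mono) auto
 moreover have "0 < e * (\<bar>S\<bar> + 1)" using e by simp
 ultimately have "L + e * S < 0" by (simp add: algebra_simps)
 then have "e * (L + e * S) < 0" using e by (simp add: mult_pos_neg)
 then show False using assms(2)[OF e(1,2)] by (simp add: algebra_simps power2_eq_square)
qed

text \<open>A hat of height \<open>d\<close>, placed in one period thanks to d \<le> pi. Paired with
  its derivative, a density with primitive \<open>v\<close> integrates to the negative second
  difference 2 * v(x0) - v(x0 - d) - v(x0 + d).\<close>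

lemma tent:
 fixes x0 d :: real
 assumes d: "0 < d" "d <= pi"
 obtains \<eta> \<eta>' where "circle_H1 \<eta> \<eta>'"
  "!!x. x0 - d <= x ==> x <= x0 - d + 2 * pi ==> \<eta> x = max 0 (d - \<bar>x - x0\<bar>)"
  "!!x. x0 - d <= x ==> x < x0 - d + 2 * pi ==> \<eta>' x = (if x < x0 then 1 else if x < x0 + d then -1 else 0)"
proof -
 let ?k = "%x. if x < x0 then 1 else if x < x0 + d then -1 else (0::real)" and ?T = "%x. max 0 (d - \<bar>x - x0\<bar>)"
 let ?c = "x0 - d"
 have km: "?k \<in> borel_measurable borel" by measurable
 have ki: "L1_on {a..b} ?k" "L1_on {a..b} (%x. (?k x)^2)" for a b
 proof -
  have one: "L1_on {a..b} (%_. 1 :: real)" by (intro cont_set_integrable continuous_intros)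
  show "L1_on {a..b} ?k"
   by (rule set_integrable_bound[OF one]) (use km in "auto simp: set_borel_measurable_def")
  have "(%x. (?k x)^2) \<in> borel_measurable borel" using km by measurable
  then show "L1_on {a..b} (%x. (?k x)^2)"
   by (intro set_integrable_bound[OF one]) (auto simp: set_borel_measurable_def)
 qed
 have val: "(LINT y:{?c..x}|lborel. ?k y) = ?T x" if x: "?c <= x" "x <= ?c + 2 * pi" for x
 proof -
  have hi: "(?k has_integral ?T x - ?T ?c) {?c..x}"
  proof (rule fundamental_theorem_of_calculus_interior_strong[of "{x0, x0 + d}"])
   show "continuous_on {?c..x} ?T" by (intro continuous_intros)
   fix y assume y: "y \<in> {?c<..<x} - {x0, x0 + d}"
   consider "y < x0" | "x0 < y" "y < x0 + d" | "x0 + d < y" using y by fastforce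
   then have "(?T has_real_derivative ?k y) (at y)"
   proof cases
    case 1
    have "((%x. d + x - x0) has_real_derivative 1) (at y)" by (auto intro!: derivative_eq_intros)
    then have "(?T has_real_derivative 1) (at y)"
     by (rule has_field_derivative_transform_within_open[where S="{?c<..<x0}"]) (use 1 y in auto)
    then show ?thesis using 1 by simp
   next
    case 2
    have "((%x. d - x + x0) has_real_derivative -1) (at y)" by (auto intro!: derivative_eq_intros)
    then have "(?T has_real_derivative -1) (at y)"
     by (rule has_field_derivative_transform_within_open[where S="{x0<..<x0+d}"]) (use 2 in auto)
    then show ?thesis using 2 by simp
   next
    case 3
    have "((%x. 0) has_real_derivative 0) (at y)" by simp
    then have "(?T has_real_derivative 0) (at y)"
     by (rule has_field_derivative_transform_within_open[where S="{x0+d<..}"]) (use 3 d in auto)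
    then show ?thesis using 3 d by simp
   qed
   then show "(?T has_vector_derivative ?k y) (at y)" by (simp add: has_real_derivative_iff_has_vector_derivative)
  qed (use x in auto)
  have "(LINT y:{?c..x}|lborel. ?k y) = integral {?c..x} ?k"
   by (rule set_borel_integral_eq_integral(2)[OF ki(1)])
  also have "... = ?T x - ?T ?c" by (rule integral_unique[OF hi])
  also have "?T ?c = 0" using d by simp
  finally show ?thesis by simp
 qed
 have "?T (?c + 2 * pi) = 0" using d by simp
 then have k0: "(LINT y:{?c..?c + 2 * pi}|lborel. ?k y) = 0" using val[of "?c + 2 * pi"] by simp
 obtain \<eta> \<eta>' where e: "circle_H1 \<eta> \<eta>'" "!!x. ?c <= x ==> x < ?c + 2 * pi ==> \<eta>' x = ?k x"
  "!!x. ?c <= x ==> x <= ?c + 2 * pi ==> \<eta> x = (LINT y:{?c..x}|lborel. ?k y)"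
  by (rule periodize[OF km ki k0]) (rule that; assumption)
 show ?thesis by (rule that[OF e(1)]) (use e val in auto)
qed

lemma window_ball:
 assumes "periodic f" "periodic h" "!!x. c <= x ==> x < c + 2 * pi ==> P (f x) (h x)"
 shows "P (f x) (h x)"
proof -
 obtain n :: int where "c <= x + of_int n * (2 * pi)" "x + of_int n * (2 * pi) < c + 2 * pi" by (rule fold_period)
 then have "P (f (x + of_int n * (2 * pi))) (h (x + of_int n * (2 * pi)))" by (rule assms(3))
 then show ?thesis using periodic_int[OF assms(1)] periodic_int[OF assms(2)] by simp
qed

locale energy_minimizer =
 fixes \<alpha> M :: real and v g :: "real => real"
 assumes alpha: "0 < \<alpha>" and M: "0 < M" and H: "circle_H1 v g" and v_nonneg: "0 <= v x"
  and mass: "(\<oint>x. v x) = M"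
  and minimal: "circle_H1 y h ==> (!!x. 0 <= y x) ==> (\<oint>x. y x) = M ==>
   circle_energy \<alpha> v g <= circle_energy \<alpha> y h"
begin

abbreviation mean :: "(real => real) => real" where "mean f \<equiv> \<oint>x. f x"

lemma v_cont: "continuous_on S v" by (rule circle_H1D(5)[OF H])

lemma mean_add_scaled:
 assumes "circle_H1 \<eta> \<eta>'" "circle_H1 \<theta> \<theta>'"
 shows "mean (%x. \<eta> x + c * \<theta> x) = mean \<eta> + c * mean \<theta>"
 using cont_set_integrable[OF circle_H1D(5)[OF assms(1)]] cont_set_integrable[OF circle_H1D(5)[OF assms(2)]]
 by (simp add: set_integral_add)

lemma variation_nonneg:
 assumes e: "circle_H1 \<xi> \<xi>'" "mean \<xi> = 0" "0 < e1" "!!e x. 0 < e ==> e < e1 ==> 0 <= v x + e * \<xi> x"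
 shows "0 <= first_variation \<alpha> v g \<xi> \<xi>'"
proof (rule quadratic_nonneg_slope[OF e(3)])
 fix t assume t: "0 < t" "t < e1"
 have "circle_energy \<alpha> v g <= circle_energy \<alpha> (%x. v x + t * \<xi> x) (%x. g x + t * \<xi>' x)"
  by (rule minimal[OF circle_H1_add_scaled[OF H e(1)]]) (use e t mean_add_scaled[OF H e(1)] mass in auto)
 then show "0 <= t * first_variation \<alpha> v g \<xi> \<xi>' + t^2 * ((1/2) * (mean (%x. (\<xi>' x)^2) - \<alpha>\<^sup>2 * mean (%x. (\<xi> x)^2)))"
  unfolding energy_expansion[OF H e(1)] by simp
qed

text \<open>A direction along which mass can be added freely and removed up to the amount
  \<open>c\<close> without making \<open>v\<close> negative. It repairs the mass of an arbitrary
  variation.\<close>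

lemma positive_bump:
 obtains \<theta> \<theta>' c where "circle_H1 \<theta> \<theta>'" "0 < mean \<theta>" "0 < c" "!!x. 0 <= \<theta> x" "!!x. c * \<theta> x <= v x"
proof -
 have "EX x. 0 < v x"
 proof (rule ccontr)
  assume "\<nexists>x. 0 < v x"
  then have "v = (%x. 0)" using v_nonneg by (intro ext) (metis less_le)
  then show False using mass M by simp
 qed
 then obtain z where z: "0 < v z" by blast
 have "(v \<longlongrightarrow> v z) (nhds z)"
  using v_cont[of UNIV] by (simp add: continuous_on_eq_continuous_at isCont_def tendsto_nhds_iff)
 then have "eventually (%x. v z / 2 < v x) (nhds z)" by (rule order_tendstoD) (use z in auto)
 then obtain e where e: "e > 0" "!!x. dist x z < e ==> v z / 2 < v x" by (auto simp: eventually_nhds_metric)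
 define d where "d = min e pi"
 have d: "0 < d" "d <= pi" "d <= e" using e by (auto simp: d_def)
 obtain \<theta> \<theta>' where t: "circle_H1 \<theta> \<theta>'" "!!x. z - d <= x ==> x <= z - d + 2 * pi ==> \<theta> x = max 0 (d - \<bar>x - z\<bar>)"
  by (rule tent[OF d(1,2), of z]) (rule that; assumption)
 define c where "c = v z / (2 * d)"
 have c: "0 < c" "c * d = v z / 2" using z d by (auto simp: c_def)
 have "0 <= \<theta> x & c * \<theta> x <= v x" for x
 proof (rule window_ball[OF circle_H1D(2)[OF t(1)] circle_H1D(2)[OF H], of "z - d" "%p q. 0 <= p & c * p <= q"])
  fix x assume x: "z - d <= x" "x < z - d + 2 * pi"
  then have tx: "\<theta> x = max 0 (d - \<bar>x - z\<bar>)" using t(2) by simp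
  show "0 <= \<theta> x & c * \<theta> x <= v x"
  proof (cases "\<bar>x - z\<bar> < d")
   case True
   have "c * \<theta> x <= c * d" using tx True c by (intro mult_left_mono) auto
   then show ?thesis using e(2)[of x] True d c tx by (auto simp: dist_real_def)
  next
   case False
   then show ?thesis using tx v_nonneg[of x] by simp
  qed
 qed
 then have th: "!!x. 0 <= \<theta> x" "!!x. c * \<theta> x <= v x" by auto
 have "0 < mean \<theta>"
 proof (rule ccontr)
  assume "~ 0 < mean \<theta>"
  then have "\<theta> x = 0" if "x \<in> {0..0 + 2*pi}" for x
   by (intro continuous_zero_if_integral_zero[of 0 "2*pi" \<theta> x]) (use th that circle_H1D(5)[OF t(1)] in auto)
  then have "\<theta> z = 0" by (rule periodic_zero[OF circle_H1D(2)[OF t(1)]])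
  then show False using t(2)[of z] d by simp
 qed
 then show ?thesis using that t(1) c(1) th by blast
qed

text \<open>A variation that keeps \<open>v\<close> nonnegative is corrected by a multiple of the
  bump until its mean is zero. The price per unit of mass, minus the first variation along the bump
  divided by its mean, is the Lagrange multiplier \<open>l\<close>.\<close>

lemma euler_inequality:
 obtains l where "!!\<eta> \<eta>' e1. circle_H1 \<eta> \<eta>' ==> 0 < e1 ==> (!!e x. 0 < e ==> e < e1 ==> 0 <= v x + e * \<eta> x) ==>
  0 <= first_variation \<alpha> v g \<eta> \<eta>' + l * mean \<eta>"
proof -
 obtain \<theta> \<theta>' c where t: "circle_H1 \<theta> \<theta>'" "0 < mean \<theta>" "0 < c" "!!x. 0 <= \<theta> x" "!!x. c * \<theta> x <= v x"
  by (rule positive_bump) (rule that; assumption)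
 show ?thesis
 proof (rule that[of "- first_variation \<alpha> v g \<theta> \<theta>' / mean \<theta>"])
  fix \<eta> \<eta>' e1 assume h: "circle_H1 \<eta> \<eta>'" "0 < (e1::real)" "!!e x. 0 < e ==> e < e1 ==> 0 <= v x + e * \<eta> x"
  define r where "r = - mean \<eta> / mean \<theta>"
  define e2 where "e2 = min (e1 / 2) (c / (2 * (\<bar>r\<bar> + 1)))"
  have e2: "0 < e2" "e2 <= e1 / 2" "e2 <= c / (2 * (\<bar>r\<bar> + 1))"
  proof -
   show "0 < e2" using h(2) t(3) by (simp add: e2_def)
   show "e2 <= e1 / 2" unfolding e2_def by (rule min.cobounded1)
   show "e2 <= c / (2 * (\<bar>r\<bar> + 1))" unfolding e2_def by (rule min.cobounded2)
  qed
  have "0 <= first_variation \<alpha> v g (%x. \<eta> x + r * \<theta> x) (%x. \<eta>' x + r * \<theta>' x)"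
  proof (rule variation_nonneg[OF circle_H1_add_scaled[OF h(1) t(1)] _ e2(1)])
   show "mean (%x. \<eta> x + r * \<theta> x) = 0" unfolding mean_add_scaled[OF h(1) t(1)] r_def using t(2) by simp
   fix e x assume e: "0 < e" "e < e2"
   \<comment> \<open>The varied function is the average of v + 2 e \<eta> and v + 2 e r \<theta>, so
     each of the two variations is tested at twice the step.\<close>
   have 1: "0 <= v x + (2 * e) * \<eta> x" using e e2 by (intro h(3)) auto
   have "e2 * (2 * (\<bar>r\<bar> + 1)) <= c" using e2(3) by (subst (asm) pos_le_divide_eq) auto
   moreover have "e * (2 * (\<bar>r\<bar> + 1)) <= e2 * (2 * (\<bar>r\<bar> + 1))" using e by (intro mult_right_mono) auto
   ultimately have "e * (2 * (\<bar>r\<bar> + 1)) <= c" by linarith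
   moreover have "2 * e * \<bar>r\<bar> <= e * (2 * (\<bar>r\<bar> + 1))" using e by (simp add: algebra_simps)
   ultimately have "2 * e * \<bar>r\<bar> * \<theta> x <= c * \<theta> x" using t(4) by (intro mult_right_mono) auto
   also have "... <= v x" by (rule t(5))
   finally have 2: "2 * e * \<bar>r\<bar> * \<theta> x <= v x" .
   have "- (2 * e * \<bar>r\<bar> * \<theta> x) <= 2 * e * r * \<theta> x"
   proof -
    have "- (\<bar>r\<bar>) * (2 * e * \<theta> x) <= r * (2 * e * \<theta> x)" using t(4)[of x] e by (intro mult_right_mono) auto
    then show ?thesis by (simp add: mult_ac)
   qed
   then have "0 <= v x + 2 * e * r * \<theta> x" using 2 by linarith
   then show "0 <= v x + e * (\<eta> x + r * \<theta> x)" using 1 by (simp add: algebra_simps)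
  qed
  then show "0 <= first_variation \<alpha> v g \<eta> \<eta>' + - first_variation \<alpha> v g \<theta> \<theta>' / mean \<theta> * mean \<eta>"
   unfolding first_variation_add_scaled[OF H h(1) t(1)] r_def by (simp add: mult_ac)
 qed
qed

lemma window_integral:
 assumes "circle_H1 \<eta> \<eta>'"
 shows "mean (%x. g x * \<eta>' x) = (LINT x:{c..c + 2*pi}|lborel. g x * \<eta>' x)"
  "continuous_on UNIV h ==> periodic h ==> mean (%x. h x * \<eta> x) = (LINT x:{c..c + 2*pi}|lborel. h x * \<eta> x)"
proof -
 have "AE x in lborel. g (x + 2 * pi) * \<eta>' (x + 2 * pi) = g x * \<eta>' x"
  using circle_H1D(6)[OF H] circle_H1D(6)[OF assms] by eventually_elim simp
 then show "mean (%x. g x * \<eta>' x) = (LINT x:{c..c + 2*pi}|lborel. g x * \<eta>' x)"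
  by (intro periodic_window_any[symmetric] circle_H1_prod[OF H assms])
 show "mean (%x. h x * \<eta> x) = (LINT x:{c..c + 2*pi}|lborel. h x * \<eta> x)" if h: "continuous_on UNIV h" "periodic h"
  by (intro periodic_window_any[symmetric] cont_set_integrable continuous_intros circle_H1D(5)[OF assms] continuous_on_subset[OF h(1)])
   (use h(2) circle_H1D(2)[OF assms] in "auto simp: periodic_def")
qed

text \<open>A tent centred at a zero of \<open>v\<close> only adds mass and is thus admissible. Its
  first variation contains the negative second difference of \<open>v\<close>; the term with
  \<alpha> has the favourable sign, and everything else is of the order of the area of the tent,
  that is d^2. So a minimizer leaves its zeros at most quadratically.\<close>

lemma quadratic_bound_at_zero:
 assumes l: "!!\<eta> \<eta>' e1. circle_H1 \<eta> \<eta>' ==> 0 < e1 ==> (!!e x. 0 < e ==> e < e1 ==> 0 <= v x + e * \<eta> x) ==>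
  0 <= first_variation \<alpha> v g \<eta> \<eta>' + l * mean \<eta>"
  and z: "v x0 = 0" and d: "0 < d" "d <= pi"
 shows "v (x0 - d) + v (x0 + d) <= 2 * (\<bar>l\<bar> + 1) * d^2"
proof -
 obtain \<eta> \<eta>' where t: "circle_H1 \<eta> \<eta>'" "!!x. x0 - d <= x ==> x <= x0 - d + 2 * pi ==> \<eta> x = max 0 (d - \<bar>x - x0\<bar>)"
  "!!x. x0 - d <= x ==> x < x0 - d + 2 * pi ==> \<eta>' x = (if x < x0 then 1 else if x < x0 + d then -1 else 0)"
  by (rule tent[OF d, of x0]) (rule that; assumption)
 let ?c = "x0 - d"
 have nn: "0 <= \<eta> x" for x
  by (rule window_ball[OF circle_H1D(2)[OF t(1)] circle_H1D(2)[OF t(1)], of ?c "%p q. 0 <= p"]) (use t(2) in auto)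
 have A: "0 <= first_variation \<alpha> v g \<eta> \<eta>' + l * mean \<eta>"
  by (rule l[OF t(1), of 1]) (use nn v_nonneg in auto)
 have pg: "primitive v g" by (rule circle_H1D(1)[OF H])
 have gi: "L1_on {a..b} (%x. g x * \<eta>' x)" for a b by (rule circle_H1_prod[OF H t(1)])
 have ec: "continuous_on S \<eta>" for S by (rule circle_H1D(5)[OF t(1)])
 have e1: "mean (%x. g x * \<eta>' x) = - v (x0 - d) - v (x0 + d)"
 proof -
  have "mean (%x. g x * \<eta>' x) = (LINT x:{?c..?c + 2*pi}|lborel. g x * \<eta>' x)" by (rule window_integral(1)[OF t(1)])
  also have "... = (LINT x:{?c..x0}|lborel. g x * \<eta>' x) + ((LINT x:{x0..x0+d}|lborel. g x * \<eta>' x) + (LINT x:{x0+d..?c + 2*pi}|lborel. g x * \<eta>' x))"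
   using set_integral_split[OF _ _ gi, of ?c x0 "?c + 2*pi"] set_integral_split[OF _ _ gi, of x0 "x0+d" "?c + 2*pi"] d by simp
  also have "(LINT x:{?c..x0}|lborel. g x * \<eta>' x) = (LINT x:{?c..x0}|lborel. g x)"
   unfolding set_lebesgue_integral_def
  proof (rule integral_cong_AE)
   show "AE x in lborel. indicat_real {?c..x0} x *\<^sub>R (g x * \<eta>' x) = indicat_real {?c..x0} x *\<^sub>R g x"
    using AE_lborel_singleton[of x0] by eventually_elim (use t(3) d in "auto simp: indicator_def")
  qed (use gi[of ?c x0] circle_H1D(4)[OF H, of ?c x0] in "auto simp: set_integrable_def")
  also have "(LINT x:{x0..x0+d}|lborel. g x * \<eta>' x) = (LINT x:{x0..x0+d}|lborel. - g x)"
   unfolding set_lebesgue_integral_def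
  proof (rule integral_cong_AE)
   show "AE x in lborel. indicat_real {x0..x0+d} x *\<^sub>R (g x * \<eta>' x) = indicat_real {x0..x0+d} x *\<^sub>R - g x"
    using AE_lborel_singleton[of "x0 + d"] by eventually_elim (use t(3) d in "auto simp: indicator_def")
  qed (use gi[of x0 "x0+d"] set_integrable_uminus[OF circle_H1D(4)[OF H, of x0 "x0+d"]] in "auto simp: set_integrable_def")
  also have "(LINT x:{x0+d..?c + 2*pi}|lborel. g x * \<eta>' x) = 0"
   unfolding set_lebesgue_integral_def
  proof (rule integral_eq_zero_AE)
   show "AE x in lborel. indicat_real {x0+d..?c + 2*pi} x *\<^sub>R (g x * \<eta>' x) = 0"
    using AE_lborel_singleton[of "?c + 2*pi"] by eventually_elim (use t(3) d in "auto simp: indicator_def")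
  qed
  also have "(LINT x:{x0..x0+d}|lborel. - g x) = - (v (x0 + d) - v x0)"
   using set_integral_uminus[OF circle_H1D(4)[OF H, of x0 "x0+d"]] primitiveD(2)[OF pg, of x0 "x0+d"] d by simp
  also have "(LINT x:{?c..x0}|lborel. g x) = v x0 - v ?c" using primitiveD(2)[OF pg, of ?c x0] d by simp
  finally show ?thesis using z by simp
 qed
 have e2: "0 <= mean (%x. v x * \<eta> x)" by (rule set_integral_nonneg) (use nn v_nonneg in auto)
 have e3: "mean \<eta> <= 2 * d^2"
 proof -
  have "mean \<eta> = (LINT x:{?c..?c + 2*pi}|lborel. \<eta> x)"
   using window_integral(2)[OF t(1), of "%_. 1" ?c] by (simp add: periodic_def)
  also have "... = (LINT x:{?c..x0+d}|lborel. \<eta> x)"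
   by (rule set_integral_supp_cong) (use t(2) d in auto)
  also have "... <= (LINT x:{?c..x0+d}|lborel. d)"
   by (rule set_integral_mono) (use t(2) d in "auto intro!: cont_set_integrable ec continuous_intros")
  also have "... = 2 * d^2" using d by (simp add: set_integral_const power2_eq_square)
  finally show ?thesis .
 qed
 have e4: "- mean (%x. \<eta> x * cos x) <= mean \<eta>"
 proof -
  have "mean (%x. - \<eta> x) <= mean (%x. \<eta> x * cos x)"
  proof (rule set_integral_mono)
   show "- \<eta> x <= \<eta> x * cos x" for x using mult_left_mono[OF cos_ge_minus_one nn[of x], of x] by simp
  qed (intro cont_set_integrable continuous_intros ec)+
  then show ?thesis using set_integral_uminus[OF cont_set_integrable[OF ec]] by simp
 qed
 have m0: "0 <= mean \<eta>" by (rule set_integral_nonneg) (use nn in auto)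
 have "v (x0 - d) + v (x0 + d) <= - \<alpha>\<^sup>2 * mean (%x. v x * \<eta> x) - mean (%x. \<eta> x * cos x) + l * mean \<eta>"
  using A unfolding first_variation_def e1 by simp
 also have "... <= mean \<eta> + \<bar>l\<bar> * mean \<eta>"
 proof -
  have "l * mean \<eta> <= \<bar>l\<bar> * mean \<eta>" using m0 by (intro mult_right_mono) auto
  moreover have "0 <= \<alpha>^2 * mean (%x. v x * \<eta> x)" using e2 by simp
  ultimately show ?thesis using e4 by linarith
 qed
 also have "... = (\<bar>l\<bar> + 1) * mean \<eta>" by (simp add: algebra_simps)
 also have "... <= (\<bar>l\<bar> + 1) * (2 * d^2)" using e3 by (intro mult_left_mono) auto
 finally show ?thesis by (simp only: mult_ac)
qed

text \<open>The argument of du Bois-Reymond. Let h = g - R and test with the primitive of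
  \<open>h\<close> minus its mean on [c, d]. There \<open>v\<close> is bounded away from 0, so both
  signs of the variation are allowed, the inequality becomes an equality, and it states that the
  variance of \<open>h\<close> on [c, d] is 0.\<close>

lemma euler_equation:
 assumes l: "!!\<eta> \<eta>' e1. circle_H1 \<eta> \<eta>' ==> 0 < e1 ==> (!!e x. 0 < e ==> e < e1 ==> 0 <= v x + e * \<eta> x) ==>
  0 <= first_variation \<alpha> v g \<eta> \<eta>' + l * mean \<eta>"
  and R: "primitive R (%x. l - \<alpha>\<^sup>2 * v x - cos x)"
  and cd: "c < d" "d < c + 2 * pi" and pos: "!!x. x \<in> {c..d} ==> 0 < v x"
 obtains C where "AE x in lborel. x \<in> {c..d} --> g x = R x + C"
proof -
 let ?r = "%x. l - \<alpha>\<^sup>2 * v x - cos x"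
 define h where "h = (%x. g x - R x)"
 have Rc: "continuous_on S R" for S by (rule primitive_continuous[OF R])
 have hi: "L1_on {a..b} h" for a b
  unfolding h_def by (intro set_integral_diff(1) circle_H1D(4)[OF H] cont_set_integrable Rc)
 have h2: "L1_on {a..b} (%x. (h x + t)^2)" for a b t
 proof -
  have e: "(%x. (h x + t)^2) = (%x. (g x + (t - R x))^2)" by (simp add: h_def algebra_simps)
  have c: "continuous_on {a..b} (%x. t - R x)" by (intro continuous_intros Rc)
  show ?thesis unfolding e
  proof (rule set_integral_square_expand(2)[OF circle_H1D(3)[OF H]])
   show "L1_on {a..b} (%x. g x * (t - R x))"
    using set_integrable_cont_mult[OF c circle_H1D(4)[OF H]] by (simp add: mult.commute)
  qed (intro cont_set_integrable continuous_intros Rc)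
 qed
 define hb where "hb = (LINT x:{c..d}|lborel. h x) / (d - c)"
 define k where "k = (%x. if x \<in> {c..d} then h x + - hb else 0)"
 have gm: "g \<in> borel_measurable borel"
  by (rule L1_loc_UNIV_borel) (use circle_H1D(4)[OF H] in "simp add: L1_loc_UNIV_iff")
 have km: "k \<in> borel_measurable borel"
  unfolding k_def h_def using gm borel_measurable_continuous_onI[OF Rc] by measurable
 have kind: "(%x. indicat_real {c..c+2*pi} x *\<^sub>R F (k x)) = (%x. indicat_real {c..d} x *\<^sub>R F (h x + - hb))"
  if "F 0 = (0::real)" for F :: "real => real"
  using that cd by (auto simp: k_def indicator_def fun_eq_iff)
 have hbi: "L1_on {c..d} (%x. h x + - hb)" by (intro set_integral_add(1) hi cont_set_integrable continuous_intros)
 have ki: "L1_on {c..c + 2 * pi} k" "L1_on {c..c + 2 * pi} (%x. (k x)^2)"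
  using kind[of "%x. x"] kind[of "%x. x^2"] hbi h2[of c d "- hb"] unfolding set_integrable_def by simp_all
 have mean0: "(LINT x:{c..d}|lborel. h x + - hb) = 0"
  using set_integral_add(2)[OF hi cont_set_integrable[OF continuous_on_const], of c d "- hb"] cd
  by (simp add: set_integral_const hb_def)
 have k0: "(LINT x:{c..c + 2 * pi}|lborel. k x) = 0"
  using mean0 kind[of "%x. x"] unfolding set_lebesgue_integral_def by simp
 obtain \<eta> \<eta>' where e: "circle_H1 \<eta> \<eta>'" "!!x. c <= x ==> x < c + 2 * pi ==> \<eta>' x = k x"
  "!!x. c <= x ==> x <= c + 2 * pi ==> \<eta> x = (LINT y:{c..x}|lborel. k y)"
  by (rule periodize[OF km ki k0]) (rule that; assumption)
 have e0: "\<eta> x = 0" if x: "d <= x" "x <= c + 2 * pi" for x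
 proof -
  have "(LINT y:{c..x}|lborel. k y) = (LINT y:{c..c + 2 * pi}|lborel. k y)"
   by (rule set_integral_supp_cong) (use x cd in "auto simp: k_def")
  then show ?thesis using e(3)[of x] x cd k0 by simp
 qed
 have ec: "\<eta> c = 0" using e0[of "c + 2 * pi"] cd circle_H1D(2)[OF e(1)] by (simp add: periodic_def)
 obtain B where B: "!!x. \<bar>\<eta> x\<bar> <= B" "0 < B"
  by (rule periodic_bounded[OF circle_H1D(5)[OF e(1)] circle_H1D(2)[OF e(1)]]) (rule that; assumption)
 obtain y where y: "y \<in> {c..d}" "!!x. x \<in> {c..d} ==> v y <= v x"
  using continuous_attains_inf[of "{c..d}" v] v_cont cd by auto
 define e1 where "e1 = v y / B"
 have e1: "0 < e1" using pos[OF y(1)] B by (simp add: e1_def)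
 have adm: "0 <= v x + t * (s * \<eta> x)" if t: "0 < t" "t < e1" and s: "\<bar>s\<bar> = 1" for t x s
 proof (rule window_ball[OF circle_H1D(2)[OF H] circle_H1D(2)[OF e(1)], of c "%p q. 0 <= p + t * (s * q)"])
  fix x assume x: "c <= x" "x < c + 2 * pi"
  show "0 <= v x + t * (s * \<eta> x)"
  proof (cases "x <= d")
   case True
   have "\<bar>t * (s * \<eta> x)\<bar> = t * \<bar>\<eta> x\<bar>" using t s by (simp add: abs_mult)
   also have "... <= e1 * B" using t B e1 by (intro mult_mono) auto
   also have "... = v y" using B by (simp add: e1_def)
   also have "... <= v x" using y(2) x True by simp
   finally show ?thesis by linarith
  next
   case False
   then show ?thesis using e0[of x] x v_nonneg[of x] by simp
  qed
 qed
 have A1: "0 <= first_variation \<alpha> v g \<eta> \<eta>' + l * mean \<eta>"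
  by (rule l[OF e(1) e1]) (use adm[of _ 1] in auto)
 have z: "circle_H1 (%x. 0) (%x. 0)" by (simp add: circle_H1_def primitive_const periodic_def set_integrable_def)
 have neg: "circle_H1 (%x. 0 + (-1) * \<eta> x) (%x. 0 + (-1) * \<eta>' x)" by (rule circle_H1_add_scaled[OF z e(1)])
 have "0 <= first_variation \<alpha> v g (%x. 0 + (-1) * \<eta> x) (%x. 0 + (-1) * \<eta>' x) + l * mean (%x. 0 + (-1) * \<eta> x)"
  by (rule l[OF neg e1]) (use adm[of _ "-1"] in auto)
 then have A2: "0 <= - first_variation \<alpha> v g \<eta> \<eta>' - l * mean \<eta>"
  unfolding first_variation_add_scaled[OF H z e(1)] mean_add_scaled[OF z e(1)] by (simp add: first_variation_def)
 let ?W = "{c..c + 2 * pi}"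
 have rc: "continuous_on UNIV ?r" by (intro continuous_intros v_cont)
 have rper: "periodic ?r" using circle_H1D(2)[OF H] by (simp add: periodic_def)
 have lin: "mean (%x. ?r x * \<eta> x) = l * mean \<eta> - \<alpha>\<^sup>2 * mean (%x. v x * \<eta> x) - mean (%x. \<eta> x * cos x)"
 proof -
  have ci: "L1_on {0..2*pi} (%x. l * \<eta> x)" "L1_on {0..2*pi} (%x. \<alpha>^2 * (v x * \<eta> x))" "L1_on {0..2*pi} (%x. \<eta> x * cos x)"
   by (intro cont_set_integrable continuous_intros v_cont circle_H1D(5)[OF e(1)])+
  have "(%x. ?r x * \<eta> x) = (%x. (l * \<eta> x - \<alpha>\<^sup>2 * (v x * \<eta> x)) - \<eta> x * cos x)" by (auto simp: algebra_simps)
  then show ?thesis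
   by (simp only: set_integral_diff(2)[OF set_integral_diff(1)[OF ci(1,2)] ci(3)] set_integral_diff(2)[OF ci(1,2)] set_integral_mult_right)
 qed
 have "mean (%x. g x * \<eta>' x) + mean (%x. ?r x * \<eta> x) = 0"
  using A1 A2 unfolding lin first_variation_def by linarith
 then have S: "(LINT x:?W|lborel. g x * \<eta>' x) + (LINT x:?W|lborel. ?r x * \<eta> x) = 0"
  using window_integral(1)[OF e(1), of c] window_integral(2)[OF e(1) rc rper, of c] by simp
 have ibp: "(LINT x:?W|lborel. R x * \<eta>' x) + (LINT x:?W|lborel. \<eta> x * ?r x) = 0"
  using integral_by_parts_primitive[OF R circle_H1D(1)[OF e(1)], of c "c + 2*pi"] ec e0[of "c + 2*pi"] cd by simp
 have Ri: "L1_on ?W (%x. R x * \<eta>' x)" by (rule set_integrable_cont_mult[OF Rc circle_H1D(4)[OF e(1)]])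
 have hk: "(LINT x:?W|lborel. h x * \<eta>' x) = 0"
 proof -
  have "(LINT x:?W|lborel. h x * \<eta>' x) = (LINT x:?W|lborel. g x * \<eta>' x - R x * \<eta>' x)" by (simp add: h_def left_diff_distrib)
  also have "... = (LINT x:?W|lborel. g x * \<eta>' x) - (LINT x:?W|lborel. R x * \<eta>' x)"
   by (rule set_integral_diff(2)[OF circle_H1_prod[OF H e(1)] Ri])
  finally show ?thesis using S ibp by (simp add: mult.commute)
 qed
 have hh: "(LINT x:{c..d}|lborel. h x * (h x + - hb)) = 0"
 proof -
  have "AE x in lborel. indicat_real ?W x *\<^sub>R (h x * \<eta>' x) = indicat_real {c..d} x *\<^sub>R (h x * (h x + - hb))"
   using AE_lborel_singleton[of "c + 2*pi"] by eventually_elim (use e(2) cd in "auto simp: indicator_def k_def")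
  moreover have hm: "h \<in> borel_measurable borel" unfolding h_def using gm borel_measurable_continuous_onI[OF Rc] by measurable
  moreover have "\<eta>' \<in> borel_measurable borel"
   by (rule L1_loc_UNIV_borel) (use circle_H1D(4)[OF e(1)] in "simp add: L1_loc_UNIV_iff")
  ultimately have "(LINT x:?W|lborel. h x * \<eta>' x) = (LINT x:{c..d}|lborel. h x * (h x + - hb))"
   unfolding set_lebesgue_integral_def by (intro integral_cong_AE) auto
  then show ?thesis using hk by simp
 qed
 have sq: "(LINT x:{c..d}|lborel. (h x + - hb)^2) = 0"
 proof -
  have i1: "L1_on {c..d} (%x. hb * (h x + - hb))" using hbi by (rule set_integrable_mult_right)
  have i2: "L1_on {c..d} (%x. h x * (h x + - hb))"
  proof -
   have "(%x. h x * (h x + - hb)) = (%x. (h x + - hb)^2 + hb * (h x + - hb))" by (auto simp: power2_eq_square algebra_simps)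
   then show ?thesis using set_integral_add(1)[OF h2 i1, of "- hb"] by simp
  qed
  have "(%x. (h x + - hb)^2) = (%x. h x * (h x + - hb) - hb * (h x + - hb))" by (auto simp: power2_eq_square algebra_simps)
  then have "(LINT x:{c..d}|lborel. (h x + - hb)^2) = (LINT x:{c..d}|lborel. h x * (h x + - hb)) - hb * (LINT x:{c..d}|lborel. h x + - hb)"
   by (simp only: set_integral_diff(2)[OF i2 i1] set_integral_mult_right)
  then show ?thesis using hh mean0 by simp
 qed
 have "AE x in lborel. indicat_real {c..d} x *\<^sub>R (h x + - hb)\<^sup>2 = 0"
  using sq h2[of c d "- hb"] unfolding set_lebesgue_integral_def set_integrable_def
  by (subst (asm) integral_nonneg_eq_0_iff_AE) auto
 then have "AE x in lborel. x \<in> {c..d} --> g x = R x + hb"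
  by eventually_elim (auto simp: h_def indicator_def)
 then show ?thesis by (rule that)
qed

end

text \<open>Let \<open>a\<close> be the last zero before \<open>x\<close>. The quadratic bound and
  the mean value theorem give a point of (a, x) with slope at most K * (x - a), and the bounded
  second derivative transports this to \<open>x\<close>. The constants are the same on all
  components, so the bound also works where zeros accumulate.\<close>

lemma slope_bound_right:
 fixes v w1 w2 :: "real => real"
 assumes nn: "!!x. 0 <= v x" and d1: "!!x. (v has_real_derivative w1 x) (at x)"
  and d2: "!!x. 0 < v x ==> (w1 has_real_derivative w2 x) (at x)"
  and K2: "!!x. \<bar>w2 x\<bar> <= K2" and K: "0 <= K" "!!a y. v a = 0 ==> \<bar>y - a\<bar> <= 1 ==> v y <= K * (y - a)^2"
  and z: "v x0 = 0" and x: "x0 < x" "x <= x0 + 1" and w1z: "!!x. v x = 0 ==> w1 x = 0"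
 shows "\<bar>w1 x\<bar> <= (K + K2) * (x - x0)"
proof (cases "v x = 0")
 case True
 have "0 <= K2" using K2[of 0] by linarith
 then show ?thesis using True w1z K x by simp
next
 case False
 have vc: "continuous_on S v" for S by (rule DERIV_imp_continuous_on[OF d1])
 let ?Z = "{y \<in> {x0..x}. v y = 0}"
 have "compact ?Z" using continuous_closed_preimage_constant[OF vc closed_atLeastAtMost, of x0 x 0]
  by (auto simp: compact_eq_bounded_closed intro: bounded_subset[OF bounded_closed_interval])
 moreover have "x0 \<in> ?Z" using z x by simp
 ultimately obtain a where a: "a \<in> ?Z" "!!y. y \<in> ?Z ==> y <= a"
  using compact_attains_sup[of ?Z] by blast
 have ax: "x0 <= a" "a < x" using a False by (auto simp: less_le)
 have pos: "0 < v y" if "a < y" "y <= x" for y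
  using a(2)[of y] that ax nn[of y] by (auto simp: less_le)
 obtain s where s: "a < s" "s < x" "v x - v a = (x - a) * w1 s"
  using MVT2[OF ax(2), of v w1] d1 by blast
 have K20: "0 <= K2" using K2[of 0] by linarith
 have "v x <= K * (x - a)^2" using K(2)[of a x] a ax x by auto
 then have "(x - a) * w1 s <= (x - a) * (K * (x - a))" using s a by (simp add: power2_eq_square mult_ac)
 then have s1: "w1 s <= K * (x - a)" using ax by simp
 have "0 <= (x - a) * w1 s" using s(3) a nn[of x] by simp
 then have s0: "0 <= w1 s" using ax by (simp add: zero_le_mult_iff)
 obtain t where t: "s < t" "t < x" "w1 x - w1 s = (x - s) * w2 t"
  using MVT2[OF s(2), of w1 w2] d2 pos s by (metis less_le_trans order.strict_trans2)
 have "\<bar>w1 x - w1 s\<bar> = (x - s) * \<bar>w2 t\<bar>" using t s by (simp add: abs_mult)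
 also have "... <= (x - a) * K2" using s ax K2[of t] by (intro mult_mono) auto
 finally have "\<bar>w1 x\<bar> <= K * (x - a) + (x - a) * K2" using s0 s1 by linarith
 also have "... = (K + K2) * (x - a)" by (simp add: algebra_simps)
 also have "... <= (K + K2) * (x - x0)" using ax K K20 by (intro mult_left_mono) auto
 finally show ?thesis .
qed

context energy_minimizer
begin

text \<open>Where \<open>v\<close> is positive the Euler equation makes its derivative locally R +
  C, which gives the pressure law. At a zero the quadratic bound yields derivative 0, and the two
  one-sided slope bounds make the derivative continuous there.\<close>

theorem minimizer_film: "EX w1 w2. film \<alpha> v w1 w2"
proof (rule euler_inequality)
 fix l assume l: "!!\<eta> \<eta>' e1. circle_H1 \<eta> \<eta>' ==> 0 < e1 ==> (!!e x. 0 < e ==> e < e1 ==> 0 <= v x + e * \<eta> x) ==>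
  0 <= first_variation \<alpha> v g \<eta> \<eta>' + l * mean \<eta>"
 let ?r = "%x. l - \<alpha>\<^sup>2 * v x - cos x"
 have rc: "continuous_on S ?r" for S by (intro continuous_intros v_cont)
 obtain R where R: "primitive R ?r"
  using primitive_indefinite_integral[OF cont_set_integrable[OF rc]] by blast
 have Rd: "(R has_real_derivative ?r x) (at x)" for x
  by (rule primitive_DERIV[OF R rc, of "x - 1" x "x + 1"]) auto
 have Rc: "continuous_on S R" for S by (rule primitive_continuous[OF R])
 have per: "periodic v" by (rule circle_H1D(2)[OF H])
 have rper: "periodic ?r" using per by (simp add: periodic_def)
 define K where "K = 2 * (\<bar>l\<bar> + 1)"
 have quad: "v y <= K * (y - a)^2" if z: "v a = 0" and y: "\<bar>y - a\<bar> <= 1" for a y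
 proof (cases "y = a")
  case False
  have "\<bar>y - a\<bar> <= pi" using y pi_gt3 by linarith
  then have "v (a - \<bar>y - a\<bar>) + v (a + \<bar>y - a\<bar>) <= K * \<bar>y - a\<bar>\<^sup>2"
   unfolding K_def using False by (intro quadratic_bound_at_zero[OF l z]) auto
  moreover have "v y <= v (a - \<bar>y - a\<bar>) + v (a + \<bar>y - a\<bar>)"
   using v_nonneg[of "a - \<bar>y - a\<bar>"] v_nonneg[of "a + \<bar>y - a\<bar>"] by (cases "y <= a") auto
  ultimately show ?thesis by simp
 qed (use z in simp)
 have K0: "0 <= K" by (simp add: K_def)
 \<comment> \<open>The Euler equation holds almost everywhere only; integrating its continuous right
   side upgrades it to a classical derivative near \<open>x\<close>.\<close>
 have loc: "\<exists>e>0. EX C. ALL y. x - e < y & y < x + e --> 0 < v y & (v has_real_derivative R y + C) (at y)" if px: "0 < v x" for x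
 proof -
  have "(v \<longlongrightarrow> v x) (nhds x)"
   using v_cont[of UNIV] by (simp add: continuous_on_eq_continuous_at isCont_def tendsto_nhds_iff)
  then have "eventually (%x. 0 < v x) (nhds x)" by (rule order_tendstoD) (use px in auto)
  then obtain e0 where e0: "e0 > 0" "!!y. dist y x < e0 ==> 0 < v y" by (auto simp: eventually_nhds_metric)
  define e where "e = min (e0 / 2) 1"
  have e: "0 < e" "e <= 1" "e < e0" using e0 by (auto simp: e_def min_def)
  have pos: "0 < v y" if "y \<in> {x - e..x + e}" for y using e0(2)[of y] that e by (auto simp: dist_real_def)
  have c1: "x - e < x + e" "x + e < (x - e) + 2 * pi" using e pi_gt3 by linarith+
  obtain C where C: "AE y in lborel. y \<in> {x - e..x + e} --> g y = R y + C"
   by (rule euler_equation[OF l R c1 pos]) (assumption | rule that)+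
  have cc: "continuous_on S (%y. R y + C)" for S by (intro continuous_intros Rc)
  obtain V where V: "primitive V (%y. R y + C)"
   using primitive_indefinite_integral[OF cont_set_integrable[OF cc]] by blast
  have pg: "primitive v g" by (rule circle_H1D(1)[OF H])
  have eq: "V y - V (x - e) + v (x - e) = v y" if "y \<in> {x - e<..<x + e}" for y
  proof -
   have "(LINT t:{x - e..y}|lborel. g t) = (LINT t:{x - e..y}|lborel. R t + C)"
    unfolding set_lebesgue_integral_def
   proof (rule integral_cong_AE)
    show "AE t in lborel. indicat_real {x - e..y} t *\<^sub>R g t = indicat_real {x - e..y} t *\<^sub>R (R t + C)"
     using C by eventually_elim (use that in "auto simp: indicator_def")
   qed (use circle_H1D(4)[OF H, of "x-e" y] cont_set_integrable[OF cc, of "x-e" y] in "auto simp: set_integrable_def")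
   then show ?thesis using primitiveD(2)[OF pg, of "x-e" y] primitiveD(2)[OF V, of "x-e" y] that by simp
  qed
  have "(v has_real_derivative R y + C) (at y)" if y: "x - e < y" "y < x + e" for y
  proof -
   have "(V has_real_derivative R y + C) (at y)"
    by (rule primitive_DERIV[OF V cc, of "x - e" y "x + e"]) (use y in auto)
   then have "((%y. V y - V (x - e) + v (x - e)) has_real_derivative R y + C) (at y)"
    by (auto intro!: derivative_eq_intros)
   then show ?thesis
    by (rule has_field_derivative_transform_within_open[where S="{x-e<..<x+e}"]) (use y eq in auto)
  qed
  then show ?thesis using e pos by (intro exI[of _ e] conjI exI[of _ C]) auto
 qed
 define w1 where "w1 = (%x. if 0 < v x then deriv v x else 0)"
 define w2 where "w2 = (%x. if 0 < v x then ?r x else 0)"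
 have d1: "(v has_real_derivative w1 x) (at x)" for x
 proof (cases "0 < v x")
  case True
  obtain e C where "e > 0" "!!y. x - e < y & y < x + e ==> 0 < v y & (v has_real_derivative R y + C) (at y)"
   using loc[OF True] by blast
  then have dv: "(v has_real_derivative R x + C) (at x)" by simp
  then have "deriv v x = R x + C" by (rule DERIV_imp_deriv)
  with dv True show ?thesis by (simp add: w1_def)
 next
  case False
  then have z: "v x = 0" using v_nonneg[of x] by simp
  have "((%h. (v (x + h) - v x) / h) \<longlongrightarrow> 0) (at 0)"
  proof (rule Lim_null_comparison)
   show "((%h. K * \<bar>h\<bar>) \<longlongrightarrow> 0) (at 0)" by (auto intro!: tendsto_eq_intros)
   have "norm ((v (x + h) - v x) / h) <= K * \<bar>h\<bar>" if h: "h ~= 0" "dist h 0 < 1" for h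
   proof -
    have "v (x + h) <= (K * \<bar>h\<bar>) * \<bar>h\<bar>" using quad[OF z, of "x + h"] h by (simp add: power2_eq_square abs_mult[symmetric] mult.assoc)
    then show ?thesis using z h v_nonneg[of "x + h"] by (simp add: abs_divide divide_le_eq)
   qed
   then show "\<forall>\<^sub>F h in at 0. norm ((v (x + h) - v x) / h) <= K * \<bar>h\<bar>"
    unfolding eventually_at by (intro exI[of _ 1]) auto
  qed
  then show ?thesis using z by (simp add: DERIV_def w1_def)
 qed
 have d2: "(w1 has_real_derivative w2 x) (at x)" if pv: "0 < v x" for x
 proof -
  obtain e C where e: "e > 0" "!!y. x - e < y & y < x + e ==> 0 < v y & (v has_real_derivative R y + C) (at y)"
   using loc[OF pv] by blast
  have "((%y. R y + C) has_real_derivative w2 x) (at x)"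
   using Rd[of x] pv by (auto intro!: derivative_eq_intros simp: w2_def)
  then show ?thesis
  proof (rule has_field_derivative_transform_within_open[where S="{x-e<..<x+e}"])
   fix y assume "y \<in> {x-e<..<x+e}"
   then have "(v has_real_derivative R y + C) (at y)" using e(2) by simp
   then show "R y + C = w1 y" using d1 DERIV_unique by blast
  qed (use e in auto)
 qed
 have d3: "(w2 has_real_derivative sin x - \<alpha>\<^sup>2 * w1 x) (at x)" if "0 < v x" for x
 proof -
  have "(?r has_real_derivative sin x - \<alpha>\<^sup>2 * w1 x) (at x)"
   by (rule DERIV_cong, (rule derivative_intros d1)+) simp
  moreover have "open {x. 0 < v x}" by (rule open_Collect_less) (auto intro: v_cont)
  ultimately show ?thesis
   by (rule has_field_derivative_transform_within_open) (use that in "auto simp: w2_def")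
 qed
 obtain B where B: "!!x. \<bar>?r x\<bar> <= B" "0 < B"
  by (rule periodic_bounded[OF rc rper]) (rule that; assumption)
 have w2b: "\<bar>w2 x\<bar> <= B" for x using B(1)[of x] B(2) by (simp add: w2_def)
 have w1z: "v x = 0 ==> w1 x = 0" for x by (simp add: w1_def)
 have right: "\<bar>w1 x\<bar> <= (K + B) * (x - x0)" if "v x0 = 0" "x0 < x" "x <= x0 + 1" for x x0
  by (rule slope_bound_right[OF v_nonneg d1 d2 w2b K0 quad that w1z])
 have left: "\<bar>w1 x\<bar> <= (K + B) * (x0 - x)" if "v x0 = 0" "x < x0" "x0 <= x + 1" for x x0
 proof -
  have m: "((%x. - x) has_real_derivative -1) (at x)" for x :: real by (auto intro!: derivative_eq_intros)
  have "\<bar>- w1 (- (- x))\<bar> <= (K + B) * (- x - (- x0))"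
  proof (rule slope_bound_right[of "%x. v (- x)" "%x. - w1 (- x)" "%x. w2 (- x)"])
   show "((%x. v (- x)) has_real_derivative - w1 (- x)) (at x)" for x using DERIV_chain2[OF d1[of "-x"] m] by simp
   show "((%x. - w1 (- x)) has_real_derivative w2 (- x)) (at x)" if "0 < v (- x)" for x
    using DERIV_minus[OF DERIV_chain2[OF d2[OF that] m]] by simp
   show "v (- y) <= K * (y - a)^2" if "v (- a) = 0" "\<bar>y - a\<bar> <= 1" for a y
    using quad[OF that(1), of "- y"] that(2) by (simp add: power2_commute abs_minus_commute)
  qed (use that v_nonneg w2b K0 w1z in auto)
  then show ?thesis by simp
 qed
 have c1: "continuous_on UNIV w1"
 proof (rule continuous_at_imp_continuous_on, rule ballI)
  fix x0
  show "isCont w1 x0"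
  proof (cases "0 < v x0")
   case True
   then show ?thesis using d2 DERIV_isCont by blast
  next
   case False
   then have z: "v x0 = 0" using v_nonneg[of x0] by simp
   have "(w1 \<longlongrightarrow> 0) (at x0)"
   proof (rule Lim_null_comparison)
    show "((%x. (K + B) * \<bar>x - x0\<bar>) \<longlongrightarrow> 0) (at x0)" by (auto intro!: tendsto_eq_intros)
    have "norm (w1 x) <= (K + B) * \<bar>x - x0\<bar>" if "x ~= x0" "dist x x0 < 1" for x
     using right[OF z, of x] left[OF z, of x] that by (cases "x < x0") (auto simp: dist_real_def)
    then show "\<forall>\<^sub>F x in at x0. norm (w1 x) <= (K + B) * \<bar>x - x0\<bar>"
     unfolding eventually_at by (intro exI[of _ 1]) auto
   qed
   then show ?thesis using w1z[OF z] by (simp add: isCont_def)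
  qed
 qed
 have "film \<alpha> v w1 w2"
  by unfold_locales (use alpha per v_nonneg d1 c1 d2 d3 in "auto simp: w2_def")
 then show ?thesis by blast
qed

end

section \<open>Energy decay along the regularized flow\<close>

lemma Ck_on_cong:
 assumes "open S" "!!x. x \<in> S ==> f x = g x" "Ck_on k S f"
 shows "Ck_on k S g"
 using assms(2,3)
proof (induction k arbitrary: f g)
 case 0
 then have "continuous_on S f" by simp
 then have "continuous_on S g" by (rule continuous_on_eq) (rule 0(1))
 then show ?case by simp
next
 case (Suc k)
 have d: "(g has_derivative frechet_derivative f (at x)) (at x)" if "x \<in> S" for x
 proof (rule has_derivative_transform_within_open[OF _ assms(1) that])
  show "(f has_derivative frechet_derivative f (at x)) (at x)"
   using Suc.prems(2) that frechet_derivative_works by auto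
 qed (use Suc.prems(1) in auto)
 then have "g differentiable (at x)" if "x \<in> S" for x using that differentiableI by blast
 moreover have "Ck_on k S (%x. frechet_derivative g (at x) v)" for v
 proof (rule Suc.IH)
  show "Ck_on k S (%x. frechet_derivative f (at x) v)" using Suc.prems(2) by simp
  show "frechet_derivative f (at x) v = frechet_derivative g (at x) v" if "x \<in> S" for x
   using frechet_derivative_at[OF d[OF that]] by simp
 qed
 ultimately show ?case by simp
qed

lemma smooth_on_continuous: "smooth_on S f ==> continuous_on S f"
 unfolding smooth_on_def by (metis Ck_on.simps(1))

lemma smooth_on_partial_x:
 fixes u :: "real => real => real"
 assumes S: "open S" and u: "smooth_on S (%(t, x). u t x)"
 shows "(t, x) \<in> S ==> (u t has_real_derivative deriv (u t) x) (at x)"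
  and "smooth_on S (%(t, x). deriv (u t) x)"
proof -
 let ?F = "%(t, x). u t x"
 have C1: "!!k. Ck_on (Suc k) S ?F" using u unfolding smooth_on_def by blast
 have d: "(u t has_real_derivative frechet_derivative ?F (at (t, x)) (0, 1)) (at x)" if "(t, x) \<in> S" for t x
 proof -
  have "?F differentiable (at (t, x))" using C1[of 0] that by simp
  then have F: "(?F has_derivative frechet_derivative ?F (at (t, x))) (at (t, x))" by (simp add: frechet_derivative_works)
  have p: "((%y. (t, y)) has_derivative (%h. (0, h))) (at x)" by (auto intro!: derivative_eq_intros)
  have "((%y. ?F (t, y)) has_derivative (%h. frechet_derivative ?F (at (t, x)) (0, h))) (at x)"
   using has_derivative_compose[OF p, of ?F] F by simp
  moreover have "(%h. frechet_derivative ?F (at (t, x)) (0, h)) = (%h. frechet_derivative ?F (at (t, x)) (0, 1) * h)"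
  proof
   fix h :: real
   have "linear (frechet_derivative ?F (at (t, x)))" using F has_derivative_linear by blast
   from linear_scale[OF this, of h "(0, 1)"]
   show "frechet_derivative ?F (at (t, x)) (0, h) = frechet_derivative ?F (at (t, x)) (0, 1) * h" by simp
  qed
  ultimately show ?thesis by (simp add: has_field_derivative_def)
 qed
 show "(t, x) \<in> S ==> (u t has_real_derivative deriv (u t) x) (at x)"
  using d DERIV_imp_deriv by metis
 show "smooth_on S (%(t, x). deriv (u t) x)"
  unfolding smooth_on_def
 proof
  fix k
  show "Ck_on k S (%(t, x). deriv (u t) x)"
  proof (rule Ck_on_cong[OF S])
   show "Ck_on k S (%p. frechet_derivative ?F (at p) (0, 1))" using C1[of k] by simp
   show "frechet_derivative ?F (at p) (0, 1) = (case p of (t, x) => deriv (u t) x)" if "p \<in> S" for p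
    using d[of "fst p" "snd p"] that DERIV_imp_deriv by (cases p) fastforce
  qed
 qed
qed

lemma smooth_on_partial_t:
 fixes u :: "real => real => real"
 assumes S: "open S" and u: "smooth_on S (%(t, x). u t x)"
 shows "(t, x) \<in> S ==> ((%s. u s x) has_real_derivative deriv (%s. u s x) t) (at t)"
  and "continuous_on S (%(t, x). deriv (%s. u s x) t)"
proof -
 let ?F = "%(t, x). u t x"
 have C1: "Ck_on (Suc 0) S ?F" using u unfolding smooth_on_def by blast
 have d: "((%s. u s x) has_real_derivative frechet_derivative ?F (at (t, x)) (1, 0)) (at t)" if "(t, x) \<in> S" for t x
 proof -
  have "?F differentiable (at (t, x))" using C1 that by simp
  then have F: "(?F has_derivative frechet_derivative ?F (at (t, x))) (at (t, x))" by (simp add: frechet_derivative_works)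
  have p: "((%s. (s, x)) has_derivative (%h. (h, 0))) (at t)" by (auto intro!: derivative_eq_intros)
  have "((%s. ?F (s, x)) has_derivative (%h. frechet_derivative ?F (at (t, x)) (h, 0))) (at t)"
   using has_derivative_compose[OF p, of ?F] F by simp
  moreover have "(%h. frechet_derivative ?F (at (t, x)) (h, 0)) = (%h. frechet_derivative ?F (at (t, x)) (1, 0) * h)"
  proof
   fix h :: real
   have "linear (frechet_derivative ?F (at (t, x)))" using F has_derivative_linear by blast
   from linear_scale[OF this, of h "(1, 0)"]
   show "frechet_derivative ?F (at (t, x)) (h, 0) = frechet_derivative ?F (at (t, x)) (1, 0) * h" by simp
  qed
  ultimately show ?thesis by (simp add: has_field_derivative_def)
 qed
 show "(t, x) \<in> S ==> ((%s. u s x) has_real_derivative deriv (%s. u s x) t) (at t)"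
  using d DERIV_imp_deriv by metis
 have "Ck_on 0 S (%p. frechet_derivative ?F (at p) (1, 0))" using C1 by simp
 then have "continuous_on S (%p. frechet_derivative ?F (at p) (1, 0))" by simp
 then show "continuous_on S (%(t, x). deriv (%s. u s x) t)"
 proof (rule continuous_on_eq)
  show "frechet_derivative ?F (at p) (1, 0) = (case p of (t, x) => deriv (%s. u s x) t)" if "p \<in> S" for p
   using d[of "fst p" "snd p"] that DERIV_imp_deriv by (cases p) fastforce
 qed
qed

lemma deriv_periodic:
 fixes f :: "real => real"
 assumes "periodic f" "!!x. (f has_real_derivative deriv f x) (at x)"
 shows "periodic (deriv f)"
 unfolding periodic_def
proof
 fix x
 have "((%x. f (x + 2 * pi)) has_real_derivative deriv f (x + 2 * pi)) (at x)"
  using assms(2)[of "x + 2 * pi"] by (simp add: DERIV_shift)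
 moreover have "(%x. f (x + 2 * pi)) = f" using assms(1) by (auto simp: periodic_def)
 ultimately show "deriv f (x + 2 * pi) = deriv f x" using DERIV_unique assms(2) by metis
qed

locale regularized =
 fixes \<alpha> :: real and g :: "real => real" and v :: "real => real => real"
 assumes sol: "regularized_solution \<alpha> g v" and g_nonneg: "0 <= g z"
begin

abbreviation "S \<equiv> {0::real<..} \<times> (UNIV :: real set)"
definition "v1 t = deriv (v t)"
definition "v2 t = deriv (v1 t)"
definition "v3 t = deriv (v2 t)"
definition "vt t x = deriv (%s. v s x) t"
definition "p t x = v2 t x + \<alpha>^2 * v t x + cos x"
definition "p1 t x = v3 t x + \<alpha>^2 * v1 t x - sin x"

lemma S_open: "open S" by (intro open_Times) auto

lemma smooths: "smooth_on S (%(t, x). v t x)" "smooth_on S (%(t, x). v1 t x)" "smooth_on S (%(t, x). v2 t x)" "smooth_on S (%(t, x). v3 t x)"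
proof -
 show 0: "smooth_on S (%(t, x). v t x)" using sol unfolding regularized_solution_def by blast
 show 1: "smooth_on S (%(t, x). v1 t x)" unfolding v1_def by (rule smooth_on_partial_x(2)[OF S_open 0])
 show 2: "smooth_on S (%(t, x). v2 t x)" unfolding v2_def by (rule smooth_on_partial_x(2)[OF S_open 1])
 show "smooth_on S (%(t, x). v3 t x)" unfolding v3_def by (rule smooth_on_partial_x(2)[OF S_open 2])
qed

lemma conts: "continuous_on S (%(t, x). v t x)" "continuous_on S (%(t, x). v1 t x)" "continuous_on S (%(t, x). v2 t x)"
 "continuous_on S (%(t, x). v3 t x)" "continuous_on S (%(t, x). vt t x)"
 unfolding vt_def by (rule smooth_on_continuous smooths smooth_on_partial_t(2)[OF S_open smooths(1)])+

lemma slice_cont: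
 assumes "continuous_on S (%(t, x). f t x)" "0 < t" shows "continuous_on A (f t)"
proof -
 have "continuous_on A (%x. (%(t, x). f t x) (t, x))"
 proof (rule continuous_on_compose2[OF assms(1)])
  show "continuous_on A (%x. (t, x))" by (rule continuous_on_Pair[OF continuous_on_const continuous_on_id])
 qed (use assms(2) in auto)
 then show ?thesis by simp
qed

lemma derivs:
 assumes "0 < t"
 shows "(v t has_real_derivative v1 t x) (at x)" "(v1 t has_real_derivative v2 t x) (at x)" "(v2 t has_real_derivative v3 t x) (at x)"
  "((%s. v s x) has_real_derivative vt t x) (at t)" "(p t has_real_derivative p1 t x) (at x)"
proof -
 have S: "(t, x) \<in> S" using assms by simp
 show 1: "(v t has_real_derivative v1 t x) (at x)" unfolding v1_def by (rule smooth_on_partial_x(1)[OF S_open smooths(1) S])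
 show "(v1 t has_real_derivative v2 t x) (at x)" unfolding v2_def by (rule smooth_on_partial_x(1)[OF S_open smooths(2) S])
 show 3: "(v2 t has_real_derivative v3 t x) (at x)" unfolding v3_def by (rule smooth_on_partial_x(1)[OF S_open smooths(3) S])
 show "((%s. v s x) has_real_derivative vt t x) (at t)" unfolding vt_def by (rule smooth_on_partial_t(1)[OF S_open smooths(1) S])
 show "(p t has_real_derivative p1 t x) (at x)" unfolding p_def p1_def
  by (rule DERIV_cong, (rule derivative_intros 1 3)+) simp
qed

lemma slice_conts:
 assumes "0 < t"
 shows "continuous_on A (v t)" "continuous_on A (v1 t)" "continuous_on A (v2 t)" "continuous_on A (v3 t)" "continuous_on A (vt t)"
  "continuous_on A (p t)" "continuous_on A (p1 t)"
proof -
 show c: "continuous_on A (v t)" "continuous_on A (v1 t)" "continuous_on A (v2 t)" "continuous_on A (v3 t)" "continuous_on A (vt t)"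
  by (rule slice_cont[OF _ assms], rule conts)+
 show "continuous_on A (p t)" "continuous_on A (p1 t)" unfolding p_def p1_def by (intro continuous_intros c)+
qed

lemma pers:
 assumes "0 < t" shows "periodic (v t)" "periodic (v1 t)" "periodic (v2 t)" "periodic (v3 t)" "periodic (p t)" "periodic (p1 t)"
proof -
 show 0: "periodic (v t)" using sol assms unfolding regularized_solution_def by simp
 show 1: "periodic (v1 t)" unfolding v1_def by (rule deriv_periodic[OF 0]) (use derivs(1)[OF assms] in "simp add: v1_def")
 show 2: "periodic (v2 t)" unfolding v2_def by (rule deriv_periodic[OF 1]) (use derivs(2)[OF assms] in "simp add: v2_def")
 show 3: "periodic (v3 t)" unfolding v3_def by (rule deriv_periodic[OF 2]) (use derivs(3)[OF assms] in "simp add: v3_def")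
 show "periodic (p t)" "periodic (p1 t)" using 0 1 2 3 by (auto simp: p_def p1_def periodic_def)
qed

lemma periodic_2pi: "periodic f ==> f (2 * pi) = f 0"
 unfolding periodic_def by (metis add_0)

lemma pers0:
 assumes "0 < t"
 shows "v t (2 * pi) = v t 0" "v1 t (2 * pi) = v1 t 0" "p t (2 * pi) = p t 0" "p1 t (2 * pi) = p1 t 0"
 by (rule periodic_2pi, rule pers[OF assms])+

lemma prims:
 assumes "0 < t" shows "primitive (v t) (v1 t)" "primitive (v1 t) (v2 t)" "primitive (p t) (p1 t)"
 using primitive_of_deriv[OF derivs(1)[OF assms] slice_conts(2)[OF assms]] primitive_of_deriv[OF derivs(2)[OF assms] slice_conts(3)[OF assms]]
  primitive_of_deriv[OF derivs(5)[OF assms] slice_conts(7)[OF assms]] by auto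

definition e :: "real => real" where "e t = circle_energy \<alpha> (v t) (v1 t)"

lemma e_alt:
 assumes t: "0 < t"
 shows "e t = (\<oint>x. - (1/2) * (v t x * (p t x + cos x)))"
proof -
 let ?I = "{0..2*pi}"
 have "(\<oint>x. v1 t x * v1 t x) + (\<oint>x. v t x * v2 t x) = 0"
  using integral_by_parts_primitive[OF prims(2,1)[OF t], of 0 "2*pi"] pers0[OF t] by simp
 then have a: "(\<oint>x. (v1 t x)^2) = - (\<oint>x. v t x * v2 t x)" by (simp add: power2_eq_square)
 have ci: "L1_on ?I (%x. v t x * v2 t x)" "L1_on ?I (%x. \<alpha>^2 * (v t x)^2)" "L1_on ?I (%x. 2 * (v t x * cos x))"
  by (intro cont_set_integrable continuous_intros slice_conts[OF t])+
 have "(%x. - (1/2) * (v t x * (p t x + cos x))) = (%x. - (1/2) * ((v t x * v2 t x + \<alpha>^2 * (v t x)^2) + 2 * (v t x * cos x)))"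
  by (auto simp: p_def power2_eq_square algebra_simps)
 then have "(\<oint>x. - (1/2) * (v t x * (p t x + cos x))) = - (1/2) * (((\<oint>x. v t x * v2 t x) + \<alpha>^2 * (\<oint>x. (v t x)^2)) + 2 * (\<oint>x. v t x * cos x))"
  by (simp only: set_integral_mult_right set_integral_add(2)[OF set_integral_add(1)[OF ci(1,2)] ci(3)] set_integral_add(2)[OF ci(1,2)])
 then show ?thesis unfolding e_def circle_energy_def a by (simp add: field_simps)
qed

text \<open>A symmetric quadratic form factors the difference of two energies into the increment of
  \<open>v\<close> times the sum of the two pressures. Differentiating the energy in time then takes
  one time derivative of \<open>v\<close> and continuity of the pressure, but no mixed
  derivatives.\<close>

lemma e_diff:
 assumes t: "0 < t" and s: "0 < s"
 shows "e s - e t = (\<oint>x. - (1/2) * ((v s x - v t x) * (p s x + p t x)))"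
proof -
 let ?I = "{0..2*pi}"
 have c: "continuous_on A (p r)" "continuous_on A (v r)" "continuous_on A (v2 r)" if "r = s \<or> r = t" for r A
  using slice_conts that s t by blast+
 have sym: "(\<oint>x. v t x * v2 s x) = (\<oint>x. v s x * v2 t x)"
 proof -
  have "(\<oint>x. v1 s x * v1 t x) + (\<oint>x. v t x * v2 s x) = 0"
   using integral_by_parts_primitive[OF prims(2)[OF s] prims(1)[OF t], of 0 "2*pi"] pers0[OF s] pers0[OF t] by simp
  moreover have "(\<oint>x. v1 t x * v1 s x) + (\<oint>x. v s x * v2 t x) = 0"
   using integral_by_parts_primitive[OF prims(2)[OF t] prims(1)[OF s], of 0 "2*pi"] pers0[OF s] pers0[OF t] by simp
  ultimately show ?thesis by (simp add: mult.commute)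
 qed
 have ci: "L1_on ?I (%x. - (1/2) * (v s x * (p s x + cos x)))" "L1_on ?I (%x. - (1/2) * (v t x * (p t x + cos x)))"
  "L1_on ?I (%x. v t x * v2 s x)" "L1_on ?I (%x. v s x * v2 t x)"
  by (intro cont_set_integrable continuous_intros c; simp)+
 have "(\<oint>x. - (1/2) * ((v s x - v t x) * (p s x + p t x))) =
  (\<oint>x. (- (1/2) * (v s x * (p s x + cos x)) - - (1/2) * (v t x * (p t x + cos x))) + (1/2) * (v t x * v2 s x - v s x * v2 t x))"
  by (rule arg_cong[where f="set_lebesgue_integral lborel ?I"]) (rule ext, simp add: p_def field_simps)
 also have "... = (\<oint>x. - (1/2) * (v s x * (p s x + cos x))) - (\<oint>x. - (1/2) * (v t x * (p t x + cos x)))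
  + (1/2) * ((\<oint>x. v t x * v2 s x) - (\<oint>x. v s x * v2 t x))"
 proof -
  have d: "L1_on ?I (%x. (1/2) * (v t x * v2 s x - v s x * v2 t x))"
   using set_integral_diff(1)[OF ci(3,4)] by (rule set_integrable_mult_right)
  show ?thesis
   by (simp only: set_integral_add(2)[OF set_integral_diff(1)[OF ci(1,2)] d] set_integral_diff(2)[OF ci(1,2)]
    set_integral_mult_right set_integral_diff(2)[OF ci(3,4)])
 qed
 finally show ?thesis unfolding e_alt[OF t] e_alt[OF s] sym by simp
qed

end

context regularized
begin

text \<open>Dominated convergence for the difference quotient in \<open>e_diff\<close>. On the
  compact time window [t/2, 2 t] the mean value theorem bounds the quotient of \<open>v\<close> by
  the maximum of \<open>vt\<close>, and the pressure is bounded there as well.\<close>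

lemma e_deriv:
 assumes t: "0 < t"
 shows "(e has_real_derivative - (\<oint>x. vt t x * p t x)) (at t)"
proof -
 let ?I = "{0..2*pi}" and ?K = "{t/2..2*t} \<times> {0..2*pi}"
 have KS: "?K \<subseteq> S" using t by auto
 have cK: "compact ?K" by (intro compact_Times) auto
 have "continuous_on S (%(t, x). p t x)"
 proof -
  have "continuous_on S (%z. (case z of (t, x) => v2 t x) + \<alpha>^2 * (case z of (t, x) => v t x) + cos (snd z))"
   by (intro continuous_intros conts)
  then show ?thesis by (rule continuous_on_eq) (auto simp: p_def)
 qed
 note pc = this
 have bound: "EX B. \<forall>s\<in>{t/2..2*t}. \<forall>x\<in>?I. \<bar>f s x\<bar> <= B" if f: "continuous_on S (%(t, x). f t x)" for f :: "real => real => real"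
 proof -
  have "compact ((%(t, x). f t x) ` ?K)" by (rule compact_continuous_image[OF continuous_on_subset[OF f KS] cK])
  then obtain B where "\<forall>y\<in>(%(t, x). f t x) ` ?K. norm y <= B" using compact_imp_bounded bounded_iff by blast
  then show ?thesis by (intro exI[of _ B]) force
 qed
 obtain B1 where B1: "!!s x. s \<in> {t/2..2*t} ==> x \<in> ?I ==> \<bar>vt s x\<bar> <= B1" using bound[OF conts(5)] by blast
 obtain B2 where B2: "!!s x. s \<in> {t/2..2*t} ==> x \<in> ?I ==> \<bar>p s x\<bar> <= B2" using bound[OF pc] by blast
 have "((%s. (e s - e t) / (s - t)) \<longlongrightarrow> - (\<oint>x. vt t x * p t x)) (at t)"
  unfolding tendsto_at_iff_sequentially
 proof (intro allI impI)
  fix X :: "nat => real" assume X: "ALL i. X i \<in> UNIV - {t}" "X ----> t"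
  have "eventually (%i. t/2 < X i) sequentially" "eventually (%i. X i < 2 * t) sequentially"
   using t by (intro order_tendstoD[OF X(2)], simp)+
  then have ev: "eventually (%i. X i \<in> {t/2<..<2*t}) sequentially" by eventually_elim auto
  then obtain N where N: "!!i. X (i + N) \<in> {t/2<..<2*t}" unfolding eventually_sequentially by (metis le_add2)
  let ?Y = "%i. X (i + N)"
  have Y: "?Y ----> t" "!!i. ?Y i ~= t" using LIMSEQ_ignore_initial_segment[OF X(2)] X(1) by auto
  have Y0: "0 < ?Y i" for i using N[of i] t by auto
  let ?q = "%i x. - (1/2) * ((v (?Y i) x - v t x) / (?Y i - t) * (p (?Y i) x + p t x))"
  have eq: "(e (?Y i) - e t) / (?Y i - t) = (\<oint>x. ?q i x)" for i
  proof -
   have "(\<oint>x. ?q i x) = (\<oint>x. (1 / (?Y i - t)) * (- (1/2) * ((v (?Y i) x - v t x) * (p (?Y i) x + p t x))))"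
    by (rule arg_cong[where f="set_lebesgue_integral lborel ?I"]) (rule ext, simp)
   also have "... = (1 / (?Y i - t)) * (e (?Y i) - e t)" unfolding e_diff[OF t Y0] by (rule set_integral_mult_right)
   finally show ?thesis by simp
  qed
  have "(%i. \<oint>x. ?q i x) ----> (\<oint>x. - (1/2) * (vt t x * (p t x + p t x)))"
   unfolding set_lebesgue_integral_def
  proof (rule integral_dominated_convergence)
   show "integrable lborel (%x. indicat_real ?I x *\<^sub>R (B1 * (2 * B2)))"
    using cont_set_integrable[OF continuous_on_const] unfolding set_integrable_def by blast
   have "L1_on ?I (?q i)" for i
    using slice_conts[OF t] slice_conts[OF Y0] Y(2) by (intro cont_set_integrable continuous_intros) auto
   then show "(%x. indicat_real ?I x *\<^sub>R ?q i x) \<in> borel_measurable lborel" for i unfolding set_integrable_def by blast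
   have "L1_on ?I (%x. - (1/2) * (vt t x * (p t x + p t x)))"
    using slice_conts[OF t] by (intro cont_set_integrable continuous_intros) auto
   then show "(%x. indicat_real ?I x *\<^sub>R (- (1/2) * (vt t x * (p t x + p t x)))) \<in> borel_measurable lborel" unfolding set_integrable_def by blast
   show "AE x in lborel. (%i. indicat_real ?I x *\<^sub>R ?q i x) ----> indicat_real ?I x *\<^sub>R (- (1/2) * (vt t x * (p t x + p t x)))"
   proof (intro AE_I2)
    fix x
    have "((%s. (v s x - v t x) / (s - t)) \<longlongrightarrow> vt t x) (at t)"
     using derivs(4)[OF t] by (simp add: has_field_derivative_iff)
    then have a: "(%i. (v (?Y i) x - v t x) / (?Y i - t)) ----> vt t x"
     unfolding tendsto_at_iff_sequentially using Y by (auto simp: o_def)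
    have "isCont (%(t, x). p t x) (t, x)" using pc S_open t by (simp add: continuous_on_eq_continuous_at)
    then have b: "(%i. p (?Y i) x) ----> p t x"
     using isCont_tendsto_compose[of "(t, x)" "%(t, x). p t x" "%i. (?Y i, x)" sequentially] tendsto_Pair[OF Y(1) tendsto_const] by auto
    show "(%i. indicat_real ?I x *\<^sub>R ?q i x) ----> indicat_real ?I x *\<^sub>R (- (1/2) * (vt t x * (p t x + p t x)))"
     by (intro tendsto_intros a b)
   qed
   show "AE x in lborel. norm (indicat_real ?I x *\<^sub>R ?q i x) <= indicat_real ?I x *\<^sub>R (B1 * (2 * B2))" for i
   proof (intro AE_I2)
    fix x
    show "norm (indicat_real ?I x *\<^sub>R ?q i x) <= indicat_real ?I x *\<^sub>R (B1 * (2 * B2))"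
    proof (cases "x \<in> ?I")
     case True
     have q1: "\<bar>(v (?Y i) x - v t x) / (?Y i - t)\<bar> <= B1"
     proof -
      have mv: "EX z. t/2 < z & z < 2*t & v b x - v a x = (b - a) * vt z x" if "a < b" "t/2 < a" "b < 2 * t" for a b
      proof -
       have d: "((%s. v s x) has_real_derivative vt s x) (at s)" if "a <= s" for s
        by (rule derivs(4)) (use that \<open>t/2 < a\<close> t in linarith)
       obtain z where z: "a < z" "z < b" "v b x - v a x = (b - a) * vt z x"
        using MVT2[OF \<open>a < b\<close>, of "%s. v s x" "%s. vt s x"] d by blast
       then have "t/2 < z" "z < 2 * t" using that by linarith+
       then show ?thesis using z by blast
      qed
      have "EX z. t/2 < z & z < 2*t & (v (?Y i) x - v t x) / (?Y i - t) = vt z x"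
      proof (cases "?Y i < t")
       case True
       then obtain z where "t/2 < z" "z < 2*t" "v t x - v (?Y i) x = (t - ?Y i) * vt z x" using mv[OF True] N[of i] t by auto
       moreover from this have "v (?Y i) x - v t x = (?Y i - t) * vt z x" by (simp add: algebra_simps)
       ultimately show ?thesis using Y(2)[of i] by auto
      next
       case False
       then have "t < ?Y i" using Y(2)[of i] by simp
       then obtain z where "t/2 < z" "z < 2*t" "v (?Y i) x - v t x = (?Y i - t) * vt z x" using mv[of t "?Y i"] N[of i] t by auto
       then show ?thesis using Y(2)[of i] by auto
      qed
      then show ?thesis using B1[OF _ True] by (metis atLeastAtMost_iff less_imp_le)
     qed
     have q2: "\<bar>p (?Y i) x + p t x\<bar> <= 2 * B2"
     proof -
      have "\<bar>p (?Y i) x\<bar> <= B2" using N[of i] by (intro B2[OF _ True]) auto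
      moreover have "\<bar>p t x\<bar> <= B2" using t by (intro B2[OF _ True]) auto
      ultimately show ?thesis by linarith
     qed
     have prod: "\<bar>(v (?Y i) x - v t x) / (?Y i - t) * (p (?Y i) x + p t x)\<bar> <= B1 * (2 * B2)"
      unfolding abs_mult[of "(v (?Y i) x - v t x) / (?Y i - t)"]
      by (rule mult_mono[OF q1 q2 order_trans[OF abs_ge_zero q1] abs_ge_zero])
     have half: "norm (- (1/2) * Z) <= C" if "\<bar>Z\<bar> <= C" for Z C :: real unfolding real_norm_def using that by linarith
     have i1: "indicat_real ?I x = 1" using True by simp
     show ?thesis unfolding i1 scaleR_one by (rule half[OF prod])
    qed simp
   qed
  qed
  then have "(%i. (e (?Y i) - e t) / (?Y i - t)) ----> (\<oint>x. - (1/2) * (vt t x * (p t x + p t x)))"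
   unfolding eq .
  moreover have "(\<oint>x. - (1/2) * (vt t x * (p t x + p t x))) = - (\<oint>x. vt t x * p t x)"
   by (simp add: set_lebesgue_integral_def)
  ultimately have "(%i. (e (X (i + N)) - e t) / (X (i + N) - t)) ----> - (\<oint>x. vt t x * p t x)" by simp
  then show "((%s. (e s - e t) / (s - t)) \<circ> X) ----> - (\<oint>x. vt t x * p t x)"
   unfolding o_def by (rule LIMSEQ_offset)
 qed
 then show ?thesis by (simp add: has_field_derivative_iff)
qed

text \<open>By the equation \<open>- vt\<close> is the space derivative of the flux
  \<open>g (v t y) * p1 t y\<close>, so integrating by parts turns the integral into that of
  \<open>g\<close> times the square of the pressure gradient.\<close>

lemma dissipation_sign:
 assumes t: "0 < t"
 shows "0 <= (\<oint>x. vt t x * p t x)"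
proof -
 let ?I = "{0..2*pi}"
 let ?J = "%y. g (v t y) * p1 t y"
 have pe: "deriv (%z. (deriv ^^ 2) (v t) z + \<alpha>^2 * v t z + cos z) y = p1 t y" for y
  using DERIV_imp_deriv[OF derivs(5)[OF t]] unfolding p_def[abs_def] v2_def v1_def by (simp add: numeral_2_eq_2)
 have Jd: "(?J has_real_derivative - vt t x) (at x)" for x
 proof -
  have "\<forall>t>0. ALL x. ((%y. g (v t y) * deriv (%z. (deriv ^^ 2) (v t) z + \<alpha>^2 * v t z + cos z) y)
   has_real_derivative - deriv (%s. v s x) t) (at x)"
   using sol unfolding regularized_solution_def by (elim conjE)
  from this[rule_format, OF t, of x] show ?thesis unfolding pe vt_def .
 qed
 have pJ: "primitive ?J (%x. - vt t x)"
  by (rule primitive_of_deriv[OF Jd]) (intro continuous_intros slice_conts[OF t])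
 have "(\<oint>x. ?J x * p1 t x) + (\<oint>x. p t x * - vt t x) = 0"
  using integral_by_parts_primitive[OF pJ prims(3)[OF t], of 0 "2*pi"] pers0[OF t] by simp
 moreover have "(\<oint>x. p t x * - vt t x) = - (\<oint>x. vt t x * p t x)"
  by (simp add: set_lebesgue_integral_def mult.commute)
 moreover have "0 <= (\<oint>x. ?J x * p1 t x)"
  by (rule set_integral_nonneg) (simp add: g_nonneg mult.assoc)
 ultimately show ?thesis by simp
qed

theorem e_decreasing:
 assumes "0 < s" "s <= t" shows "e t <= e s"
proof (rule DERIV_nonpos_imp_nonincreasing[OF assms(2)])
 fix r assume "s <= r" "r <= t"
 then have r: "0 < r" using assms by simp
 show "EX y. DERIV e r :> y & y <= 0" using e_deriv[OF r] dissipation_sign[OF r] by (intro exI conjI) auto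
qed

end

section \<open>Uniform boundedness and duality in L2\<close>

text \<open>Sokal's gliding hump: the partial sums \<open>P k\<close> of a geometric series with suitably chosen signs
 converge in \<open>L\<^sup>2\<close> to a function whose pairing with the \<open>k\<close>-th function is of order
 \<open>3\<^sup>-\<^sup>k\<close> times its norm.\<close>

lemma L2_uniformly_bounded:
 fixes F :: "nat => 'a => real"
 assumes m[measurable]: "!!j. F j \<in> borel_measurable M" and i: "!!j. integrable M (%x. (F j x)^2)"
  and b: "!!\<psi>. \<psi> \<in> borel_measurable M ==> integrable M (%x. (\<psi> x)^2) ==> EX B. ALL j. \<bar>\<integral>x. F j x * \<psi> x \<partial>M\<bar> <= B"
 shows "EX C. ALL j. (\<integral>x. (F j x)^2 \<partial>M) <= C"
proof (rule ccontr)
 assume "\<nexists>C. ALL j. (\<integral>x. (F j x)^2 \<partial>M) <= C"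
 then have "ALL k. EX j. (9 ^ k)^2 < (\<integral>x. (F j x)^2 \<partial>M)" by (meson not_le)
 \<comment> \<open>Norms above 9^k beat the coefficients 3^-k to come: the pairing with the k-th
   chosen function will be at least 3^k / 2.\<close>
 then obtain j where j: "!!k::nat. (9 ^ k)^2 < (\<integral>x. (F (j k) x)^2 \<partial>M)" by metis
 define N where "N k = sqrt (\<integral>x. (F (j k) x)^2 \<partial>M)" for k
 have N: "9 ^ k < N k" "0 < N k" "(N k)^2 = (\<integral>x. (F (j k) x)^2 \<partial>M)" for k
 proof -
  show "9 ^ k < N k" unfolding N_def by (rule real_less_rsqrt[OF j])
  then show "0 < N k" by (meson less_trans zero_less_numeral zero_less_power)
  show "(N k)^2 = (\<integral>x. (F (j k) x)^2 \<partial>M)" unfolding N_def by simp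
 qed
 define h where "h k x = F (j k) x / N k" for k x
 have hm[measurable]: "h k \<in> borel_measurable M" for k unfolding h_def by measurable
 have h2: "integrable M (%x. (h k x)^2)" "(\<integral>x. (h k x)^2 \<partial>M) = 1" for k
 proof -
  have e: "(%x. (h k x)^2) = (%x. (F (j k) x)^2 / (N k)^2)" by (auto simp: h_def power_divide)
  show "integrable M (%x. (h k x)^2)" unfolding e using i by simp
  show "(\<integral>x. (h k x)^2 \<partial>M) = 1"
   unfolding e integral_divide_zero N(3)[symmetric] using N(2)[of k] by simp
 qed
 define c where "c k = (1/3::real) ^ k" for k
 have c: "0 < c k" for k by (simp add: c_def)
 have csum: "(\<Sum>i<n. c i) <= 3/2" for n
 proof -
  have cS: "c (Suc n) = c n / 3" for n by (simp add: c_def)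
  have "(\<Sum>i<n. c i) = 3/2 - 3/2 * c n" by (induction n) (simp_all add: cS, simp add: c_def)
  then show ?thesis using c[of n] by linarith
 qed
 \<comment> \<open>All coefficients after the k-th together reach at most half of it, so later terms
   cannot undo more than half of what the k-th contributes.\<close>
 have ctail: "(\<Sum>i\<in>{Suc k..<n}. c i) <= c k / 2" for k n
 proof (induction n)
  case (Suc n)
  have "(\<Sum>i\<in>{Suc k..<n}. c i) <= c k / 2 - c n / 2 * 3 \<or> n <= k" if "Suc k <= n" for n
   using that
  proof (induction n rule: dec_induct)
   case base
   then show ?case by (simp add: c_def)
  next
   case (step n)
   then show ?case by (simp add: c_def)
  qed
  from this[of "Suc n"] show ?case using c[of "Suc n"] c[of k] by (cases "Suc k <= Suc n") (auto simp: not_le)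
 qed (use c[of k] in simp)
 \<comment> \<open>The sign is chosen so that the new term, whose own pairing is
   \<open>c k * N k\<close>, adds to the pairing accumulated so far instead of cancelling
   it.\<close>
 define P where "P = rec_nat (%x. 0) (%k p x. p x + (if 0 <= (\<integral>x. F (j k) x * p x \<partial>M) then 1 else -1) * c k * h k x)"
 define s where "s k = (if 0 <= (\<integral>x. F (j k) x * P k x \<partial>M) then 1 else -1 :: real)" for k
 have P0: "P 0 x = 0" and PS: "P (Suc k) x = P k x + s k * c k * h k x" for k x by (simp_all add: P_def s_def)
 have s1: "\<bar>s k\<bar> = 1" for k by (simp add: s_def)
 have Psum: "P n x = (\<Sum>k<n. s k * c k * h k x)" for n x by (induction n) (auto simp: P0 PS)
 have Pm[measurable]: "P n \<in> borel_measurable M" for n unfolding Psum[abs_def] by measurable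
 define Q where "Q x = (\<Sum>k. c k * (h k x)^2)" for x
 have cs: "summable c" unfolding c_def by simp
 have ae: "AE x in M. summable (%k. c k * (h k x)^2)"
 proof -
  have "(\<integral>\<^sup>+x. (\<Sum>k. ennreal (c k * (h k x)^2)) \<partial>M) = (\<Sum>k. \<integral>\<^sup>+x. ennreal (c k * (h k x)^2) \<partial>M)"
   by (rule nn_integral_suminf) simp
  also have "... = (\<Sum>k. ennreal (c k))"
  proof (rule suminf_cong)
   fix k
   have "(\<integral>\<^sup>+x. ennreal (c k * (h k x)^2) \<partial>M) = ennreal (\<integral>x. c k * (h k x)^2 \<partial>M)"
    by (rule nn_integral_eq_integral) (use h2 c[of k] in auto)
   then show "(\<integral>\<^sup>+x. ennreal (c k * (h k x)^2) \<partial>M) = ennreal (c k)" by (simp add: h2)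
  qed
  also have "... = ennreal (suminf c)" by (rule suminf_ennreal2[OF less_imp_le[OF c] cs])
  also have "... < \<infinity>" by simp
  finally have "AE x in M. (\<Sum>k. ennreal (c k * (h k x)^2)) ~= \<infinity>"
   by (intro nn_integral_PInf_AE) auto
  then show ?thesis
  proof eventually_elim
   case (elim x)
   then show ?case using c by (intro summable_suminf_not_top) (auto simp: less_imp_le)
  qed
 qed
 have Qi: "integrable M Q" unfolding Q_def
 proof (rule integrable_suminf)
  show "integrable M (%x. c k * (h k x)^2)" for k using h2 by simp
  show "AE x in M. summable (%k. norm (c k * (h k x)^2))" using ae by eventually_elim (use c in "simp add: abs_mult less_imp_le")
  show "summable (%k. \<integral>x. norm (c k * (h k x)^2) \<partial>M)" using h2 c cs by (simp add: abs_mult less_imp_le)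
 qed
 have Qm[measurable]: "Q \<in> borel_measurable M" using Qi by simp
 \<comment> \<open>A square-integrable majorant of all partial sums, obtained from Cauchy-Schwarz
   with the weights \<open>c\<close>, whose sum is at most 3/2.\<close>
 define R where "R x = sqrt (3/2 * Q x)" for x
 have bound: "(\<Sum>i<n. c i * \<bar>h i x\<bar>) <= R x" if "summable (%k. c k * (h k x)^2)" for n x
 proof -
  have "(\<Sum>i<n. sqrt (c i) * (sqrt (c i) * \<bar>h i x\<bar>))^2 <= (\<Sum>i<n. (sqrt (c i))^2) * (\<Sum>i<n. (sqrt (c i) * \<bar>h i x\<bar>)^2)"
   by (rule Cauchy_Schwarz_ineq_sum)
  also have "... = (\<Sum>i<n. c i) * (\<Sum>i<n. c i * (h i x)^2)" using c by (simp add: power_mult_distrib less_imp_le)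
  also have "... <= 3/2 * Q x"
  proof (rule mult_mono[OF csum])
   show "(\<Sum>i<n. c i * (h i x)^2) <= Q x" unfolding Q_def by (rule sum_le_suminf[OF that]) (use c in "auto simp: less_imp_le")
  qed (use c in "auto intro!: sum_nonneg simp: less_imp_le")
  finally have "(\<Sum>i<n. c i * \<bar>h i x\<bar>)^2 <= 3/2 * Q x" using c by (simp add: mult.assoc[symmetric] less_imp_le)
  then show ?thesis unfolding R_def by (rule real_le_rsqrt)
 qed
 have ae2: "AE x in M. summable (%k. s k * c k * h k x) & (ALL n. \<bar>P n x\<bar> <= R x) & 0 <= Q x"
  using ae
 proof eventually_elim
  case (elim x)
  have "summable (%k. c k * \<bar>h k x\<bar>)"
   by (rule summableI_nonneg_bounded[of _ "R x"]) (use bound[OF elim] c in "auto simp: less_imp_le")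
  then have "summable (%k. norm (s k * c k * h k x))" using c s1 by (simp add: abs_mult less_imp_le)
  then have 1: "summable (%k. s k * c k * h k x)" by (rule summable_norm_cancel)
  have 2: "\<bar>P n x\<bar> <= R x" for n
  proof -
   have "\<bar>P n x\<bar> <= (\<Sum>i<n. \<bar>s i * c i * h i x\<bar>)" unfolding Psum by (rule sum_abs)
   also have "... = (\<Sum>i<n. c i * \<bar>h i x\<bar>)" using c s1 by (simp add: abs_mult less_imp_le)
   finally show ?thesis using bound[OF elim, of n] by simp
  qed
  have 3: "0 <= Q x" unfolding Q_def by (rule suminf_nonneg[OF elim]) (use c in "auto simp: less_imp_le")
  show ?case using 1 2 3 by blast
 qed
 define \<psi> where "\<psi> x = (\<Sum>k. s k * c k * h k x)" for x
 have lim: "AE x in M. (%n. P n x) ----> \<psi> x"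
  using ae2 by eventually_elim (use summable_LIMSEQ in \<open>auto simp: Psum \<psi>_def\<close>)
 have psim[measurable]: "\<psi> \<in> borel_measurable M" unfolding \<psi>_def by measurable
 have Rm[measurable]: "R \<in> borel_measurable M" unfolding R_def by measurable
 have R2: "integrable M (%x. (R x)^2)"
 proof (rule integrable_cong_AE_imp)
  show "integrable M (%x. 3/2 * Q x)" using Qi by simp
  show "AE x in M. 3/2 * Q x = (R x)^2" using ae2 by eventually_elim (simp add: R_def)
 qed simp
 have psiR: "AE x in M. \<bar>\<psi> x\<bar> <= R x"
  using lim ae2
 proof eventually_elim
  case (elim x)
  have "(%n. \<bar>P n x\<bar>) ----> \<bar>\<psi> x\<bar>" using elim by (intro tendsto_rabs) auto
  then show ?case by (rule LIMSEQ_le_const2) (use elim in auto)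
 qed
 have psi2: "integrable M (%x. (\<psi> x)^2)"
 proof (rule Bochner_Integration.integrable_bound[OF R2])
  show "AE x in M. norm ((\<psi> x)^2) <= norm ((R x)^2)"
   using psiR by eventually_elim (simp, rule abs_le_square_iff[THEN iffD1], simp)
 qed simp
 obtain B where B: "!!j. \<bar>\<integral>x. F j x * \<psi> x \<partial>M\<bar> <= B" using b[OF psim psi2] by blast
 have Fh: "integrable M (%x. F (j k) x * h i x)" "\<bar>\<integral>x. F (j k) x * h i x \<partial>M\<bar> <= N k" for k i
 proof -
  show "integrable M (%x. F (j k) x * h i x)" by (rule cauchy_schwarz_integral(1)) (use i h2 in auto)
  have "\<bar>\<integral>x. F (j k) x * h i x \<partial>M\<bar> <= (\<integral>x. \<bar>F (j k) x * h i x\<bar> \<partial>M)" by (rule integral_abs_bound)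
  also have "... <= sqrt (\<integral>x. (F (j k) x)^2 \<partial>M) * sqrt (\<integral>x. (h i x)^2 \<partial>M)" by (rule cauchy_schwarz_integral(3)) (use i h2 in auto)
  finally show "\<bar>\<integral>x. F (j k) x * h i x \<partial>M\<bar> <= N k" by (simp add: h2 N_def)
 qed
 define p where "p k n = (\<integral>x. F (j k) x * P n x \<partial>M)" for k n
 have FP: "integrable M (%x. F (j k) x * P n x)" for k n
 proof (induction n)
  case (Suc n)
  have "(%x. F (j k) x * P (Suc n) x) = (%x. F (j k) x * P n x + (s n * c n) * (F (j k) x * h n x))" by (auto simp: PS algebra_simps)
  then show ?case using Suc Fh(1) by simp
 qed (simp add: P0)
 have pS: "p k (Suc n) = p k n + s n * c n * (\<integral>x. F (j k) x * h n x \<partial>M)" for k n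
 proof -
  have "(%x. F (j k) x * P (Suc n) x) = (%x. F (j k) x * P n x + (s n * c n) * (F (j k) x * h n x))" by (auto simp: PS algebra_simps)
  then show ?thesis unfolding p_def using FP Fh(1) by simp
 qed
 have own: "(\<integral>x. F (j k) x * h k x \<partial>M) = N k" for k
 proof -
  have "(\<integral>x. F (j k) x * h k x \<partial>M) = (\<integral>x. (F (j k) x)^2 / N k \<partial>M)" by (simp add: h_def power2_eq_square)
  also have "... = (N k)^2 / N k" unfolding N(3) by simp
  finally show ?thesis using N(2)[of k] by (simp add: power2_eq_square)
 qed
 have big: "c k * N k <= \<bar>p k (Suc k)\<bar>" for k
 proof -
  have "p k (Suc k) = p k k + s k * (c k * N k)" unfolding pS own by simp
  moreover have "s k = (if 0 <= p k k then 1 else -1)" by (simp add: s_def p_def)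
  moreover have "0 < c k * N k" using c N by simp
  ultimately show ?thesis by auto
 qed
 have tail: "\<bar>p k n - p k (Suc k)\<bar> <= (\<Sum>i\<in>{Suc k..<n}. c i) * N k" if "Suc k <= n" for k n
  using that
 proof (induction n rule: dec_induct)
  case (step n)
  have "\<bar>s n * c n * (\<integral>x. F (j k) x * h n x \<partial>M)\<bar> <= c n * N k"
   using Fh(2)[of k n] c[of n] s1[of n] by (simp add: abs_mult less_imp_le)
  then have "\<bar>p k (Suc n) - p k (Suc k)\<bar> <= (\<Sum>i\<in>{Suc k..<n}. c i) * N k + c n * N k"
   using step.IH pS[of k n] by linarith
  then show ?case using step.hyps by (simp add: algebra_simps)
 qed simp
 have half: "c k * N k / 2 <= \<bar>p k n\<bar>" if "Suc k <= n" for k n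
 proof -
  have "(\<Sum>i\<in>{Suc k..<n}. c i) * N k <= c k / 2 * N k" using ctail N(2)[of k] by (intro mult_right_mono) (auto simp: less_imp_le)
  then have "\<bar>p k n - p k (Suc k)\<bar> <= c k * N k / 2" using tail[OF that] by simp
  then show ?thesis using big[of k] by linarith
 qed
 have plim: "(%n. p k n) ----> (\<integral>x. F (j k) x * \<psi> x \<partial>M)" for k
  unfolding p_def
 proof (rule integral_dominated_convergence)
  show "integrable M (%x. \<bar>F (j k) x * R x\<bar>)" by (intro integrable_abs cauchy_schwarz_integral(1)) (use i R2 in auto)
  show "AE x in M. (%n. F (j k) x * P n x) ----> F (j k) x * \<psi> x" using lim by eventually_elim (intro tendsto_intros)
  show "AE x in M. norm (F (j k) x * P n x) <= \<bar>F (j k) x * R x\<bar>" for n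
   using ae2
  proof eventually_elim
   case (elim x)
   then have "\<bar>P n x\<bar> <= \<bar>R x\<bar>" by (meson abs_ge_self order_trans)
   then show ?case by (simp add: abs_mult mult_left_mono)
  qed
 qed simp_all
 have "3 ^ k / 2 <= B" for k
 proof -
  have "c k * N k / 2 <= \<bar>\<integral>x. F (j k) x * \<psi> x \<partial>M\<bar>"
  proof (rule LIMSEQ_le_const[OF tendsto_rabs[OF plim]])
   show "EX N'. \<forall>n\<ge>N'. c k * N k / 2 <= \<bar>p k n\<bar>" using half by blast
  qed
  also have "... <= B" by (rule B)
  finally have "c k * N k / 2 <= B" .
  moreover have "3 ^ k = c k * 9 ^ k" unfolding c_def by (simp add: power_mult_distrib[symmetric])
  moreover have "c k * 9 ^ k <= c k * N k" using N(1)[of k] c[of k] by (intro mult_left_mono) auto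
  ultimately show ?thesis by linarith
 qed
 moreover obtain k where "2 * B < 3 ^ k" using real_arch_pow[of 3 "2 * B"] by auto
 ultimately show False by (smt (verit) field_sum_of_halves)
qed

lemma AE_continuous_approximation:
 fixes g :: "real => real"
 assumes "g \<in> borel_measurable borel"
 obtains G where "!!n::nat. continuous_on UNIV (G n)" "AE x in lborel. (%n. G n x) ----> g x"
proof -
 have "g \<in> borel_measurable (lebesgue_on UNIV)"
  by (intro measurable_restrict_space1 measurable_completion) (use assms in simp)
 then have "g measurable_on UNIV" by (subst measurable_on_iff_borel_measurable) auto
 then obtain N G where NG: "negligible N" "!!n. continuous_on UNIV (G n)" "!!x. x \<notin> N ==> (%n. G n x) ----> g x"
  unfolding measurable_on_def by auto
 have "AE x in lebesgue. x \<notin> N" using NG(1) by (simp add: negligible_iff_null_sets AE_not_in)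
 then have "AE x in lborel. x \<notin> N" by (simp add: AE_completion_iff)
 then have "AE x in lborel. (%n. G n x) ----> g x" by eventually_elim (rule NG(3))
 then show ?thesis using that NG(2) by blast
qed

text \<open>The tested inequality passes from polynomials to continuous functions by Weierstrass,
  and from these to truncations of \<open>g\<close> by almost everywhere approximation under a
  common bound. Testing with a truncation bounds the square of its norm by \<open>L\<close> times
  its norm; monotone truncation levels then recover \<open>g\<close>.\<close>

lemma L2_norm_bound_by_duality:
 fixes g :: "real => real"
 assumes gm: "g \<in> borel_measurable borel" and g2: "L1_on {a..b} (%x. (g x)^2)" and L: "0 <= L"
  and test: "!!\<phi> \<phi>'. primitive \<phi> \<phi>' ==> (LINT x:{a..b}|lborel. g x * \<phi> x) <= L * sqrt (LINT x:{a..b}|lborel. (\<phi> x)^2)"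
 shows "(LINT x:{a..b}|lborel. (g x)^2) <= L^2"
proof -
 let ?I = "{a..b}"
 have one: "L1_on ?I (%_. c :: real)" for c by (intro cont_set_integrable continuous_intros)
 have gi: "L1_on ?I g"
 proof -
  have "L1_on ?I (%x. g x * 1)"
   by (rule set_integrable_mult_L2(1)) (use gm g2 one in "auto simp: set_borel_measurable_def")
  then show ?thesis by simp
 qed
 have cont: "(LINT x:?I|lborel. g x * \<phi> x) <= L * sqrt (LINT x:?I|lborel. (\<phi> x)^2)" if c: "continuous_on ?I \<phi>" for \<phi>
 proof -
  have "ALL n. EX q. real_polynomial_function q & (\<forall>x\<in>?I. \<bar>\<phi> x - q x\<bar> < 1 / real (Suc n))"
   using Stone_Weierstrass_real_polynomial_function[OF compact_Icc c] by (metis zero_less_divide_1_iff of_nat_0_less_iff zero_less_Suc)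
  then obtain q where q: "!!n. real_polynomial_function (q n)" "!!n x. x \<in> ?I ==> \<bar>\<phi> x - q n x\<bar> < 1 / real (Suc n)" by metis
  have qt: "(%n. q n x) ----> \<phi> x" if "x \<in> ?I" for x
  proof -
   have "(%n. q n x - \<phi> x) ----> 0"
   proof (rule Lim_null_comparison)
    show "\<forall>\<^sub>F n in sequentially. norm (q n x - \<phi> x) <= 1 / real (Suc n)"
     using q(2)[OF that] by (intro always_eventually allI) (simp add: abs_minus_commute less_imp_le)
    show "(%n. 1 / real (Suc n)) ----> 0" by (rule LIMSEQ_Suc[OF lim_1_over_n])
   qed
   then show ?thesis by (simp add: LIM_zero_iff)
  qed
  have "compact (\<phi> ` ?I)" by (rule compact_continuous_image[OF c compact_Icc])
  then obtain B where B: "!!x. x \<in> ?I ==> \<bar>\<phi> x\<bar> <= B"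
   by (metis (no_types, lifting) bounded_iff compact_imp_bounded image_eqI real_norm_def)
  have qB: "\<bar>q n x\<bar> <= B + 1" if "x \<in> ?I" for n x
  proof -
   have "1 / real (Suc n) <= 1" by simp
   then show ?thesis using q(2)[OF that, of n] B[OF that] by linarith
  qed
  have qc: "continuous_on S (q n)" for S n using q(1) continuous_on_polymonial_function by (simp add: continuous_on_polymonial_function real_polynomial_function_eq)
  have ineq: "(LINT x:?I|lborel. g x * q n x) <= L * sqrt (LINT x:?I|lborel. (q n x)^2)" for n
  proof -
   obtain q' where q': "real_polynomial_function q'" "!!x. (q n has_real_derivative q' x) (at x)"
    using has_real_derivative_polynomial_function[OF q(1)] by blast
   have "continuous_on UNIV q'" using q'(1) by (simp add: continuous_on_polymonial_function real_polynomial_function_eq)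
   then show ?thesis by (intro test[OF primitive_of_deriv[OF q'(2)]])
  qed
  have t1: "(%n. LINT x:?I|lborel. g x * q n x) ----> (LINT x:?I|lborel. g x * \<phi> x)"
   unfolding set_lebesgue_integral_def
  proof (rule integral_dominated_convergence)
   show "integrable lborel (%x. \<bar>(B + 1) * (indicat_real ?I x *\<^sub>R g x)\<bar>)"
    using gi unfolding set_integrable_def by (intro integrable_abs integrable_mult_right)
   show "(%x. indicat_real ?I x *\<^sub>R (g x * \<phi> x)) \<in> borel_measurable lborel"
    using set_integrable_cont_mult[OF c gi] unfolding set_integrable_def by (simp add: mult.commute)
   show "(%x. indicat_real ?I x *\<^sub>R (g x * q n x)) \<in> borel_measurable lborel" for n
    using set_integrable_cont_mult[OF qc gi, of n] unfolding set_integrable_def by (simp add: mult.commute)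
   show "AE x in lborel. (%n. indicat_real ?I x *\<^sub>R (g x * q n x)) ----> indicat_real ?I x *\<^sub>R (g x * \<phi> x)"
   proof (intro AE_I2)
    fix x show "(%n. indicat_real ?I x *\<^sub>R (g x * q n x)) ----> indicat_real ?I x *\<^sub>R (g x * \<phi> x)"
     by (cases "x \<in> ?I") (auto intro!: tendsto_intros qt)
   qed
   show "AE x in lborel. norm (indicat_real ?I x *\<^sub>R (g x * q n x)) <= \<bar>(B + 1) * (indicat_real ?I x *\<^sub>R g x)\<bar>" for n
   proof (intro AE_I2)
    fix x show "norm (indicat_real ?I x *\<^sub>R (g x * q n x)) <= \<bar>(B + 1) * (indicat_real ?I x *\<^sub>R g x)\<bar>"
    proof (cases "x \<in> ?I")
     case True
     have "\<bar>g x\<bar> * \<bar>q n x\<bar> <= \<bar>g x\<bar> * \<bar>B + 1\<bar>" using qB[OF True, of n] by (intro mult_left_mono) auto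
     then show ?thesis using True by (simp add: abs_mult mult.commute)
    qed simp
   qed
  qed
  have t2: "(%n. LINT x:?I|lborel. (q n x)^2) ----> (LINT x:?I|lborel. (\<phi> x)^2)"
   unfolding set_lebesgue_integral_def
  proof (rule integral_dominated_convergence)
   show "integrable lborel (%x. indicat_real ?I x *\<^sub>R ((B + 1)^2))"
    using one unfolding set_integrable_def by blast
   have "L1_on ?I (%x. (\<phi> x)^2)" by (intro cont_set_integrable continuous_intros c)
   then show "(%x. indicat_real ?I x *\<^sub>R (\<phi> x)\<^sup>2) \<in> borel_measurable lborel" unfolding set_integrable_def by blast
   have "L1_on ?I (%x. (q n x)^2)" for n by (intro cont_set_integrable continuous_intros qc)
   then show "(%x. indicat_real ?I x *\<^sub>R (q n x)\<^sup>2) \<in> borel_measurable lborel" for n unfolding set_integrable_def by blast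
   show "AE x in lborel. (%n. indicat_real ?I x *\<^sub>R (q n x)\<^sup>2) ----> indicat_real ?I x *\<^sub>R (\<phi> x)\<^sup>2"
   proof (intro AE_I2)
    fix x show "(%n. indicat_real ?I x *\<^sub>R (q n x)\<^sup>2) ----> indicat_real ?I x *\<^sub>R (\<phi> x)\<^sup>2"
     by (cases "x \<in> ?I") (auto intro!: tendsto_intros qt)
   qed
   show "AE x in lborel. norm (indicat_real ?I x *\<^sub>R (q n x)\<^sup>2) <= indicat_real ?I x *\<^sub>R ((B + 1)^2)" for n
   proof (intro AE_I2)
    fix x show "norm (indicat_real ?I x *\<^sub>R (q n x)\<^sup>2) <= indicat_real ?I x *\<^sub>R ((B + 1)^2)"
    proof (cases "x \<in> ?I")
     case True
     have "\<bar>q n x\<bar>\<^sup>2 <= (B + 1)^2" using qB[OF True, of n] by (intro power_mono) auto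
     then show ?thesis using True by simp
    qed simp
   qed
  qed
  show ?thesis by (rule LIMSEQ_le[OF t1 tendsto_mult[OF tendsto_const tendsto_real_sqrt[OF t2]]]) (use ineq in blast)
 qed
 define T where "T N x = max (- real N) (min (real N) (g x))" for N x
 have Tm: "T N \<in> borel_measurable borel" for N unfolding T_def using gm by measurable
 have Tb: "\<bar>T N x\<bar> <= real N" for N x by (auto simp: T_def)
 obtain G where G: "!!n::nat. continuous_on UNIV (G n)" "AE x in lborel. (%n. G n x) ----> g x"
  by (rule AE_continuous_approximation[OF gm]) (rule that; assumption)
 have trunc: "(LINT x:?I|lborel. g x * T N x) <= L * sqrt (LINT x:?I|lborel. (T N x)^2)" for N
 proof -
  define H where "H n x = max (- real N) (min (real N) (G n x))" for n x
  have Hc: "continuous_on S (H n)" for S n unfolding H_def by (intro continuous_intros continuous_on_subset[OF G(1)]) auto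
  have Hb: "\<bar>H n x\<bar> <= real N" for n x by (auto simp: H_def)
  have Ht: "AE x in lborel. (%n. H n x) ----> T N x" using G(2) unfolding H_def T_def
   by eventually_elim (intro tendsto_intros)
  have t1: "(%n. LINT x:?I|lborel. g x * H n x) ----> (LINT x:?I|lborel. g x * T N x)"
   unfolding set_lebesgue_integral_def
  proof (rule integral_dominated_convergence)
   show "integrable lborel (%x. \<bar>real N * (indicat_real ?I x *\<^sub>R g x)\<bar>)"
    using gi unfolding set_integrable_def by (intro integrable_abs integrable_mult_right)
   show "(%x. indicat_real ?I x *\<^sub>R (g x * T N x)) \<in> borel_measurable lborel" using gm Tm by measurable
   show "(%x. indicat_real ?I x *\<^sub>R (g x * H n x)) \<in> borel_measurable lborel" for n
    using gm borel_measurable_continuous_onI[OF Hc] by measurable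
   show "AE x in lborel. (%n. indicat_real ?I x *\<^sub>R (g x * H n x)) ----> indicat_real ?I x *\<^sub>R (g x * T N x)"
    using Ht by eventually_elim (intro tendsto_intros)
   show "AE x in lborel. norm (indicat_real ?I x *\<^sub>R (g x * H n x)) <= \<bar>real N * (indicat_real ?I x *\<^sub>R g x)\<bar>" for n
   proof (intro AE_I2)
    fix x
    have "\<bar>g x\<bar> * \<bar>H n x\<bar> <= \<bar>g x\<bar> * real N" by (rule mult_left_mono[OF Hb]) simp
    then show "norm (indicat_real ?I x *\<^sub>R (g x * H n x)) <= \<bar>real N * (indicat_real ?I x *\<^sub>R g x)\<bar>"
     by (simp add: indicator_def abs_mult mult.commute)
   qed
  qed
  have t2: "(%n. LINT x:?I|lborel. (H n x)^2) ----> (LINT x:?I|lborel. (T N x)^2)"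
   unfolding set_lebesgue_integral_def
  proof (rule integral_dominated_convergence)
   show "integrable lborel (%x. indicat_real ?I x *\<^sub>R ((real N)^2))"
    using one unfolding set_integrable_def by blast
   show "(%x. indicat_real ?I x *\<^sub>R (T N x)\<^sup>2) \<in> borel_measurable lborel" using Tm by measurable
   show "(%x. indicat_real ?I x *\<^sub>R (H n x)\<^sup>2) \<in> borel_measurable lborel" for n
    using borel_measurable_continuous_onI[OF Hc] by measurable
   show "AE x in lborel. (%n. indicat_real ?I x *\<^sub>R (H n x)\<^sup>2) ----> indicat_real ?I x *\<^sub>R (T N x)\<^sup>2"
    using Ht by eventually_elim (intro tendsto_intros)
   show "AE x in lborel. norm (indicat_real ?I x *\<^sub>R (H n x)\<^sup>2) <= indicat_real ?I x *\<^sub>R ((real N)^2)" for n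
   proof (intro AE_I2)
    fix x
    have "\<bar>H n x\<bar>\<^sup>2 <= (real N)^2" by (rule power_mono[OF Hb]) simp
    then show "norm (indicat_real ?I x *\<^sub>R (H n x)\<^sup>2) <= indicat_real ?I x *\<^sub>R ((real N)^2)"
     by (simp add: indicator_def)
   qed
  qed
  show ?thesis by (rule LIMSEQ_le[OF t1 tendsto_mult[OF tendsto_const tendsto_real_sqrt[OF t2]]]) (use cont[OF Hc] in blast)
 qed
 have T2: "(T N x)^2 <= (real N)^2" for N x
  using power_mono[OF Tb[of N x], of 2] by simp
 have Ti: "L1_on ?I (%x. (T N x)^2)" for N
  by (rule set_integrable_bound[OF one[of "(real N)^2"]]) (use Tm T2 in "auto simp: set_borel_measurable_def")
 have TL: "(LINT x:?I|lborel. (T N x)^2) <= L^2" for N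
 proof -
  let ?q = "LINT x:?I|lborel. (T N x)^2"
  have q0: "0 <= ?q" by (rule set_integral_nonneg) simp
  have gTi: "L1_on ?I (%x. g x * T N x)"
   by (rule set_integrable_mult_L2(1)) (use gm Tm g2 Ti in "auto simp: set_borel_measurable_def")
  have "?q <= (LINT x:?I|lborel. g x * T N x)"
  proof (rule set_integral_mono[OF Ti gTi])
   fix x
   have "0 <= (g x - T N x) * T N x"
   proof -
    consider "real N < g x" | "g x < - real N" | "- real N <= g x" "g x <= real N" by linarith
    then show ?thesis
    proof cases
     case 1
     then have "T N x = real N" by (simp add: T_def)
     then show ?thesis using 1 by simp
    next
     case 2
     then have "T N x = - real N" by (simp add: T_def)
     then show ?thesis using 2 by (intro mult_nonpos_nonpos) auto
    next
     case 3
     then have "T N x = g x" by (simp add: T_def)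
     then show ?thesis by simp
    qed
   qed
   then show "(T N x)^2 <= g x * T N x" by (simp add: algebra_simps power2_eq_square)
  qed
  also have "... <= L * sqrt ?q" by (rule trunc)
  finally have "sqrt ?q * sqrt ?q <= L * sqrt ?q" using q0 by simp
  then have "sqrt ?q <= L"
  proof (cases "?q = 0")
   case False
   then have "0 < sqrt ?q" using q0 by simp
   then show ?thesis using \<open>sqrt ?q * sqrt ?q <= L * sqrt ?q\<close> by (rule mult_right_le_imp_le[rotated])
  qed (use L in simp)
  then have "(sqrt ?q)^2 <= L^2" using q0 by (intro power_mono) auto
  then show ?thesis using q0 by simp
 qed
 have "(%N. LINT x:?I|lborel. (T N x)^2) ----> (LINT x:?I|lborel. (g x)^2)"
  unfolding set_lebesgue_integral_def
 proof (rule integral_dominated_convergence)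
  show "integrable lborel (%x. indicat_real ?I x *\<^sub>R ((g x)^2))" using g2 unfolding set_integrable_def .
  show "(%x. indicat_real ?I x *\<^sub>R (g x)\<^sup>2) \<in> borel_measurable lborel" "(%x. indicat_real ?I x *\<^sub>R (T N x)\<^sup>2) \<in> borel_measurable lborel" for N
   using gm Tm by measurable
  show "AE x in lborel. (%N. indicat_real ?I x *\<^sub>R (T N x)\<^sup>2) ----> indicat_real ?I x *\<^sub>R (g x)\<^sup>2"
  proof (intro AE_I2)
   fix x
   obtain N0 where N0: "\<bar>g x\<bar> <= real N0" using real_arch_simple by blast
   have "\<forall>N\<ge>N0. T N x = g x"
   proof (intro allI impI)
    fix N assume "N0 <= N"
    then have "\<bar>g x\<bar> <= real N" using N0 by linarith
    then show "T N x = g x" by (auto simp: T_def)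
   qed
   then show "(%N. indicat_real ?I x *\<^sub>R (T N x)\<^sup>2) ----> indicat_real ?I x *\<^sub>R (g x)\<^sup>2"
    by (intro tendsto_eventually eventually_sequentiallyI[of N0]) simp
  qed
  show "AE x in lborel. norm (indicat_real ?I x *\<^sub>R (T N x)\<^sup>2) <= indicat_real ?I x *\<^sub>R ((g x)^2)" for N
  proof (intro AE_I2)
   fix x
   have "\<bar>T N x\<bar> <= \<bar>g x\<bar>" by (auto simp: T_def)
   then have "(T N x)^2 <= (g x)^2" by (simp add: abs_le_square_iff)
   then show "norm (indicat_real ?I x *\<^sub>R (T N x)\<^sup>2) <= indicat_real ?I x *\<^sub>R ((g x)^2)" by (simp add: indicator_def)
  qed
 qed
 then show ?thesis by (rule LIMSEQ_le_const2) (use TL in blast)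
qed

section \<open>Continuous representatives and the extended-valued energy\<close>

lemma AE_eq_continuous_imp_eq:
 fixes f h :: "real => real"
 assumes c: "continuous_on UNIV f" "continuous_on UNIV h" and ae: "AE x in lborel. f x = h x"
 shows "f x = h x"
proof -
 have cc: "continuous_on S (%x. \<bar>f x - h x\<bar>)" for S by (intro continuous_intros continuous_on_subset[OF c(1)] continuous_on_subset[OF c(2)]) auto
 have "(LINT y:{x..x + 1}|lborel. \<bar>f y - h y\<bar>) = (LINT y:{x..x + 1}|lborel. 0)"
  by (rule set_lebesgue_integral_cong_AE) (use ae borel_measurable_continuous_onI[OF cc] in auto)
 then have "(LINT y:{x..x + 1}|lborel. \<bar>f y - h y\<bar>) <= 0" by (simp add: set_lebesgue_integral_def)
 then have "\<bar>f x - h x\<bar> = 0"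
  by (intro continuous_zero_if_integral_zero[OF cc]) auto
 then show ?thesis by simp
qed

lemma AE_nonneg_continuous:
 fixes f :: "real => real"
 assumes c: "continuous_on UNIV f" and ae: "AE x in lborel. 0 <= f x"
 shows "0 <= f x"
proof -
 have "f x = max 0 (f x)"
  by (rule AE_eq_continuous_imp_eq[OF c, of "%x. max 0 (f x)"]) (use ae in "auto intro!: continuous_intros c elim!: eventually_mono")
 then show ?thesis by linarith
qed

lemma AE_shift:
 assumes "AE x :: real in lborel. P x" shows "AE x in lborel. P (p + x)"
proof (rule AE_distrD[of "(+) p" lborel borel])
 show "AE x in distr lborel borel ((+) p). P x" using assms unfolding lborel_distr_plus .
qed simp

lemma AE_eq_periodic_imp_periodic:
 assumes F: "continuous_on UNIV F" and f: "periodic f" and ae: "AE x in lborel. f x = F x"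
 shows "periodic F"
proof -
 have c: "continuous_on UNIV (%x. F (x + 2 * pi))" by (intro continuous_on_compose2[OF F] continuous_intros) auto
 have "AE x in lborel. F (x + 2 * pi) = F x"
  using ae AE_shift[OF ae, of "2 * pi"] by eventually_elim (use f in "simp add: periodic_def add.commute")
 from AE_eq_continuous_imp_eq[OF c F this] show ?thesis by (simp add: periodic_def)
qed

lemma H_circle_1_representative:
 assumes "H_circle 1 f"
 obtains F g where "circle_H1 F g" "AE x in lborel. f x = F x" "AE x in lborel. g x = wderiv UNIV f x"
proof -
 from assms obtain g where g: "periodic f" "weak_deriv UNIV f g" "L2_loc UNIV g"
  unfolding H_circle_def One_nat_def by auto
 obtain F where F: "primitive F g" "AE x in lborel. f x = F x"
  by (rule weak_deriv_UNIV_imp_primitive[OF g(2)]) (rule that; assumption)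
 have "periodic F" by (rule AE_eq_periodic_imp_periodic[OF primitive_continuous[OF F(1)] g(1) F(2)])
 moreover have "L1_on {a..b} (%x. (g x)^2)" for a b
  using g(3) by (simp add: L2_loc_def L2_on_def)
 ultimately have "circle_H1 F g" using F(1) by (simp add: circle_H1_def)
 moreover have "AE x in lborel. g x = wderiv UNIV f x"
  using weak_deriv_unique[OF open_UNIV g(2) weak_deriv_wderiv[OF g(2)]] by simp
 ultimately show ?thesis by (rule that[OF _ F(2)])
qed

lemma circle_H1_imp_H_circle:
 assumes H: "circle_H1 f g"
 shows "H_circle 1 f" "weak_deriv UNIV f g" "AE x in lborel. g x = wderiv UNIV f x"
proof -
 show w: "weak_deriv UNIV f g" by (rule primitive_imp_weak_deriv[OF circle_H1D(1)[OF H]])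
 have b: "g \<in> borel_measurable borel" using w by (auto simp: weak_deriv_def intro: L1_loc_UNIV_borel)
 have "L2_loc UNIV g"
  using L1_loc_UNIV_I[OF circle_H1D(3)[OF H]] b unfolding L2_loc_def L2_on_def L1_loc_def set_borel_measurable_def
  by (auto intro!: borel_measurable_indicator simp: compact_imp_closed)
 then show "H_circle 1 f" unfolding H_circle_def One_nat_def
  using w L2_loc_continuous[OF circle_H1D(5)[OF H]] circle_H1D(2)[OF H] by auto
 show "AE x in lborel. g x = wderiv UNIV f x"
  using weak_deriv_unique[OF open_UNIV w weak_deriv_wderiv[OF w]] by simp
qed

lemma H_circle_1_borel:
 assumes "H_circle 1 f" shows "f \<in> borel_measurable borel" "wderiv UNIV f \<in> borel_measurable borel"
proof -
 obtain g where "weak_deriv UNIV f g" using assms unfolding H_circle_def One_nat_def by auto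
 from weak_deriv_wderiv[OF this] show "f \<in> borel_measurable borel" "wderiv UNIV f \<in> borel_measurable borel"
  by (auto simp: weak_deriv_def intro: L1_loc_UNIV_borel)
qed

lemma energy_representative:
 assumes f: "H_circle 1 f" and F: "circle_H1 F g" and ae: "AE x in lborel. f x = F x" "AE x in lborel. g x = wderiv UNIV f x"
 shows "energy \<alpha> f = ereal (circle_energy \<alpha> F g)"
proof -
 let ?I = "{0..2*pi}"
 note fm[measurable] = H_circle_1_borel[OF f]
 have gm[measurable]: "g \<in> borel_measurable borel" using circle_H1_imp_H_circle(2)[OF F] by (auto simp: weak_deriv_def intro: L1_loc_UNIV_borel)
 have Fm[measurable]: "F \<in> borel_measurable borel" by (rule borel_measurable_continuous_onI[OF circle_H1D(5)[OF F]])
 have "(\<oint>x. (wderiv UNIV f x)^2 - \<alpha>\<^sup>2 * (f x)^2) = (\<oint>x. (g x)^2 - \<alpha>\<^sup>2 * (F x)^2)"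
  by (rule set_lebesgue_integral_cong_AE) (use ae in "auto elim!: eventually_elim2")
 also have "... = (\<oint>x. (g x)^2) - (\<oint>x. \<alpha>^2 * (F x)^2)"
  by (rule set_integral_diff(2)) (use circle_H1D(3)[OF F] in "auto intro!: cont_set_integrable continuous_intros circle_H1D(5)[OF F]")
 finally have 1: "(\<oint>x. (wderiv UNIV f x)^2 - \<alpha>\<^sup>2 * (f x)^2) = (\<oint>x. (g x)^2) - \<alpha>\<^sup>2 * (\<oint>x. (F x)^2)" by simp
 have 2: "(\<oint>x. f x * cos x) = (\<oint>x. F x * cos x)"
  by (rule set_lebesgue_integral_cong_AE) (use ae(1) in "auto elim!: eventually_mono")
 show ?thesis using f unfolding energy_def circle_energy_def 1 2 by simp
qed

lemma circle_H1_energy: "circle_H1 f g ==> energy \<alpha> f = ereal (circle_energy \<alpha> f g)"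
 by (rule energy_representative[OF circle_H1_imp_H_circle(1) _ AE_I2 circle_H1_imp_H_circle(3)]) auto

lemma circle_H1_admissible:
 assumes "circle_H1 f g" "!!x. 0 <= f x" "(\<oint>x. f x) = M"
 shows "f \<in> admissible M"
 using assms L2_loc_continuous[OF circle_H1D(5)[OF assms(1)], of UNIV] circle_H1D(2)[OF assms(1)]
 by (simp add: admissible_def L2_loc_def)

lemma dist_H1_representative:
 assumes f: "circle_H1 f g" and h: "H_circle 1 h" "AE x in lborel. k x = wderiv UNIV h x" and k: "k \<in> borel_measurable borel"
 shows "dist_H1 f h = ennreal (sqrt (\<oint>x. (g x - k x)^2))"
proof -
 note [measurable] = k H_circle_1_borel[OF h(1)] H_circle_1_borel[OF circle_H1_imp_H_circle(1)[OF f]]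
 have gm[measurable]: "g \<in> borel_measurable borel" using circle_H1_imp_H_circle(2)[OF f] by (auto simp: weak_deriv_def intro: L1_loc_UNIV_borel)
 have "(\<oint>x. (wderiv UNIV f x - wderiv UNIV h x)^2) = (\<oint>x. (g x - k x)^2)"
  by (rule set_lebesgue_integral_cong_AE) (use circle_H1_imp_H_circle(3)[OF f] h(2) in "auto elim!: eventually_elim2")
 then show ?thesis using circle_H1_imp_H_circle(1)[OF f] h(1) by (simp add: dist_H1_def)
qed

lemma energy_minimizer_representative:
 assumes a: "0 < \<alpha>" and M: "0 < M" and m: "is_arg_min (energy \<alpha>) (%w. w \<in> admissible M) f"
 obtains v g where "energy_minimizer \<alpha> M v g" "H_circle 1 f" "AE x in lborel. f x = v x" "AE x in lborel. g x = wderiv UNIV f x"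
proof -
 \<comment> \<open>The constant function of mass M has finite energy, so the minimal energy is
   finite and the minimizer has a weak derivative in L2.\<close>
 have c: "circle_H1 (%x. M / (2 * pi)) (%x. 0)"
  by (simp add: circle_H1_def primitive_const periodic_def set_integrable_def)
 have "(%x. M / (2 * pi)) \<in> admissible M"
  by (rule circle_H1_admissible[OF c]) (use M in "auto simp: set_integral_const")
 then have "energy \<alpha> f <= energy \<alpha> (%x. M / (2 * pi))" using m by (auto simp: is_arg_min_def not_less)
 then have fin: "energy \<alpha> f ~= \<infinity>" unfolding circle_H1_energy[OF c] by auto
 then have f: "H_circle 1 f" by (auto simp: energy_def split: if_splits)
 have fa: "AE x in lborel. 0 <= f x" "(\<oint>x. f x) = M" using m by (auto simp: is_arg_min_def admissible_def)
 obtain v g where v: "circle_H1 v g" "AE x in lborel. f x = v x" "AE x in lborel. g x = wderiv UNIV f x"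
  by (rule H_circle_1_representative[OF f]) (rule that; assumption)
 have "energy_minimizer \<alpha> M v g"
 proof
  show "0 < \<alpha>" "0 < M" "circle_H1 v g" by fact+
  show "0 <= v x" for x
   by (rule AE_nonneg_continuous[OF circle_H1D(5)[OF v(1)]]) (use fa(1) v(2) in eventually_elim, simp)
  have "(\<oint>x. f x) = (\<oint>x. v x)"
   by (rule set_lebesgue_integral_cong_AE) (use v(2) H_circle_1_borel(1)[OF f] borel_measurable_continuous_onI[OF circle_H1D(5)[OF v(1)]] in "auto elim!: eventually_mono")
  then show "(\<oint>x. v x) = M" using fa(2) by simp
  fix y h assume y: "circle_H1 y h" "!!x. 0 <= y x" "(\<oint>x. y x) = M"
  have "energy \<alpha> f <= energy \<alpha> y" using m circle_H1_admissible[OF y] by (auto simp: is_arg_min_def not_less)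
  then show "circle_energy \<alpha> v g <= circle_energy \<alpha> y h"
   unfolding energy_representative[OF f v] circle_H1_energy[OF y(1)] by simp
 qed
 then show ?thesis by (rule that[OF _ f v(2,3)])
qed

lemma circle_H1_borel: "circle_H1 f g ==> g \<in> borel_measurable borel"
 using circle_H1D(4) by (intro L1_loc_UNIV_borel L1_loc_UNIV_I)

section \<open>Lower semicontinuity, compactness and completeness\<close>

lemma set_uniform_integral_tendsto:
 fixes F :: "nat => 'a::euclidean_space => real"
 assumes B: "B \<in> sets borel" "emeasure lborel B < \<infinity>" and F: "!!j. L1_on B (F j)" and f: "L1_on B f"
  and u: "uniform_limit B F f sequentially"
 shows "(%j. LINT x:B|lborel. F j x) ----> (LINT x:B|lborel. f x)"
proof (rule LIMSEQ_I)
 fix e :: real assume e: "0 < e"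
 define d where "d = e / (2 * (measure lborel B + 1))"
 have mB: "0 <= measure lborel B" by simp
 have pos: "0 < 2 * (measure lborel B + 1)" using add_nonneg_pos[OF mB zero_less_one] by simp
 have d: "0 < d" "d * measure lborel B < e"
 proof -
  show "0 < d" using divide_pos_pos[OF e pos] unfolding d_def .
  then have "d * measure lborel B <= d * (measure lborel B + 1)" by (intro mult_left_mono) simp_all
  also have "... = e / 2" unfolding d_def using pos by (simp add: field_simps del: distrib_left_numeral)
  finally show "d * measure lborel B < e" using e by simp
 qed
 have one: "L1_on B (%_. d)" using B by (simp add: set_integrable_def)
 obtain N where "\<forall>j\<ge>N. \<forall>x\<in>B. \<bar>F j x - f x\<bar> < d"
  using uniform_limitD[OF u d(1)] unfolding eventually_sequentially dist_real_def by blast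
 then have N: "N <= j ==> x \<in> B ==> \<bar>F j x - f x\<bar> < d" for j x by blast
 have "norm ((LINT x:B|lborel. F j x) - (LINT x:B|lborel. f x)) < e" if "N <= j" for j
 proof -
  have i: "L1_on B (%x. F j x - f x)" by (rule set_integral_diff(1)[OF F f])
  have "\<bar>LINT x:B|lborel. F j x - f x\<bar> <= (LINT x:B|lborel. \<bar>F j x - f x\<bar>)"
   unfolding set_lebesgue_integral_def by (rule order_trans[OF integral_abs_bound]) (simp add: abs_mult)
  also have "... <= (LINT x:B|lborel. d)"
   by (rule set_integral_mono[OF set_integrable_abs[OF i] one]) (use N that in "simp add: less_imp_le")
  also have "... = d * measure lborel B" using B by (simp add: set_integral_const)
  finally show ?thesis using d(2) set_integral_diff(2)[OF F f] by simp
 qed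
 then show "EX no. \<forall>n\<ge>no. norm ((LINT x:B|lborel. F n x) - (LINT x:B|lborel. f x)) < e" by blast
qed

lemma uniform_integral_tendsto:
 fixes F :: "nat => real => real"
 assumes F: "!!j. continuous_on {a..b} (F j)" and f: "continuous_on {a..b} f"
  and u: "uniform_limit {a..b} F f sequentially"
 shows "(%j. LINT x:{a..b}|lborel. F j x) ----> (LINT x:{a..b}|lborel. f x)"
 by (rule set_uniform_integral_tendsto[OF _ _ cont_set_integrable[OF F] cont_set_integrable[OF f] u]) (auto simp: emeasure_lborel_Icc_eq)

lemma bounded_on_Icc:
 fixes f :: "real => real"
 assumes "continuous_on {a..b} f" obtains B where "0 < B" "!!x. x \<in> {a..b} ==> \<bar>f x\<bar> <= B"
proof -
 have "compact (f ` {a..b})" by (rule compact_continuous_image[OF assms compact_Icc])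
 then obtain B where B: "\<forall>y\<in>f ` {a..b}. norm y <= B" using compact_imp_bounded bounded_iff by blast
 have "\<bar>f x\<bar> <= \<bar>B\<bar> + 1" if "x \<in> {a..b}" for x
 proof -
  have "norm (f x) <= B" using B that by blast
  then show ?thesis by simp
 qed
 then show ?thesis using that[of "\<bar>B\<bar> + 1"] by simp
qed

lemma uniform_limit_mult_cont:
 fixes F G :: "nat => real => real"
 assumes "uniform_limit {a..b} F f sequentially" "continuous_on {a..b} f"
  "uniform_limit {a..b} G g sequentially" "continuous_on {a..b} g"
 shows "uniform_limit {a..b} (%j x. F j x * G j x) (%x. f x * g x) sequentially"
proof (rule uniform_lim_mult[OF assms(1,3)])
 show "bounded (f ` {a..b})" "bounded (g ` {a..b})"
  using assms by (auto intro!: compact_imp_bounded compact_continuous_image)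
qed

text \<open>All terms but the Dirichlet integral converge. For that one, integration by parts moves
  the derivative onto a test function, where uniform convergence of \<open>F\<close> suffices, and
  L2 duality turns the limiting inequalities into the bound on \<open>g\<close>.\<close>

lemma energy_lower_semicontinuous:
 assumes fj: "!!j. circle_H1 (F j) (G j)" and f: "circle_H1 f g"
  and u: "uniform_limit {0..2*pi} F f sequentially"
  and b: "!!j. circle_energy \<alpha> (F j) (G j) <= b j" "b ----> l"
 shows "circle_energy \<alpha> f g <= l"
proof -
 let ?I = "{0..2*pi}"
 have Fc: "continuous_on S (F j)" and fc: "continuous_on S f" for S j by (rule circle_H1D(5)[OF fj] circle_H1D(5)[OF f])+
 have t1: "(%j. \<oint>x. (F j x)^2) ----> (\<oint>x. (f x)^2)"
  unfolding power2_eq_square by (intro uniform_integral_tendsto uniform_limit_mult_cont u continuous_intros Fc fc)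
 have t2: "(%j. \<oint>x. F j x * cos x) ----> (\<oint>x. f x * cos x)"
  by (intro uniform_integral_tendsto uniform_limit_mult_cont u continuous_intros Fc fc uniform_limit_const)
 define B where "B j = 2 * b j + \<alpha>^2 * (\<oint>x. (F j x)^2) + 2 * (\<oint>x. F j x * cos x)" for j
 define L where "L = 2 * l + \<alpha>^2 * (\<oint>x. (f x)^2) + 2 * (\<oint>x. f x * cos x)"
 have BL: "B ----> L" unfolding B_def L_def by (intro tendsto_intros b(2) t1 t2)
 have GB: "(\<oint>x. (G j x)^2) <= B j" for j
  using b(1)[of j] unfolding circle_energy_def B_def by (simp add: field_simps)
 have G0: "0 <= (\<oint>x. (G j x)^2)" for j by (rule set_integral_nonneg) simp
 have B0: "0 <= B j" for j using order_trans[OF G0 GB] .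
 have L0: "0 <= L" by (rule LIMSEQ_le_const[OF BL]) (use B0 in blast)
 have "(\<oint>x. (g x)^2) <= (sqrt L)^2"
 proof (rule L2_norm_bound_by_duality[OF circle_H1_borel[OF f] circle_H1D(3)[OF f]])
  show "0 <= sqrt L" using L0 by simp
  fix \<phi> \<phi>' assume p: "primitive \<phi> \<phi>'"
  have pc: "continuous_on S \<phi>" for S by (rule primitive_continuous[OF p])
  have p2: "L1_on ?I (%x. (\<phi> x)^2)" by (intro cont_set_integrable continuous_intros pc)
  have bj: "F j (2 * pi) * \<phi> (2 * pi) - F j 0 * \<phi> 0 - (\<oint>x. F j x * \<phi>' x) <= sqrt (B j) * sqrt (\<oint>x. (\<phi> x)^2)" for j
  proof -
   have "(\<oint>x. F j x * \<phi>' x) + (\<oint>x. \<phi> x * G j x) = F j (2*pi) * \<phi> (2*pi) - F j 0 * \<phi> 0"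
    by (rule integral_by_parts_primitive[OF circle_H1D(1)[OF fj] p]) simp
   then have "F j (2 * pi) * \<phi> (2 * pi) - F j 0 * \<phi> 0 - (\<oint>x. F j x * \<phi>' x) = (\<oint>x. \<phi> x * G j x)" by simp
   also have "... <= (\<oint>x. \<bar>\<phi> x * G j x\<bar>)"
   proof (rule set_integral_mono)
    show "L1_on ?I (%x. \<phi> x * G j x)" by (rule set_integrable_cont_mult[OF pc circle_H1D(4)[OF fj]])
    then show "L1_on ?I (%x. \<bar>\<phi> x * G j x\<bar>)" by (rule set_integrable_abs)
   qed simp
   also have "... <= sqrt (\<oint>x. (\<phi> x)^2) * sqrt (\<oint>x. (G j x)^2)"
    by (rule set_integrable_mult_L2(3)) (use p2 circle_H1D(3)[OF fj] circle_H1_borel[OF fj] borel_measurable_continuous_onI[OF pc] in "auto simp: set_borel_measurable_def")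
   also have "... <= sqrt (\<oint>x. (\<phi> x)^2) * sqrt (B j)"
    using GB[of j] by (intro mult_left_mono) (auto intro!: set_integral_nonneg)
   finally show ?thesis by (simp add: mult.commute)
  qed
  have pt: "(%j. F j x) ----> f x" if "x \<in> ?I" for x by (rule tendsto_uniform_limitI[OF u that])
  have it: "(%j. \<oint>x. F j x * \<phi>' x) ----> (\<oint>x. f x * \<phi>' x)"
  proof -
   obtain K where K: "0 < K" "!!x. x \<in> ?I ==> \<bar>f x\<bar> <= K" by (rule bounded_on_Icc[OF fc]) (rule that; assumption)
   have "eventually (%j. \<forall>x\<in>?I. dist (F j x) (f x) < 1) sequentially" by (rule uniform_limitD[OF u]) simp
   then obtain N where "\<forall>j\<ge>N. \<forall>x\<in>?I. \<bar>F j x - f x\<bar> < 1" unfolding eventually_sequentially dist_real_def by blast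
   then have N: "N <= j ==> x \<in> ?I ==> \<bar>F j x - f x\<bar> < 1" for j x by blast
   have "(%j. \<oint>x. F (j + N) x * \<phi>' x) ----> (\<oint>x. f x * \<phi>' x)"
    unfolding set_lebesgue_integral_def
   proof (rule integral_dominated_convergence)
    show "integrable lborel (%x. \<bar>(K + 1) * (indicat_real ?I x *\<^sub>R \<phi>' x)\<bar>)"
     using primitiveD(1)[OF p] unfolding set_integrable_def by (intro integrable_abs integrable_mult_right)
    show "(%x. indicat_real ?I x *\<^sub>R (f x * \<phi>' x)) \<in> borel_measurable lborel"
     using set_integrable_cont_mult[OF fc primitiveD(1)[OF p]] unfolding set_integrable_def by blast
    show "(%x. indicat_real ?I x *\<^sub>R (F (j + N) x * \<phi>' x)) \<in> borel_measurable lborel" for j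
     using set_integrable_cont_mult[OF Fc primitiveD(1)[OF p]] unfolding set_integrable_def by blast
    show "AE x in lborel. (%j. indicat_real ?I x *\<^sub>R (F (j + N) x * \<phi>' x)) ----> indicat_real ?I x *\<^sub>R (f x * \<phi>' x)"
    proof (intro AE_I2)
     fix x show "(%j. indicat_real ?I x *\<^sub>R (F (j + N) x * \<phi>' x)) ----> indicat_real ?I x *\<^sub>R (f x * \<phi>' x)"
      by (cases "x \<in> ?I") (auto intro!: tendsto_intros LIMSEQ_ignore_initial_segment[OF pt])
    qed
    show "AE x in lborel. norm (indicat_real ?I x *\<^sub>R (F (j + N) x * \<phi>' x)) <= \<bar>(K + 1) * (indicat_real ?I x *\<^sub>R \<phi>' x)\<bar>" for j
    proof (intro AE_I2)
     fix x show "norm (indicat_real ?I x *\<^sub>R (F (j + N) x * \<phi>' x)) <= \<bar>(K + 1) * (indicat_real ?I x *\<^sub>R \<phi>' x)\<bar>"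
     proof (cases "x \<in> ?I")
      case True
      have "\<bar>F (j + N) x\<bar> <= \<bar>K + 1\<bar>" using N[of "j + N" x] K(2)[OF True] True K(1) by auto
      then show ?thesis using True by (simp add: abs_mult mult_right_mono)
     qed simp
    qed
   qed
   then show ?thesis by (rule LIMSEQ_offset)
  qed
  have "f (2 * pi) * \<phi> (2 * pi) - f 0 * \<phi> 0 - (\<oint>x. f x * \<phi>' x) <= sqrt L * sqrt (\<oint>x. (\<phi> x)^2)"
  proof (rule LIMSEQ_le)
   show "(%j. F j (2 * pi) * \<phi> (2 * pi) - F j 0 * \<phi> 0 - (\<oint>x. F j x * \<phi>' x)) ----> f (2 * pi) * \<phi> (2 * pi) - f 0 * \<phi> 0 - (\<oint>x. f x * \<phi>' x)"
    by (intro tendsto_intros it pt) auto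
   show "(%j. sqrt (B j) * sqrt (\<oint>x. (\<phi> x)^2)) ----> sqrt L * sqrt (\<oint>x. (\<phi> x)^2)"
    by (intro tendsto_intros BL)
  qed (use bj in blast)
  moreover have "(\<oint>x. f x * \<phi>' x) + (\<oint>x. \<phi> x * g x) = f (2*pi) * \<phi> (2*pi) - f 0 * \<phi> 0"
   by (rule integral_by_parts_primitive[OF circle_H1D(1)[OF f] p]) simp
  ultimately show "(\<oint>x. g x * \<phi> x) <= sqrt L * sqrt (\<oint>x. (\<phi> x)^2)"
   by (simp add: mult.commute)
 qed
 then have "(\<oint>x. (g x)^2) <= L" using L0 by simp
 then show ?thesis unfolding circle_energy_def L_def by (simp add: field_simps)
qed

text \<open>Each sequence of pairings converges and is therefore bounded, which is the hypothesis of
  the uniform boundedness principle.\<close>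

lemma weakly_L2_bounded:
 assumes S: "S \<in> sets borel" and w: "weakly_L2 S fs f"
 obtains C where "0 <= C" "!!j. (LINT p:S|lborel. (fs j p)^2) <= C"
proof -
 let ?F = "%j p. indicat_real S p *\<^sub>R fs j p"
 have L: "L2_on S (fs j)" for j using w by (simp add: weakly_L2_def)
 have e: "(%p. (?F j p)^2) = (%p. indicat_real S p *\<^sub>R (fs j p)\<^sup>2)" for j by (auto simp: indicator_def)
 have "EX C. ALL j. (\<integral>p. (?F j p)^2 \<partial>lborel) <= C"
 proof (rule L2_uniformly_bounded)
  show "?F j \<in> borel_measurable lborel" for j using L by (simp add: L2_on_def set_borel_measurable_def)
  show "integrable lborel (%p. (?F j p)^2)" for j unfolding e using L by (simp add: L2_on_def set_integrable_def)
  fix \<psi> :: "'a => real" assume psi: "\<psi> \<in> borel_measurable lborel" "integrable lborel (%x. (\<psi> x)^2)"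
  show "EX B. ALL j. \<bar>\<integral>p. ?F j p * \<psi> p \<partial>lborel\<bar> <= B"
  proof -
   have "L2_on S \<psi>" unfolding L2_on_def set_borel_measurable_def set_integrable_def
   proof
    show "(%x. indicat_real S x *\<^sub>R \<psi> x) \<in> borel_measurable lborel" using psi(1) S by simp
    show "integrable lborel (%x. indicat_real S x *\<^sub>R (\<psi> x)\<^sup>2)"
     by (rule integrable_mult_indicator[OF _ psi(2)]) (use S in simp)
   qed
   then have "(%j. LINT p:S|lborel. fs j p * \<psi> p) ----> (LINT p:S|lborel. f p * \<psi> p)" using w by (simp add: weakly_L2_def)
   then have "convergent (%j. LINT p:S|lborel. fs j p * \<psi> p)" by (rule convergentI)
   then have "Bseq (%j. LINT p:S|lborel. fs j p * \<psi> p)" by (rule convergent_imp_Bseq)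
   then obtain B where B: "ALL j. norm (LINT p:S|lborel. fs j p * \<psi> p) <= B" by (rule BseqE)
   have "(\<integral>p. ?F j p * \<psi> p \<partial>lborel) = (LINT p:S|lborel. fs j p * \<psi> p)" for j
    by (simp add: set_lebesgue_integral_def mult.assoc)
   then show ?thesis using B by (intro exI[of _ B]) simp
  qed
 qed
 then obtain C where C: "!!j. (\<integral>p. (?F j p)^2 \<partial>lborel) <= C" by blast
 have "(LINT p:S|lborel. (fs j p)^2) <= \<bar>C\<bar>" for j using C[of j] unfolding e set_lebesgue_integral_def by linarith
 then show ?thesis using that[of "\<bar>C\<bar>"] by simp
qed

lemma circle_H1_hoelder:
 assumes H: "circle_H1 f g" and xy: "0 <= x" "x <= y" "y <= 2 * pi"
 shows "\<bar>f y - f x\<bar> <= sqrt (y - x) * sqrt (\<oint>x. (g x)^2)"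
proof -
 have gb: "set_borel_measurable lborel {x..y} g" by (rule set_integrable_imp_measurable[OF circle_H1D(4)[OF H]])
 have "f y - f x = (LINT z:{x..y}|lborel. g z)" using primitiveD(2)[OF circle_H1D(1)[OF H] xy(2)] by simp
 then have "\<bar>f y - f x\<bar> = \<bar>LINT z:{x..y}|lborel. 1 * g z\<bar>" by simp
 also have "... <= (LINT z:{x..y}|lborel. \<bar>1 * g z\<bar>)"
  unfolding set_lebesgue_integral_def by (rule order_trans[OF integral_abs_bound]) (simp add: abs_mult)
 also have "... <= sqrt (LINT z:{x..y}|lborel. 1^2) * sqrt (LINT z:{x..y}|lborel. (g z)^2)"
  by (rule set_integrable_mult_L2(3)[OF _ cont_set_integrable[OF continuous_on_const] gb circle_H1D(3)[OF H]]) (auto simp: set_borel_measurable_def)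
 also have "(LINT z:{x..y}|lborel. 1^2) = y - x" using xy by (simp add: set_integral_const)
 also have "sqrt (y - x) * sqrt (LINT z:{x..y}|lborel. (g z)^2) <= sqrt (y - x) * sqrt (\<oint>x. (g x)^2)"
 proof (intro mult_left_mono real_sqrt_le_mono)
  show "(LINT z:{x..y}|lborel. (g z)^2) <= (\<oint>x. (g x)^2)"
   unfolding set_lebesgue_integral_def
   by (rule integral_mono) (use circle_H1D(3)[OF H] xy in "auto simp: set_integrable_def indicator_def")
 qed (use xy in auto)
 finally show ?thesis .
qed

text \<open>Bounded Dirichlet integrals give a common Hoelder modulus of exponent 1/2 on one period;
  the limit found there is unfolded by periodicity, which preserves uniformity.\<close>

lemma arzela_ascoli_circle:
 fixes F :: "nat => real => real"
 assumes H: "!!k. circle_H1 (F k) (G k)" and B: "!!k x. \<bar>F k x\<bar> <= B"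
  and C: "!!k. (\<oint>x. (G k x)^2) <= C"
 obtains f r where "strict_mono (r :: nat => nat)" "periodic f" "continuous_on UNIV f"
  "uniform_limit UNIV (%k. F (r k)) f sequentially"
proof -
 let ?I = "{0..2*pi::real}"
 have "EX h r. continuous_on ?I h & strict_mono (r :: nat => nat) &
  (\<forall>e>0. EX N. ALL n x. n \<ge> N & x \<in> ?I --> norm (F (r n) x - h x) < e)"
 proof (rule Arzela_Ascoli[of ?I F B])
  show "!!n x. x \<in> ?I ==> norm (F n x) <= B" using B by simp
  fix x e :: real assume x: "x \<in> ?I" and e: "0 < e"
  define d where "d = (e / (sqrt \<bar>C\<bar> + 1))^2"
  have s1: "0 < sqrt \<bar>C\<bar> + 1" by (intro add_nonneg_pos) auto
  have d: "0 < d" using e s1 by (simp add: d_def)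
  have hold: "\<bar>F n b - F n a\<bar> < e" if "a \<in> ?I" "b \<in> ?I" "a <= b" "b - a < d" for n a b
  proof -
   have "\<bar>F n b - F n a\<bar> <= sqrt (b - a) * sqrt (\<oint>x. (G n x)^2)"
    by (rule circle_H1_hoelder[OF H]) (use that in auto)
   also have "... <= sqrt (b - a) * sqrt \<bar>C\<bar>"
    using C[of n] that by (intro mult_left_mono real_sqrt_le_mono) auto
   also have "... <= sqrt (b - a) * (sqrt \<bar>C\<bar> + 1)" using that by (intro mult_left_mono) auto
   also have "... < sqrt d * (sqrt \<bar>C\<bar> + 1)" using that s1 by (intro mult_strict_right_mono) auto
   also have "... = e" using e s1 by (simp add: d_def real_sqrt_abs)
   finally show ?thesis .
  qed
  have "norm (F n x - F n y) < e" if "y \<in> ?I & norm (x - y) < d" for n y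
  proof (cases "x <= y")
   case True
   then show ?thesis using hold[of x y n] that x by (simp add: abs_minus_commute)
  next
   case False
   then show ?thesis using hold[of y x n] that x by simp
  qed
  then show "EX d. 0 < d & (ALL n y. y \<in> ?I & norm (x - y) < d --> norm (F n x - F n y) < e)" using d by blast
 next
  fix h k assume a: "continuous_on ?I h" "strict_mono (k :: nat => nat)"
   "!!e. 0 < e ==> EX N. ALL n x. n \<ge> N & x \<in> ?I --> norm (F (k n) x - h x) < e"
  show "EX h r. continuous_on ?I h & strict_mono (r :: nat => nat) &
   (\<forall>e>0. EX N. ALL n x. n \<ge> N & x \<in> ?I --> norm (F (r n) x - h x) < e)"
   by (rule exI[of _ h], rule exI[of _ k]) (intro conjI allI[of "%e. 0 < e --> Q e" for Q] impI a)
 qed (rule compact_Icc)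
 then obtain h r where hr: "continuous_on ?I h" "strict_mono (r :: nat => nat)"
  "\<forall>e>0. EX N. ALL n x. n \<ge> N & x \<in> ?I --> norm (F (r n) x - h x) < e" by (elim exE conjE)
 define f where "f x = h (x - of_int \<lfloor>x / (2 * pi)\<rfloor> * (2 * pi))" for x
 have fold: "x - of_int \<lfloor>x / (2 * pi)\<rfloor> * (2 * pi) \<in> ?I" for x
 proof -
  have 1: "of_int \<lfloor>x / (2 * pi)\<rfloor> * (2 * pi) <= x"
   using of_int_floor_le[of "x / (2 * pi)"] pi_gt_zero by (subst (asm) pos_le_divide_eq) auto
  have "x / (2 * pi) < of_int \<lfloor>x / (2 * pi)\<rfloor> + 1" by linarith
  then have "x < (of_int \<lfloor>x / (2 * pi)\<rfloor> + 1) * (2 * pi)" using pi_gt_zero by (subst (asm) pos_divide_less_eq) auto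
  with 1 show ?thesis by (simp add: distrib_right)
 qed
 have Ff: "F k x = F k (x - of_int \<lfloor>x / (2 * pi)\<rfloor> * (2 * pi))" for k x
  using periodic_int[OF circle_H1D(2)[OF H], of k x "- \<lfloor>x / (2 * pi)\<rfloor>"] by simp
 have u: "uniform_limit UNIV (%k. F (r k)) f sequentially"
 proof (rule uniform_limitI)
  fix e :: real assume "0 < e"
  with hr(3) obtain N where "ALL n x. n \<ge> N & x \<in> ?I --> norm (F (r n) x - h x) < e" by auto
  then have N: "N <= n ==> x \<in> ?I ==> norm (F (r n) x - h x) < e" for n x by blast
  show "\<forall>\<^sub>F n in sequentially. \<forall>x\<in>UNIV. dist (F (r n) x) (f x) < e"
  proof (rule eventually_sequentiallyI[of N], intro ballI)
   fix n x assume "N <= n"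
   from N[OF this fold[of x]] show "dist (F (r n) x) (f x) < e" by (simp add: Ff[symmetric] f_def dist_real_def)
  qed
 qed
 have lim: "(%k. F (r k) x) ----> f x" for x by (rule tendsto_uniform_limitI[OF u]) simp
 have "f (x + 2 * pi) = f x" for x
  using LIMSEQ_unique[OF lim[of "x + 2 * pi"]] lim[of x] circle_H1D(2)[OF H] by (simp add: periodic_def)
 then have "periodic f" by (simp add: periodic_def)
 moreover have "continuous_on UNIV f"
  by (rule uniform_limit_theorem[OF always_eventually u]) (use circle_H1D(5)[OF H] in auto)
 ultimately show ?thesis by (rule that[OF hr(2) _ _ u])
qed

lemma exists_le_mean:
 assumes c: "continuous_on {0..2*pi} f" and m: "(\<oint>x. f x) = M"
 shows "\<exists>x\<in>{0..2*pi}. f x <= M / (2 * pi)"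
proof (rule ccontr)
 assume "~ (\<exists>x\<in>{0..2*pi}. f x <= M / (2 * pi))"
 then have gt: "x \<in> {0..2*pi} ==> M / (2 * pi) < f x" for x by (simp add: not_le)
 have i: "L1_on {0..2*pi} f" by (rule cont_set_integrable[OF c])
 have "(\<oint>x. f x - M / (2 * pi)) = (\<oint>x. f x) - (\<oint>x. M / (2 * pi))"
  by (rule set_integral_diff(2)[OF i]) (simp add: set_integrable_def)
 also have "... = 0" using m by (simp add: set_integral_const)
 finally have "f 0 - M / (2 * pi) = 0"
  by (intro continuous_zero_if_integral_zero[of 0 "2*pi" "%x. f x - M / (2 * pi)"]) (use gt c in "auto intro!: continuous_intros less_imp_le")
 then show False using gt[of 0] by simp
qed

lemma circle_H1_sup_bound:
 assumes H: "circle_H1 f g" and nn: "!!x. 0 <= f x" and m: "(\<oint>x. f x) = M"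
 shows "f x <= M / (2 * pi) + sqrt (2 * pi) * sqrt (\<oint>x. (g x)^2)"
proof -
 let ?G = "\<oint>x. (g x)^2"
 obtain z where z: "z \<in> {0..2*pi}" "f z <= M / (2 * pi)" using exists_le_mean[OF circle_H1D(5)[OF H] m] by blast
 obtain k :: int where k: "0 <= x + of_int k * (2 * pi)" "x + of_int k * (2 * pi) < 0 + 2 * pi" by (rule fold_period)
 define y where "y = x + of_int k * (2 * pi)"
 have y: "y \<in> {0..2*pi}" "f y = f x" using k periodic_int[OF circle_H1D(2)[OF H]] by (auto simp: y_def)
 have G: "0 <= ?G" by (rule set_integral_nonneg) simp
 have "\<bar>f (max y z) - f (min y z)\<bar> <= sqrt (max y z - min y z) * sqrt ?G"
  by (rule circle_H1_hoelder[OF H]) (use y z in auto)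
 also have "... <= sqrt (2 * pi) * sqrt ?G" using y z G by (intro mult_right_mono real_sqrt_le_mono) auto
 also have "\<bar>f (max y z) - f (min y z)\<bar> = \<bar>f y - f z\<bar>" by (auto simp: max_def min_def)
 finally show ?thesis using y(2) z(2) by linarith
qed

text \<open>Let \<open>s\<close> be the L2 norm of the derivative. Fixed mass and nonnegativity
  bound the integral of f^2 by M times the maximum of \<open>f\<close>, which is linear in
  \<open>s\<close>. So bounded energy gives s^2 \<le> a + b * s, whatever the size of
  \<alpha>.\<close>

lemma circle_H1_energy_bound:
 assumes M: "0 < M"
 obtains K where "0 < K" "!!f g x. circle_H1 f g ==> (!!x. 0 <= f x) ==> (\<oint>x. f x) = M ==>
  circle_energy \<alpha> f g <= e ==> (\<oint>x. (g x)^2) <= K & \<bar>f x\<bar> <= K"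
proof -
 define a where "a = 2 * e + \<alpha>^2 * M * (M / (2 * pi)) + 2 * M"
 define b where "b = \<alpha>^2 * M * sqrt (2 * pi)"
 \<comment> \<open>Chosen so that s > s0 \<ge> 1 would give s^2 > \<bar>a\<bar> * s + b * s + s,
   which exceeds a + b * s.\<close>
 define s0 where "s0 = \<bar>a\<bar> + b + 1"
 have b0: "0 <= b" using M by (simp add: b_def)
 have s01: "1 <= s0" using b0 by (simp add: s0_def)
 define K where "K = s0^2 + M / (2 * pi) + sqrt (2 * pi) * s0"
 have K: "0 < K" "s0^2 <= K" "M / (2 * pi) + sqrt (2 * pi) * s0 <= K"
 proof -
  have "0 < M / (2 * pi)" using M by simp
  moreover have "0 <= sqrt (2 * pi) * s0" using s01 by simp
  ultimately show "0 < K" "s0^2 <= K" "M / (2 * pi) + sqrt (2 * pi) * s0 <= K"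
   using zero_le_power2[of s0] unfolding K_def by linarith+
 qed
 have main: "(\<oint>x. (g x)^2) <= K & \<bar>f x\<bar> <= K"
  if H: "circle_H1 f g" and nn: "!!x. 0 <= f x" and m: "(\<oint>x. f x) = M" and E: "circle_energy \<alpha> f g <= e" for f g x
 proof -
  let ?I = "{0..2*pi}"
  define G where "G = (\<oint>x. (g x)^2)"
  define s where "s = sqrt G"
  have G0: "0 <= G" unfolding G_def by (rule set_integral_nonneg) simp
  have s: "0 <= s" "s^2 = G" using G0 by (auto simp: s_def)
  let ?S = "M / (2 * pi) + sqrt (2 * pi) * s"
  have sup: "f x <= ?S" for x unfolding s_def G_def by (rule circle_H1_sup_bound[OF H nn m])
  have fc: "continuous_on S f" for S by (rule circle_H1D(5)[OF H])
  have "(\<oint>x. (f x)^2) <= (\<oint>x. ?S * f x)"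
  proof (rule set_integral_mono)
   fix x assume "x \<in> ?I"
   show "(f x)^2 <= ?S * f x" unfolding power2_eq_square by (rule mult_right_mono[OF sup nn])
  qed (intro cont_set_integrable continuous_intros fc)+
  then have f2: "(\<oint>x. (f x)^2) <= ?S * M" using m by simp
  have fcos: "(\<oint>x. f x * cos x) <= M"
   unfolding m[symmetric]
  proof (rule set_integral_mono)
   fix x assume "x \<in> ?I"
   show "f x * cos x <= f x" using mult_left_mono[OF cos_le_one[of x] nn[of x]] by simp
  qed (intro cont_set_integrable continuous_intros fc)+
  have "s^2 <= 2 * e + \<alpha>^2 * (\<oint>x. (f x)^2) + 2 * (\<oint>x. f x * cos x)"
   using E unfolding circle_energy_def s(2) G_def by (simp add: field_simps)
  also have "... <= 2 * e + \<alpha>^2 * (?S * M) + 2 * M"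
   using mult_left_mono[OF f2, of "\<alpha>^2"] fcos by simp
  also have "... = a + b * s" unfolding a_def b_def by (simp add: algebra_simps)
  finally have q: "s^2 <= a + b * s" .
  have ss: "s <= s0"
  proof (rule ccontr)
   assume "~ s <= s0"
   then have lt: "s0 < s" by simp
   then have s1: "1 <= s" using s01 by simp
   have "s0 * s <= s^2" unfolding power2_eq_square using lt s(1) by (intro mult_right_mono) auto
   moreover have "s0 * s = \<bar>a\<bar> * s + b * s + s" by (simp add: s0_def algebra_simps)
   moreover have "\<bar>a\<bar> * 1 <= \<bar>a\<bar> * s" using s1 by (intro mult_left_mono) auto
   ultimately show False using q s1 by linarith
  qed
  have "G <= s0^2" unfolding s(2)[symmetric] using ss s(1) by (intro power_mono)
  moreover have "f x <= M / (2 * pi) + sqrt (2 * pi) * s0" using order_trans[OF sup[of x] add_left_mono[OF mult_left_mono[OF ss]]] by simp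
  ultimately show ?thesis using K nn[of x] by (auto simp: G_def)
 qed
 show ?thesis
 proof (rule that[OF K(1)])
  fix f g :: "real => real" and x
  assume a: "circle_H1 f g" "!!x. 0 <= f x" "(\<oint>x. f x) = M" "circle_energy \<alpha> f g <= e"
  show "(\<oint>x. (g x)^2) <= K & \<bar>f x\<bar> <= K" by (rule main[OF a])
 qed
qed

context energy_minimizer
begin

text \<open>The midpoint is nonnegative with mass M, so its energy is at least minimal. For a
  quadratic functional it equals the mean of the two energies minus a quarter of the quadratic part
  of the difference, which is thereby controlled by the excess of the two energies over the
  minimum.\<close>

lemma parallelogram:
 assumes 1: "circle_H1 f1 g1" "!!x. 0 <= f1 x" "(\<oint>x. f1 x) = M"
  and 2: "circle_H1 f2 g2" "!!x. 0 <= f2 x" "(\<oint>x. f2 x) = M"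
 shows "(\<oint>x. (g1 x - g2 x)^2) <=
  4 * (circle_energy \<alpha> f1 g1 + circle_energy \<alpha> f2 g2 - 2 * circle_energy \<alpha> v g) + \<alpha>^2 * (\<oint>x. (f1 x - f2 x)^2)"
proof -
 define h where "h x = f1 x + (-1) * f2 x" for x
 define h' where "h' x = g1 x + (-1) * g2 x" for x
 have h: "circle_H1 h h'" unfolding h_def[abs_def] h'_def[abs_def] by (rule circle_H1_add_scaled[OF 1(1) 2(1)])
 have f1: "f1 = (%x. f2 x + 1 * h x)" "g1 = (%x. g2 x + 1 * h' x)" by (auto simp: h_def h'_def)
 define L where "L = first_variation \<alpha> f2 g2 h h'"
 define S where "S = (1/2) * ((\<oint>x. (h' x)^2) - \<alpha>\<^sup>2 * (\<oint>x. (h x)^2))"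
 have e1: "circle_energy \<alpha> f1 g1 = circle_energy \<alpha> f2 g2 + L + S"
  unfolding f1 using energy_expansion[OF 2(1) h, of \<alpha> 1] by (simp add: L_def S_def)
 let ?m = "%x. f2 x + (1/2) * h x"
 have mid: "circle_energy \<alpha> ?m (%x. g2 x + (1/2) * h' x) = circle_energy \<alpha> f2 g2 + L / 2 + S / 4"
  using energy_expansion[OF 2(1) h, of \<alpha> "1/2"] by (simp add: L_def S_def power2_eq_square)
 have "circle_energy \<alpha> v g <= circle_energy \<alpha> ?m (%x. g2 x + (1/2) * h' x)"
 proof (rule minimal)
  show "circle_H1 ?m (%x. g2 x + (1/2) * h' x)" by (rule circle_H1_add_scaled[OF 2(1) h])
  show "0 <= ?m x" for x using 1(2)[of x] 2(2)[of x] by (simp add: h_def field_simps)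
  have "(\<oint>x. ?m x) = (\<oint>x. (1/2) * f1 x + (1/2) * f2 x)"
   by (rule arg_cong[of _ _ "%f. \<oint>x. f x"]) (auto simp: h_def field_simps)
  also have "... = (\<oint>x. (1/2) * f1 x) + (\<oint>x. (1/2) * f2 x)"
   by (rule set_integral_add(2)) (auto intro!: cont_set_integrable continuous_intros circle_H1D(5)[OF 1(1)] circle_H1D(5)[OF 2(1)])
  also have "... = M" using 1(3) 2(3) by simp
  finally show "(\<oint>x. ?m x) = M" .
 qed
 then have "2 * S <= 4 * (circle_energy \<alpha> f1 g1 + circle_energy \<alpha> f2 g2 - 2 * circle_energy \<alpha> v g)"
  unfolding mid e1 by (simp add: algebra_simps)
 moreover have "(%x. (h' x)^2) = (%x. (g1 x - g2 x)^2)" "(%x. (h x)^2) = (%x. (f1 x - f2 x)^2)"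
  by (auto simp: h_def h'_def)
 ultimately show ?thesis unfolding S_def by simp
qed

end

lemma circle_H1_of_window:
 assumes per: "periodic f" and k: "k \<in> borel_measurable borel" "L1_on {0..2*pi} k" "L1_on {0..2*pi} (%x. (k x)^2)"
  and kint: "!!x. 0 <= x ==> x <= 2 * pi ==> (LINT y:{0..x}|lborel. k y) = f x - f 0"
 obtains g where "circle_H1 f g" "!!x. 0 <= x ==> x < 2 * pi ==> g x = k x"
proof -
 have "f (2 * pi) = f 0" using per[unfolded periodic_def, rule_format, of 0] by simp
 then have kk: "L1_on {0..0 + 2 * pi} k" "L1_on {0..0 + 2 * pi} (%x. (k x)^2)"
  "(LINT x:{0..0 + 2 * pi}|lborel. k x) = 0" using k(2,3) kint[of "2*pi"] by simp_all
 obtain \<eta> \<eta>' where e: "circle_H1 \<eta> \<eta>'" "!!x. 0 <= x ==> x < 0 + 2 * pi ==> \<eta>' x = k x"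
  "!!x. 0 <= x ==> x <= 0 + 2 * pi ==> \<eta> x = (LINT y:{0..x}|lborel. k y)"
  by (rule periodize[OF k(1) kk]) (rule that; assumption)
 have "f x = f 0 + \<eta> x" for x
 proof -
  obtain n :: int where n: "0 <= x + of_int n * (2 * pi)" "x + of_int n * (2 * pi) < 0 + 2 * pi" by (rule fold_period)
  have "\<eta> (x + of_int n * (2 * pi)) = f (x + of_int n * (2 * pi)) - f 0" using n e(3) kint by simp
  then show ?thesis using periodic_int[OF per] periodic_int[OF circle_H1D(2)[OF e(1)]] by simp
 qed
 then have ff: "f = (%x. f 0 + \<eta> x)" by (rule ext)
 have "primitive (%x. f 0 + \<eta> x) (%x. 0 + \<eta>' x)" by (rule primitive_add[OF primitive_const circle_H1D(1)[OF e(1)]])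
 then have "circle_H1 f \<eta>'" using per circle_H1D(3)[OF e(1)] ff by (simp add: circle_H1_def)
 then show ?thesis by (rule that) (use e(2) in simp)
qed

text \<open>The increments of the derivatives have geometrically small L2 norms, hence summable L1
  norms on the period, and their series defines a limit density. Fatou's lemma keeps it square
  integrable.\<close>

lemma circle_H1_complete:
 assumes H: "!!k. circle_H1 (F k) (G k)" and u: "!!x. (%k. F k x) ----> f x"
  and C: "!!k. (\<oint>x. (G k x)^2) <= C"
  and cauchy: "!!k. (\<oint>x. (G (Suc k) x - G k x)^2) <= ((1/2) ^ k)^2"
 obtains g where "circle_H1 f g"
proof -
 let ?I = "{0..2*pi::real}"
 define D where "D k x = indicat_real ?I x * (G (Suc k) x - G k x)" for k x
 have Gm[measurable]: "G k \<in> borel_measurable borel" for k by (rule circle_H1_borel[OF H])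
 have Di: "integrable lborel (D k)" for k
  using set_integral_diff(1)[OF circle_H1D(4)[OF H, of 0 "2*pi" "Suc k"] circle_H1D(4)[OF H, of 0 "2*pi" k]]
  unfolding set_integrable_def D_def by simp
 have Dn: "(\<integral>x. norm (D k x) \<partial>lborel) <= sqrt (2 * pi) * (1/2) ^ k" for k
 proof -
  have d: "circle_H1 (%x. F (Suc k) x + (-1) * F k x) (%x. G (Suc k) x + (-1) * G k x)" by (rule circle_H1_add_scaled[OF H H])
  have "(\<integral>x. norm (D k x) \<partial>lborel) = (\<oint>x. \<bar>1 * (G (Suc k) x - G k x)\<bar>)"
   unfolding set_lebesgue_integral_def D_def by (simp add: abs_mult)
  also have "... <= sqrt (\<oint>z. 1^2) * sqrt (\<oint>x. (G (Suc k) x - G k x)^2)"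
   by (rule set_integrable_mult_L2(3)[OF _ cont_set_integrable[OF continuous_on_const]])
    (use circle_H1D(3)[OF d, of 0 "2*pi"] in "auto simp: set_borel_measurable_def")
  also have "... <= sqrt (2 * pi) * sqrt (((1/2) ^ k)^2)"
   using cauchy[of k] by (intro mult_mono real_sqrt_le_mono) (auto simp: set_integral_const intro!: set_integral_nonneg)
  finally show ?thesis by (simp add: real_sqrt_abs)
 qed
 have geo: "summable (%k. sqrt (2 * pi) * (1/2) ^ k)" by simp
 have Ds: "summable (%k. \<integral>x. norm (D k x) \<partial>lborel)"
  by (rule summable_comparison_test'[OF geo, of 0]) (use Dn in auto)
 have ae: "AE x in lborel. summable (%k. norm (D k x))"
 proof -
  have "(\<integral>\<^sup>+x. (\<Sum>k. ennreal (norm (D k x))) \<partial>lborel) = (\<Sum>k. \<integral>\<^sup>+x. ennreal (norm (D k x)) \<partial>lborel)"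
   by (rule nn_integral_suminf) (use Di in measurable)
  also have "... = (\<Sum>k. ennreal (\<integral>x. norm (D k x) \<partial>lborel))"
   by (rule suminf_cong) (use Di in "auto intro!: nn_integral_eq_integral")
  also have "... = ennreal (\<Sum>k. \<integral>x. norm (D k x) \<partial>lborel)" by (rule suminf_ennreal2[OF _ Ds]) simp
  also have "... < \<infinity>" by simp
  finally have "AE x in lborel. (\<Sum>k. ennreal (norm (D k x))) ~= \<infinity>"
   by (intro nn_integral_PInf_AE) (use Di in auto)
  then show ?thesis by eventually_elim (auto intro: summable_suminf_not_top)
 qed
 define k where "k x = G 0 x + (\<Sum>i. D i x)" for x
 have Sum: "L1_on {a..b} (%x. \<Sum>i. D i x)" "(%i. LINT x:{a..b}|lborel. D i x) sums (LINT x:{a..b}|lborel. (\<Sum>i. D i x))" for a b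
 proof -
  have e: "(%x. \<Sum>i. indicat_real {a..b} x *\<^sub>R D i x) = (%x. indicat_real {a..b} x *\<^sub>R (\<Sum>i. D i x))"
   by (auto simp: indicator_def fun_eq_iff)
  have ii: "integrable lborel (%x. indicat_real {a..b} x *\<^sub>R D i x)" for i by (rule integrable_mult_indicator[OF _ Di]) simp
  have as: "AE x in lborel. summable (%i. norm (indicat_real {a..b} x *\<^sub>R D i x))"
   using ae by eventually_elim (auto simp: indicator_def)
  have ss: "summable (%i. \<integral>x. norm (indicat_real {a..b} x *\<^sub>R D i x) \<partial>lborel)"
  proof (rule summable_comparison_test'[OF Ds, of 0])
   fix i :: nat
   have "(\<integral>x. norm (indicat_real {a..b} x *\<^sub>R D i x) \<partial>lborel) <= (\<integral>x. norm (D i x) \<partial>lborel)"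
    by (rule integral_mono) (use ii[of i] Di[of i] in "auto simp: indicator_def")
   then show "norm (\<integral>x. norm (indicat_real {a..b} x *\<^sub>R D i x) \<partial>lborel) <= (\<integral>x. norm (D i x) \<partial>lborel)" by simp
  qed
  show "L1_on {a..b} (%x. \<Sum>i. D i x)"
   using integrable_suminf[OF ii as ss] unfolding e set_integrable_def .
  show "(%i. LINT x:{a..b}|lborel. D i x) sums (LINT x:{a..b}|lborel. (\<Sum>i. D i x))"
   using sums_integral[OF ii as ss] unfolding e set_lebesgue_integral_def .
 qed
 have ki: "L1_on {a..b} k" for a b
  unfolding k_def[abs_def] by (rule set_integral_add(1)[OF circle_H1D(4)[OF H] Sum(1)])
 have km[measurable]: "k \<in> borel_measurable borel" by (rule L1_loc_UNIV_borel[OF L1_loc_UNIV_I[OF ki]])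
 have tele: "(\<Sum>i<n. G (Suc i) x - G i x) = G n x - G 0 x" for n x by (rule sum_lessThan_telescope)
 have kint: "(LINT y:{0..x}|lborel. k y) = f x - f 0" if x: "x \<in> ?I" for x
 proof -
  have "(LINT y:{0..x}|lborel. D i y) = (F (Suc i) x - F (Suc i) 0) - (F i x - F i 0)" for i
  proof -
   have "(LINT y:{0..x}|lborel. D i y) = (LINT y:{0..x}|lborel. G (Suc i) y - G i y)"
    unfolding set_lebesgue_integral_def by (rule Bochner_Integration.integral_cong) (use x in "auto simp: D_def indicator_def")
   also have "... = (LINT y:{0..x}|lborel. G (Suc i) y) - (LINT y:{0..x}|lborel. G i y)"
    by (rule set_integral_diff(2)[OF circle_H1D(4)[OF H] circle_H1D(4)[OF H]])
   also have "... = (F (Suc i) x - F (Suc i) 0) - (F i x - F i 0)"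
    using x by (simp add: primitiveD(2)[OF circle_H1D(1)[OF H]])
   finally show ?thesis .
  qed
  then have "(\<Sum>i<n. LINT y:{0..x}|lborel. D i y) = (F n x - F n 0) - (F 0 x - F 0 0)" for n
   using sum_lessThan_telescope[of "%i. F i x - F i 0" n] by simp
  moreover have "(%n. (F n x - F n 0) - (F 0 x - F 0 0)) ----> (f x - f 0) - (F 0 x - F 0 0)"
   by (intro tendsto_intros u)
  ultimately have "(%n. \<Sum>i<n. LINT y:{0..x}|lborel. D i y) ----> (f x - f 0) - (F 0 x - F 0 0)" by presburger
  from LIMSEQ_unique[OF Sum(2)[of 0 x, unfolded sums_def] this]
  have "(LINT y:{0..x}|lborel. (\<Sum>i. D i y)) = (f x - f 0) - (F 0 x - F 0 0)" .
  moreover have "(LINT y:{0..x}|lborel. G 0 y) = F 0 x - F 0 0" using x by (simp add: primitiveD(2)[OF circle_H1D(1)[OF H]])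
  ultimately show ?thesis unfolding k_def using set_integral_add(2)[OF circle_H1D(4)[OF H, of 0 x 0] Sum(1)] by simp
 qed
 have k2: "L1_on ?I (%x. (k x)^2)"
 proof -
  let ?u = "%n x. ennreal (indicat_real ?I x * (G n x)^2)"
  have lim: "AE x in lborel. ennreal (indicat_real ?I x * (k x)^2) = liminf (%n. ?u n x)"
   using ae
  proof eventually_elim
   case (elim x)
   have s: "(%n. \<Sum>i<n. D i x) ----> (\<Sum>i. D i x)" using summable_LIMSEQ[OF summable_norm_cancel[OF elim]] .
   have "(%n. ?u n x) ----> ennreal (indicat_real ?I x * (k x)^2)"
   proof (cases "x \<in> ?I")
    case True
    then have "(\<Sum>i<n. D i x) = G n x - G 0 x" for n using tele[of x n] by (simp add: D_def)
    then have "(%n. G 0 x + (G n x - G 0 x)) ----> k x" unfolding k_def using s by (intro tendsto_intros) simp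
    then have "(%n. G n x) ----> k x" by simp
    then show ?thesis by (intro tendsto_ennrealI tendsto_intros)
   qed simp
   then show ?case by (rule lim_imp_Liminf[OF sequentially_bot, symmetric])
  qed
  have "(\<integral>\<^sup>+x. ennreal (indicat_real ?I x * (k x)^2) \<partial>lborel) = (\<integral>\<^sup>+x. liminf (%n. ?u n x) \<partial>lborel)"
   by (rule nn_integral_cong_AE[OF lim])
  also have "... <= liminf (%n. \<integral>\<^sup>+x. ?u n x \<partial>lborel)"
   by (rule nn_integral_liminf) simp
  also have "... <= ennreal C"
  proof (rule Liminf_le[OF sequentially_bot always_eventually], intro allI)
   fix n
   have "(\<integral>\<^sup>+x. ?u n x \<partial>lborel) = ennreal (\<integral>x. indicat_real ?I x * (G n x)^2 \<partial>lborel)"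
    by (rule nn_integral_eq_integral) (use circle_H1D(3)[OF H, of 0 "2*pi" n] in "auto simp: set_integrable_def")
   also have "... <= ennreal C" using C[of n] by (intro ennreal_leI) (simp add: set_lebesgue_integral_def)
   finally show "(\<integral>\<^sup>+x. ?u n x \<partial>lborel) <= ennreal C" .
  qed
  also have "... < \<infinity>" by simp
  finally have "integrable lborel (%x. indicat_real ?I x * (k x)^2)" by (intro integrableI_nonneg) auto
  then show ?thesis by (simp add: set_integrable_def)
 qed
 have pf: "periodic f" unfolding periodic_def
 proof
  fix x
  have "F k (x + 2 * pi) = F k x" for k using circle_H1D(2)[OF H, of k] unfolding periodic_def by blast
  then show "f (x + 2 * pi) = f x" using LIMSEQ_unique[OF u[of "x + 2*pi"]] u[of x] by simp
 qed
 have kint': "0 <= x ==> x <= 2 * pi ==> (LINT y:{0..x}|lborel. k y) = f x - f 0" for x by (rule kint) simp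
 show ?thesis by (rule circle_H1_of_window[OF pf km ki k2 kint']) (assumption, assumption, (rule that; assumption))
qed

section \<open>Passage to the limit in the averaged energy\<close>

lemma fubini_rectangle:
 fixes F :: "real \<times> real => real"
 assumes i: "L1_on (A \<times> J) F"
 shows "L1_on A (%t. LINT x:J|lborel. F (t, x))"
  "(LINT t:A|lborel. (LINT x:J|lborel. F (t, x))) = (LINT p:A \<times> J|lborel. F p)"
  "AE t in lborel. t \<in> A --> L1_on J (%x. F (t, x))"
proof -
 let ?f = "%p. indicat_real (A \<times> J) p *\<^sub>R F p"
 have f: "integrable (lborel \<Otimes>\<^sub>M lborel) ?f" using i unfolding set_integrable_def lborel_prod .
 have e: "(%x. ?f (t, x)) = (%x. indicat_real A t *\<^sub>R (indicat_real J x *\<^sub>R F (t, x)))" for t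
  by (auto simp: indicator_def)
 have in1: "(\<integral>x. ?f (t, x) \<partial>lborel) = indicat_real A t *\<^sub>R (LINT x:J|lborel. F (t, x))" for t
  unfolding e set_lebesgue_integral_def by (rule integral_scaleR_right)
 show "L1_on A (%t. LINT x:J|lborel. F (t, x))"
  using lborel_pair.integrable_fst'[OF f] unfolding in1 set_integrable_def .
 show "(LINT t:A|lborel. (LINT x:J|lborel. F (t, x))) = (LINT p:A \<times> J|lborel. F p)"
  using lborel_pair.integral_fst'[OF f] unfolding in1 unfolding set_lebesgue_integral_def lborel_prod .
 show "AE t in lborel. t \<in> A --> L1_on J (%x. F (t, x))"
  using lborel_pair.AE_integrable_fst'[OF f]
 proof eventually_elim
  case (elim t)
  then show ?case unfolding e set_integrable_def by (auto simp: indicator_def)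
 qed
qed

lemma L2_on_subset: "L2_on S f ==> B \<in> sets borel ==> B \<subseteq> S ==> L2_on B f"
 unfolding L2_on_def by (auto intro: set_integrable_subset set_borel_measurable_subset)

lemma L2_on_mult: "L2_on S f ==> L2_on S g ==> L1_on S (%x. f x * g x)"
 unfolding L2_on_def by (rule set_integrable_mult_L2(1)) auto

lemma L2_on_compact_continuous:
 fixes f :: "'a::euclidean_space => real"
 assumes "compact K" "continuous_on K f" shows "L2_on K f"
 unfolding L2_on_def
proof
 have "set_borel_measurable borel K f"
  by (rule set_measurable_continuous_on[OF _ assms(2)]) (use compact_imp_closed[OF assms(1)] in auto)
 then show "set_borel_measurable lborel K f" by (simp add: set_borel_measurable_def)
 show "L1_on K (%x. (f x)^2)"
  unfolding set_integrable_def by (intro borel_integrable_compact continuous_intros assms)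
qed

locale bf_limit =
 fixes \<alpha> :: real and u uxx :: "real => real => real" and v :: "nat => real => real => real" and g :: "nat => real => real"
 assumes alpha: "0 < \<alpha>"
  and reg: "regularized \<alpha> (g j) (v j)"
  and unif: "0 < T ==> uniform_limit ({0..T} \<times> UNIV) (%j (t, x). v j t x) (%(t, x). u t x) sequentially"
  and weak: "0 < T ==> weakly_L2 ({0<..<T} \<times> {0..2*pi}) (%j (t, x). (deriv ^^ 2) (v j t) x) (%(t, x). uxx t x)"
begin

lemma v_cont: "continuous_on ({0..} \<times> UNIV) (%(t, x). v j t x)"
 using regularized.sol[OF reg] unfolding regularized_solution_def by blast

lemma u_cont: "0 < T ==> continuous_on ({0..T} \<times> UNIV) (%(t, x). u t x)"
 by (rule uniform_limit_theorem[OF always_eventually unif])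
  (auto intro: continuous_on_subset[OF v_cont])

lemma u_slice_cont: "0 <= t ==> continuous_on S (u t)"
proof -
 assume t: "0 <= t"
 have "continuous_on S (%x. (%(t, x). u t x) (t, x))"
 proof (rule continuous_on_compose2[OF u_cont[of "t + 1"]])
  show "continuous_on S (%x. (t, x))" by (rule continuous_on_Pair[OF continuous_on_const continuous_on_id])
 qed (use t in auto)
 then show ?thesis by simp
qed

definition q :: "real \<times> real => real" where
 "q p = - (1/2) * (u (fst p) (snd p) * (uxx (fst p) (snd p) + \<alpha>^2 * u (fst p) (snd p) + 2 * cos (snd p)))"

definition avg_energy :: "real => real" where "avg_energy t = (\<oint>x. q (t, x))"

text \<open>For each regularized flow, decay gives |A| times the energy at T at most the integral of
  the energy over A. On the right the product of v and its second derivative converges, as a strong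
  times a weak limit; on the left lower semicontinuity at the single time T is enough. No strong
  convergence of derivatives at a fixed time is ever used.\<close>

theorem energy_le_average:
 assumes T: "0 < T" and uT: "circle_H1 (u T) gT" and A: "A \<in> sets borel" "A \<subseteq> {0<..<T}" "0 < emeasure lborel A"
  and c: "AE t in lborel. t \<in> A --> avg_energy t <= c"
 shows "circle_energy \<alpha> (u T) gT <= c"
proof -
 let ?I = "{0..2*pi::real}"
 let ?P = "{0<..<T} \<times> ?I" and ?K = "{0..T} \<times> ?I" and ?B = "A \<times> ?I"
 define w where "w j p = v j (fst p) (snd p)" for j p
 define a where "a j p = (deriv ^^ 2) (v j (fst p)) (snd p)" for j p
 define w0 where "w0 p = u (fst p) (snd p)" for p
 define a0 where "a0 p = uxx (fst p) (snd p)" for p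
 define Q where "Q j p = - (1/2) * (w j p * (a j p + \<alpha>^2 * w j p + 2 * cos (snd p)))" for j p
 have K: "compact ?K" by (intro compact_Times) auto
 have Bb: "?B \<in> sets borel" using A(1) by (intro borel_Times) auto
 have BP: "?B \<subseteq> ?P" "?B \<subseteq> ?K" using A(2) by auto
 have Pb: "?P \<in> sets borel" by (intro borel_Times) auto
 have BK: "emeasure lborel S < \<infinity>" if "S \<subseteq> ?K" for S :: "(real \<times> real) set"
 proof -
  have "emeasure lborel S <= emeasure lborel ?K" by (rule emeasure_mono[OF that]) (use borel_compact[OF K] in simp)
  also have "... < \<infinity>" by (rule emeasure_compact_finite[OF K])
  finally show ?thesis .
 qed
 have Afin: "emeasure lborel A < \<infinity>"
 proof -
  have "emeasure lborel A <= emeasure lborel {0<..<T}" by (rule emeasure_mono[OF A(2)]) simp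
  also have "... < \<infinity>" using T by simp
  finally show ?thesis .
 qed
 have Apos: "0 < measure lborel A" using A(3) Afin by (simp add: measure_def enn2real_positive_iff)
 have ww: "w j = (%(t, x). v j t x)" "w0 = (%(t, x). u t x)" "a j = (%(t, x). (deriv ^^ 2) (v j t) x)" "a0 = (%(t, x). uxx t x)" for j
  by (auto simp: w_def w0_def a_def a0_def fun_eq_iff)
 have wc: "continuous_on ?K (w j)" "continuous_on ?K w0" for j
  unfolding ww by (rule continuous_on_subset[OF v_cont], force) (rule continuous_on_subset[OF u_cont[OF T]], force)
 have wL: "L2_on ?B (w j)" "L2_on ?B w0" for j
  using L2_on_subset[OF L2_on_compact_continuous[OF K] Bb BP(2)] wc by auto
 note wk = weak[OF T, folded ww]
 have aL: "L2_on ?P (a j)" "L2_on ?P a0" for j using wk unfolding weakly_L2_def by auto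
 have aB: "L2_on ?B (a j)" "L2_on ?B a0" for j using L2_on_subset[OF aL(1) Bb BP(1)] L2_on_subset[OF aL(2) Bb BP(1)] by auto
 have ul: "uniform_limit ?K w w0 sequentially"
  unfolding ww by (rule uniform_limit_on_subset[OF unif[OF T]]) auto
 have bd: "bounded (w0 ` ?K)" by (intro compact_imp_bounded compact_continuous_image wc K)
 define r where "r j p = \<alpha>^2 * w j p + 2 * cos (snd p)" for j p
 define r0 where "r0 p = \<alpha>^2 * w0 p + 2 * cos (snd p)" for p
 have rc: "continuous_on ?K (r j)" "continuous_on ?K r0" for j unfolding r_def r0_def by (intro continuous_intros wc)+
 have ur: "uniform_limit ?K r r0 sequentially"
 proof -
  have "uniform_limit ?K (%j p. \<alpha>^2 * w j p) (%p. \<alpha>^2 * w0 p) sequentially"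
   by (rule bounded_linear.uniform_limit[OF bounded_linear_mult_right ul])
  then show ?thesis unfolding r_def r0_def by (rule uniform_limit_add[OF _ uniform_limit_const])
 qed
 have uwr: "uniform_limit ?B (%j p. w j p * r j p) (%p. w0 p * r0 p) sequentially"
  by (rule uniform_limit_on_subset[OF uniform_lim_mult[OF ul ur bd] BP(2)]) (intro compact_imp_bounded compact_continuous_image rc K)
 have cK: "L1_on ?B f" if "continuous_on ?K f" for f :: "real \<times> real => real"
 proof -
  have "L1_on ?K f" unfolding set_integrable_def by (rule borel_integrable_compact[OF K that])
  then show ?thesis by (rule set_integrable_subset) (use Bb BP(2) in simp_all)
 qed
 have iwr: "L1_on ?B (%p. w j p * r j p)" "L1_on ?B (%p. w0 p * r0 p)" for j
  by (intro cK continuous_intros wc rc)+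
 have lim1: "(%j. LINT p:?B|lborel. w j p * r j p) ----> (LINT p:?B|lborel. w0 p * r0 p)"
  by (rule set_uniform_integral_tendsto[OF Bb BK[OF BP(2)] iwr uwr])
 have iwa: "L1_on ?B (%p. w j p * a i p)" "L1_on ?B (%p. w0 p * a i p)" "L1_on ?B (%p. w0 p * a0 p)" for i j
  by (rule L2_on_mult; rule wL aB)+
 have lim2: "(%j. LINT p:?B|lborel. w0 p * a j p) ----> (LINT p:?B|lborel. w0 p * a0 p)"
 proof -
  \<comment> \<open>Weak convergence is given on the full rectangle; cutting \<open>u\<close> off
    outside A moves the restriction in time into the test function.\<close>
  let ?psi = "%p. indicat_real ?B p * w0 p"
  have "L2_on ?P ?psi"
  proof -
   have e: "(%p. indicat_real ?P p *\<^sub>R ?psi p) = (%p. indicat_real ?B p *\<^sub>R w0 p)"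
    "(%p. indicat_real ?P p *\<^sub>R (?psi p)\<^sup>2) = (%p. indicat_real ?B p *\<^sub>R (w0 p)\<^sup>2)"
   proof -
    have *: "indicat_real ?P p *\<^sub>R ?psi p = indicat_real ?B p *\<^sub>R w0 p"
     "indicat_real ?P p *\<^sub>R (?psi p)\<^sup>2 = indicat_real ?B p *\<^sub>R (w0 p)\<^sup>2" for p
    proof (atomize (full), cases "p \<in> ?B")
     case True
     have "p \<in> ?P" by (rule subsetD[OF BP(1) True])
     with True show "indicat_real ?P p *\<^sub>R ?psi p = indicat_real ?B p *\<^sub>R w0 p &
      indicat_real ?P p *\<^sub>R (?psi p)\<^sup>2 = indicat_real ?B p *\<^sub>R (w0 p)\<^sup>2"
      by (simp only: indicator_simps scaleR_one mult_1_left simp_thms)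
    next
     case False
     have "indicat_real ?B p = 0" using False by (simp only: indicator_simps simp_thms)
     then show "indicat_real ?P p *\<^sub>R ?psi p = indicat_real ?B p *\<^sub>R w0 p &
      indicat_real ?P p *\<^sub>R (?psi p)\<^sup>2 = indicat_real ?B p *\<^sub>R (w0 p)\<^sup>2" by simp
    qed
    show "(%p. indicat_real ?P p *\<^sub>R ?psi p) = (%p. indicat_real ?B p *\<^sub>R w0 p)"
     "(%p. indicat_real ?P p *\<^sub>R (?psi p)\<^sup>2) = (%p. indicat_real ?B p *\<^sub>R (w0 p)\<^sup>2)" by (rule ext, rule *)+
   qed
   show ?thesis using wL(2) unfolding L2_on_def set_borel_measurable_def set_integrable_def e .
  qed
  then have "(%j. LINT p:?P|lborel. a j p * ?psi p) ----> (LINT p:?P|lborel. a0 p * ?psi p)"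
   using wk unfolding weakly_L2_def by blast
  moreover have "(LINT p:?P|lborel. f p * ?psi p) = (LINT p:?B|lborel. w0 p * f p)" for f
   unfolding set_lebesgue_integral_def by (rule Bochner_Integration.integral_cong) (use BP(1) in "auto simp: indicator_def")
  ultimately show ?thesis by simp
 qed
 obtain C where C: "0 <= C" "!!j. (LINT p:?P|lborel. (a j p)^2) <= C"
  by (rule weakly_L2_bounded[OF Pb wk]) (rule that; assumption)
 \<comment> \<open>A bound for the L1 norm of \<open>a j\<close>, uniform in \<open>j\<close>. It
   lets the uniformly small factor \<open>w j p - w0 p\<close> suppress the product although
   \<open>a j\<close> itself converges only weakly.\<close>
 define D where "D = sqrt (measure lborel ?B) * sqrt C"
 have one: "L2_on ?B (%_. 1)" by (rule L2_on_subset[OF L2_on_compact_continuous[OF K continuous_on_const] Bb BP(2)])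
 have aD: "(LINT p:?B|lborel. \<bar>a j p\<bar>) <= D" for j
 proof -
  have "(LINT p:?B|lborel. \<bar>1 * a j p\<bar>) <= sqrt (LINT p:?B|lborel. 1^2) * sqrt (LINT p:?B|lborel. (a j p)^2)"
   by (rule set_integrable_mult_L2(3)) (use one aB(1)[of j] in "simp_all add: L2_on_def")
  also have "(LINT p:?B|lborel. 1^2) = measure lborel ?B" using Bb BK[OF BP(2)] by (simp add: set_integral_const)
  also have "(LINT p:?B|lborel. (a j p)^2) <= C"
  proof -
   have "(LINT p:?B|lborel. (a j p)^2) <= (LINT p:?P|lborel. (a j p)^2)"
    unfolding set_lebesgue_integral_def
    by (rule integral_mono) (use aB(1)[of j] aL(1)[of j] BP(1) in "auto simp: L2_on_def set_integrable_def indicator_def")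
   then show ?thesis using C(2)[of j] by simp
  qed
  finally show ?thesis unfolding D_def by (simp add: mult_left_mono)
 qed
 have D0: "0 <= D" unfolding D_def using C(1) by simp
 have lim3: "(%j. LINT p:?B|lborel. (w j p - w0 p) * a j p) ----> 0"
 proof (rule LIMSEQ_I)
  fix e :: real assume e: "0 < e"
  define d where "d = e / (2 * (D + 1))"
  have d: "0 < d" "d * D < e"
  proof -
   show "0 < d" using e D0 by (simp add: d_def)
   have "d * D <= d * (D + 1)" using \<open>0 < d\<close> by simp
   also have "... = e / 2" unfolding d_def using D0 by (simp add: field_simps)
   finally show "d * D < e" using e by simp
  qed
  obtain N where N: "!!j p. N <= j ==> p \<in> ?K ==> dist (w j p) (w0 p) < d"
   using uniform_limitD[OF ul d(1)] unfolding eventually_sequentially by blast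
  have "norm ((LINT p:?B|lborel. (w j p - w0 p) * a j p) - 0) < e" if "N <= j" for j
  proof -
   have i: "L1_on ?B (%p. (w j p - w0 p) * a j p)"
    unfolding left_diff_distrib by (rule set_integral_diff(1)[OF iwa(1,2)])
   have ai: "L1_on ?B (%p. \<bar>a j p\<bar>)"
    using set_integrable_abs[OF L2_on_mult[OF one aB(1)]] by simp
   have "\<bar>LINT p:?B|lborel. (w j p - w0 p) * a j p\<bar> <= (LINT p:?B|lborel. \<bar>(w j p - w0 p) * a j p\<bar>)"
    unfolding set_lebesgue_integral_def by (rule order_trans[OF integral_abs_bound]) (simp add: abs_mult)
   also have "... <= (LINT p:?B|lborel. d * \<bar>a j p\<bar>)"
   proof (rule set_integral_mono[OF set_integrable_abs[OF i] set_integrable_mult_right[OF ai]])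
    fix p assume "p \<in> ?B"
    then have "\<bar>w j p - w0 p\<bar> <= d" using N[OF that, of p] BP(2) by (auto simp: dist_real_def less_imp_le)
    then show "\<bar>(w j p - w0 p) * a j p\<bar> <= d * \<bar>a j p\<bar>" by (simp add: abs_mult mult_right_mono)
   qed
   also have "... = d * (LINT p:?B|lborel. \<bar>a j p\<bar>)" by simp
   also have "... <= d * D" using aD d(1) by (intro mult_left_mono) auto
   finally show ?thesis using d(2) by simp
  qed
  then show "EX no. \<forall>n\<ge>no. norm ((LINT p:?B|lborel. (w n p - w0 p) * a n p) - 0) < e" by blast
 qed
 have Qi: "L1_on ?B (Q j)" for j
 proof -
  have e: "Q j = (%p. - (1/2) * (w j p * a j p + w j p * r j p))" by (auto simp: Q_def r_def algebra_simps)
  show ?thesis unfolding e by (rule set_integrable_mult_right) (rule set_integral_add(1)[OF iwa(1) iwr(1)])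
 qed
 have Qint: "(LINT p:?B|lborel. Q j p) = - (1/2) * (((LINT p:?B|lborel. (w j p - w0 p) * a j p) + (LINT p:?B|lborel. w0 p * a j p)) + (LINT p:?B|lborel. w j p * r j p))" for j
 proof -
  have e: "Q j = (%p. - (1/2) * (((w j p - w0 p) * a j p + w0 p * a j p) + w j p * r j p))" by (auto simp: Q_def r_def algebra_simps)
  have i: "L1_on ?B (%p. (w j p - w0 p) * a j p)"
   unfolding left_diff_distrib by (rule set_integral_diff(1)[OF iwa(1,2)])
  show ?thesis unfolding e
   by (simp only: set_integral_mult_right set_integral_add(2)[OF set_integral_add(1)[OF i iwa(2)] iwr(1)] set_integral_add(2)[OF i iwa(2)])
 qed
 have qe: "q = (%p. - (1/2) * (w0 p * a0 p + w0 p * r0 p))" by (auto simp: q_def w0_def a0_def r0_def algebra_simps)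
 have qi: "L1_on ?B q"
  unfolding qe by (rule set_integrable_mult_right) (rule set_integral_add(1)[OF iwa(3) iwr(2)])
 have qint: "(LINT p:?B|lborel. q p) = - (1/2) * ((0 + (LINT p:?B|lborel. w0 p * a0 p)) + (LINT p:?B|lborel. w0 p * r0 p))"
  unfolding qe by (simp only: set_integral_mult_right set_integral_add(2)[OF iwa(3) iwr(2)] add_0)
 have Qlim: "(%j. LINT p:?B|lborel. Q j p) ----> (LINT p:?B|lborel. q p)"
  unfolding Qint qint by (intro tendsto_intros lim1 lim2 lim3)
 have ej: "measure lborel A * regularized.e \<alpha> (v j) T <= (LINT p:?B|lborel. Q j p)" for j
 proof -
  interpret R: regularized \<alpha> "g j" "v j" by (rule reg)
  note fub = fubini_rectangle[OF Qi[of j]]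
  have eq: "(\<oint>x. Q j (t, x)) = R.e t" if "t \<in> A" for t
  proof -
   have "0 < t" using that A(2) by auto
   moreover have "Q j (t, x) = - (1/2) * (v j t x * (R.p t x + cos x))" for x
    by (simp add: Q_def w_def a_def R.p_def R.v2_def R.v1_def numeral_2_eq_2)
   ultimately show ?thesis using R.e_alt by simp
  qed
  have "measure lborel A * R.e T = (LINT t:A|lborel. R.e T)" using A(1) Afin by (simp add: set_integral_const)
  also have "... <= (LINT t:A|lborel. (\<oint>x. Q j (t, x)))"
  proof (rule set_integral_mono[OF _ fub(1)])
   show "L1_on A (%t. R.e T)" using A(1) Afin by (simp add: set_integrable_def)
   fix t assume t: "t \<in> A"
   then have "0 < t" "t <= T" using A(2) by auto
   then show "R.e T <= (\<oint>x. Q j (t, x))" unfolding eq[OF t] by (rule R.e_decreasing)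
  qed
  also have "... = (LINT p:?B|lborel. Q j p)" by (rule fub(2))
  finally show ?thesis .
 qed
 have vH: "circle_H1 (v j T) (regularized.v1 (v j) T)" for j
 proof -
  interpret R: regularized \<alpha> "g j" "v j" by (rule reg)
  show ?thesis unfolding circle_H1_def using R.prims(1)[OF T] R.pers(1)[OF T]
   by (auto intro!: cont_set_integrable continuous_intros R.slice_conts[OF T])
 qed
 have "circle_energy \<alpha> (u T) gT <= (LINT p:?B|lborel. q p) / measure lborel A"
 proof (rule energy_lower_semicontinuous[OF vH uT])
  have "uniform_limit {0..2*pi} (%j x. w j (T, x)) (%x. w0 (T, x)) sequentially"
   unfolding uniform_limit_iff
  proof (intro allI impI)
   fix e :: real assume "0 < e"
   from uniform_limitD[OF ul this]
   show "\<forall>\<^sub>F n in sequentially. \<forall>x\<in>{0..2*pi}. dist (w n (T, x)) (w0 (T, x)) < e"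
    by eventually_elim (use T in auto)
  qed
  then show "uniform_limit {0..2*pi} (%j. v j T) (u T) sequentially" by (simp add: w_def w0_def)
  show "circle_energy \<alpha> (v j T) (regularized.v1 (v j) T) <= (LINT p:?B|lborel. Q j p) / measure lborel A" for j
  proof -
   interpret R: regularized \<alpha> "g j" "v j" by (rule reg)
   show ?thesis using ej[of j] Apos by (simp add: R.e_def pos_le_divide_eq mult.commute)
  qed
  show "(%j. (LINT p:?B|lborel. Q j p) / measure lborel A) ----> (LINT p:?B|lborel. q p) / measure lborel A"
   using Apos by (intro tendsto_intros Qlim) auto
 qed
 also have "... <= c"
 proof -
  note fub = fubini_rectangle[OF qi]
  have "(LINT p:?B|lborel. q p) = (LINT t:A|lborel. avg_energy t)" unfolding avg_energy_def by (rule fub(2)[symmetric])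
  also have "... <= (LINT t:A|lborel. c)"
  proof (rule set_integral_mono_AE)
   show "L1_on A avg_energy" unfolding avg_energy_def[abs_def] by (rule fub(1))
   show "L1_on A (%t. c)" using A(1) Afin by (simp add: set_integrable_def)
   show "AE t\<in>A in lborel. avg_energy t <= c" by (rule c)
  qed
  also have "... = c * measure lborel A" using A(1) Afin by (simp add: set_integral_const)
  finally show ?thesis using Apos by (simp add: pos_divide_le_eq)
 qed
 finally show ?thesis .
qed

end

section \<open>Limits of slices with vanishing dissipation\<close>

text \<open>A window around a point of [0, 2 pi] may leave the period. Three consecutive periods
  contain it, at the cost of a factor 3 in the dissipation.\<close>

lemma nn_integral_three_windows:
 fixes h :: "real => ennreal"
 assumes h[measurable]: "h \<in> borel_measurable borel" and per: "!!x. h (x + 2 * pi) = h x"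
  and b: "(\<integral>\<^sup>+x\<in>{0..2*pi}. h x \<partial>lborel) <= c"
 shows "(\<integral>\<^sup>+x\<in>{-2*pi..4*pi}. h x \<partial>lborel) <= c + c + c"
proof -
 have shift: "(\<integral>\<^sup>+x\<in>{p..p+2*pi}. h x \<partial>lborel) = (\<integral>\<^sup>+x\<in>{0..2*pi}. h x \<partial>lborel)" if p: "!!x. h (x + p) = h x" for p
 proof -
  have "(\<integral>\<^sup>+x\<in>{p..p+2*pi}. h x \<partial>lborel) = ennreal \<bar>1\<bar> * (\<integral>\<^sup>+x. h (p + 1 * x) * indicator {p..p+2*pi} (p + 1 * x) \<partial>lborel)"
   by (rule nn_integral_real_affine) auto
  also have "... = (\<integral>\<^sup>+x\<in>{0..2*pi}. h x \<partial>lborel)"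
  proof -
   have "h (p + x) = h x" for x using p[of x] by (simp add: add.commute)
   then show ?thesis by (auto intro!: nn_integral_cong simp: indicator_def)
  qed
  finally show ?thesis .
 qed
 have pm: "h (x + - (2 * pi)) = h x" for x using per[of "x - 2 * pi"] by simp
 have "(\<integral>\<^sup>+x\<in>{-2*pi..4*pi}. h x \<partial>lborel) <= (\<integral>\<^sup>+x. (h x * indicator {-(2*pi)..-(2*pi)+2*pi} x + h x * indicator {0..2*pi} x) + h x * indicator {2*pi..2*pi+2*pi} x \<partial>lborel)"
  by (rule nn_integral_mono) (auto simp: indicator_def)
 also have "... = (\<integral>\<^sup>+x\<in>{-(2*pi)..-(2*pi)+2*pi}. h x \<partial>lborel) + (\<integral>\<^sup>+x\<in>{0..2*pi}. h x \<partial>lborel) + (\<integral>\<^sup>+x\<in>{2*pi..2*pi+2*pi}. h x \<partial>lborel)"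
  by (simp add: nn_integral_add)
 also have "... <= c + c + c"
  unfolding shift[OF pm] shift[OF per] by (intro add_mono b)
 finally show ?thesis .
qed

lemma primitive_hoelder:
 assumes p: "primitive f g" and g2: "L1_on {a..b} (%x. (g x)^2)" and xy: "a <= x" "x <= y" "y <= b"
 shows "\<bar>f y - f x\<bar> <= sqrt (b - a) * sqrt (LINT x:{a..b}|lborel. (g x)^2)"
proof -
 have gi: "L1_on {a..b} g" by (rule primitiveD(1)[OF p])
 have gxy: "L1_on {x..y} (%x. \<bar>g x\<bar>)" by (rule set_integrable_abs[OF primitiveD(1)[OF p]])
 have "\<bar>f y - f x\<bar> = \<bar>LINT z:{x..y}|lborel. g z\<bar>" using primitiveD(2)[OF p xy(2)] by simp
 also have "... <= (LINT z:{x..y}|lborel. \<bar>g z\<bar>)"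
  unfolding set_lebesgue_integral_def by (rule order_trans[OF integral_abs_bound]) (simp add: abs_mult)
 also have "... <= (LINT z:{a..b}|lborel. \<bar>1 * g z\<bar>)"
  unfolding set_lebesgue_integral_def
  by (rule integral_mono) (use gxy set_integrable_abs[OF gi] xy in "auto simp: set_integrable_def indicator_def")
 also have "... <= sqrt (LINT z:{a..b}|lborel. 1^2) * sqrt (LINT z:{a..b}|lborel. (g z)^2)"
  by (rule set_integrable_mult_L2(3)[OF _ cont_set_integrable[OF continuous_on_const] set_integrable_imp_measurable[OF gi] g2]) (auto simp: set_borel_measurable_def)
 also have "(LINT z:{a..b}|lborel. 1^2) = b - a" using xy by (simp add: set_integral_const)
 finally show ?thesis .
qed

lemma circle_H1_oscillation:
 assumes H: "circle_H1 f g"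
 shows "\<bar>f x - f z\<bar> <= sqrt (2 * pi) * sqrt (\<oint>x. (g x)^2)"
proof -
 obtain k :: int where k: "0 <= x + of_int k * (2 * pi)" "x + of_int k * (2 * pi) < 0 + 2 * pi" by (rule fold_period)
 obtain j :: int where j: "0 <= z + of_int j * (2 * pi)" "z + of_int j * (2 * pi) < 0 + 2 * pi" by (rule fold_period)
 have e: "f (x + of_int k * (2 * pi)) = f x" "f (z + of_int j * (2 * pi)) = f z" by (rule periodic_int[OF circle_H1D(2)[OF H]])+
 have *: "\<bar>f s - f r\<bar> <= sqrt (2 * pi) * sqrt (\<oint>x. (g x)^2)" if "0 <= r" "r <= s" "s <= 2 * pi" for r s
  using primitive_hoelder[OF circle_H1D(1)[OF H] circle_H1D(3)[OF H] that] by simp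
 show ?thesis
 proof (cases "x + of_int k * (2 * pi) <= z + of_int j * (2 * pi)")
  case True
  from *[OF k(1) this] j(2) show ?thesis unfolding e by (simp add: abs_minus_commute)
 next
  case False
  from *[OF j(1), of "x + of_int k * (2 * pi)"] k(2) False show ?thesis unfolding e by simp
 qed
qed

definition slice_dissipation :: "real => real => (real => real) => (real => real) => (real => real) => ennreal" where
 "slice_dissipation n \<alpha> f f1 d3 = (\<integral>\<^sup>+x\<in>{x. 0 < f x} \<inter> {0..2*pi}. ennreal (f x powr n * (d3 x + \<alpha>^2 * f1 x - sin x)^2) \<partial>lborel)"

lemma periodic_deriv:
 assumes "periodic f" shows "periodic (deriv f)"
proof -
 have "(%x. f (x + 2 * pi)) = f" using assms by (auto simp: periodic_def)
 then have "DERIV f (x + 2 * pi) :> D \<longleftrightarrow> DERIV f x :> D" for x D by (simp add: DERIV_shift)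
 then show ?thesis by (simp add: periodic_def deriv_def)
qed

text \<open>A solution at one fixed time, with two second derivatives: \<open>f2\<close> is a weak
  one on the whole circle, known in L2, while \<open>d2\<close> and \<open>d3\<close> are classical
  and meaningful only where \<open>f\<close> is positive.\<close>

locale slice =
 fixes f f1 f2 d2 d3 :: "real => real"
 assumes H: "circle_H1 f f1" and H1: "circle_H1 f1 f2" and nonneg: "0 <= f x"
  and d2: "0 < f x ==> (f1 has_real_derivative d2 x) (at x)"
  and d3: "0 < f x ==> (d2 has_real_derivative d3 x) (at x)"
  and d3_cont: "continuous_on {x. 0 < f x} d3" and d3_per: "periodic d3"
begin

lemma f_deriv: "(f has_real_derivative f1 x) (at x)"
 by (rule primitive_DERIV[OF circle_H1D(1)[OF H] circle_H1D(5)[OF H1], of "x - 1" _ "x + 1"]) auto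

text \<open>By periodicity the slope vanishes somewhere, so its oscillation bounds its size.\<close>

lemma f1_bound:
 assumes C: "(\<oint>x. (f2 x)^2) <= C"
 shows "\<bar>f1 x\<bar> <= sqrt (2 * pi) * sqrt C"
proof -
 have "EX z. 0 < z & z < 2 * pi & f (2 * pi) - f 0 = (2 * pi - 0) * f1 z"
  by (rule MVT2) (use f_deriv in auto)
 then obtain z where z: "f (2 * pi) - f 0 = (2 * pi) * f1 z" by auto
 moreover have "f (2 * pi) = f 0" using circle_H1D(2)[OF H, unfolded periodic_def, rule_format, of 0] by simp
 ultimately have "f1 z = 0" by simp
 then have "\<bar>f1 x\<bar> <= sqrt (2 * pi) * sqrt (\<oint>x. (f2 x)^2)" using circle_H1_oscillation[OF H1, of x z] by simp
 also have "... <= sqrt (2 * pi) * sqrt C" using C by (intro mult_left_mono real_sqrt_le_mono) auto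
 finally show ?thesis .
qed

lemma pos_open: "open {x. 0 < f x}"
 by (rule open_Collect_less) (auto intro: continuous_intros circle_H1D(5)[OF H])

text \<open>Where f \<ge> m, dividing the dissipation by m^n bounds the pressure gradient in L2, and
  Cauchy-Schwarz integrates this bound to one for the oscillation.\<close>

lemma pressure_oscillation:
 assumes dis: "slice_dissipation n \<alpha> f f1 d3 <= ennreal \<delta>" "0 <= \<delta>" and ab: "a < b" "- 2 * pi <= a" "b <= 4 * pi"
  and n: "0 < n" and m: "0 < m" "!!x. x \<in> {a..b} ==> m <= f x" and xy: "x \<in> {a..b}" "y \<in> {a..b}"
 shows "\<bar>(d2 y + \<alpha>^2 * f y + cos y) - (d2 x + \<alpha>^2 * f x + cos x)\<bar> <= sqrt (b - a) * sqrt (3 * \<delta> / m powr n)"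
proof -
 let ?p = "%x. d2 x + \<alpha>^2 * f x + cos x" and ?q = "%x. d3 x + \<alpha>^2 * f1 x - sin x"
 have pos: "0 < f x" if "x \<in> {a..b}" for x using m(2)[OF that] m(1) by simp
 have sub: "{a..b} \<subseteq> {x. 0 < f x}" using pos by auto
 have qcP: "continuous_on {x. 0 < f x} ?q" by (intro continuous_intros d3_cont circle_H1D(5)[OF H1])
 have qc: "continuous_on {a..b} ?q" by (rule continuous_on_subset[OF qcP sub])
 have pd: "(?p has_real_derivative ?q x) (at x)" if "x \<in> {a..b}" for x
  by (auto intro!: derivative_eq_intros d3[OF pos[OF that]] f_deriv)
 obtain G g where G: "primitive G g" "!!x. x \<in> {a..b} ==> G x = ?p x" "!!x. x \<in> {a..b} ==> g x = ?q x"
  apply (rule extend_primitive[OF less_imp_le[OF ab(1)] pd qc])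
  apply assumption
  apply (rule that; assumption)
  done
 have gq: "indicat_real {a..b} x *\<^sub>R (g x)\<^sup>2 = indicat_real {a..b} x *\<^sub>R (?q x)\<^sup>2" for x
  using G(3)[of x] by (auto simp: indicator_def)
 have q2: "L1_on {a..b} (%x. (?q x)^2)" by (intro cont_set_integrable continuous_intros qc)
 have g2: "L1_on {a..b} (%x. (g x)^2)" using q2 unfolding set_integrable_def gq .
 have geq: "(LINT x:{a..b}|lborel. (g x)^2) = (LINT x:{a..b}|lborel. (?q x)^2)" unfolding set_lebesgue_integral_def gq ..
 let ?h = "%x. ennreal (indicator {x. 0 < f x} x * (f x powr n * (?q x)^2))"
 have hm: "?h \<in> borel_measurable borel"
 proof -
  have "(%x. indicator {x. 0 < f x} x *\<^sub>R (f x powr n * (?q x)^2)) \<in> borel_measurable borel"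
  proof (rule borel_measurable_continuous_on_indicator)
   show "continuous_on {x. 0 < f x} (%x. f x powr n * (?q x)^2)"
    by (intro continuous_on_mult continuous_on_power qcP continuous_on_powr circle_H1D(5)[OF H] continuous_on_const) auto
  qed (use pos_open in auto)
  then show ?thesis by simp
 qed
 have hper: "?h (x + 2 * pi) = ?h x" for x
  using circle_H1D(2)[OF H] circle_H1D(2)[OF H1] d3_per by (simp add: periodic_def indicator_def)
 have "(\<integral>\<^sup>+x\<in>{0..2*pi}. ?h x \<partial>lborel) = slice_dissipation n \<alpha> f f1 d3"
  unfolding slice_dissipation_def by (auto intro!: nn_integral_cong simp: indicator_def)
 then have w0: "(\<integral>\<^sup>+x\<in>{0..2*pi}. ?h x \<partial>lborel) <= ennreal \<delta>" using dis(1) by simp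
 have "ennreal (\<integral>x. indicat_real {a..b} x *\<^sub>R (m powr n * (?q x)^2) \<partial>lborel) = (\<integral>\<^sup>+x. ennreal (indicat_real {a..b} x *\<^sub>R (m powr n * (?q x)^2)) \<partial>lborel)"
  by (rule nn_integral_eq_integral[symmetric]) (use set_integrable_mult_right[OF q2, of "m powr n"] in "auto simp: set_integrable_def")
 also have "... <= (\<integral>\<^sup>+x\<in>{-2*pi..4*pi}. ?h x \<partial>lborel)"
 proof (rule nn_integral_mono)
  fix x
  show "ennreal (indicat_real {a..b} x *\<^sub>R (m powr n * (?q x)^2)) <= ?h x * indicator {-2*pi..4*pi} x"
  proof (cases "x \<in> {a..b}")
   case True
   have "m powr n <= f x powr n" using m(1) m(2)[OF True] n by (intro powr_mono2) auto
   then show ?thesis using True pos[OF True] ab by (auto intro!: ennreal_leI mult_right_mono)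
  qed simp
 qed
 also have "... <= ennreal \<delta> + ennreal \<delta> + ennreal \<delta>" by (rule nn_integral_three_windows[OF hm hper w0])
 also have "... = ennreal (3 * \<delta>)" using dis(2) by (simp flip: ennreal_plus)
 finally have "m powr n * (LINT x:{a..b}|lborel. (?q x)^2) <= 3 * \<delta>"
  using dis(2) by (simp add: set_lebesgue_integral_def mult.left_commute)
 then have int: "(LINT x:{a..b}|lborel. (?q x)^2) <= 3 * \<delta> / m powr n" using m(1) by (simp add: pos_le_divide_eq mult.commute)
 have *: "\<bar>?p t - ?p s\<bar> <= sqrt (b - a) * sqrt (3 * \<delta> / m powr n)" if "s \<in> {a..b}" "t \<in> {a..b}" "s <= t" for s t
 proof -
  have "\<bar>G t - G s\<bar> <= sqrt (b - a) * sqrt (LINT x:{a..b}|lborel. (g x)^2)"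
   by (rule primitive_hoelder[OF G(1) g2]) (use that in auto)
  also have "... <= sqrt (b - a) * sqrt (3 * \<delta> / m powr n)"
   unfolding geq using int ab by (intro mult_left_mono real_sqrt_le_mono) auto
  finally show ?thesis using G(2)[OF that(1)] G(2)[OF that(2)] by simp
 qed
 show ?thesis
 proof (cases "x <= y")
  case True
  show ?thesis by (rule *[OF xy True])
 next
  case False
  then show ?thesis using *[OF xy(2,1)] by (simp add: abs_minus_commute)
 qed
qed

lemma slice_energy:
 "(\<oint>x. - (1/2) * (f x * (f2 x + \<alpha>^2 * f x + 2 * cos x))) = circle_energy \<alpha> f f1"
proof -
 let ?I = "{0..2*pi}"
 have fc: "continuous_on S f" for S by (rule circle_H1D(5)[OF H])
 have i1: "L1_on ?I (%x. f x * f2 x)" by (rule set_integrable_cont_mult[OF fc circle_H1D(4)[OF H1]])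
 have i2: "L1_on ?I (%x. \<alpha>^2 * (f x * f x))" "L1_on ?I (%x. 2 * (f x * cos x))"
  by (intro cont_set_integrable continuous_intros fc)+
 have per: "f (2 * pi) = f 0" "f1 (2 * pi) = f1 0"
  using circle_H1D(2)[OF H, unfolded periodic_def, rule_format, of 0] circle_H1D(2)[OF H1, unfolded periodic_def, rule_format, of 0] by simp_all
 have parts: "(\<oint>x. f x * f2 x) + (\<oint>x. f1 x * f1 x) = 0"
  using integral_by_parts_primitive[OF circle_H1D(1)[OF H] circle_H1D(1)[OF H1], of 0 "2*pi"] per by simp
 have "(\<oint>x. - (1/2) * (f x * (f2 x + \<alpha>^2 * f x + 2 * cos x)))
   = (\<oint>x. - (1/2) * ((f x * f2 x + \<alpha>^2 * (f x * f x)) + 2 * (f x * cos x)))"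
  by (simp add: algebra_simps)
 also have "... = - (1/2) * (((\<oint>x. f x * f2 x) + (\<oint>x. \<alpha>^2 * (f x * f x))) + (\<oint>x. 2 * (f x * cos x)))"
  by (simp only: set_integral_mult_right set_integral_add(2)[OF set_integral_add(1)[OF i1 i2(1)] i2(2)] set_integral_add(2)[OF i1 i2(1)])
 also have "... = circle_energy \<alpha> f f1"
  using parts unfolding circle_energy_def power2_eq_square set_integral_mult_right by (simp add: field_simps)
 finally show ?thesis .
qed

end

lemma circle_energy_tendsto:
 assumes c: "!!k. continuous_on UNIV (F k)" "continuous_on UNIV f" "!!k. continuous_on UNIV (G k)" "continuous_on UNIV g"
  and u: "uniform_limit UNIV F f sequentially" "uniform_limit UNIV G g sequentially"
 shows "(%k. circle_energy \<alpha> (F k) (G k)) ----> circle_energy \<alpha> f g"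
proof -
 have c': "continuous_on S (F k)" "continuous_on S f" "continuous_on S (G k)" "continuous_on S g" for S k
  using c by (auto intro: continuous_on_subset)
 have u': "uniform_limit {0..2*pi} F f sequentially" "uniform_limit {0..2*pi} G g sequentially"
  using u by (auto intro: uniform_limit_on_subset)
 show ?thesis unfolding circle_energy_def power2_eq_square
  by (intro tendsto_intros uniform_integral_tendsto uniform_limit_mult_cont u' continuous_intros c' uniform_limit_const)
qed

text \<open>The curvature bound gives compactness in C^1. Near a point where the limit is positive,
  vanishing dissipation flattens the pressures, but says nothing about their levels; the levels
  converge because the integral of the pressure over an interval involves only values of the film,
  its slope and sin. The limit of the levels is the constant of the pressure law.\<close>

theorem film_limit:
 fixes F F1 F2 D2 D3 :: "nat => real => real"
 assumes n: "0 < n" and alpha: "0 < \<alpha>" and S: "!!k. slice (F k) (F1 k) (F2 k) (D2 k) (D3 k)"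
  and mass: "!!k. (\<oint>x. F k x) = M"
  and C: "!!k. (\<oint>x. (F2 k x)^2) <= C"
  and dis: "!!k. slice_dissipation n \<alpha> (F k) (F1 k) (D3 k) <= ennreal (\<delta> k)" and \<delta>: "!!k. 0 <= \<delta> k" "\<delta> ----> 0"
 obtains w w1 w2 r where "film \<alpha> w w1 w2" "strict_mono (r :: nat => nat)"
  "uniform_limit UNIV (%k. F (r k)) w sequentially" "uniform_limit UNIV (%k. F1 (r k)) w1 sequentially"
proof -
 note H = slice.H[OF S] and H1 = slice.H1[OF S]
 define B1 where "B1 = sqrt (2 * pi) * sqrt C"
 have b1: "\<bar>F1 k x\<bar> <= B1" for k x unfolding B1_def by (rule slice.f1_bound[OF S C])
 have Fc: "continuous_on T (F k)" "continuous_on T (F1 k)" for T k by (rule circle_H1D(5)[OF H] circle_H1D(5)[OF H1])+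
 have G1: "(\<oint>x. (F1 k x)^2) <= 2 * pi * B1^2" for k
 proof -
  have "(\<oint>x. (F1 k x)^2) <= (\<oint>x. B1^2)"
  proof (rule set_integral_mono)
   fix x :: real
   have "\<bar>F1 k x\<bar> <= \<bar>B1\<bar>" using b1[of k x] by linarith
   then show "(F1 k x)^2 <= B1^2" by (simp add: abs_le_square_iff)
  qed (intro cont_set_integrable continuous_intros Fc)+
  then show ?thesis by (simp add: set_integral_const mult.commute)
 qed
 have b0: "\<bar>F k x\<bar> <= M / (2 * pi) + sqrt (2 * pi) * sqrt (2 * pi * B1^2)" for k x
 proof -
  have "F k x <= M / (2 * pi) + sqrt (2 * pi) * sqrt (\<oint>x. (F1 k x)^2)"
   by (rule circle_H1_sup_bound[OF H slice.nonneg[OF S] mass])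
  also have "... <= M / (2 * pi) + sqrt (2 * pi) * sqrt (2 * pi * B1^2)"
   using G1[of k] by (intro add_left_mono mult_left_mono real_sqrt_le_mono) auto
  finally show ?thesis using slice.nonneg[OF S] by simp
 qed
 obtain w1 r1 where r1: "strict_mono (r1 :: nat => nat)" "periodic w1" "continuous_on UNIV w1" "uniform_limit UNIV (%k. F1 (r1 k)) w1 sequentially"
  by (rule arzela_ascoli_circle[OF H1 b1 C]) (rule that; assumption)
 obtain w r2 where r2: "strict_mono (r2 :: nat => nat)" "periodic w" "continuous_on UNIV w" "uniform_limit UNIV (%k. F (r1 (r2 k))) w sequentially"
  by (rule arzela_ascoli_circle[OF H[of "r1 k" for k] b0[of "r1 k" for k] G1[of "r1 k" for k]]) (rule that; assumption)
 define r where "r = r1 \<circ> r2"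
 have r: "strict_mono r" unfolding r_def by (rule strict_mono_o[OF r1(1) r2(1)])
 have u0: "uniform_limit UNIV (%k. F (r k)) w sequentially" using r2(4) by (simp add: r_def)
 have u1: "uniform_limit UNIV (%k. F1 (r k)) w1 sequentially"
  unfolding uniform_limit_iff
 proof (intro allI impI)
  fix e :: real assume "0 < e"
  from uniform_limitD[OF r1(4) this] have "\<forall>\<^sub>F k in sequentially. \<forall>x\<in>UNIV. dist (F1 (r1 k) x) (w1 x) < e" .
  from eventually_compose_filterlim[OF this filterlim_subseq[OF r2(1)]]
  show "\<forall>\<^sub>F k in sequentially. \<forall>x\<in>UNIV. dist (F1 (r k) x) (w1 x) < e" by (simp add: r_def)
 qed
 have lim0: "(%k. F (r k) x) ----> w x" and lim1: "(%k. F1 (r k) x) ----> w1 x" for x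
  by (rule tendsto_uniform_limitI[OF u0] tendsto_uniform_limitI[OF u1]; simp)+
 have wc: "continuous_on T w" "continuous_on T w1" for T using r2(3) r1(3) by (auto intro: continuous_on_subset)
 have uI: "uniform_limit {a..b} (%k. F (r k)) w sequentially" "uniform_limit {a..b} (%k. F1 (r k)) w1 sequentially" for a b
  using u0 u1 by (auto intro: uniform_limit_on_subset)
 have wpos: "0 <= w x" for x by (rule LIMSEQ_le_const[OF lim0]) (use slice.nonneg[OF S] in auto)
 have pw: "primitive w w1" unfolding primitive_def
 proof (intro allI impI conjI)
  fix a b :: real assume ab: "a <= b"
  show "L1_on {a..b} w1" by (rule cont_set_integrable[OF wc(2)])
  have "(%k. LINT x:{a..b}|lborel. F1 (r k) x) ----> (LINT x:{a..b}|lborel. w1 x)"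
   by (rule uniform_integral_tendsto[OF Fc(2) wc(2) uI(2)])
  moreover have "(LINT x:{a..b}|lborel. F1 (r k) x) = F (r k) b - F (r k) a" for k
   by (rule primitiveD(2)[OF circle_H1D(1)[OF H] ab])
  ultimately have "(%k. F (r k) b - F (r k) a) ----> (LINT x:{a..b}|lborel. w1 x)" by simp
  then show "w b - w a = (LINT x:{a..b}|lborel. w1 x)" by (rule LIMSEQ_unique[OF tendsto_diff[OF lim0 lim0]])
 qed
 have dw: "(w has_real_derivative w1 x) (at x)" for x
  by (rule primitive_DERIV[OF pw wc(2), of "x - 1" x "x + 1"]) auto
 have win: "EX l e. 0 < e & (ALL y. \<bar>y - x0\<bar> < e --> 0 < w y & (w1 has_real_derivative (l - \<alpha>\<^sup>2 * w y - cos y)) (at y))"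
  if x0: "0 < w x0" "0 <= x0" "x0 <= 2 * pi" for x0
 proof -
  have "isCont w x0" using wc(1)[of UNIV] by (simp add: continuous_on_eq_continuous_at)
  then have "\<forall>e>0. \<exists>d>0. ALL y. dist y x0 < d --> dist (w y) (w x0) < e" unfolding continuous_at_eps_delta .
  moreover have "0 < w x0 / 2" using x0(1) by simp
  ultimately obtain d where d0: "0 < d" "ALL y. dist y x0 < d --> dist (w y) (w x0) < w x0 / 2" by blast
  then have d: "0 < d" "\<bar>y - x0\<bar> < d ==> \<bar>w y - w x0\<bar> < w x0 / 2" for y by (auto simp: dist_real_def)
  \<comment> \<open>At most half the radius given by continuity, and at most 1 so that the window
    stays inside the three periods [-2 pi, 4 pi].\<close>
  define e where "e = min (d / 2) 1"
  have e: "0 < e" "e < d" "e <= 1" using d(1) by (auto simp: e_def min_def)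
  define a where "a = x0 - e" define b where "b = x0 + e"
  have pi3: "3 < pi" by (rule pi_gt3)
  have ab: "a < b" "- 2 * pi <= a" "b <= 4 * pi" using e x0 pi3 by (auto simp: a_def b_def)
  have wm: "w x0 / 2 < w y" if "y \<in> {a..b}" for y
  proof -
   have "\<bar>y - x0\<bar> < d" using that e by (auto simp: a_def b_def)
   from d(2)[OF this] show ?thesis by linarith
  qed
  \<comment> \<open>On the window the limit exceeds half of \<open>w x0\<close>, and the
    approximants are eventually within a quarter of \<open>w x0\<close>, hence also above a
    quarter.\<close>
  define m where "m = w x0 / 4"
  have m: "0 < m" using x0 by (simp add: m_def)
  have "\<forall>\<^sub>F k in sequentially. \<forall>x\<in>UNIV. dist (F (r k) x) (w x) < m" by (rule uniform_limitD[OF u0 m])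
  then obtain N where N: "\<forall>k\<ge>N. ALL x. \<bar>F (r k) x - w x\<bar> < m" unfolding eventually_sequentially dist_real_def by auto
  have Fm: "m <= F (r k) x" if "N <= k" "x \<in> {a..b}" for k x
  proof -
   have "\<bar>F (r k) x - w x\<bar> < m" using N that(1) by blast
   then show ?thesis using wm[OF that(2)] x0(1) unfolding m_def by linarith
  qed
  define P where "P k x = D2 (r k) x + \<alpha>^2 * F (r k) x + cos x" for k x
  define o' where "o' k = sqrt (b - a) * sqrt (3 * \<delta> (r k) / m powr n)" for k
  have osc: "\<bar>P k y - P k x0\<bar> <= o' k" if "N <= k" "y \<in> {a..b}" for k y
   unfolding P_def o'_def
   by (rule slice.pressure_oscillation[OF S dis \<delta>(1) ab n m]) (use Fm[OF that(1)] that(2) e in "auto simp: a_def b_def")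
  have o0: "o' ----> 0"
  proof -
   have "(%k. sqrt (b - a) * sqrt (3 * \<delta> (r k) / m powr n)) ----> sqrt (b - a) * sqrt (3 * 0 / m powr n)"
    using LIMSEQ_subseq_LIMSEQ[OF \<delta>(2) r] m by (intro tendsto_intros) (auto simp: o_def)
   then show ?thesis by (simp add: o'_def[abs_def])
  qed
  \<comment> \<open>The integral of the pressure over [x, y], written without second derivatives so
    that it converges.\<close>
  define A where "A k x y = (F1 (r k) y - F1 (r k) x) + \<alpha>^2 * (LINT z:{x..y}|lborel. F (r k) z) + (sin y - sin x)" for k x y
  define A' where "A' x y = (w1 y - w1 x) + \<alpha>^2 * (LINT z:{x..y}|lborel. w z) + (sin y - sin x)" for x y
  have AA: "(%k. A k x y) ----> A' x y" for x y
   unfolding A_def A'_def by (intro tendsto_intros lim1 uniform_integral_tendsto Fc wc uI)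
  have Ab: "\<bar>A k x y - P k x0 * (y - x)\<bar> <= o' k * (y - x)" if k: "N <= k" and xy: "x \<in> {a..b}" "y \<in> {a..b}" "x < y" for k x y
  proof -
   obtain W where W: "primitive W (F (r k))" using primitive_indefinite_integral[of "F (r k)"] cont_set_integrable[OF Fc(1)] by blast
   have dW: "(W has_real_derivative F (r k) z) (at z)" for z
    by (rule primitive_DERIV[OF W Fc(1), of "z - 1" z "z + 1"]) auto
   let ?f = "%z. F1 (r k) z + \<alpha>^2 * W z + sin z"
   have dd: "(?f has_real_derivative P k z) (at z)" if "z \<in> {a..b}" for z
   proof -
    have "0 < F (r k) z" using Fm[OF k that] m by simp
    from slice.d2[OF S this] show ?thesis unfolding P_def by (intro DERIV_add DERIV_cmult dW DERIV_sin)
   qed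
   have "EX z. x < z & z < y & ?f y - ?f x = (y - x) * P k z"
    by (rule MVT2[OF xy(3)]) (use dd xy in auto)
   then obtain z where z: "x < z" "z < y" "?f y - ?f x = (y - x) * P k z" by blast
   have "W y - W x = (LINT z:{x..y}|lborel. F (r k) z)" using primitiveD(2)[OF W less_imp_le[OF xy(3)]] by simp
   then have "A k x y = ?f y - ?f x" by (simp add: A_def algebra_simps)
   then have "A k x y - P k x0 * (y - x) = (P k z - P k x0) * (y - x)" unfolding z(3) by (simp add: algebra_simps)
   then have "\<bar>A k x y - P k x0 * (y - x)\<bar> = \<bar>P k z - P k x0\<bar> * (y - x)" using xy(3) by (simp add: abs_mult)
   also have "... <= o' k * (y - x)" using osc[OF k, of z] z xy by (intro mult_right_mono) auto
   finally show ?thesis .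
  qed
  have lim_diff: "(%k. A k x y - P k x0 * (y - x)) ----> 0" if xy: "x \<in> {a..b}" "y \<in> {a..b}" "x < y" for x y
  proof (rule Lim_null_comparison)
   show "\<forall>\<^sub>F k in sequentially. norm (A k x y - P k x0 * (y - x)) <= o' k * (y - x)"
    by (rule eventually_sequentiallyI[of N]) (use Ab[OF _ xy] in simp)
   show "(%k. o' k * (y - x)) ----> 0" using tendsto_mult_right[OF o0, of "y - x"] by simp
  qed
  \<comment> \<open>The pressure at \<open>x0\<close> differs from its mean over the window by at
    most \<open>o' k\<close>, so it tends to the limit of the means.\<close>
  define l where "l = A' a b / (b - a)"
  have Pl: "(%k. P k x0) ----> l"
  proof -
   have "(%k. (A k a b - (A k a b - P k x0 * (b - a))) / (b - a)) ----> (A' a b - 0) / (b - a)"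
    using ab by (intro tendsto_intros AA lim_diff) auto
   then show ?thesis using ab by (simp add: l_def)
  qed
  have Al: "A' x y = l * (y - x)" if xy: "x \<in> {a..b}" "y \<in> {a..b}" "x < y" for x y
  proof -
   have "(%k. A k x y - P k x0 * (y - x)) ----> A' x y - l * (y - x)" by (intro tendsto_intros AA Pl)
   from LIMSEQ_unique[OF this lim_diff[OF xy]] show ?thesis by simp
  qed
  obtain W where W: "primitive W w" using primitive_indefinite_integral[of w] cont_set_integrable[OF wc(1)] by blast
  have dW: "(W has_real_derivative w z) (at z)" for z
   by (rule primitive_DERIV[OF W wc(1), of "z - 1" z "z + 1"]) auto
  have D: "(w1 has_real_derivative (l - \<alpha>\<^sup>2 * w y - cos y)) (at y)" if y: "y \<in> {a<..<b}" for y
  proof (rule has_field_derivative_transform_within_open[where S = "{a<..<b}"])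
   show "((%y. w1 a - \<alpha>\<^sup>2 * (W y - W a) - (sin y - sin a) + l * (y - a)) has_real_derivative (l - \<alpha>\<^sup>2 * w y - cos y)) (at y)"
    by (auto intro!: derivative_eq_intros dW)
   fix z assume z: "z \<in> {a<..<b}"
   have "A' a z = l * (z - a)" by (rule Al) (use z ab in auto)
   moreover have "W z - W a = (LINT x:{a..z}|lborel. w x)" using primitiveD(2)[OF W, of a z] z by simp
   ultimately show "w1 a - \<alpha>\<^sup>2 * (W z - W a) - (sin z - sin a) + l * (z - a) = w1 z" unfolding A'_def by simp
  qed (use y in auto)
  have pos: "0 < w y" if "\<bar>y - x0\<bar> < e" for y
  proof -
   have "y \<in> {a..b}" using that by (auto simp: a_def b_def)
   then show ?thesis using wm[of y] x0(1) by simp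
  qed
  have "ALL y. \<bar>y - x0\<bar> < e --> 0 < w y & (w1 has_real_derivative (l - \<alpha>\<^sup>2 * w y - cos y)) (at y)"
  proof (intro allI impI conjI)
   fix y assume y: "\<bar>y - x0\<bar> < e"
   show "0 < w y" by (rule pos[OF y])
   show "(w1 has_real_derivative (l - \<alpha>\<^sup>2 * w y - cos y)) (at y)" by (rule D) (use y in "auto simp: a_def b_def")
  qed
  then show ?thesis using e(1) by blast
 qed
 have loc: "EX l e. 0 < e & (ALL y. \<bar>y - x0\<bar> < e --> 0 < w y & (w1 has_real_derivative (l - \<alpha>\<^sup>2 * w y - cos y)) (at y))"
  if x0: "0 < w x0" for x0
 proof -
  obtain j :: int where j: "0 <= x0 + of_int j * (2 * pi)" "x0 + of_int j * (2 * pi) < 0 + 2 * pi" by (rule fold_period)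
  let ?s = "of_int j * (2 * pi)"
  have per: "w (y + ?s) = w y" "w1 (y + ?s) = w1 y" "cos (y + ?s) = cos y" for y
   using periodic_int[OF r2(2)] periodic_int[OF r1(2)] periodic_int[of cos] by (auto simp: periodic_def)
  have "0 < w (x0 + ?s)" "x0 + ?s <= 2 * pi" using x0 per j(2) by auto
  from win[OF this(1) j(1) this(2)] obtain l e where le: "0 < e"
   "ALL y. \<bar>y - (x0 + ?s)\<bar> < e --> 0 < w y & (w1 has_real_derivative (l - \<alpha>\<^sup>2 * w y - cos y)) (at y)" by blast
  have "0 < w y & (w1 has_real_derivative (l - \<alpha>\<^sup>2 * w y - cos y)) (at y)" if "\<bar>y - x0\<bar> < e" for y
  proof -
   have "\<bar>(y + ?s) - (x0 + ?s)\<bar> < e" using that by simp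
   with le(2) have "0 < w (y + ?s) & (w1 has_real_derivative (l - \<alpha>\<^sup>2 * w (y + ?s) - cos (y + ?s))) (at (y + ?s))" by blast
   then have "0 < w y" "(w1 has_real_derivative (l - \<alpha>\<^sup>2 * w y - cos y)) (at (y + ?s))" unfolding per by auto
   then show ?thesis unfolding DERIV_shift per by simp
  qed
  then show ?thesis using le(1) by blast
 qed
 define w2 where "w2 x = (if 0 < w x then deriv w1 x else 0)" for x
 have "film \<alpha> w w1 w2"
 proof
  show "0 < \<alpha>" "periodic w" "continuous_on UNIV w1" by fact+
  show "0 <= w x" "(w has_real_derivative w1 x) (at x)" for x by (rule wpos dw)+
  show "w2 x = 0" if "w x = 0" for x using that by (simp add: w2_def)
  fix x assume x: "0 < w x"
  from loc[OF x] obtain l e where e: "0 < e" and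
   le: "ALL y. \<bar>y - x\<bar> < e --> 0 < w y & (w1 has_real_derivative (l - \<alpha>\<^sup>2 * w y - cos y)) (at y)" by blast
  have w2: "w2 y = l - \<alpha>\<^sup>2 * w y - cos y" if "\<bar>y - x\<bar> < e" for y
  proof -
   have "0 < w y" "(w1 has_real_derivative (l - \<alpha>\<^sup>2 * w y - cos y)) (at y)" using le that by auto
   then show ?thesis by (simp add: w2_def DERIV_imp_deriv)
  qed
  have "(w1 has_real_derivative (l - \<alpha>\<^sup>2 * w x - cos x)) (at x)" using le e by simp
  then show "(w1 has_real_derivative w2 x) (at x)" using w2[of x] e by simp
  show "(w2 has_real_derivative (sin x - \<alpha>\<^sup>2 * w1 x)) (at x)"
  proof (rule has_field_derivative_transform_within_open[where S = "ball x e"])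
   show "((%y. l - \<alpha>\<^sup>2 * w y - cos y) has_real_derivative (sin x - \<alpha>\<^sup>2 * w1 x)) (at x)"
    by (auto intro!: derivative_eq_intros dw)
   show "l - \<alpha>\<^sup>2 * w y - cos y = w2 y" if "y \<in> ball x e" for y
    using w2[of y] that by (simp add: dist_real_def abs_minus_commute)
  qed (use e in auto)
 qed
 then show ?thesis by (rule that[OF _ r u0 u1])
qed

section \<open>Times of bounded curvature and small dissipation\<close>

lemma primitive_cong_AE:
 assumes p: "primitive f g" and ae: "AE x in lborel. g x = h x" and h: "continuous_on UNIV h"
 shows "primitive f h"
 unfolding primitive_def
proof (intro allI impI conjI)
 fix a b :: real assume ab: "a <= b"
 show "L1_on {a..b} h" by (rule cont_set_integrable[OF continuous_on_subset[OF h]]) simp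
 have gb: "g \<in> borel_measurable borel" by (rule L1_loc_UNIV_borel[OF L1_loc_UNIV_I[OF primitiveD(1)[OF p]]])
 have "(LINT x:{a..b}|lborel. g x) = (LINT x:{a..b}|lborel. h x)"
  by (rule set_lebesgue_integral_cong_AE) (use ae gb borel_measurable_continuous_onI[OF h] in "auto elim!: eventually_mono")
 then show "f b - f a = (LINT x:{a..b}|lborel. h x)" using primitiveD(2)[OF p ab] by simp
qed

lemma continuous_H2_circle:
 assumes f: "continuous_on UNIV f" "periodic f" and w: "weak_deriv UNIV f g" "weak_deriv UNIV g h"
  and h2: "L1_on {0..2*pi} (%x. (h x)^2)"
 obtains f1 f2 where "circle_H1 f f1" "circle_H1 f1 f2" "!!x. (f has_real_derivative f1 x) (at x)"
  "!!x. 0 <= x ==> x < 2 * pi ==> f2 x = h x"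
proof -
 obtain f1 where f1: "primitive f1 h" "AE x in lborel. g x = f1 x"
  by (rule weak_deriv_UNIV_imp_primitive[OF w(2)]) (rule that; assumption)
 have f1c: "continuous_on S f1" for S by (rule primitive_continuous[OF f1(1)])
 obtain f0 where f0: "primitive f0 g" "AE x in lborel. f x = f0 x"
  by (rule weak_deriv_UNIV_imp_primitive[OF w(1)]) (rule that; assumption)
 have "f = f0" by (rule ext) (rule AE_eq_continuous_imp_eq[OF f(1) primitive_continuous[OF f0(1)] f0(2)])
 then have p: "primitive f f1" using primitive_cong_AE[OF f0(1) f1(2) f1c] by simp
 have d: "(f has_real_derivative f1 x) (at x)" for x by (rule primitive_DERIV[OF p f1c, of "x - 1" x "x + 1"]) auto
 have "f1 = deriv f" using DERIV_imp_deriv[OF d] by (intro ext) simp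
 then have per1: "periodic f1" using periodic_deriv[OF f(2)] by simp
 have "circle_H1 f f1" unfolding circle_H1_def using p f(2) by (auto intro!: cont_set_integrable continuous_intros f1c)
 moreover have hb: "h \<in> borel_measurable borel" by (rule L1_loc_UNIV_borel[OF L1_loc_UNIV_I[OF primitiveD(1)[OF f1(1)]]])
 obtain f2 where "circle_H1 f1 f2" "!!x. 0 <= x ==> x < 2 * pi ==> f2 x = h x"
  by (rule circle_H1_of_window[OF per1 hb primitiveD(1)[OF f1(1)] h2 primitiveD(2)[OF f1(1)]]) (assumption, (rule that; assumption))
 ultimately show ?thesis using d by (intro that)
qed

lemma smooth_on_continuous_partial_x:
 fixes u :: "real => real => real"
 assumes S: "open S" and u: "smooth_on S (%(t, x). u t x)"
 shows "smooth_on S (%(t, x). (deriv ^^ k) (u t) x)"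
  "(t, x) \<in> S ==> ((deriv ^^ k) (u t) has_real_derivative (deriv ^^ Suc k) (u t) x) (at x)"
proof -
 show s: "smooth_on S (%(t, x). (deriv ^^ k) (u t) x)" for k
 proof (induction k)
  case (Suc k)
  from smooth_on_partial_x(2)[OF S, of "%t. (deriv ^^ k) (u t)", OF Suc] show ?case by simp
 qed (use u in simp)
 show "((deriv ^^ k) (u t) has_real_derivative (deriv ^^ Suc k) (u t) x) (at x)" if "(t, x) \<in> S"
  using smooth_on_partial_x(1)[OF S, of "%t. (deriv ^^ k) (u t)", OF s that] by simp
qed

text \<open>If few good times existed, \<open>1 <= X / C + D / \<delta>\<close> would hold at almost every time, and integrating
 this over a long interval contradicts the linear bound on \<open>X\<close> and the boundedness of \<open>D\<close>.\<close>

lemma good_times: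
 fixes X D :: "real => ennreal"
 assumes X[measurable]: "X \<in> borel_measurable borel" and D[measurable]: "D \<in> borel_measurable borel"
  and AB: "0 <= A" "0 <= B" and Xb: "(\<integral>\<^sup>+t\<in>{0<..<T}. X t \<partial>lborel) <= ennreal (A + B * T)"
  and Db: "(\<integral>\<^sup>+t\<in>{0<..<T}. D t \<partial>lborel) <= ennreal K" "0 <= K"
  and \<delta>: "0 < \<delta>" and T: "1 <= T" "2 * K / \<delta> < T"
 shows "0 < emeasure lborel {t \<in> {0<..<T}. X t <= ennreal (2 * (A + B + 1)) & D t <= ennreal \<delta>}"
proof (rule ccontr)
 \<comment> \<open>For T \<ge> 1 the integral of \<open>X\<close> is at most (A + B) * T, so by
   Chebyshev \<open>X\<close> exceeds this level during less than half of the time; 2 * K / \<delta>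
   < T does the same for \<open>D\<close> and \<delta>.\<close>
 let ?C = "2 * (A + B + 1)"
 let ?G = "{t \<in> {0<..<T}. X t <= ennreal ?C & D t <= ennreal \<delta>}"
 assume "~ 0 < emeasure lborel ?G"
 then have 0: "emeasure lborel ?G = 0" by simp
 have C: "0 < ?C" using AB by simp
 have Gm: "?G \<in> sets lborel" by measurable
 have ae: "AE t in lborel. t \<notin> ?G" by (rule AE_not_in) (use 0 Gm in "simp add: null_sets_def")
 have step: "1 <= ennreal (1 / ?C) * X t + ennreal (1 / \<delta>) * D t" if "~ X t <= ennreal ?C \<or> ~ D t <= ennreal \<delta>" for t
  using that
 proof
  assume "~ X t <= ennreal ?C"
  then have "ennreal (1 / ?C) * ennreal ?C <= ennreal (1 / ?C) * X t" by (intro mult_left_mono) auto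
  moreover have "ennreal (1 / ?C) * ennreal ?C = 1" using C by (simp flip: ennreal_mult ennreal_1)
  ultimately show ?thesis by (metis add_increasing2 zero_le)
 next
  assume "~ D t <= ennreal \<delta>"
  then have "ennreal (1 / \<delta>) * ennreal \<delta> <= ennreal (1 / \<delta>) * D t" by (intro mult_left_mono) auto
  moreover have "ennreal (1 / \<delta>) * ennreal \<delta> = 1" using \<delta> by (simp flip: ennreal_mult ennreal_1)
  ultimately show ?thesis by (metis add_increasing zero_le)
 qed
 have "ennreal T = (\<integral>\<^sup>+t. indicator {0<..<T} t \<partial>lborel)" using T(1) by simp
 also have "... <= (\<integral>\<^sup>+t. ennreal (1 / ?C) * (X t * indicator {0<..<T} t) + ennreal (1 / \<delta>) * (D t * indicator {0<..<T} t) \<partial>lborel)"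
 proof (rule nn_integral_mono_AE)
  show "AE t in lborel. indicator {0<..<T} t <= ennreal (1 / ?C) * (X t * indicator {0<..<T} t) + ennreal (1 / \<delta>) * (D t * indicator {0<..<T} t)"
   using ae
  proof eventually_elim
   case (elim t)
   show ?case
   proof (cases "t \<in> {0<..<T}")
    case True
    then show ?thesis using step[of t] elim by simp
   qed simp
  qed
 qed
 also have "... = ennreal (1 / ?C) * (\<integral>\<^sup>+t\<in>{0<..<T}. X t \<partial>lborel) + ennreal (1 / \<delta>) * (\<integral>\<^sup>+t\<in>{0<..<T}. D t \<partial>lborel)"
  by (simp add: nn_integral_add nn_integral_cmult)
 also have "... <= ennreal (1 / ?C) * ennreal (A + B * T) + ennreal (1 / \<delta>) * ennreal K"
  by (intro add_mono mult_left_mono Xb Db(1)) auto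
 also have "... = ennreal (1 / ?C * (A + B * T) + 1 / \<delta> * K)"
 proof -
  have "0 <= A + B * T" using AB T(1) by simp
  then have p1: "0 <= 1 / ?C * (A + B * T)" using C by simp
  have p2: "0 <= 1 / \<delta> * K" using \<delta> Db(2) by simp
  have "ennreal (1 / ?C * (A + B * T)) = ennreal (1 / ?C) * ennreal (A + B * T)"
   by (rule ennreal_mult) (use C \<open>0 <= A + B * T\<close> in simp_all)
  moreover have "ennreal (1 / \<delta> * K) = ennreal (1 / \<delta>) * ennreal K"
   by (rule ennreal_mult) (use \<delta> Db(2) in simp_all)
  ultimately show ?thesis unfolding ennreal_plus[OF p1 p2] by (simp only:)
 qed
 finally have "T <= 1 / ?C * (A + B * T) + 1 / \<delta> * K"
  using AB T(1) C \<delta> Db(2) by (subst (asm) ennreal_le_iff) (auto intro!: add_nonneg_nonneg divide_nonneg_pos)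
 moreover have "1 / ?C * (A + B * T) <= T / 2"
 proof -
  have "A * 1 <= A * T" using AB(1) T(1) by (intro mult_left_mono) auto
  then have "A + B * T <= T / 2 * ?C" using T(1) by (simp add: algebra_simps)
  then show ?thesis using C by (simp add: pos_divide_le_eq)
 qed
 moreover have "1 / \<delta> * K < T / 2"
 proof -
  have "2 * K / \<delta> = 2 * (1 / \<delta> * K)" by simp
  with T(2) show ?thesis by linarith
 qed
 ultimately show False by linarith
qed

lemma tonelli_strip:
 fixes h :: "real \<times> real => ennreal"
 assumes h[measurable]: "h \<in> borel_measurable borel"
 shows "(%t. \<integral>\<^sup>+x\<in>{0..2*pi}. h (t, x) \<partial>lborel) \<in> borel_measurable borel"
  "(\<integral>\<^sup>+t\<in>{0<..<T}. (\<integral>\<^sup>+x\<in>{0..2*pi}. h (t, x) \<partial>lborel) \<partial>lborel) = (\<integral>\<^sup>+p\<in>{0<..<T} \<times> {0..2*pi}. h p \<partial>lborel)"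
proof -
 have h'[measurable]: "h \<in> borel_measurable (borel \<Otimes>\<^sub>M borel)" using h by (simp add: borel_prod)
 show "(%t. \<integral>\<^sup>+x\<in>{0..2*pi}. h (t, x) \<partial>lborel) \<in> borel_measurable borel" by measurable
 have m: "(%p. h p * indicator ({0<..<T} \<times> {0..2*pi}) p) \<in> borel_measurable (lborel \<Otimes>\<^sub>M lborel)" by measurable
 have "(\<integral>\<^sup>+t\<in>{0<..<T}. (\<integral>\<^sup>+x\<in>{0..2*pi}. h (t, x) \<partial>lborel) \<partial>lborel)
  = (\<integral>\<^sup>+t. (\<integral>\<^sup>+x. h (t, x) * indicator ({0<..<T} \<times> {0..2*pi}) (t, x) \<partial>lborel) \<partial>lborel)"
  by (rule nn_integral_cong) (auto simp: indicator_def intro!: nn_integral_cong)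
 also have "... = (\<integral>\<^sup>+p\<in>{0<..<T} \<times> {0..2*pi}. h p \<partial>lborel)"
  using lborel.nn_integral_fst[OF m] by (simp add: lborel_prod)
 finally show "(\<integral>\<^sup>+t\<in>{0<..<T}. (\<integral>\<^sup>+x\<in>{0..2*pi}. h (t, x) \<partial>lborel) \<partial>lborel) = (\<integral>\<^sup>+p\<in>{0<..<T} \<times> {0..2*pi}. h p \<partial>lborel)" .
qed

section \<open>Approach of the energy to its minimum\<close>

locale long_time =
 fixes n \<alpha> M :: real and u uxx :: "real => real => real" and ustar v gv :: "real => real"
 assumes n: "0 < n" and alpha: "0 < \<alpha>" and M: "0 < M"
  and sol: "global_strong_solution n \<alpha> u uxx" and mass: "has_mass M u" and bf: "bernis_friedman n \<alpha> u uxx"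
  and argmin: "is_arg_min (energy \<alpha>) (%w. w \<in> admissible M) ustar"
  and unique: "1 < \<alpha> ==> ALL w. steady_state n \<alpha> M w & zero_dissipation n \<alpha> w &
     energy \<alpha> w <= energy \<alpha> (u 0) --> (AE x in lborel. w x = ustar x)"
  and v: "energy_minimizer \<alpha> M v gv" "H_circle 1 ustar" "AE x in lborel. ustar x = v x" "AE x in lborel. gv x = wderiv UNIV ustar x"
begin

lemma u_props: assumes "0 <= t" shows "periodic (u t)" "0 <= u t x" "(\<oint>x. u t x) = M"
 using sol mass assms unfolding global_strong_solution_def has_mass_def by blast+

lemma limit_exists:
 obtains w g where "bf_limit \<alpha> u uxx w g" "smooth_on {(t, x). 0 < t & 0 < u t x} (%(t, x). u t x)"
proof -
 note b = bf[unfolded bernis_friedman_def, THEN conjunct1]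
 from b obtain f \<epsilon> w where a: "regularization n f" "ALL j. (0::real) < \<epsilon> j" "ALL j. regularized_solution \<alpha> (f (\<epsilon> j)) (w j)"
  "\<forall>T>0. uniform_limit ({0..T} \<times> UNIV) (%j (t, x). w j t x) (%(t, x). u t x) sequentially"
  "smooth_on {(t, x). 0 < t & 0 < u t x} (%(t, x). u t x)"
  "\<forall>T>0. weakly_L2 ({0<..<T} \<times> {0..2*pi}) (%j (t, x). (deriv ^^ 2) (w j t) x) (%(t, x). uxx t x)"
  apply (elim exE conjE)
  apply (rule that)
  apply assumption+
  done
 have "bf_limit \<alpha> u uxx w (%j. f (\<epsilon> j))"
 proof
  show "regularized_solution \<alpha> (f (\<epsilon> j)) (w j)" for j using a(3) by blast
  show "0 <= f (\<epsilon> j) z" for j z using a(1,2) unfolding regularization_def by blast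
 qed (use a(4,6) alpha in blast)+
 then show ?thesis by (rule that[OF _ a(5)])
qed

lemma u_slice_cont: assumes "0 <= t" shows "continuous_on S (u t)"
proof -
 obtain w g where w: "bf_limit \<alpha> u uxx w g" by (rule limit_exists)
 show ?thesis by (rule bf_limit.u_slice_cont[OF w assms])
qed

lemma energy_le_avg:
 assumes T: "0 < T" and uT: "circle_H1 (u T) gT" and A: "A \<in> sets borel" "A \<subseteq> {0<..<T}" "0 < emeasure lborel A"
  and c: "AE t in lborel. t \<in> A --> (\<oint>x. - (1/2) * (u t x * (uxx t x + \<alpha>^2 * u t x + 2 * cos x))) <= c"
 shows "circle_energy \<alpha> (u T) gT <= c"
proof -
 obtain w g where w: "bf_limit \<alpha> u uxx w g" by (rule limit_exists)
 show ?thesis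
  by (rule bf_limit.energy_le_average[OF w T uT A]) (use c in "simp add: bf_limit.avg_energy_def[OF w] bf_limit.q_def[OF w]")
qed

abbreviation "\<Omega> \<equiv> {(t, x). 0 < t & 0 < u t x}"

lemma \<Omega>: "open \<Omega>" "smooth_on \<Omega> (%(t, x). u t x)"
proof -
 obtain w g where w: "bf_limit \<alpha> u uxx w g" "smooth_on \<Omega> (%(t, x). u t x)" by (rule limit_exists)
 show "smooth_on \<Omega> (%(t, x). u t x)" by (rule w(2))
 let ?S = "{0::real<..} \<times> (UNIV :: real set)"
 have oS: "open ?S" by (intro open_Times) auto
 have "continuous_on ?S (%(t, x). u t x)"
  unfolding continuous_on_eq_continuous_at[OF oS]
 proof
  fix p assume p: "p \<in> ?S"
  have o: "open ({0<..<fst p + 1} \<times> (UNIV :: real set))" by (intro open_Times) auto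
  have "continuous_on ({0<..<fst p + 1} \<times> UNIV) (%(t, x). u t x)"
   by (rule continuous_on_subset[OF bf_limit.u_cont[OF w(1), of "fst p + 1"]]) (use p in auto)
  then have "\<forall>q\<in>{0<..<fst p + 1} \<times> UNIV. isCont (%(t, x). u t x) q" unfolding continuous_on_eq_continuous_at[OF o] .
  moreover have "p \<in> {0<..<fst p + 1} \<times> UNIV" using p by (cases p) simp
  ultimately show "isCont (%(t, x). u t x) p" by (rule bspec)
 qed
 from continuous_open_preimage[OF this oS, of "{0<..}"]
 have "open (?S \<inter> (%(t, x). u t x) -` {0<..})" by simp
 also have "?S \<inter> (%(t, x). u t x) -` {0<..} = \<Omega>" by auto
 finally show "open \<Omega>" .
qed

text \<open>Agreement of \<open>f2\<close> with \<open>uxx\<close> is asked on the half-open period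
  only: \<open>f2\<close> is a periodic function built from one period, and \<open>uxx t\<close>
  need not repeat its value at 2 pi.\<close>

definition good :: "real => (real => real) => bool" where
 "good t f2 \<longleftrightarrow> slice (u t) (deriv (u t)) f2 ((deriv ^^ 2) (u t)) ((deriv ^^ 3) (u t)) & (ALL x. 0 <= x --> x < 2 * pi --> f2 x = uxx t x)"

lemma AE_good: "AE t in lborel. 0 < t --> (EX f2. good t f2)"
proof -
 have L: "L2_loc_H2 u uxx" using sol by (simp add: global_strong_solution_def)
 then obtain ux where ux: "AE t in lborel. 0 < t --> periodic (u t) & weak_deriv UNIV (u t) (ux t) & weak_deriv UNIV (ux t) (uxx t)"
  "!!a b. 0 < a ==> a < b ==> L2_on ({a..b} \<times> {0..2*pi}) (%(t, x). uxx t x)"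
  unfolding L2_loc_H2_def by blast
 \<comment> \<open>These compact intervals exhaust the positive times, so countably many exceptional
   null sets from Fubini suffice.\<close>
 have "AE t in lborel. \<forall>N::nat. t \<in> {1 / (real N + 1)..real N + 2} --> L1_on {0..2*pi} (%x. (uxx t x)^2)"
  unfolding AE_all_countable
 proof
  fix N :: nat
  have "1 / (real N + 1) <= 1" by simp
  then have lt: "1 / (real N + 1) < real N + 2" by linarith
  have "L2_on ({1 / (real N + 1)..real N + 2} \<times> {0..2*pi}) (%(t, x). uxx t x)" by (rule ux(2)[OF _ lt]) simp
  then have "L1_on ({1 / (real N + 1)..real N + 2} \<times> {0..2*pi}) (%p. ((%(t, x). uxx t x) p)^2)" by (simp add: L2_on_def)
  from fubini_rectangle(3)[OF this]
  show "AE t in lborel. t \<in> {1 / (real N + 1)..real N + 2} --> L1_on {0..2*pi} (%x. (uxx t x)^2)" by simp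
 qed
 with ux(1) show ?thesis
 proof eventually_elim
  case (elim t)
  show ?case
  proof
   assume t: "0 < t"
   obtain N :: nat where N: "max t (1 / t) < real N" using reals_Archimedean2 by blast
   have "1 / (real N + 1) <= t"
   proof -
    have "1 / t <= real N + 1" using N by simp
    then have "1 <= (real N + 1) * t" using t by (simp add: pos_divide_le_eq)
    then show ?thesis by (simp add: divide_le_eq mult.commute)
   qed
   then have "t \<in> {1 / (real N + 1)..real N + 2}" using N by simp
   then have h2: "L1_on {0..2*pi} (%x. (uxx t x)^2)" using elim(2) by blast
   have e: "weak_deriv UNIV (u t) (ux t)" "weak_deriv UNIV (ux t) (uxx t)" using elim(1) t by auto
   obtain f1 f2 where f: "circle_H1 (u t) f1" "circle_H1 f1 f2" "!!x. (u t has_real_derivative f1 x) (at x)"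
    "!!x. 0 <= x ==> x < 2 * pi ==> f2 x = uxx t x"
    by (rule continuous_H2_circle[OF u_slice_cont u_props(1) e h2]) (use t in simp, use t in simp, (rule that; assumption))
   have f1: "f1 = deriv (u t)" using DERIV_imp_deriv[OF f(3)] by (intro ext) simp
   have in\<Omega>: "(t, x) \<in> \<Omega>" if "0 < u t x" for x using that t by simp
   note d = smooth_on_continuous_partial_x(2)[OF \<Omega> in\<Omega>]
   have "slice (u t) (deriv (u t)) f2 ((deriv ^^ 2) (u t)) ((deriv ^^ 3) (u t))"
   proof
    show "circle_H1 (u t) (deriv (u t))" "circle_H1 (deriv (u t)) f2" using f(1,2) unfolding f1 .
    show "0 <= u t x" for x using u_props(2) t by simp
    show "(deriv (u t) has_real_derivative (deriv ^^ 2) (u t) x) (at x)" if "0 < u t x" for x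
     using d[OF that, of 1] by (simp add: numeral_2_eq_2)
    show "((deriv ^^ 2) (u t) has_real_derivative (deriv ^^ 3) (u t) x) (at x)" if "0 < u t x" for x
     using d[OF that, of 2] by (simp add: numeral_3_eq_3 numeral_2_eq_2)
    have "continuous_on {x. 0 < u t x} (%x. (%(t, x). (deriv ^^ 3) (u t) x) (t, x))"
     by (rule continuous_on_compose2[OF smooth_on_continuous[OF smooth_on_continuous_partial_x(1)[OF \<Omega>]]])
      (use t in "auto intro!: continuous_intros")
    then show "continuous_on {x. 0 < u t x} ((deriv ^^ 3) (u t))" by simp
    show "periodic ((deriv ^^ 3) (u t))"
     using periodic_deriv[OF periodic_deriv[OF periodic_deriv[OF u_props(1)]]] t by (simp add: numeral_3_eq_3)
   qed
   then show "EX f2. good t f2" unfolding good_def using f(4) by blast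
  qed
 qed
qed

abbreviation "Es \<equiv> circle_energy \<alpha> v gv"

lemma vH: "circle_H1 v gv" and v_nonneg: "0 <= v x" and v_mass: "(\<oint>x. v x) = M"
 using v(1) unfolding energy_minimizer_def by auto

lemma v_minimal: "circle_H1 y h ==> (!!x. 0 <= y x) ==> (\<oint>x. y x) = M ==> Es <= circle_energy \<alpha> y h"
 using v(1) unfolding energy_minimizer_def by blast

lemma initial_energy: obtains e0 where "energy \<alpha> (u 0) = ereal e0"
proof -
 have "energy \<alpha> (u 0) < \<infinity>" using bf by (simp add: bernis_friedman_def)
 then show ?thesis using that unfolding energy_def by (auto split: if_splits)
qed

lemma dissipation_inequality:
 assumes "0 < T"
 shows "energy \<alpha> (u T) + enn2ereal
    (\<integral>\<^sup>+p\<in>{(t, x). 0 < t & t < T & 0 <= x & x <= 2 * pi & 0 < u t x}.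
     (case p of (t, x) => ennreal (u t x powr n *
       ((deriv ^^ 3) (u t) x + \<alpha>^2 * deriv (u t) x - sin x)^2)) \<partial>lborel)
    <= energy \<alpha> (u 0)"
 using bf[unfolded bernis_friedman_def, THEN conjunct2, THEN conjunct2, THEN conjunct2] assms by blast

text \<open>This holds at every positive time and not just almost every one: the energy inequality
  keeps the energy finite, and \<open>energy\<close> is infinite on functions without a weak
  derivative in L2.\<close>

lemma H1_slice:
 assumes T: "0 < T" obtains g where "circle_H1 (u T) g"
proof -
 obtain e0 where e0: "energy \<alpha> (u 0) = ereal e0" by (rule initial_energy)
 have "energy \<alpha> (u T) + 0 <= ereal e0"
  using order_trans[OF add_left_mono[OF enn2ereal_nonneg] dissipation_inequality[OF T]] e0 by simp
 then have "H_circle 1 (u T)" by (auto simp: energy_def split: if_splits)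
 then obtain F g where F: "circle_H1 F g" "AE x in lborel. u T x = F x"
  by (rule H_circle_1_representative)
 have "u T = F"
  by (rule ext) (rule AE_eq_continuous_imp_eq[OF u_slice_cont circle_H1D(5)[OF F(1)] F(2)], use T in simp)
 then show ?thesis using that F(1) by simp
qed

lemma slice_energy_bounds:
 assumes T: "0 < T" and g: "circle_H1 (u T) g" and e0: "energy \<alpha> (u 0) = ereal e0"
 shows "Es <= circle_energy \<alpha> (u T) g" "circle_energy \<alpha> (u T) g <= e0"
proof -
 show "Es <= circle_energy \<alpha> (u T) g" by (rule v_minimal[OF g]) (use u_props[of T] T in auto)
 have "energy \<alpha> (u T) + 0 <= energy \<alpha> (u 0)"
  by (rule order_trans[OF add_left_mono[OF enn2ereal_nonneg] dissipation_inequality[OF T]])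
 then show "circle_energy \<alpha> (u T) g <= e0" unfolding circle_H1_energy[OF g] e0 by simp
qed

abbreviation "dis t \<equiv> slice_dissipation n \<alpha> (u t) (deriv (u t)) ((deriv ^^ 3) (u t))"

definition hd :: "real \<times> real => ennreal" where
 "hd p = ennreal (indicat_real \<Omega> p *\<^sub>R (case p of (t, x) => u t x powr n * ((deriv ^^ 3) (u t) x + \<alpha>^2 * deriv (u t) x - sin x)^2))"

lemma hd_borel: "hd \<in> borel_measurable borel"
proof -
 have c: "continuous_on \<Omega> (%(t, x). (deriv ^^ k) (u t) x)" for k
  by (rule smooth_on_continuous[OF smooth_on_continuous_partial_x(1)[OF \<Omega>]])
 have "continuous_on \<Omega> (%p. (%(t, x). u t x) p powr n * ((%(t, x). (deriv ^^ 3) (u t) x) p + \<alpha>^2 * (%(t, x). deriv (u t) x) p - sin (snd p))^2)"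
  using c[of 0] c[of 1] by (intro continuous_on_mult continuous_on_power continuous_on_diff continuous_on_add continuous_on_powr c continuous_on_const continuous_on_sin continuous_on_snd continuous_on_id) auto
 then have "(%p. indicat_real \<Omega> p *\<^sub>R ((%(t, x). u t x) p powr n * ((%(t, x). (deriv ^^ 3) (u t) x) p + \<alpha>^2 * (%(t, x). deriv (u t) x) p - sin (snd p))^2)) \<in> borel_measurable borel"
  by (intro borel_measurable_continuous_on_indicator) (use \<Omega>(1) in auto)
 then have "(%p. ennreal (indicat_real \<Omega> p *\<^sub>R ((%(t, x). u t x) p powr n * ((%(t, x). (deriv ^^ 3) (u t) x) p + \<alpha>^2 * (%(t, x). deriv (u t) x) p - sin (snd p))^2))) \<in> borel_measurable borel"
  by measurable
 also have "(%p. ennreal (indicat_real \<Omega> p *\<^sub>R ((%(t, x). u t x) p powr n * ((%(t, x). (deriv ^^ 3) (u t) x) p + \<alpha>^2 * (%(t, x). deriv (u t) x) p - sin (snd p))^2))) = hd"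
  by (auto simp: hd_def fun_eq_iff)
 finally show ?thesis .
qed

lemma dis_eq: "0 < t ==> (\<integral>\<^sup>+x\<in>{0..2*pi}. hd (t, x) \<partial>lborel) = dis t"
 unfolding slice_dissipation_def by (rule nn_integral_cong) (auto simp: hd_def indicator_def)

text \<open>The energy at time T never falls below the minimum, so the dissipation up to any time is
  limited by the initial excess.\<close>

lemma total_dissipation:
 assumes T: "0 < T" and e0: "energy \<alpha> (u 0) = ereal e0"
 shows "(\<integral>\<^sup>+t\<in>{0<..<T}. (\<integral>\<^sup>+x\<in>{0..2*pi}. hd (t, x) \<partial>lborel) \<partial>lborel) <= ennreal (e0 - Es)" "Es <= e0"
proof -
 obtain g where g: "circle_H1 (u T) g" by (rule H1_slice[OF T])
 note b = slice_energy_bounds[OF T g e0]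
 show "Es <= e0" using b by simp
 let ?I = "\<integral>\<^sup>+p\<in>{(t, x). 0 < t & t < T & 0 <= x & x <= 2 * pi & 0 < u t x}.
     (case p of (t, x) => ennreal (u t x powr n *
       ((deriv ^^ 3) (u t) x + \<alpha>^2 * deriv (u t) x - sin x)^2)) \<partial>lborel"
 have "(\<integral>\<^sup>+p\<in>{0<..<T} \<times> {0..2*pi}. hd p \<partial>lborel) = ?I"
  by (rule nn_integral_cong) (auto simp: hd_def indicator_def)
 then have eq: "(\<integral>\<^sup>+t\<in>{0<..<T}. (\<integral>\<^sup>+x\<in>{0..2*pi}. hd (t, x) \<partial>lborel) \<partial>lborel) = ?I"
  unfolding tonelli_strip(2)[OF hd_borel] .
 have ineq: "ereal (circle_energy \<alpha> (u T) g) + enn2ereal ?I <= ereal e0"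
  using dissipation_inequality[OF T] unfolding circle_H1_energy[OF g] e0 .
 have "?I <= ennreal (e0 - Es)"
 proof (cases ?I)
  case (real r)
  have "enn2ereal ?I = ereal r" using real by (simp add: enn2ereal_ennreal)
  then have "circle_energy \<alpha> (u T) g + r <= e0" using ineq by simp
  then show ?thesis unfolding real using b(1) by (intro ennreal_leI) simp
 next
  case top
  then show ?thesis using ineq by simp
 qed
 then show "(\<integral>\<^sup>+t\<in>{0<..<T}. (\<integral>\<^sup>+x\<in>{0..2*pi}. hd (t, x) \<partial>lborel) \<partial>lborel) <= ennreal (e0 - Es)" unfolding eq .
qed

lemma curvature_bound:
 obtains A B where "0 <= A" "0 <= B" "!!T. 0 < T ==> (\<integral>\<^sup>+p\<in>{0<..<T} \<times> {0..2*pi}. (case p of (t, x) => ennreal ((uxx t x)^2)) \<partial>lborel) <= ennreal (A + B * T)"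
 using bf[unfolded bernis_friedman_def, THEN conjunct2, THEN conjunct2, THEN conjunct1] by blast

text \<open>The indicator sits inside the square because joint measurability of \<open>uxx\<close>
  is available for its restriction to the strip.\<close>

definition hX :: "real => real \<times> real => ennreal" where
 "hX T p = ennreal ((indicat_real ({0<..<T} \<times> {0..2*pi}) p *\<^sub>R (case p of (t, x) => uxx t x))^2)"

lemma hX_borel: assumes "0 < T" shows "hX T \<in> borel_measurable borel"
proof -
 obtain w g where w: "bf_limit \<alpha> u uxx w g" by (rule limit_exists)
 have "L2_on ({0<..<T} \<times> {0..2*pi}) (%(t, x). uxx t x)" using bf_limit.weak[OF w assms] by (simp add: weakly_L2_def)
 then have "(%p. indicat_real ({0<..<T} \<times> {0..2*pi}) p *\<^sub>R (case p of (t, x) => uxx t x)) \<in> borel_measurable borel"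
  by (simp add: L2_on_def set_borel_measurable_def)
 then show ?thesis unfolding hX_def[abs_def] by measurable
qed

lemma good_set:
 assumes d: "0 < \<delta>" and e0: "energy \<alpha> (u 0) = ereal e0" and A: "0 <= A" "0 <= B"
  and AB: "!!T. 0 < T ==> (\<integral>\<^sup>+p\<in>{0<..<T} \<times> {0..2*pi}. (case p of (t, x) => ennreal ((uxx t x)^2)) \<partial>lborel) <= ennreal (A + B * T)"
  and T: "1 <= T" "2 * (e0 - Es) / \<delta> < T"
 obtains G where "G \<in> sets borel" "G \<subseteq> {0<..<T}" "0 < emeasure lborel G"
  "!!t. t \<in> G ==> (\<integral>\<^sup>+x\<in>{0..2*pi}. ennreal ((uxx t x)^2) \<partial>lborel) <= ennreal (2 * (A + B + 1))"
  "!!t. t \<in> G ==> dis t <= ennreal \<delta>"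
proof -
 have T0: "0 < T" using T by simp
 let ?X = "%t. \<integral>\<^sup>+x\<in>{0..2*pi}. hX T (t, x) \<partial>lborel" and ?D = "%t. \<integral>\<^sup>+x\<in>{0..2*pi}. hd (t, x) \<partial>lborel"
 note X = tonelli_strip[OF hX_borel[OF T0]] and D = tonelli_strip[OF hd_borel]
 have "(\<integral>\<^sup>+p\<in>{0<..<T} \<times> {0..2*pi}. hX T p \<partial>lborel) = (\<integral>\<^sup>+p\<in>{0<..<T} \<times> {0..2*pi}. (case p of (t, x) => ennreal ((uxx t x)^2)) \<partial>lborel)"
  by (rule nn_integral_cong) (auto simp: hX_def indicator_def)
 then have Xb: "(\<integral>\<^sup>+t\<in>{0<..<T}. ?X t \<partial>lborel) <= ennreal (A + B * T)" unfolding X(2) using AB[OF T0] by simp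
 let ?G = "{t \<in> {0<..<T}. ?X t <= ennreal (2 * (A + B + 1)) & ?D t <= ennreal \<delta>}"
 show ?thesis
 proof (rule that[of ?G])
  show "?G \<in> sets borel" using X(1) D(1) by measurable
  show "0 < emeasure lborel ?G"
   by (rule good_times[OF X(1) D(1) A Xb total_dissipation(1)[OF T0 e0] _ d T]) (use total_dissipation(2)[OF T0 e0] in simp)
  fix t assume t: "t \<in> ?G"
  have "?X t = (\<integral>\<^sup>+x\<in>{0..2*pi}. ennreal ((uxx t x)^2) \<partial>lborel)"
   by (rule nn_integral_cong) (use t in "auto simp: hX_def indicator_def")
  then show "(\<integral>\<^sup>+x\<in>{0..2*pi}. ennreal ((uxx t x)^2) \<partial>lborel) <= ennreal (2 * (A + B + 1))" using t by simp
  show "dis t <= ennreal \<delta>" using t dis_eq[of t] by simp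
 qed auto
qed

text \<open>The two regimes meet here. For \<alpha> at most 1, \<open>v\<close> has no more energy
  than \<open>w\<close>, so \<open>convex_unique\<close> identifies them; for \<alpha> > 1 the film
  is a steady state with zero dissipation below the initial energy, and the assumption on such
  states applies.\<close>

lemma film_is_minimizer:
 assumes f: "film \<alpha> w w1 w2" and m: "(\<oint>x. w x) = M" and E: "circle_energy \<alpha> w w1 <= e0" "energy \<alpha> (u 0) = ereal e0"
 shows "w = v" "circle_energy \<alpha> w w1 = Es"
proof -
 interpret film \<alpha> w w1 w2 by (rule f)
 have H: "circle_H1 w w1" unfolding circle_H1_def using primitive_w per
  by (auto intro!: cont_set_integrable continuous_intros continuous_on_subset[OF cont1])
 show wv: "w = v"
 proof (cases "\<alpha> <= 1")
  case True
  have "v x = w x" for x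
   by (rule convex_unique[OF True]) (use M m v_mass circle_H1D[OF vH] v_nonneg v_minimal[OF H nonneg m] in auto)
  then show ?thesis by auto
 next
  case False
  have "steady_state n \<alpha> M w" "zero_dissipation n \<alpha> w" using film_steady_state[OF n m] film_zero_dissipation by auto
  moreover have "energy \<alpha> w <= energy \<alpha> (u 0)" using E circle_H1_energy[OF H] by simp
  ultimately have "AE x in lborel. w x = ustar x" using unique False by auto
  then have "AE x in lborel. w x = v x" using v(3) by eventually_elim simp
  then show ?thesis by (intro ext AE_eq_continuous_imp_eq circle_H1D(5)[OF H] circle_H1D(5)[OF vH])
 qed
 have "ereal (circle_energy \<alpha> w w1) = ereal Es" using circle_H1_energy[OF H, of \<alpha>] circle_H1_energy[OF vH, of \<alpha>] wv by simp
 then show "circle_energy \<alpha> w w1 = Es" by simp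
qed

lemma curvature_slice:
 assumes g: "good t f2" and b: "(\<integral>\<^sup>+x\<in>{0..2*pi}. ennreal ((uxx t x)^2) \<partial>lborel) <= ennreal C" "0 <= C"
 shows "(\<oint>x. (f2 x)^2) <= C"
proof -
 have s: "circle_H1 (deriv (u t)) f2" using g by (auto simp: good_def slice_def)
 have e: "AE x in lborel. x ~= 2 * pi" by (rule AE_lborel_singleton)
 have "ennreal (\<integral>x. indicat_real {0..2*pi} x *\<^sub>R (f2 x)\<^sup>2 \<partial>lborel) = (\<integral>\<^sup>+x. ennreal (indicat_real {0..2*pi} x *\<^sub>R (f2 x)\<^sup>2) \<partial>lborel)"
  by (rule nn_integral_eq_integral[symmetric]) (use circle_H1D(3)[OF s, of 0 "2*pi"] in "auto simp: set_integrable_def")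
 also have "... = (\<integral>\<^sup>+x\<in>{0..2*pi}. ennreal ((uxx t x)^2) \<partial>lborel)"
  by (rule nn_integral_cong_AE) (use e g in "auto simp: indicator_def good_def elim!: eventually_mono")
 finally have "ennreal (\<integral>x. indicat_real {0..2*pi} x *\<^sub>R (f2 x)\<^sup>2 \<partial>lborel) <= ennreal C" using b(1) by simp
 then show ?thesis unfolding set_lebesgue_integral_def ennreal_le_iff[OF b(2)] .
qed

lemma good_energy:
 assumes g: "good t f2"
 shows "(\<oint>x. - (1/2) * (u t x * (uxx t x + \<alpha>^2 * u t x + 2 * cos x))) = circle_energy \<alpha> (u t) (deriv (u t))"
proof -
 have s: "slice (u t) (deriv (u t)) f2 ((deriv ^^ 2) (u t)) ((deriv ^^ 3) (u t))" using g by (simp add: good_def)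
 let ?k1 = "%x. indicat_real {0..2*pi} x *\<^sub>R (- (1/2) * (u t x * (uxx t x + \<alpha>^2 * u t x + 2 * cos x)))"
 let ?k2 = "%x. indicat_real {0..2*pi} x *\<^sub>R (- (1/2) * (u t x * (f2 x + \<alpha>^2 * u t x + 2 * cos x)))"
 have [measurable]: "f2 \<in> borel_measurable borel" by (rule circle_H1_borel[OF slice.H1[OF s]])
 have [measurable]: "u t \<in> borel_measurable borel" by (rule borel_measurable_continuous_onI[OF circle_H1D(5)[OF slice.H[OF s]]])
 have k2: "?k2 \<in> borel_measurable borel" by measurable
 have eq: "?k1 x = ?k2 x" if "x ~= 2 * pi" for x
  using g that by (cases "0 <= x & x < 2 * pi") (auto simp: good_def indicator_def)
 \<comment> \<open>Measurability of the integrand with \<open>uxx t\<close> is inherited from the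
   one with \<open>f2\<close>, from which it differs at most at the point 2 pi.\<close>
 have c: "?k1 = (%x. if x = 2 * pi then ?k1 (2 * pi) else ?k2 x)" using eq by (intro ext) auto
 have "(%x. if x = 2 * pi then ?k1 (2 * pi) else ?k2 x) \<in> borel_measurable borel" using k2 by measurable
 then have k1: "?k1 \<in> borel_measurable borel"
  by (rule iffD2[OF arg_cong[where f = "%h. h \<in> borel_measurable borel", OF c]])
 have "(\<integral>x. ?k1 x \<partial>lborel) = (\<integral>x. ?k2 x \<partial>lborel)"
 proof (rule integral_cong_AE)
  show "AE x in lborel. ?k1 x = ?k2 x" using AE_lborel_singleton[of "2 * pi"] by eventually_elim (rule eq)
 qed (use k1 k2 in simp_all)
 then show ?thesis unfolding slice.slice_energy[OF s, of \<alpha>, symmetric] set_lebesgue_integral_def .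
qed

text \<open>Compactness by contradiction: slices with bounded curvature, dissipation tending to 0
  and energy above the minimum by \<epsilon> would converge in C^1 to a film of energy at least Es +
  \<epsilon>, whereas \<open>film_is_minimizer\<close> gives that film the energy Es.\<close>

lemma good_energy_small:
 assumes e0: "energy \<alpha> (u 0) = ereal e0" and eps: "0 < \<epsilon>" and C: "0 <= C"
 obtains \<delta> where "0 < \<delta>" "!!t f2. 0 < t ==> good t f2 ==> (\<integral>\<^sup>+x\<in>{0..2*pi}. ennreal ((uxx t x)^2) \<partial>lborel) <= ennreal C ==>
  dis t <= ennreal \<delta> ==> circle_energy \<alpha> (u t) (deriv (u t)) <= Es + \<epsilon>"
proof -
 have "\<exists>\<delta>>0. ALL t f2. 0 < t & good t f2 & (\<integral>\<^sup>+x\<in>{0..2*pi}. ennreal ((uxx t x)^2) \<partial>lborel) <= ennreal C &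
  dis t <= ennreal \<delta> --> circle_energy \<alpha> (u t) (deriv (u t)) <= Es + \<epsilon>"
 proof (rule ccontr)
  assume neg: "~ ?thesis"
  have "EX t f2. 0 < t & good t f2 & (\<integral>\<^sup>+x\<in>{0..2*pi}. ennreal ((uxx t x)^2) \<partial>lborel) <= ennreal C &
   dis t <= ennreal (1 / (real k + 1)) & Es + \<epsilon> < circle_energy \<alpha> (u t) (deriv (u t))" for k :: nat
  proof -
   have "0 < 1 / (real k + 1)" by simp
   with neg have "~ (ALL t f2. 0 < t & good t f2 & (\<integral>\<^sup>+x\<in>{0..2*pi}. ennreal ((uxx t x)^2) \<partial>lborel) <= ennreal C &
    dis t <= ennreal (1 / (real k + 1)) --> circle_energy \<alpha> (u t) (deriv (u t)) <= Es + \<epsilon>)" by blast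
   then show ?thesis unfolding not_all not_imp not_le by blast
  qed
  then obtain t where "ALL k. EX f2. 0 < t k & good (t k) f2 & (\<integral>\<^sup>+x\<in>{0..2*pi}. ennreal ((uxx (t k) x)^2) \<partial>lborel) <= ennreal C &
   dis (t k) <= ennreal (1 / (real k + 1)) & Es + \<epsilon> < circle_energy \<alpha> (u (t k)) (deriv (u (t k)))" by moura
  then obtain F2 where t: "ALL k. 0 < t k & good (t k) (F2 k) & (\<integral>\<^sup>+x\<in>{0..2*pi}. ennreal ((uxx (t k) x)^2) \<partial>lborel) <= ennreal C &
   dis (t k) <= ennreal (1 / (real k + 1)) & Es + \<epsilon> < circle_energy \<alpha> (u (t k)) (deriv (u (t k)))" by moura
  have S: "slice (u (t k)) (deriv (u (t k))) (F2 k) ((deriv ^^ 2) (u (t k))) ((deriv ^^ 3) (u (t k)))" for k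
   using t by (simp add: good_def)
  have tm: "(\<oint>x. u (t k) x) = M" for k using u_props(3) t less_imp_le by blast
  have tC: "(\<oint>x. (F2 k x)^2) <= C" for k by (rule curvature_slice[OF _ _ C]) (use t in blast)+
  have tD: "dis (t k) <= ennreal (1 / (real k + 1))" for k using t by blast
  have null: "(%k. 1 / (real k + 1)) ----> 0" using LIMSEQ_inverse_real_of_nat by (simp add: inverse_eq_divide add.commute)
  obtain w w1 w2 r where w: "film \<alpha> w w1 w2" "strict_mono (r :: nat => nat)"
   "uniform_limit UNIV (%k. u (t (r k))) w sequentially" "uniform_limit UNIV (%k. deriv (u (t (r k)))) w1 sequentially"
   by (rule film_limit[OF n alpha S tm tC tD _ null]) (simp, (rule that; assumption))
  have uc: "continuous_on T (u (t k))" "continuous_on T (deriv (u (t k)))" for T k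
   by (rule circle_H1D(5)[OF slice.H[OF S]] circle_H1D(5)[OF slice.H1[OF S]])+
  have wc: "continuous_on T w" "continuous_on T w1" for T
   using film.w_cont[OF w(1)] film.cont1[OF w(1)] by (auto intro: continuous_on_subset)
  have lim: "(%k. circle_energy \<alpha> (u (t (r k))) (deriv (u (t (r k))))) ----> circle_energy \<alpha> w w1"
   by (rule circle_energy_tendsto[OF uc(1) wc(1) uc(2) wc(2) w(3,4)])
  have "(%k. \<oint>x. u (t (r k)) x) ----> (\<oint>x. w x)"
   by (rule uniform_integral_tendsto[OF uc(1) wc(1) uniform_limit_on_subset[OF w(3)]]) simp
  then have wm: "(\<oint>x. w x) = M" unfolding tm by (simp add: LIMSEQ_const_iff)
  have "circle_energy \<alpha> w w1 <= e0"
   by (rule LIMSEQ_le_const2[OF lim]) (use slice_energy_bounds(2)[OF _ slice.H[OF S] e0] t in blast)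
  from film_is_minimizer(2)[OF w(1) wm this e0] have "circle_energy \<alpha> w w1 = Es" .
  moreover have "Es + \<epsilon> <= circle_energy \<alpha> w w1"
   by (rule LIMSEQ_le_const[OF lim]) (use t less_imp_le in blast)
  ultimately show False using eps by simp
 qed
 then obtain \<delta> where "0 < \<delta>" "ALL t f2. 0 < t & good t f2 & (\<integral>\<^sup>+x\<in>{0..2*pi}. ennreal ((uxx t x)^2) \<partial>lborel) <= ennreal C &
  dis t <= ennreal \<delta> --> circle_energy \<alpha> (u t) (deriv (u t)) <= Es + \<epsilon>" by blast
 then show ?thesis by (intro that[of \<delta>]) blast+
qed

text \<open>The threshold \<delta> depends on \<epsilon> and the curvature constants but not on T.
  So one value of \<open>K\<close> serves all later times, each of which has its own set of good
  earlier times to average over.\<close>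

theorem energy_tends_to_minimum:
 assumes eps: "0 < \<epsilon>"
 obtains K where "0 < K" "!!T g. K <= T ==> circle_H1 (u T) g ==> circle_energy \<alpha> (u T) g <= Es + \<epsilon>"
proof -
 obtain e0 where e0: "energy \<alpha> (u 0) = ereal e0" by (rule initial_energy)
 obtain A B where A: "0 <= A" "0 <= B" "!!T. 0 < T ==> (\<integral>\<^sup>+p\<in>{0<..<T} \<times> {0..2*pi}. (case p of (t, x) => ennreal ((uxx t x)^2)) \<partial>lborel) <= ennreal (A + B * T)"
  by (rule curvature_bound) (rule that; assumption)
 have C: "0 <= 2 * (A + B + 1)" using A(1,2) by simp
 obtain \<delta> where d: "0 < \<delta>" "!!t f2. 0 < t ==> good t f2 ==> (\<integral>\<^sup>+x\<in>{0..2*pi}. ennreal ((uxx t x)^2) \<partial>lborel) <= ennreal (2 * (A + B + 1)) ==>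
  dis t <= ennreal \<delta> ==> circle_energy \<alpha> (u t) (deriv (u t)) <= Es + \<epsilon>"
  by (rule good_energy_small[OF e0 eps C]) (rule that; assumption)
 \<comment> \<open>The total dissipation is at most e0 - Es, so times with dissipation above
   \<delta> have measure at most q / 2, less than half of any interval of length T > q.\<close>
 define q where "q = 2 * (e0 - Es) / \<delta>"
 define K where "K = 1 + \<bar>q\<bar>"
 have K0: "0 < K" unfolding K_def by (intro add_pos_nonneg) auto
 have main: "circle_energy \<alpha> (u T) g <= Es + \<epsilon>" if T: "K <= T" and g: "circle_H1 (u T) g" for T g
 proof -
  have T1: "1 <= T" "q < T" using T abs_ge_self[of q] abs_ge_zero[of q] unfolding K_def by linarith+
  obtain G where G: "G \<in> sets borel" "G \<subseteq> {0<..<T}" "0 < emeasure lborel G"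
   "!!t. t \<in> G ==> (\<integral>\<^sup>+x\<in>{0..2*pi}. ennreal ((uxx t x)^2) \<partial>lborel) <= ennreal (2 * (A + B + 1))"
   "!!t. t \<in> G ==> dis t <= ennreal \<delta>"
   by (rule good_set[OF d(1) e0 A T1(1) T1(2)[unfolded q_def]]) (assumption, (rule that; assumption))
  show ?thesis
  proof (rule energy_le_avg[OF _ g G(1-3)])
   show "0 < T" using T1 by simp
   show "AE t in lborel. t \<in> G --> (\<oint>x. - (1/2) * (u t x * (uxx t x + \<alpha>^2 * u t x + 2 * cos x))) <= Es + \<epsilon>"
    using AE_good
   proof eventually_elim
    case (elim t)
    show ?case
    proof
     assume t: "t \<in> G"
     then have t0: "0 < t" using G(2) by auto
     with elim obtain f2 where f2: "good t f2" by blast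
     show "(\<oint>x. - (1/2) * (u t x * (uxx t x + \<alpha>^2 * u t x + 2 * cos x))) <= Es + \<epsilon>"
      unfolding good_energy[OF f2] by (rule d(2)[OF t0 f2 G(4)[OF t] G(5)[OF t]])
    qed
   qed
  qed
 qed
 show ?thesis
 proof (rule that[OF K0])
  fix T g assume "K <= T" "circle_H1 (u T) g"
  then show "circle_energy \<alpha> (u T) g <= Es + \<epsilon>" by (rule main)
 qed
qed

end

section \<open>Convergence in the Sobolev distance\<close>

context long_time
begin

lemma H1_distance:
 assumes T: "0 < T" and g: "circle_H1 (u T) g"
 shows "dist_H1 (u T) ustar = ennreal (sqrt (\<oint>x. (g x - gv x)^2))"
 by (rule dist_H1_representative[OF g v(2) v(4) circle_H1_borel[OF vH]])

text \<open>The parallelogram law is used twice. Between two members of a uniformly convergent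
  subsequence it makes the derivatives Cauchy, which puts the uniform limit \<open>y\<close> into
  the Sobolev space; lower semicontinuity makes \<open>y\<close> a minimizer, hence a film, hence
  equal to \<open>v\<close>. Between a member and \<open>v\<close> it then shows that the
  derivatives converge to \<open>gv\<close>.\<close>

lemma almost_minimizers_converge:
 assumes f: "!!k. circle_H1 (f k) (g k)" "!!k x. 0 <= f k x" "!!k. (\<oint>x. f k x) = M"
  and E: "!!k. circle_energy \<alpha> (f k) (g k) <= Es + a k" "a ----> 0" and e0: "!!k. circle_energy \<alpha> (f k) (g k) <= e0" "energy \<alpha> (u 0) = ereal e0"
 obtains r where "strict_mono (r :: nat => nat)" "(%k. \<oint>x. (g (r k) x - gv x)^2) ----> 0"
proof -
 let ?I = "{0..2*pi::real}"
 obtain K where Kk: "ALL k x. (\<oint>x. (g k x)^2) <= K & \<bar>f k x\<bar> <= K"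
 proof (rule circle_H1_energy_bound[OF M, where \<alpha> = \<alpha> and e = e0])
  fix K assume b: "!!f g (x :: real). circle_H1 f g ==> (!!x. 0 <= f x) ==> (\<oint>x. f x) = M ==>
   circle_energy \<alpha> f g <= e0 ==> (\<oint>x. (g x)^2) <= K & \<bar>f x\<bar> <= K"
  have "ALL k x. (\<oint>x. (g k x)^2) <= K & \<bar>f k x\<bar> <= K"
   by (intro allI) (rule b[OF f(1) f(2) f(3) e0(1)])
  then show thesis by (rule that)
 qed
 have Kk: "(\<oint>x. (g k x)^2) <= K" "\<bar>f k x\<bar> <= K" for k x using Kk by blast+
 obtain y r where y: "strict_mono (r :: nat => nat)" "periodic y" "continuous_on UNIV y" "uniform_limit UNIV (%k. f (r k)) y sequentially"
  by (rule arzela_ascoli_circle[OF f(1) Kk(2) Kk(1)]) (rule that; assumption)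
 have fc: "continuous_on S (f k)" for S k by (rule circle_H1D(5)[OF f(1)])
 have yc: "continuous_on S y" for S by (rule continuous_on_subset[OF y(3)]) simp
 have lim: "(%k. f (r k) x) ----> y x" for x by (rule tendsto_uniform_limitI[OF y(4)]) simp
 have y0: "0 <= y x" for x by (rule LIMSEQ_le_const[OF lim]) (use f(2) in blast)
 have yI: "uniform_limit ?I (%k. f (r k)) y sequentially" by (rule uniform_limit_on_subset[OF y(4)]) simp
 have "(%k. \<oint>x. f (r k) x) ----> (\<oint>x. y x)"
  by (rule uniform_integral_tendsto[OF fc yc yI])
 then have ym: "(\<oint>x. y x) = M" unfolding f(3) by (simp add: LIMSEQ_const_iff)
 have ar: "(%k. a (r k)) ----> 0" using LIMSEQ_subseq_LIMSEQ[OF E(2) y(1)] by (simp add: o_def)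
 have "EX N. \<forall>k\<ge>N. \<forall>l\<ge>N. (\<oint>x. (g (r k) x - g (r l) x)^2) <= e" if e: "0 < e" for e
 proof -
  \<comment> \<open>Two functions within \<open>d\<close> of the limit differ by at most 2 d,
    contributing \<alpha>^2 * 8 * pi * d^2 \<le> e/2; the other half of \<open>e\<close> is left for
    the energy excess.\<close>
  define d where "d = sqrt (e / (16 * pi * (\<alpha>^2 + 1)))"
  have a1: "0 < \<alpha>^2 + 1" by (intro add_nonneg_pos) auto
  have d: "0 < d" "d^2 * (16 * pi * (\<alpha>^2 + 1)) = e"
   using e a1 by (simp_all add: d_def)
  have "\<forall>\<^sub>F k in sequentially. \<forall>x\<in>UNIV. dist (f (r k) x) (y x) < d" by (rule uniform_limitD[OF y(4) d(1)])
  then obtain N1 where N1: "\<forall>k\<ge>N1. ALL x. \<bar>f (r k) x - y x\<bar> < d" unfolding eventually_sequentially dist_real_def by auto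
  have "\<forall>\<^sub>F k in sequentially. a (r k) < e / 16" by (rule order_tendstoD(2)[OF ar]) (use e in simp)
  then obtain N2 where N2: "\<forall>k\<ge>N2. a (r k) < e / 16" unfolding eventually_sequentially by blast
  have "(\<oint>x. (g (r k) x - g (r l) x)^2) <= e" if kl: "max N1 N2 <= k" "max N1 N2 <= l" for k l
  proof -
   have "(\<oint>x. (f (r k) x - f (r l) x)^2) <= (\<oint>x. (2 * d)^2)"
   proof (rule set_integral_mono)
    fix x :: real
    have "\<bar>f (r k) x - y x\<bar> < d" "\<bar>f (r l) x - y x\<bar> < d" using N1 kl by auto
    then have "\<bar>f (r k) x - f (r l) x\<bar> <= \<bar>2 * d\<bar>" by linarith
    then show "(f (r k) x - f (r l) x)^2 <= (2 * d)^2" by (simp only: abs_le_square_iff)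
   qed (intro cont_set_integrable continuous_intros fc)+
   also have "... = 8 * pi * d^2" by (simp add: set_integral_const power_mult_distrib)
   finally have fd: "(\<oint>x. (f (r k) x - f (r l) x)^2) <= 8 * pi * d^2" .
   have "a (r k) < e / 16" "a (r l) < e / 16" using N2 kl by auto
   then have s: "4 * (circle_energy \<alpha> (f (r k)) (g (r k)) + circle_energy \<alpha> (f (r l)) (g (r l)) - 2 * Es) <= e / 2"
   proof -
    have "circle_energy \<alpha> (f (r k)) (g (r k)) + circle_energy \<alpha> (f (r l)) (g (r l)) - 2 * Es <= e / 8"
     using E(1)[of "r k"] E(1)[of "r l"] \<open>a (r k) < e / 16\<close> \<open>a (r l) < e / 16\<close> by linarith
    from mult_left_mono[OF this, of 4] show ?thesis by simp
   qed
   have "\<alpha>^2 * (8 * pi * d^2) <= (\<alpha>^2 + 1) * (8 * pi * d^2)" by (intro mult_right_mono) auto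
   also have "... = e / 2" using d(2) by (simp add: algebra_simps)
   finally have "\<alpha>^2 * (\<oint>x. (f (r k) x - f (r l) x)^2) <= e / 2"
    using mult_left_mono[OF fd, of "\<alpha>^2"] by simp
   from order_trans[OF energy_minimizer.parallelogram[OF v(1) f(1) f(2) f(3) f(1) f(2) f(3)] add_mono[OF s this]]
   show ?thesis by simp
  qed
  then show ?thesis by blast
 qed
 then have "ALL j. EX N. \<forall>k\<ge>N. \<forall>l\<ge>N. (\<oint>x. (g (r k) x - g (r l) x)^2) <= ((1/2) ^ j)^2" by simp
 then obtain N where N: "ALL j. \<forall>k\<ge>N j. \<forall>l\<ge>N j. (\<oint>x. (g (r k) x - g (r l) x)^2) <= ((1/2) ^ j)^2" by (rule choice[THEN exE])
 \<comment> \<open>Summing the \<open>N i\<close> makes both \<open>s j\<close> and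
   \<open>s (Suc j)\<close> at least \<open>N j\<close>, as consecutive increments require; adding
   \<open>j\<close> drives \<open>s\<close> to infinity.\<close>
 define s where "s j = (\<Sum>i\<le>j. N i) + j" for j :: nat
 have sN: "N j <= s j" "N j <= s (Suc j)" "j <= s j" for j
 proof -
  have "N j <= (\<Sum>i\<le>j. N i)" by (rule member_le_sum) auto
  then show "N j <= s j" "N j <= s (Suc j)" "j <= s j" by (auto simp: s_def)
 qed
 have s_top: "filterlim s at_top sequentially"
  by (rule filterlim_at_top_mono[OF filterlim_ident]) (use sN(3) in simp)
 obtain gy where gy: "circle_H1 y gy"
 proof (rule circle_H1_complete[of "%j. f (r (s j))" "%j. g (r (s j))" y K])
  show "circle_H1 (f (r (s k))) (g (r (s k)))" for k by (rule f(1))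
  show "(%k. f (r (s k)) x) ----> y x" for x by (rule filterlim_compose[OF lim s_top])
  show "(\<oint>x. (g (r (s k)) x)^2) <= K" for k by (rule Kk(1))
  show "(\<oint>x. (g (r (s (Suc k))) x - g (r (s k)) x)^2) <= ((1/2) ^ k)^2" for k
   using N sN by blast
 qed (rule that)
 have bl: "(%k. Es + a (r k)) ----> Es + 0" by (intro tendsto_intros ar)
 from energy_lower_semicontinuous[where F = "%k. f (r k)" and G = "%k. g (r k)" and b = "%k. Es + a (r k)", OF f(1) gy yI E(1) bl]
 have Ey: "circle_energy \<alpha> y gy <= Es" by simp
 have "energy_minimizer \<alpha> M y gy"
 proof
  show "0 < \<alpha>" "0 < M" "circle_H1 y gy" by (rule alpha M gy)+
  show "0 <= y x" "(\<oint>x. y x) = M" for x by (rule y0 ym)+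
  fix z h assume "circle_H1 z h" "!!x. 0 <= z x" "(\<oint>x. z x) = M"
  from v_minimal[OF this] Ey show "circle_energy \<alpha> y gy <= circle_energy \<alpha> z h" by simp
 qed
 from energy_minimizer.minimizer_film[OF this] obtain w1 w2 where film: "film \<alpha> y w1 w2" by blast
 have yH: "circle_H1 y w1" unfolding circle_H1_def using film.primitive_w[OF film] y(2)
  by (auto intro!: cont_set_integrable continuous_intros continuous_on_subset[OF film.cont1[OF film]])
 \<comment> \<open>\<open>w1\<close> and \<open>gy\<close> are two versions of the derivative of
   \<open>y\<close>; the energies agree because \<open>energy\<close> depends on \<open>y\<close>
   alone.\<close>
 have "ereal (circle_energy \<alpha> y w1) = ereal (circle_energy \<alpha> y gy)"
  unfolding circle_H1_energy[OF yH, symmetric] circle_H1_energy[OF gy, symmetric] ..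
 then have "circle_energy \<alpha> y w1 <= e0"
  using Ey order_trans[OF v_minimal[OF f(1) f(2) f(3)] e0(1)] by simp
 from film_is_minimizer(1)[OF film ym this e0(2)] have yv: "y = v" .
 have "(%k. \<oint>x. (g (r k) x - gv x)^2) ----> 0"
 proof (rule Lim_null_comparison)
  show "\<forall>\<^sub>F k in sequentially. norm (\<oint>x. (g (r k) x - gv x)^2) <= 4 * a (r k) + \<alpha>^2 * (\<oint>x. (f (r k) x - v x)^2)"
  proof (intro always_eventually allI)
   fix k
   have "0 <= (\<oint>x. (g (r k) x - gv x)^2)" by (rule set_integral_nonneg) simp
   moreover have "(\<oint>x. (g (r k) x - gv x)^2) <=
    4 * (circle_energy \<alpha> (f (r k)) (g (r k)) + Es - 2 * Es) + \<alpha>^2 * (\<oint>x. (f (r k) x - v x)^2)"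
    by (rule energy_minimizer.parallelogram[OF v(1) f(1) f(2) f(3) vH v_nonneg v_mass])
   ultimately show "norm (\<oint>x. (g (r k) x - gv x)^2) <= 4 * a (r k) + \<alpha>^2 * (\<oint>x. (f (r k) x - v x)^2)"
    using E(1)[of "r k"] by (simp add: algebra_simps)
  qed
  have u1: "uniform_limit ?I (%k x. f (r k) x - v x) (%x. y x - v x) sequentially"
   by (rule uniform_limit_minus[OF yI uniform_limit_const])
  have vc: "continuous_on S v" for S by (rule circle_H1D(5)[OF vH])
  have "(%k. \<oint>x. (f (r k) x - v x) * (f (r k) x - v x)) ----> (\<oint>x. (y x - v x) * (y x - v x))"
   by (intro uniform_integral_tendsto uniform_limit_mult_cont u1 continuous_intros fc yc vc)
  then have "(%k. \<oint>x. (f (r k) x - v x)^2) ----> 0" by (simp add: yv power2_eq_square)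
  then have "(%k. 4 * a (r k) + \<alpha>^2 * (\<oint>x. (f (r k) x - v x)^2)) ----> 4 * 0 + \<alpha>^2 * 0"
   by (intro tendsto_intros ar)
  then show "(%k. 4 * a (r k) + \<alpha>^2 * (\<oint>x. (f (r k) x - v x)^2)) ----> 0" by simp
 qed
 then show ?thesis by (rule that[OF y(1)])
qed

theorem convergence: "((%t. dist_H1 (u t) ustar) \<longlongrightarrow> 0) at_top"
proof (rule ccontr)
 assume neg: "~ ((%t. dist_H1 (u t) ustar) \<longlongrightarrow> 0) at_top"
 obtain e0 where e0: "energy \<alpha> (u 0) = ereal e0" by (rule initial_energy)
 from neg obtain \<eta> where \<eta>: "0 < \<eta>" "~ (\<forall>\<^sub>F t in at_top. dist_H1 (u t) ustar < \<eta>)"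
  unfolding order_tendsto_iff by auto
 have far: "\<exists>t\<ge>K. \<eta> <= dist_H1 (u t) ustar" for K
  using \<eta>(2) unfolding eventually_at_top_linorder by (auto simp: not_less)
 have "EX t. 1 <= t & (EX g. circle_H1 (u t) g & circle_energy \<alpha> (u t) g <= Es + 1 / (real k + 1)) & \<eta> <= dist_H1 (u t) ustar" for k :: nat
 proof -
  have "0 < 1 / (real k + 1)" by simp
  then obtain K where K: "0 < K" "!!T g. K <= T ==> circle_H1 (u T) g ==> circle_energy \<alpha> (u T) g <= Es + 1 / (real k + 1)"
   by (rule energy_tends_to_minimum) (rule that; assumption)
  obtain t where t: "max K 1 <= t" "\<eta> <= dist_H1 (u t) ustar" using far by blast
  obtain g where g: "circle_H1 (u t) g" by (rule H1_slice[of t]) (use t in simp)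
  have "circle_energy \<alpha> (u t) g <= Es + 1 / (real k + 1)" by (rule K(2)[OF _ g]) (use t in simp)
  then show ?thesis using t g by auto
 qed
 then have "ALL k. EX t. 1 <= t & (EX g. circle_H1 (u t) g & circle_energy \<alpha> (u t) g <= Es + 1 / (real k + 1)) & \<eta> <= dist_H1 (u t) ustar" by (rule allI)
 then obtain t where t: "ALL k. 1 <= t k & (EX g. circle_H1 (u (t k)) g & circle_energy \<alpha> (u (t k)) g <= Es + 1 / (real k + 1)) & \<eta> <= dist_H1 (u (t k)) ustar"
  by (rule choice[THEN exE])
 then have "ALL k. EX g. circle_H1 (u (t k)) g & circle_energy \<alpha> (u (t k)) g <= Es + 1 / (real k + 1)" by blast
 then obtain g where g: "ALL k. circle_H1 (u (t k)) (g k) & circle_energy \<alpha> (u (t k)) (g k) <= Es + 1 / (real k + 1)"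
  by (rule choice[THEN exE])
 have t0: "0 < t k" "0 <= t k" for k using t[rule_format, of k] by auto
 have gH: "circle_H1 (u (t k)) (g k)" and gE: "circle_energy \<alpha> (u (t k)) (g k) <= Es + 1 / (real k + 1)" for k
  using g by blast+
 have null: "(%k. 1 / (real k + 1)) ----> 0" using LIMSEQ_inverse_real_of_nat by (simp add: inverse_eq_divide add.commute)
 obtain r where r: "strict_mono (r :: nat => nat)" "(%k. \<oint>x. (g (r k) x - gv x)^2) ----> 0"
  by (rule almost_minimizers_converge[OF gH u_props(2)[OF t0(2)] u_props(3)[OF t0(2)] gE null slice_energy_bounds(2)[OF t0(1) gH e0] e0])
   (rule that; assumption)
 have "(%k. ennreal (sqrt (\<oint>x. (g (r k) x - gv x)^2))) ----> ennreal (sqrt 0)"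
  by (intro tendsto_ennrealI tendsto_real_sqrt r(2))
 then have "(%k. dist_H1 (u (t (r k))) ustar) ----> 0"
  unfolding H1_distance[OF t0(1) gH] by simp
 moreover have "\<eta> <= dist_H1 (u (t (r k))) ustar" for k using t by blast
 ultimately have "\<eta> <= 0" by (intro LIMSEQ_le_const[of _ 0 \<eta>]) auto
 then show False using \<eta>(1) by simp
qed

end

theorem theorem4p3:
  fixes n \<alpha> M :: real
    and u uxx :: "real \<Rightarrow> real \<Rightarrow> real"
    and ustar :: "real \<Rightarrow> real"
  assumes "0 < n" and "0 < \<alpha>" and "0 < M"
    and "global_strong_solution n \<alpha> u uxx"
    and "has_mass M u"
    and "bernis_friedman n \<alpha> u uxx"
    and "is_arg_min (energy \<alpha>) (\<lambda>w. w \<in> admissible M) ustar"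
    and "1 < \<alpha> \<Longrightarrow> \<forall>w. steady_state n \<alpha> M w \<and> zero_dissipation n \<alpha> w \<and>
           energy \<alpha> w \<le> energy \<alpha> (u 0) \<longrightarrow> (AE x in lborel. w x = ustar x)"
  shows "((\<lambda>t. dist_H1 (u t) ustar) \<longlongrightarrow> 0) at_top"
proof -
 obtain v g where v: "energy_minimizer \<alpha> M v g" "H_circle 1 ustar" "AE x in lborel. ustar x = v x" "AE x in lborel. g x = wderiv UNIV ustar x"
  by (rule energy_minimizer_representative[OF assms(2,3,7)])
 have "long_time n \<alpha> M u uxx ustar v g"
  by (rule long_time.intro[OF assms v])
 then show ?thesis by (rule long_time.convergence)
qed

end
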